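(* Let $\mu_j\in\sigma(A_1)\cap\sigma(\hat A_2)$ be a double eigenvalue of $\mathcal{A}$, $\mu_j=\mu_{j+1}$, with eigenfunction $U$ and adjoined function $U_*$ as in the context. Then both eigenfunctions $u_{\varepsilon,j}$ and $u_{\varepsilon,j+1}$ of (P$_\varepsilon$) converge in $H^1(a,b)$ as $\varepsilon\to0$ to the same eigenfunction $U$, and the difference $\frac{1}{\sqrt\varepsilon}(u_{\varepsilon,j+1}-u_{\varepsilon,j})$ converges in $H^1(a,b)$ to the adjoined function $\gamma U_*$ for a certain $\gamma\ne0$. Besides, $\lambda_\varepsilon^-=\lambda_j^\varepsilon$, $\lambda_\varepsilon^+=\lambda_{j+1}^\varepsilon$ and $u_{\varepsilon,j}$, $u_{\varepsilon,j+1}$ admit asymptotic expansions in powers of $\sqrt\varepsilon$ with the coefficients $\omega,\nu_n^\pm,v_n^\pm,w_n^\pm$ constructed in the context for $\mu=\mu_j$, and the following estimates of the remainder terms hold: for every $n\in\mathbb{N}$ there are constants $c_n^\pm,C_n^\pm$ such that for all sufficiently small $\varepsilon>0$ $$\bigl|\varepsilon^{-1}\lambda_\varepsilon^\pm-\bigl(\mu_j\pm\sqrt\varepsilon\,\omega+\varepsilon\nu_2^\pm+\cdots+\varepsilon^{n/2}\nu_n^\pm\bigr)\bigr|\le c_n^\pm\varepsilon^{(n+1)/2},$$ $$\|u_{\varepsilon,j}-\vartheta_\varepsilon^-U_{\varepsilon,n}^-\|_{H^1(a,b)}\le C_n^-\varepsilon^{\frac{n+1}{2}},\qquad \|u_{\varepsilon,j+1}-\vartheta_\varepsilon^+U_{\varepsilon,n}^+\|_{H^1(a,b)}\le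 C_n^+\varepsilon^{\frac{n+1}{2}},$$ where $U_{\varepsilon,n}^\pm=\mp\varepsilon^{1/2}w+\varepsilon w_2^\pm+\cdots+\varepsilon^{n/2}w_n^\pm$ on $I_a$, $U_{\varepsilon,n}^\pm=v+\varepsilon^{1/2}v_1^\pm+\cdots+\varepsilon^{n/2}v_n^\pm$ on $I_b$, and $\vartheta_\varepsilon^\pm$ are normalizing multipliers (real numbers, which may depend on $n$) with strictly positive limits as $\varepsilon\to0$.
   Context: Let $a<0<b$, $I_a=(a,0)$, $I_b=(0,b)$. Let $k,r$ be smooth positive functions on $[a,0]$ and $\kappa,\rho$ smooth positive functions on $[0,b]$. Let $R=r$ on $I_a$ and $R=\rho$ on $I_b$. Perturbed problem (P$_\varepsilon$), $\varepsilon>0$: $(k u_\varepsilon')'+\varepsilon^{-1}\lambda^\varepsilon r u_\varepsilon=0$ in $I_a$; $\ \varepsilon(\kappa u_\varepsilon')'+\lambda^\varepsilon\rho u_\varepsilon=0$ in $I_b$; $\ u_\varepsilon(-0)=u_\varepsilon(+0)$, $\ (ku_\varepsilon')(-0)=\varepsilon(\kappa u_\varepsilon')(+0)$; $\ u_\varepsilon(a)=0$, $u_\varepsilon(b)=0$. Its spectrum is real, discrete and simple, $0<\lambda_1^\varepsilon<\lambda_2^\varepsilon<\dots\to\infty$. The corresponding real-valued eigenfunctions $u_{\varepsilon,j}$ are normalized by $\int_a^b R\,u_{\varepsilon,j}^2\,dx=1$ and $u_{\varepsilon,j}'(b)>0$. Operators: $A_1=-\frac1r\frac{d}{dx}k\frac{d}{dx}$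 in $L_2(r,I_a)$ with domain $\{u\in H^2(I_a):u(a)=0,\ u'(0)=0\}$; $\hat A_2=-\frac1\rho\frac{d}{dx}\kappa\frac{d}{dx}$ in $L_2(\rho,I_b)$ with domain $\{u\in H^2(I_b):u(0)=u(b)=0\}$; $\mathcal{A}(u_1,u_2)=\bigl(-\frac1r(ku_1')',-\frac1\rho(\kappa u_2')'\bigr)$ in $\mathcal{L}=L_2(r,I_a)\oplus L_2(\rho,I_b)$ with domain $\{(u_1,u_2)\in H^2(I_a)\oplus H^2(I_b): u_1(a)=u_1'(0)=0,\ u_2(b)=0,\ u_1(0)=u_2(0)\}$. A pair $(u_1,u_2)\in\mathcal{L}$ is identified with the function on $(a,b)$ equal to $u_1$ on $I_a$ and $u_2$ on $I_b$. The spectrum of $\mathcal{A}$ is real and discrete and equals $\sigma(A_1)\cup\sigma(\hat A_2)$; $\mu_1\le\mu_2\le\cdots$ are the eigenvalues of $\mathcal{A}$ in increasing order, repeated according to algebraic multiplicity; the eigenvalues of algebraic multiplicity $2$ are exactly the points of $\sigma(A_1)\cap\sigma(\hat A_2)$. Construction for $\mu\in\sigma(A_1)\cap\sigma(\hat A_2)$. Let $v$ be the real eigenfunction of $\hat A_2$ with eigenvalue $\mu$, $\int_0^b\rho v^2\,dx=1$, $v'(b)>0$. Let $w$ be the real eigenfunction of $A_1$ with eigenvalue $\mu$, $\int_a^0 r w^2\,dx=1$, with sign such that $w(0)v'(0)>0$. Put $\omega=\kappa(0)w(0)v'(0)>0$. Let $U=0$ on $I_a$, $U=v$ on $I_b$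 (an eigenfunction of $\mathcal{A}$), and let $U_*$ be the adjoined function, i.e. the solution of $(\mathcal{A}-\mu\mathcal{I})U_*=U$, with $\int_a^b R\,U\,U_*\,dx=0$. Coefficients of the "$+$" branch: $\nu_1^+=\omega$, $v_0^+=v$, $w_1^+=-w$, and $\nu_n^+$ ($n\ge2$), $v_n^+$ ($n\ge1$), $w_{n+1}^+$ ($n\ge1$) are uniquely determined recursively by requiring that for all $n\ge1$ (superscript $+$ omitted) $$(\kappa v_n')'+\mu\rho v_n=-\rho\sum_{i=1}^{n}\nu_i v_{n-i}\ \text{ in } I_b,\quad v_n(0)=w_n(0),\quad v_n(b)=0,$$ $$(kw_{n+1}')'+\mu r w_{n+1}=-r\sum_{i=1}^{n}\nu_i w_{n+1-i}\ \text{ in } I_a,\quad w_{n+1}(a)=0,\quad (kw_{n+1}')(0)=(\kappa v_{n-1}')(0),$$ together with $\int_0^b\rho v_n v\,dx=\int_a^0 r w_{n+1}w\,dx$ for all $n\ge1$. (Here $\nu_n$ and the components of $v_{n-1}$ along $v$ and of $w_n$ along $w$ are fixed by the solvability of the $n$-th pair of problems and the last condition.) Coefficients of the "$-$" branch: $\nu_n^-=(-1)^n\nu_n^+$, $v_n^-=(-1)^nv_n^+$, $w_n^-=(-1)^nw_n^+$. *)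

theory Defs
  imports "HOL-Analysis.Analysis" "HOL-Library.Function_Algebras"
begin

text \<open>
  Throughout, a function on the interval with end points \<open>c < d\<close> is a total function whose values
  off \<open>[c,d]\<close> are irrelevant. Derivatives are taken within \<open>[c,d]\<close>, so they are one-sided at the
  end points; in particular \<open>dI a 0 u 0\<close> is \<open>u'(-0)\<close> and \<open>dI 0 b u 0\<close> is \<open>u'(+0)\<close>.
\<close>

definition dI :: "real \<Rightarrow> real \<Rightarrow> (real \<Rightarrow> 'a::real_normed_vector) \<Rightarrow> real \<Rightarrow> 'a" where
  "dI c d u x = vector_derivative u (at x within {c..d})"

definition smooth_interval :: "real \<Rightarrow> real \<Rightarrow> (real \<Rightarrow> real) \<Rightarrow> bool" where
  "smooth_interval c d f \<longleftrightarrow>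
     (\<exists>F :: nat \<Rightarrow> real \<Rightarrow> real. F 0 = f \<and>
        (\<forall>n. \<forall>x\<in>{c..d}. (F n has_real_derivative F (Suc n) x) (at x within {c..d})))"

definition L2_on :: "real \<Rightarrow> real \<Rightarrow> (real \<Rightarrow> 'a::real_normed_vector) \<Rightarrow> bool" where
  "L2_on c d f \<longleftrightarrow>
     f \<in> borel_measurable (lebesgue_on {c..d}) \<and>
     integrable (lebesgue_on {c..d}) (\<lambda>x. (norm (f x))\<^sup>2)"

definition L2_weighted_norm ::
    "(real \<Rightarrow> real) \<Rightarrow> real \<Rightarrow> real \<Rightarrow> (real \<Rightarrow> 'a::real_normed_vector) \<Rightarrow> real" where
  "L2_weighted_norm q c d f = sqrt (integral {c..d} (\<lambda>x. q x * (norm (f x))\<^sup>2))"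

text \<open>
  Sobolev functions of one variable are represented by their absolutely continuous representatives
  on the closed interval: \<open>g\<close> is the \<open>L\<^sub>2\<close> derivative of \<open>u\<close> (unique up to null sets) iff
  \<open>u(x) = u(c) + \<integral>\<^sub>c\<^sup>x g\<close> for all \<open>x\<close>. Thus the traces of \<open>H\<^sup>1\<close> functions are their point values.
\<close>

definition has_L2_deriv ::
    "real \<Rightarrow> real \<Rightarrow> (real \<Rightarrow> 'a::real_normed_vector) \<Rightarrow> (real \<Rightarrow> 'a) \<Rightarrow> bool" where
  "has_L2_deriv c d u g \<longleftrightarrow>
     L2_on c d g \<and> (\<forall>x\<in>{c..d}. (g has_integral (u x - u c)) {c..x})"

definition H1 :: "real \<Rightarrow> real \<Rightarrow> (real \<Rightarrow> 'a::real_normed_vector) set" where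
  "H1 c d = {u. \<exists>g. has_L2_deriv c d u g}"

definition H2 :: "real \<Rightarrow> real \<Rightarrow> (real \<Rightarrow> 'a::real_normed_vector) set" where
  "H2 c d = {u. \<exists>g\<in>H1 c d. has_L2_deriv c d u g}"

definition H1_norm :: "real \<Rightarrow> real \<Rightarrow> (real \<Rightarrow> real) \<Rightarrow> real" where
  "H1_norm c d u =
     sqrt (integral {c..d} (\<lambda>x. (u x)\<^sup>2)
         + integral {c..d} (\<lambda>x. ((SOME g. has_L2_deriv c d u g) x)\<^sup>2))"

definition converges_H1 ::
    "real \<Rightarrow> real \<Rightarrow> (real \<Rightarrow> real \<Rightarrow> real) \<Rightarrow> (real \<Rightarrow> real) \<Rightarrow> bool" where
  "converges_H1 c d f l \<longleftrightarrow>
     l \<in> H1 c d \<and> (\<forall>\<^sub>F \<epsilon> in at_right 0. f \<epsilon> \<in> H1 c d) \<and>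
     ((\<lambda>\<epsilon>. H1_norm c d (\<lambda>x. f \<epsilon> x - l x)) \<longlongrightarrow> 0) (at_right 0)"

definition glue :: "(real \<Rightarrow> 'a) \<times> (real \<Rightarrow> 'a) \<Rightarrow> real \<Rightarrow> 'a" where
  "glue p x = (if x < 0 then fst p x else snd p x)"

definition SL ::
    "(real \<Rightarrow> real) \<Rightarrow> real \<Rightarrow> real \<Rightarrow> (real \<Rightarrow> 'a::real_normed_vector) \<Rightarrow> real \<Rightarrow> 'a" where
  "SL p c d u = dI c d (\<lambda>x. p x *\<^sub>R dI c d u x)"

definition SL_regular ::
    "(real \<Rightarrow> real) \<Rightarrow> real \<Rightarrow> real \<Rightarrow> (real \<Rightarrow> 'a::real_normed_vector) \<Rightarrow> bool" where
  "SL_regular p c d u \<longleftrightarrow>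
     u differentiable_on {c..d} \<and> (\<lambda>x. p x *\<^sub>R dI c d u x) differentiable_on {c..d}"

text \<open>
  The condition \<open>u(-0) = u(+0)\<close> is built in: both
  regularity requirements refer to the same value \<open>u 0\<close>, to which \<open>u\<close> is continuous from either
  side.
\<close>

definition perturbed_eigenfunction ::
    "real \<Rightarrow> real \<Rightarrow> (real \<Rightarrow> real) \<Rightarrow> (real \<Rightarrow> real) \<Rightarrow> (real \<Rightarrow> real) \<Rightarrow> (real \<Rightarrow> real) \<Rightarrow>
     real \<Rightarrow> 'a::real_normed_field \<Rightarrow> (real \<Rightarrow> 'a) \<Rightarrow> bool" where
  "perturbed_eigenfunction a b k r \<kappa> \<rho> \<epsilon> z u \<longleftrightarrow>
     SL_regular k a 0 u \<and> SL_regular \<kappa> 0 b u \<and>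
     (\<forall>x\<in>{a<..<0}. SL k a 0 u x + inverse (of_real \<epsilon>) * z * of_real (r x) * u x = 0) \<and>
     (\<forall>x\<in>{0<..<b}. of_real \<epsilon> * SL \<kappa> 0 b u x + z * of_real (\<rho> x) * u x = 0) \<and>
     k 0 *\<^sub>R dI a 0 u 0 = \<epsilon> *\<^sub>R (\<kappa> 0 *\<^sub>R dI 0 b u 0) \<and>
     u a = 0 \<and> u b = 0 \<and>
     (\<exists>x\<in>{a..b}. u x \<noteq> 0)"

definition perturbed_spectrum ::
    "real \<Rightarrow> real \<Rightarrow> (real \<Rightarrow> real) \<Rightarrow> (real \<Rightarrow> real) \<Rightarrow> (real \<Rightarrow> real) \<Rightarrow> (real \<Rightarrow> real) \<Rightarrow>
     real \<Rightarrow> complex set" where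
  "perturbed_spectrum a b k r \<kappa> \<rho> \<epsilon> = {z. \<exists>u. perturbed_eigenfunction a b k r \<kappa> \<rho> \<epsilon> z u}"

text \<open>
  An operator in a function space is given by its graph: \<open>T u f\<close> means that \<open>u\<close> is in the domain
  and \<open>T u = f\<close> almost everywhere. So \<open>SL_op p q c d u f\<close> says \<open>u \<in> H\<^sup>2\<close> and \<open>-(1/q)(p u')' = f\<close>.
\<close>

definition SL_op ::
    "(real \<Rightarrow> real) \<Rightarrow> (real \<Rightarrow> real) \<Rightarrow> real \<Rightarrow> real \<Rightarrow>
     (real \<Rightarrow> 'a::real_normed_vector) \<Rightarrow> (real \<Rightarrow> 'a) \<Rightarrow> bool" where
  "SL_op p q c d u f \<longleftrightarrow>
     u \<in> H2 c d \<and> L2_on c d f \<and>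
     has_L2_deriv c d (\<lambda>x. p x *\<^sub>R dI c d u x) (\<lambda>x. - (q x *\<^sub>R f x))"

definition A1 ::
    "real \<Rightarrow> (real \<Rightarrow> real) \<Rightarrow> (real \<Rightarrow> real) \<Rightarrow>
     (real \<Rightarrow> 'a::real_normed_vector) \<Rightarrow> (real \<Rightarrow> 'a) \<Rightarrow> bool" where
  "A1 a k r u f \<longleftrightarrow> SL_op k r a 0 u f \<and> u a = 0 \<and> dI a 0 u 0 = 0"

definition A2_hat ::
    "real \<Rightarrow> (real \<Rightarrow> real) \<Rightarrow> (real \<Rightarrow> real) \<Rightarrow>
     (real \<Rightarrow> 'a::real_normed_vector) \<Rightarrow> (real \<Rightarrow> 'a) \<Rightarrow> bool" where
  "A2_hat b \<kappa> \<rho> u f \<longleftrightarrow> SL_op \<kappa> \<rho> 0 b u f \<and> u 0 = 0 \<and> u b = 0"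

definition A_op ::
    "real \<Rightarrow> real \<Rightarrow> (real \<Rightarrow> real) \<Rightarrow> (real \<Rightarrow> real) \<Rightarrow> (real \<Rightarrow> real) \<Rightarrow> (real \<Rightarrow> real) \<Rightarrow>
     (real \<Rightarrow> 'a::real_normed_vector) \<times> (real \<Rightarrow> 'a) \<Rightarrow> (real \<Rightarrow> 'a) \<times> (real \<Rightarrow> 'a) \<Rightarrow> bool" where
  "A_op a b k r \<kappa> \<rho> u f \<longleftrightarrow>
     SL_op k r a 0 (fst u) (fst f) \<and> SL_op \<kappa> \<rho> 0 b (snd u) (snd f) \<and>
     fst u a = 0 \<and> dI a 0 (fst u) 0 = 0 \<and> snd u b = 0 \<and> fst u 0 = snd u 0"

text \<open>
  Spectrum of an operator in the weighted space \<open>L\<^sub>2(q,(c,d))\<close>: the complement of the set of \<open>z\<close> for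
  which \<open>T - z\<close> is a bijection of the domain onto the space with bounded inverse. Domain elements
  are continuous, so being zero as a class means vanishing on \<open>[c,d]\<close>.
\<close>

definition resolvent_set ::
    "(real \<Rightarrow> real) \<Rightarrow> real \<Rightarrow> real \<Rightarrow> ((real \<Rightarrow> complex) \<Rightarrow> (real \<Rightarrow> complex) \<Rightarrow> bool) \<Rightarrow>
     complex set" where
  "resolvent_set q c d T =
     {z. (\<forall>u. T u (\<lambda>x. z * u x) \<longrightarrow> (\<forall>x\<in>{c..d}. u x = 0)) \<and>
         (\<exists>C. \<forall>f. L2_on c d f \<longrightarrow>
            (\<exists>u. T u (\<lambda>x. z * u x + f x) \<and>
                 L2_weighted_norm q c d u \<le> C * L2_weighted_norm q c d f))}"

definition spectrum_of ::
    "(real \<Rightarrow> real) \<Rightarrow> real \<Rightarrow> real \<Rightarrow> ((real \<Rightarrow> complex) \<Rightarrow> (real \<Rightarrow> complex) \<Rightarrow> bool) \<Rightarrow>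
     complex set" where
  "spectrum_of q c d T = - resolvent_set q c d T"

definition pair_scale ::
    "'a::field \<Rightarrow> (real \<Rightarrow> 'a) \<times> (real \<Rightarrow> 'a) \<Rightarrow> (real \<Rightarrow> 'a) \<times> (real \<Rightarrow> 'a)" where
  "pair_scale c u = ((\<lambda>x. c * fst u x), (\<lambda>x. c * snd u x))"

lemma vector_space_pair_scale: "vector_space (pair_scale :: 'a::field \<Rightarrow> _)"
  by unfold_locales (auto simp: pair_scale_def fun_eq_iff algebra_simps)

text \<open>
  \<open>root_space A z n\<close> is the kernel of \<open>(A - z)^n\<close>. Requiring the functions to vanish off the
  intervals selects exactly one function for each element, so that dimensions are those of
  subspaces of \<open>L\<^sub>2(r,I\<^sub>a) \<oplus> L\<^sub>2(\<rho>,I\<^sub>b)\<close>.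
\<close>

primrec root_space ::
    "real \<Rightarrow> real \<Rightarrow>
     ((real \<Rightarrow> complex) \<times> (real \<Rightarrow> complex) \<Rightarrow> (real \<Rightarrow> complex) \<times> (real \<Rightarrow> complex) \<Rightarrow> bool) \<Rightarrow>
     complex \<Rightarrow> nat \<Rightarrow> ((real \<Rightarrow> complex) \<times> (real \<Rightarrow> complex)) set" where
  "root_space a b T z 0 = {0}"
| "root_space a b T z (Suc n) =
     {u. (\<forall>x. x \<notin> {a..0} \<longrightarrow> fst u x = 0) \<and> (\<forall>x. x \<notin> {0..b} \<longrightarrow> snd u x = 0) \<and>
         (\<exists>f\<in>root_space a b T z n. T u (pair_scale z u + f))}"

definition algebraic_multiplicity ::
    "real \<Rightarrow> real \<Rightarrow>
     ((real \<Rightarrow> complex) \<times> (real \<Rightarrow> complex) \<Rightarrow> (real \<Rightarrow> complex) \<times> (real \<Rightarrow> complex) \<Rightarrow> bool) \<Rightarrow>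
     complex \<Rightarrow> nat" where
  "algebraic_multiplicity a b T z = vector_space.dim pair_scale (\<Union>n. root_space a b T z n)"

definition enumerates_perturbed_spectrum ::
    "real \<Rightarrow> real \<Rightarrow> (real \<Rightarrow> real) \<Rightarrow> (real \<Rightarrow> real) \<Rightarrow> (real \<Rightarrow> real) \<Rightarrow> (real \<Rightarrow> real) \<Rightarrow>
     real \<Rightarrow> (nat \<Rightarrow> real) \<Rightarrow> bool" where
  "enumerates_perturbed_spectrum a b k r \<kappa> \<rho> \<epsilon> l \<longleftrightarrow>
     strict_mono_on {1..} l \<and>
     (\<lambda>n. complex_of_real (l n)) ` {1..} = perturbed_spectrum a b k r \<kappa> \<rho> \<epsilon>"

definition enumerates_limit_spectrum ::
    "real \<Rightarrow> real \<Rightarrow> (real \<Rightarrow> real) \<Rightarrow> (real \<Rightarrow> real) \<Rightarrow> (real \<Rightarrow> real) \<Rightarrow> (real \<Rightarrow> real) \<Rightarrow>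
     (nat \<Rightarrow> real) \<Rightarrow> bool" where
  "enumerates_limit_spectrum a b k r \<kappa> \<rho> \<mu> \<longleftrightarrow>
     mono_on {1..} \<mu> \<and>
     (\<forall>z::complex. finite {n\<in>{1..}. complex_of_real (\<mu> n) = z} \<and>
        card {n\<in>{1..}. complex_of_real (\<mu> n) = z} =
          algebraic_multiplicity a b (A_op a b k r \<kappa> \<rho>) z)"

definition plus_branch ::
    "real \<Rightarrow> real \<Rightarrow> (real \<Rightarrow> real) \<Rightarrow> (real \<Rightarrow> real) \<Rightarrow> (real \<Rightarrow> real) \<Rightarrow> (real \<Rightarrow> real) \<Rightarrow>
     real \<Rightarrow> real \<Rightarrow> (real \<Rightarrow> real) \<Rightarrow> (real \<Rightarrow> real) \<Rightarrow>
     (nat \<Rightarrow> real) \<Rightarrow> (nat \<Rightarrow> real \<Rightarrow> real) \<Rightarrow> (nat \<Rightarrow> real \<Rightarrow> real) \<Rightarrow> bool" where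
  "plus_branch a b k r \<kappa> \<rho> m \<omega> v w \<nu> vs ws \<longleftrightarrow>
     \<nu> 1 = \<omega> \<and> vs 0 = v \<and> ws 1 = (\<lambda>x. - w x) \<and>
     (\<forall>n\<ge>1.
        SL_regular \<kappa> 0 b (vs n) \<and>
        (\<forall>x\<in>{0<..<b}. SL \<kappa> 0 b (vs n) x + m * \<rho> x * vs n x
                         = - \<rho> x * (\<Sum>i=1..n. \<nu> i * vs (n - i) x)) \<and>
        vs n 0 = ws n 0 \<and> vs n b = 0 \<and>
        SL_regular k a 0 (ws (n + 1)) \<and>
        (\<forall>x\<in>{a<..<0}. SL k a 0 (ws (n + 1)) x + m * r x * ws (n + 1) x
                         = - r x * (\<Sum>i=1..n. \<nu> i * ws (n + 1 - i) x)) \<and>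
        ws (n + 1) a = 0 \<and>
        k 0 * dI a 0 (ws (n + 1)) 0 = \<kappa> 0 * dI 0 b (vs (n - 1)) 0 \<and>
        integral {0..b} (\<lambda>x. \<rho> x * vs n x * v x)
          = integral {a..0} (\<lambda>x. r x * ws (n + 1) x * w x))"

definition eigenvalue_expansion :: "real \<Rightarrow> (nat \<Rightarrow> real) \<Rightarrow> nat \<Rightarrow> real \<Rightarrow> real" where
  "eigenvalue_expansion m \<nu> n \<epsilon> = m + (\<Sum>i=1..n. \<epsilon> powr (real i / 2) * \<nu> i)"

definition eigenfunction_expansion ::
    "(nat \<Rightarrow> real \<Rightarrow> real) \<Rightarrow> (nat \<Rightarrow> real \<Rightarrow> real) \<Rightarrow> nat \<Rightarrow> real \<Rightarrow> real \<Rightarrow> real" where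
  "eigenfunction_expansion vs ws n \<epsilon> =
     glue ((\<lambda>x. \<Sum>i=1..n. \<epsilon> powr (real i / 2) * ws i x),
           (\<lambda>x. \<Sum>i=0..n. \<epsilon> powr (real i / 2) * vs i x))"

text \<open>
  \<open>l \<epsilon>\<close> is a perturbed eigenvalue already divided by \<open>\<epsilon>\<close>, and \<open>f \<epsilon>\<close> its eigenfunction; note that
  \<open>\<epsilon> powr 0 = 1\<close> for \<open>\<epsilon> > 0\<close>.
\<close>

definition has_expansion ::
    "real \<Rightarrow> real \<Rightarrow> real \<Rightarrow> (nat \<Rightarrow> real) \<Rightarrow> (nat \<Rightarrow> real \<Rightarrow> real) \<Rightarrow> (nat \<Rightarrow> real \<Rightarrow> real) \<Rightarrow>
     (real \<Rightarrow> real) \<Rightarrow> (real \<Rightarrow> real \<Rightarrow> real) \<Rightarrow> bool" where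
  "has_expansion a b m \<nu> vs ws l f \<longleftrightarrow>
     (\<forall>n::nat.
        (\<exists>c. \<forall>\<^sub>F \<epsilon> in at_right 0.
           \<bar>l \<epsilon> - eigenvalue_expansion m \<nu> n \<epsilon>\<bar> \<le> c * \<epsilon> powr (real (n + 1) / 2)) \<and>
        (\<exists>C \<theta> L. L > 0 \<and> (\<theta> \<longlongrightarrow> L) (at_right 0) \<and>
           (\<forall>\<^sub>F \<epsilon> in at_right 0.
              (\<lambda>x. f \<epsilon> x - \<theta> \<epsilon> * eigenfunction_expansion vs ws n \<epsilon> x) \<in> H1 a b \<and>
              H1_norm a b (\<lambda>x. f \<epsilon> x - \<theta> \<epsilon> * eigenfunction_expansion vs ws n \<epsilon> x)
                \<le> C * \<epsilon> powr (real (n + 1) / 2))))"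

end

theory Submission
  imports Defs
begin

text \<open>
  Put \<open>z = \<lambda>\<^sup>\<epsilon>/\<epsilon>\<close>. On both intervals the perturbed problem then reads \<open>-(p y')' = z q y\<close>, and
  \<open>\<epsilon>\<close> survives only in the flux condition at \<open>0\<close>. Reflect the right interval to \<open>[-b,0]\<close>, and on
  each leg let \<open>\<phi>\<close> be the solution that vanishes at the outer end point with flux \<open>p \<phi>' = 1\<close> there,
  and \<open>\<Phi> = p \<phi>'\<close>. With \<open>L\<close> and \<open>R\<close> for the two legs, \<open>z\<close> belongs to an eigenvalue
  iff the characteristic function \<open>F\<^sub>\<epsilon>(z) = \<Phi>\<^sub>L \<phi>\<^sub>R + \<epsilon> \<Phi>\<^sub>R \<phi>\<^sub>L\<close>, taken at \<open>x = 0\<close>, vanishes. For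
  \<open>\<epsilon> = 0\<close> the zeros are those of \<open>\<Phi>\<^sub>L\<close>, which form the spectrum of \<open>A\<^sub>1\<close>, and those of \<open>\<phi>\<^sub>R\<close>,
  which form the spectrum of the operator on the right.

  The Lagrange identity shows that \<open>\<Phi>\<^sub>L\<close> and \<open>\<phi>\<^sub>R\<close> have simple zeros and determines the signs of
  their derivatives there (\<open>Phi_zero_simple\<close>, \<open>phi_zero_simple\<close>). At a common zero \<open>m\<close> the product
  behaves like a parabola, and the coupling term \<open>\<epsilon> \<Phi>\<^sub>R \<phi>\<^sub>L\<close> pushes its vertex across the axis:
  the double zero splits into exactly one zero on each side of \<open>m\<close>, at distance \<open>O(\<surd>\<epsilon>)\<close>, and convexity
  gives the inverse estimate \<open>|F\<^sub>\<epsilon>(t)| \<ge> c \<surd>\<epsilon> |t - z|\<close> (\<open>half_parabola_zero\<close>). A zero of exactly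
  one factor persists as one zero. Since the algebraic multiplicity of a real \<open>z\<close> for the limit
  operator is the number of factors that vanish at \<open>z\<close> (\<open>multiplicity\<close>), counting the zeros below \<open>m\<close>
  identifies the two split zeros as the ones with numbers \<open>j\<close> and \<open>j + 1\<close> (\<open>double_eigenvalue_splits\<close>).

  Both branches of the expansion are one series, evaluated at \<open>t = \<surd>\<epsilon>\<close> and at \<open>t = -\<surd>\<epsilon>\<close>. The
  series truncated at order \<open>N\<close> solve the equations up to \<open>O(t\<^sup>N\<^sup>+\<^sup>1)\<close>, so \<open>F\<^sub>\<epsilon>\<close> is \<open>O(t\<^sup>N\<^sup>+\<^sup>1)\<close> at the
  truncated eigenvalue (\<open>quasi_mode\<close>). The inverse estimate turns this into an eigenvalue error
  \<open>O(t\<^sup>N)\<close>, and one additional term of the series gives the stated order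
  (\<open>eigenvalue_expansion_error\<close>). An eigenfunction is a multiple of \<open>\<phi>\<close> on each leg and the truncated
  series is nearly one; after rescaling so that the multiples on the right agree, continuity at \<open>0\<close>
  forces those on the left to agree up to \<open>O(t\<^sup>n\<^sup>+\<^sup>1)\<close> (\<open>eigenfunction_error\<close>). The rescaling factor \<open>s\<close> is
  controlled by the normalization: \<open>s\<^sup>2\<close> is the weighted square integral of the truncated series up
  to an error of the same order. To first order this is \<open>1 + 2 t \<integral> R U\<^sub>0 U\<^sub>1\<close>, where \<open>U\<^sub>0 = U\<close> and \<open>U\<^sub>1\<close> is
  the first corrector, and this yields the limit \<open>2 (U\<^sub>1 - (\<integral> R U\<^sub>0 U\<^sub>1) U\<^sub>0) = 2 \<omega> U\<^sub>*\<close> of the scaled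
  difference (\<open>branch_difference\<close>, \<open>adjoined_function\<close>).
\<close>

section \<open>Sobolev norms of piecewise continuously differentiable functions\<close>

text \<open>
  The half-lines are stable under intersection and generate the Borel sets, so a vanishing primitive
  makes the integral over every Borel set vanish; a Lebesgue set differs from a Borel set by a null
  set.
\<close>

lemma AE_zero_of_zero_primitive:
  fixes h :: "real \<Rightarrow> real"
  assumes h: "h absolutely_integrable_on {c..d}"
    and zero: "\<And>x. x \<in> {c..d} \<Longrightarrow> (h has_integral 0) {c..x}"
  shows "AE x in lebesgue. x \<in> {c..d} \<longrightarrow> h x = 0"
proof (cases "c \<le> d")
  case False
  then show ?thesis by auto
next
  case cd: True
  define g where "g x = indicator {c..d} x *\<^sub>R h x" for x
  have g: "integrable lebesgue g"
    using h unfolding g_def set_integrable_def .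
  have sg: "set_integrable lebesgue A g" if "A \<in> sets lebesgue" for A
    unfolding set_integrable_def using integrable_mult_indicator[OF that g] .
  have basic: "(LINT x:{..a}|lebesgue. g x) = 0" for a
  proof -
    have "(LINT x:{..a}|lebesgue. g x) = integral {..a} g"
      by (rule set_lebesgue_integral_eq_integral) (simp add: sg)
    also have "\<dots> = integral ({..a} \<inter> {c..d}) h"
      by (subst Int_commute, subst integral_restrict_Int[symmetric], rule integral_cong)
        (auto simp: g_def indicator_def)
    also have "\<dots> = 0"
    proof (cases "a < c")
      case True
      then have "{..a} \<inter> {c..d} = {}" by auto
      then show ?thesis by simp
    next
      case False
      then have "{..a} \<inter> {c..d} = {c..min a d}" by auto
      moreover have "min a d \<in> {c..d}" using False cd by auto
      ultimately show ?thesis using zero by (simp add: integral_unique)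
    qed
    finally show ?thesis .
  qed
  have total: "(LINT x|lebesgue. g x) = 0"
  proof -
    have "(LINT x|lebesgue. g x) = (LINT x:{..d}|lebesgue. g x)"
      unfolding set_lebesgue_integral_def
      by (rule Bochner_Integration.integral_cong) (auto simp: g_def indicator_def)
    then show ?thesis using basic by simp
  qed
  have borel0: "(LINT x:A|lebesgue. g x) = 0" if "A \<in> sets borel" for A
  proof -
    have eq: "sets (borel::real measure) = sigma_sets UNIV (range (\<lambda>a::real. {..a}))"
      by (subst borel_eq_atMost) auto
    have "Int_stable (range (\<lambda>a::real. {..a}))" "range (\<lambda>a::real. {..a}) \<subseteq> Pow UNIV"
      by (auto simp: Int_stable_def)
    moreover have "A \<in> sigma_sets UNIV (range (\<lambda>a::real. {..a}))"
      using that eq by simp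
    ultimately show ?thesis
    proof (induction rule: sigma_sets_induct_disjoint)
      case (basic A)
      then show ?case using \<open>\<And>a. (LINT x:{..a}|lebesgue. g x) = 0\<close> by auto
    next
      case empty
      then show ?case by (simp add: set_lebesgue_integral_def)
    next
      case (compl A)
      then have A: "A \<in> sets lebesgue" using eq by auto
      have "(LINT x:A \<union> (UNIV - A)|lebesgue. g x) = (LINT x:A|lebesgue. g x) + (LINT x:UNIV - A|lebesgue. g x)"
        by (rule set_integral_Un) (use A sg[OF A] sg[OF sets.compl_sets[OF A]] in auto)
      moreover have "(LINT x:A \<union> (UNIV - A)|lebesgue. g x) = 0"
        using total by (simp add: set_lebesgue_integral_def)
      ultimately show ?case using compl by simp
    next
      case (union A)
      have A: "A i \<in> sets lebesgue" for i
        using union(2) eq by (metis rangeI sets_completionI_sets sets_lborel subsetD)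
      have "(LINT x:(\<Union>i. A i)|lebesgue. g x) = (\<Sum>i. (LINT x:(A i)|lebesgue. g x))"
        by (rule lebesgue_integral_countable_add)
          (use A union(1) sg in \<open>auto simp: disjoint_family_on_def\<close>)
      then show ?case using union by simp
    qed
  qed
  have "(LINT x:A|lebesgue. g x) = 0" if A: "A \<in> sets lebesgue" for A
  proof -
    obtain S N N' where *: "A = S \<union> N" "N \<subseteq> N'" "N' \<in> null_sets lborel" "S \<in> sets lborel"
      using A by (rule sets_completionE)
    have N': "N' \<in> null_sets lebesgue" using * by (simp add: null_sets_completionI)
    have SL: "S \<in> sets lebesgue" using * by simp
    have "(LINT x:A|lebesgue. g x) = (LINT x:S|lebesgue. g x)"
    proof (rule set_integral_cong_set)
      show "AE x in lebesgue. (x \<in> S) = (x \<in> A)"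
        using AE_not_in[OF N'] by eventually_elim (use * in auto)
    qed (use SL sg[OF A] sg[OF SL] in \<open>simp_all only: set_borel_measurable_def set_integrable_def borel_measurable_integrable\<close>)
    then show ?thesis using borel0 * by simp
  qed
  then have "AE x in lebesgue. g x = 0"
    using density_unique_real[OF g, of "\<lambda>x. 0"] by (simp add: set_lebesgue_integral_def)
  then show ?thesis
    by eventually_elim (auto simp: g_def indicator_def split: if_splits)
qed

lemma L2_on_absolutely_integrable:
  fixes g :: "real \<Rightarrow> real"
  assumes "L2_on c d g"
  shows "g absolutely_integrable_on {c..d}" "(\<lambda>x. (g x)\<^sup>2) absolutely_integrable_on {c..d}"
proof -
  have m: "g \<in> borel_measurable (lebesgue_on {c..d})"
    and i: "integrable (lebesgue_on {c..d}) (\<lambda>x. (g x)\<^sup>2)"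
    using assms by (auto simp: L2_on_def)
  show "(\<lambda>x. (g x)\<^sup>2) absolutely_integrable_on {c..d}"
    using i by (simp add: integrable_restrict_space set_integrable_def)
  have "integrable (lebesgue_on {c..d}) (\<lambda>x. 1 + (g x)\<^sup>2)"
    using i by (intro Bochner_Integration.integrable_add) (auto intro: continuous_imp_integrable_real)
  then have "integrable (lebesgue_on {c..d}) g"
  proof (rule Bochner_Integration.integrable_bound)
    have "\<bar>y\<bar> \<le> 1 + y\<^sup>2" for y :: real
      using zero_le_square[of "\<bar>y\<bar> - 1"] abs_ge_zero[of y] by (simp add: power2_eq_square algebra_simps)
    then show "AE x in lebesgue_on {c..d}. norm (g x) \<le> norm (1 + (g x)\<^sup>2)"
      by (simp add: abs_of_nonneg add_nonneg_nonneg)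
  qed (rule m)
  then show "g absolutely_integrable_on {c..d}"
    by (simp add: integrable_restrict_space set_integrable_def)
qed

lemma has_L2_deriv_unique_AE:
  fixes u :: "real \<Rightarrow> real"
  assumes "has_L2_deriv c d u g" "has_L2_deriv c d u h"
  shows "AE x in lebesgue. x \<in> {c..d} \<longrightarrow> g x = h x"
proof -
  have "AE x in lebesgue. x \<in> {c..d} \<longrightarrow> g x - h x = 0"
  proof (rule AE_zero_of_zero_primitive)
    show "(\<lambda>x. g x - h x) absolutely_integrable_on {c..d}"
      using assms by (intro set_integral_diff L2_on_absolutely_integrable) (auto simp: has_L2_deriv_def)
    show "((\<lambda>x. g x - h x) has_integral 0) {c..x}" if "x \<in> {c..d}" for x
      using has_integral_diff[of g "u x - u c" "{c..x}" h "u x - u c"] assms that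
      by (auto simp: has_L2_deriv_def)
  qed
  then show ?thesis by auto
qed

text \<open>
  The norm is defined through an arbitrary choice of the weak derivative; almost everywhere
  uniqueness permits any other one.
\<close>

lemma H1_norm_eq:
  assumes "has_L2_deriv c d u g"
  shows "H1_norm c d u = sqrt (integral {c..d} (\<lambda>x. (u x)\<^sup>2) + integral {c..d} (\<lambda>x. (g x)\<^sup>2))"
proof -
  let ?h = "SOME g. has_L2_deriv c d u g"
  have h: "has_L2_deriv c d u ?h" by (rule someI[of "\<lambda>g. has_L2_deriv c d u g", OF assms])
  have "integral {c..d} (\<lambda>x. (?h x)\<^sup>2) = integral {c..d} (\<lambda>x. (g x)\<^sup>2)"
  proof -
    have i: "(\<lambda>x. (?h x)\<^sup>2) absolutely_integrable_on {c..d}" "(\<lambda>x. (g x)\<^sup>2) absolutely_integrable_on {c..d}"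
      using h assms by (auto simp: has_L2_deriv_def intro: L2_on_absolutely_integrable)
    have ae: "AE x in lebesgue. indicator {c..d} x *\<^sub>R (?h x)\<^sup>2 = indicator {c..d} x *\<^sub>R (g x)\<^sup>2"
      using has_L2_deriv_unique_AE[OF h assms] by eventually_elim (auto simp: indicator_def)
    have "(LINT x:{c..d}|lebesgue. (?h x)\<^sup>2) = (LINT x:{c..d}|lebesgue. (g x)\<^sup>2)"
      unfolding set_lebesgue_integral_def
      using i ae by (intro integral_cong_AE) (auto simp: set_integrable_def)
    then show ?thesis using i by (simp add: set_lebesgue_integral_eq_integral)
  qed
  then show ?thesis by (simp add: H1_norm_def)
qed

text \<open>
  All functions below are \<open>C\<^sup>1\<close> on either side of \<open>0\<close>. Bounding the function and its one-sided
  derivatives by the same number dominates the \<open>H\<^sup>1\<close> norm and, unlike that norm, obeys the triangle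
  inequality by inspection.
\<close>

definition pw_C1_bound :: "real \<Rightarrow> real \<Rightarrow> (real \<Rightarrow> real) \<Rightarrow> real \<Rightarrow> bool" where
  "pw_C1_bound a b f \<eta> \<longleftrightarrow> continuous_on {a..b} f \<and> (\<forall>x\<in>{a..b}. \<bar>f x\<bar> \<le> \<eta>) \<and>
     (\<exists>g1 g2. continuous_on {a..0} g1 \<and> continuous_on {0..b} g2 \<and>
        (\<forall>x\<in>{a<..<0}. (f has_real_derivative g1 x) (at x)) \<and>
        (\<forall>x\<in>{0<..<b}. (f has_real_derivative g2 x) (at x)) \<and>
        (\<forall>x\<in>{a..0}. \<bar>g1 x\<bar> \<le> \<eta>) \<and> (\<forall>x\<in>{0..b}. \<bar>g2 x\<bar> \<le> \<eta>))"

lemma pw_C1_boundI: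
  assumes "continuous_on {a..b} f" "\<forall>x\<in>{a..b}. \<bar>f x\<bar> \<le> \<eta>"
    "continuous_on {a..0} g1" "continuous_on {0..b} g2"
    "\<forall>x\<in>{a<..<0}. (f has_real_derivative g1 x) (at x)"
    "\<forall>x\<in>{0<..<b}. (f has_real_derivative g2 x) (at x)"
    "\<forall>x\<in>{a..0}. \<bar>g1 x\<bar> \<le> \<eta>" "\<forall>x\<in>{0..b}. \<bar>g2 x\<bar> \<le> \<eta>"
  shows "pw_C1_bound a b f \<eta>"
  unfolding pw_C1_bound_def using assms by blast

lemma pw_C1_bound_add:
  assumes "pw_C1_bound a b f \<eta>" "pw_C1_bound a b g \<theta>"
  shows "pw_C1_bound a b (\<lambda>x. f x + g x) (\<eta> + \<theta>)"
proof -
  obtain f1 f2 where f: "continuous_on {a..0} f1" "continuous_on {0..b} f2"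
    "\<forall>x\<in>{a<..<0}. (f has_real_derivative f1 x) (at x)"
    "\<forall>x\<in>{0<..<b}. (f has_real_derivative f2 x) (at x)"
    "\<forall>x\<in>{a..0}. \<bar>f1 x\<bar> \<le> \<eta>" "\<forall>x\<in>{0..b}. \<bar>f2 x\<bar> \<le> \<eta>"
    using assms(1) by (auto simp: pw_C1_bound_def)
  obtain g1 g2 where g: "continuous_on {a..0} g1" "continuous_on {0..b} g2"
    "\<forall>x\<in>{a<..<0}. (g has_real_derivative g1 x) (at x)"
    "\<forall>x\<in>{0<..<b}. (g has_real_derivative g2 x) (at x)"
    "\<forall>x\<in>{a..0}. \<bar>g1 x\<bar> \<le> \<theta>" "\<forall>x\<in>{0..b}. \<bar>g2 x\<bar> \<le> \<theta>"
    using assms(2) by (auto simp: pw_C1_bound_def)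
  show ?thesis
  proof (rule pw_C1_boundI[where ?g1.0="\<lambda>x. f1 x + g1 x" and ?g2.0="\<lambda>x. f2 x + g2 x"])
    show "continuous_on {a..b} (\<lambda>x. f x + g x)"
      using assms by (auto simp: pw_C1_bound_def intro!: continuous_intros)
    show "\<forall>x\<in>{a..b}. \<bar>f x + g x\<bar> \<le> \<eta> + \<theta>"
      using assms unfolding pw_C1_bound_def by (meson abs_triangle_ineq add_mono order.trans)
    show "\<forall>x\<in>{a..0}. \<bar>f1 x + g1 x\<bar> \<le> \<eta> + \<theta>" "\<forall>x\<in>{0..b}. \<bar>f2 x + g2 x\<bar> \<le> \<eta> + \<theta>"
      using f g by (auto intro!: abs_triangle_ineq[THEN order.trans] add_mono)
  qed (use f g in \<open>auto intro!: continuous_intros derivative_eq_intros\<close>)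
qed

lemma pw_C1_bound_scale:
  assumes "pw_C1_bound a b f \<eta>"
  shows "pw_C1_bound a b (\<lambda>x. c * f x) (\<bar>c\<bar> * \<eta>)"
proof -
  obtain f1 f2 where f: "continuous_on {a..0} f1" "continuous_on {0..b} f2"
    "\<forall>x\<in>{a<..<0}. (f has_real_derivative f1 x) (at x)"
    "\<forall>x\<in>{0<..<b}. (f has_real_derivative f2 x) (at x)"
    "\<forall>x\<in>{a..0}. \<bar>f1 x\<bar> \<le> \<eta>" "\<forall>x\<in>{0..b}. \<bar>f2 x\<bar> \<le> \<eta>"
    using assms(1) by (auto simp: pw_C1_bound_def)
  show ?thesis
  proof (rule pw_C1_boundI[where ?g1.0="\<lambda>x. c * f1 x" and ?g2.0="\<lambda>x. c * f2 x"])
    show "continuous_on {a..b} (\<lambda>x. c * f x)"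
      using assms by (auto simp: pw_C1_bound_def intro!: continuous_intros)
    show "\<forall>x\<in>{a..b}. \<bar>c * f x\<bar> \<le> \<bar>c\<bar> * \<eta>"
      using assms unfolding pw_C1_bound_def by (auto simp: abs_mult intro!: mult_left_mono)
  qed (use f in \<open>auto intro!: continuous_intros derivative_eq_intros mult_left_mono simp: abs_mult\<close>)
qed

lemma pw_C1_bound_mono:
  "pw_C1_bound a b f \<eta> \<Longrightarrow> \<eta> \<le> \<theta> \<Longrightarrow> pw_C1_bound a b f \<theta>"
  unfolding pw_C1_bound_def by (blast intro: order.trans)

lemma pw_C1_bound_glue:
  assumes "a < 0" "0 < b"
    and "continuous_on {a..0} f1" "continuous_on {0..b} f2" "f1 0 = f2 0"
    and "continuous_on {a..0} g1" "continuous_on {0..b} g2"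
    and "\<And>x. x \<in> {a<..<0} \<Longrightarrow> (f1 has_real_derivative g1 x) (at x)"
    and "\<And>x. x \<in> {0<..<b} \<Longrightarrow> (f2 has_real_derivative g2 x) (at x)"
    and "\<And>x. x \<in> {a..0} \<Longrightarrow> \<bar>f1 x\<bar> \<le> \<eta> \<and> \<bar>g1 x\<bar> \<le> \<eta>"
    and "\<And>x. x \<in> {0..b} \<Longrightarrow> \<bar>f2 x\<bar> \<le> \<eta> \<and> \<bar>g2 x\<bar> \<le> \<eta>"
    and f1: "\<And>x. x \<in> {a..0} \<Longrightarrow> f x = f1 x" and f2: "\<And>x. x \<in> {0..b} \<Longrightarrow> f x = f2 x"
  shows "pw_C1_bound a b f \<eta>"
proof -
  have 1: "(f has_real_derivative g1 x) (at x)" if "x \<in> {a<..<0}" for x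
    by (rule has_field_derivative_transform_within_open[OF assms(8)[OF that] _ that])
      (use f1 in auto)
  have 2: "(f has_real_derivative g2 x) (at x)" if "x \<in> {0<..<b}" for x
    by (rule has_field_derivative_transform_within_open[OF assms(9)[OF that] _ that])
      (use f2 in auto)
  have "continuous_on ({a..0} \<union> {0..b}) f"
  proof (intro continuous_on_closed_Un)
    show "continuous_on {a..0} f" by (rule continuous_on_eq[OF assms(3)]) (use f1 in auto)
    show "continuous_on {0..b} f" by (rule continuous_on_eq[OF assms(4)]) (use f2 in auto)
  qed auto
  moreover have ab: "{a..b} = {a..0} \<union> {0..b}" using assms by auto
  ultimately have "continuous_on {a..b} f" by simp
  moreover have "\<forall>x\<in>{a..b}. \<bar>f x\<bar> \<le> \<eta>"
    unfolding ab using assms by auto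
  ultimately show ?thesis
    unfolding pw_C1_bound_def using 1 2 assms by blast
qed

lemma L2_on_bounded_measurable:
  fixes g :: "real \<Rightarrow> real"
  assumes m: "g \<in> borel_measurable (lebesgue_on {c..d})" and b: "\<And>x. x \<in> {c..d} \<Longrightarrow> \<bar>g x\<bar> \<le> \<eta>"
  shows "L2_on c d g"
proof -
  have "integrable (lebesgue_on {c..d}) (\<lambda>x. \<eta>\<^sup>2)"
    by (auto intro: continuous_imp_integrable_real)
  then have "integrable (lebesgue_on {c..d}) (\<lambda>x. (g x)\<^sup>2)"
  proof (rule Bochner_Integration.integrable_bound)
    show "AE x in lebesgue_on {c..d}. norm ((g x)\<^sup>2) \<le> norm (\<eta>\<^sup>2)"
    proof (rule AE_I2)
      fix x assume "x \<in> space (lebesgue_on {c..d})"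
      then have "\<bar>g x\<bar>\<^sup>2 \<le> \<eta>\<^sup>2" using b[of x] by (intro power_mono) auto
      then show "norm ((g x)\<^sup>2) \<le> norm (\<eta>\<^sup>2)" by simp
    qed
  qed (use m in measurable)
  then show ?thesis using m by (simp add: L2_on_def)
qed

lemma pw_C1_bound_H1:
  assumes f: "pw_C1_bound a b f \<eta>" and ab: "a < 0" "0 < b"
  shows "f \<in> H1 a b" "H1_norm a b f \<le> sqrt (2 * (b - a)) * \<eta>"
proof -
  obtain g1 g2 where g: "continuous_on {a..0} g1" "continuous_on {0..b} g2"
    "\<forall>x\<in>{a<..<0}. (f has_real_derivative g1 x) (at x)"
    "\<forall>x\<in>{0<..<b}. (f has_real_derivative g2 x) (at x)"
    "\<forall>x\<in>{a..0}. \<bar>g1 x\<bar> \<le> \<eta>" "\<forall>x\<in>{0..b}. \<bar>g2 x\<bar> \<le> \<eta>"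
    and cf: "continuous_on {a..b} f" and bf: "\<forall>x\<in>{a..b}. \<bar>f x\<bar> \<le> \<eta>"
    using f by (auto simp: pw_C1_bound_def)
  have \<eta>: "\<eta> \<ge> 0" using bf ab by (smt (verit) atLeastAtMost_iff)
  define g where "g x = (if x < 0 then g1 x else g2 x)" for x
  have gb: "\<bar>g x\<bar> \<le> \<eta>" if "x \<in> {a..b}" for x
    using g(5,6) that by (auto simp: g_def)
  have "g \<in> borel_measurable (lebesgue_on {a..b})"
  proof -
    have "(\<lambda>x. if x \<in> {a..<0} then g x else 0) \<in> borel_measurable lebesgue"
    proof -
      have "continuous_on {a..<0} g"
        by (rule continuous_on_eq[of _ g1]) (auto simp: g_def intro: continuous_on_subset[OF g(1)])
      then have "g \<in> borel_measurable (lebesgue_on {a..<0})"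
        by (intro continuous_imp_measurable_on_sets_lebesgue) auto
      then show ?thesis by (subst (asm) borel_measurable_if[symmetric]) auto
    qed
    moreover have "(\<lambda>x. if x \<in> {0..b} then g x else 0) \<in> borel_measurable lebesgue"
    proof -
      have "continuous_on {0..b} g"
        by (rule continuous_on_eq[of _ g2]) (auto simp: g_def intro: continuous_on_subset[OF g(2)])
      then have "g \<in> borel_measurable (lebesgue_on {0..b})"
        by (intro continuous_imp_measurable_on_sets_lebesgue) auto
      then show ?thesis by (subst (asm) borel_measurable_if[symmetric]) auto
    qed
    ultimately have "(\<lambda>x. (if x \<in> {a..<0} then g x else 0) + (if x \<in> {0..b} then g x else 0)) \<in> borel_measurable lebesgue"
      by (rule borel_measurable_add)
    also have "(\<lambda>x. (if x \<in> {a..<0} then g x else 0) + (if x \<in> {0..b} then g x else 0)) = (\<lambda>x. if x \<in> {a..b} then g x else 0)"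
      using ab by (auto simp: fun_eq_iff)
    finally show ?thesis by (subst (asm) borel_measurable_if) auto
  qed
  then have L2: "L2_on a b g" using gb by (rule L2_on_bounded_measurable)
  have D: "has_L2_deriv a b f g"
    unfolding has_L2_deriv_def
  proof (intro conjI L2 ballI)
    fix x assume x: "x \<in> {a..b}"
    show "(g has_integral f x - f a) {a..x}"
    proof (rule fundamental_theorem_of_calculus_interior_strong[of "{0}"])
      show "continuous_on {a..x} f" using cf x by (auto intro: continuous_on_subset)
      fix y assume "y \<in> {a<..<x} - {0}"
      then show "(f has_vector_derivative g y) (at y)"
        using g(3,4) x by (auto simp: g_def has_real_derivative_iff_has_vector_derivative[symmetric])
    qed (use x in auto)
  qed
  then show "f \<in> H1 a b" by (auto simp: H1_def)
  have le: "integral {a..b} (\<lambda>x. (h x)\<^sup>2) \<le> (b - a) * \<eta>\<^sup>2"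
    if "L2_on a b h" "\<And>x. x \<in> {a..b} \<Longrightarrow> \<bar>h x\<bar> \<le> \<eta>" for h
  proof -
    have "integral {a..b} (\<lambda>x. (h x)\<^sup>2) \<le> integral {a..b} (\<lambda>x. \<eta>\<^sup>2)"
    proof (rule integral_le)
      show "(\<lambda>x. (h x)\<^sup>2) integrable_on {a..b}"
        using L2_on_absolutely_integrable[OF that(1)] by (simp add: absolutely_integrable_on_def)
      fix x assume "x \<in> {a..b}"
      then have "\<bar>h x\<bar>\<^sup>2 \<le> \<eta>\<^sup>2" using that(2) by (intro power_mono) auto
      then show "(h x)\<^sup>2 \<le> \<eta>\<^sup>2" by simp
    qed auto
    then show ?thesis using ab by simp
  qed
  have "f \<in> borel_measurable (lebesgue_on {a..b})"
    using cf by (intro continuous_imp_measurable_on_sets_lebesgue) auto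
  then have "L2_on a b f" using bf by (intro L2_on_bounded_measurable) auto
  then have "integral {a..b} (\<lambda>x. (f x)\<^sup>2) + integral {a..b} (\<lambda>x. (g x)\<^sup>2) \<le> 2 * (b - a) * \<eta>\<^sup>2"
    using le[OF \<open>L2_on a b f\<close>] le[OF L2 gb] bf by (simp add: algebra_simps)
  then have "H1_norm a b f \<le> sqrt (2 * (b - a) * \<eta>\<^sup>2)"
    unfolding H1_norm_eq[OF D] by simp
  then show "H1_norm a b f \<le> sqrt (2 * (b - a)) * \<eta>"
    using \<eta> by (simp add: real_sqrt_mult)
qed

lemma H1_norm_nonneg: "0 \<le> H1_norm c d u"
proof -
  have "0 \<le> integral {c..d} (\<lambda>x. (f x)\<^sup>2)" for f :: "real \<Rightarrow> real"
    by (cases "(\<lambda>x. (f x)\<^sup>2) integrable_on {c..d}") (auto intro: integral_nonneg simp: not_integrable_integral)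
  then show ?thesis unfolding H1_norm_def by (intro real_sqrt_ge_zero add_nonneg_nonneg)
qed

lemma converges_H1I:
  assumes ab: "a < 0" "0 < b" and l: "pw_C1_bound a b l B"
    and f: "\<forall>\<^sub>F \<epsilon> in at_right 0. pw_C1_bound a b (\<lambda>x. f \<epsilon> x - l x) (\<eta> \<epsilon>)" and \<eta>: "(\<eta> \<longlongrightarrow> 0) (at_right 0)"
  shows "converges_H1 a b f l"
  unfolding converges_H1_def
proof (intro conjI)
  show "l \<in> H1 a b" by (rule pw_C1_bound_H1(1)[OF l ab])
  show "\<forall>\<^sub>F \<epsilon> in at_right 0. f \<epsilon> \<in> H1 a b"
    using f
  proof eventually_elim
    case (elim \<epsilon>)
    from pw_C1_bound_H1(1)[OF pw_C1_bound_add[OF elim l] ab] show ?case by simp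
  qed
  show "((\<lambda>\<epsilon>. H1_norm a b (\<lambda>x. f \<epsilon> x - l x)) \<longlongrightarrow> 0) (at_right 0)"
  proof (rule Lim_null_comparison)
    show "\<forall>\<^sub>F \<epsilon> in at_right 0. norm (H1_norm a b (\<lambda>x. f \<epsilon> x - l x)) \<le> sqrt (2 * (b - a)) * \<eta> \<epsilon>"
      using f
    proof eventually_elim
      case (elim \<epsilon>)
      show ?case
        using pw_C1_bound_H1(2)[OF elim ab] by (simp only: real_norm_def abs_of_nonneg[OF H1_norm_nonneg])
    qed
    show "((\<lambda>\<epsilon>. sqrt (2 * (b - a)) * \<eta> \<epsilon>) \<longlongrightarrow> 0) (at_right 0)"
      using tendsto_mult_left[OF \<eta>, of "sqrt (2 * (b - a))"] by simp
  qed
qed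

lemma has_L2_deriv_cong:
  assumes "\<And>x. x \<in> {c..d} \<Longrightarrow> u x = v x" "has_L2_deriv c d u g"
  shows "has_L2_deriv c d v g"
proof (cases "c \<le> d")
  case True
  then have "u c = v c" using assms(1) by simp
  then show ?thesis using assms by (simp add: has_L2_deriv_def)
qed (use assms in \<open>auto simp: has_L2_deriv_def\<close>)

lemma H1_cong:
  assumes "\<And>x. x \<in> {c..d} \<Longrightarrow> u x = v x"
  shows "u \<in> H1 c d \<longleftrightarrow> v \<in> H1 c d" "H1_norm c d u = H1_norm c d v"
proof -
  have eq: "has_L2_deriv c d u = has_L2_deriv c d v"
    using has_L2_deriv_cong[of c d u v] has_L2_deriv_cong[of c d v u] assms by (auto simp: fun_eq_iff)
  then show "u \<in> H1 c d \<longleftrightarrow> v \<in> H1 c d" by (simp add: H1_def)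
  have "integral {c..d} (\<lambda>x. (u x)\<^sup>2) = integral {c..d} (\<lambda>x. (v x)\<^sup>2)"
    by (rule integral_cong) (simp add: assms)
  then show "H1_norm c d u = H1_norm c d v" unfolding H1_norm_def eq by simp
qed

lemma converges_H1_cong:
  assumes "converges_H1 c d f l" "\<And>x. x \<in> {c..d} \<Longrightarrow> l x = l' x"
  shows "converges_H1 c d f l'"
proof -
  have "H1_norm c d (\<lambda>x. f \<epsilon> x - l x) = H1_norm c d (\<lambda>x. f \<epsilon> x - l' x)" for \<epsilon>
    by (rule H1_cong) (simp add: assms)
  then show ?thesis using assms H1_cong(1)[of c d l l'] by (simp add: converges_H1_def)
qed

section \<open>Sturm-Liouville equations as first-order systems\<close>

text \<open>
  The equation \<open>(p y')' = - q h\<close> with flux \<open>Y = p y'\<close>. Differentiability is required only in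
  the interior, because the eigenvalue equations are given only there. Both \<open>A u = h\<close> and, with
  \<open>h = z y\<close>, the eigenvalue problem have this form.
\<close>

definition sl_flow ::
    "(real \<Rightarrow> real) \<Rightarrow> (real \<Rightarrow> real) \<Rightarrow> real \<Rightarrow> real \<Rightarrow>
     (real \<Rightarrow> 'a::real_normed_vector) \<Rightarrow> (real \<Rightarrow> 'a) \<Rightarrow> (real \<Rightarrow> 'a) \<Rightarrow> bool" where
  "sl_flow p q c d y Y h \<longleftrightarrow> continuous_on {c..d} y \<and> continuous_on {c..d} Y \<and>
     (\<forall>x\<in>{c<..<d}. (y has_vector_derivative (1 / p x) *\<^sub>R Y x) (at x) \<and>
                    (Y has_vector_derivative - (q x *\<^sub>R h x)) (at x))"

lemma sl_flow_add:
  "sl_flow p q c d y Y h \<Longrightarrow> sl_flow p q c d y' Y' h' \<Longrightarrow>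
   sl_flow p q c d (\<lambda>x. y x + y' x) (\<lambda>x. Y x + Y' x) (\<lambda>x. h x + h' x)"
  unfolding sl_flow_def
  by (auto intro!: continuous_intros derivative_eq_intros simp: scaleR_add_right)

lemma sl_flow_scaleR:
  "sl_flow p q c d y Y h \<Longrightarrow> sl_flow p q c d (\<lambda>x. s *\<^sub>R y x) (\<lambda>x. s *\<^sub>R Y x) (\<lambda>x. s *\<^sub>R h x)"
  unfolding sl_flow_def
  by (auto intro!: continuous_intros derivative_eq_intros simp: mult.commute)

lemma sl_flow_scaleR_left:
  "sl_flow p q c d y Y h \<Longrightarrow> sl_flow p q c d (\<lambda>x. y x *\<^sub>R e) (\<lambda>x. Y x *\<^sub>R e) (\<lambda>x. h x *\<^sub>R e)"
  unfolding sl_flow_def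
  by (auto intro!: continuous_intros derivative_eq_intros
      simp: has_real_derivative_iff_has_vector_derivative[symmetric] mult.commute)

lemma sl_flow_diff:
  assumes "sl_flow p q c d y Y h" "sl_flow p q c d y' Y' h'"
  shows "sl_flow p q c d (\<lambda>x. y x - y' x) (\<lambda>x. Y x - Y' x) (\<lambda>x. h x - h' x)"
  using sl_flow_add[OF assms(1) sl_flow_scaleR[OF assms(2), of "-1"]] by simp

lemma sl_flow_zero: "sl_flow p q c d (\<lambda>x. 0) (\<lambda>x. 0) (\<lambda>x. 0)"
  by (auto simp: sl_flow_def)

lemma sl_flow_sum:
  assumes "\<And>i. i \<in> I \<Longrightarrow> sl_flow p q c d (y i) (Y i) (h i)"
  shows "sl_flow p q c d (\<lambda>x. \<Sum>i\<in>I. y i x) (\<lambda>x. \<Sum>i\<in>I. Y i x) (\<lambda>x. \<Sum>i\<in>I. h i x)"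
  using assms
  by (induction I rule: infinite_finite_induct) (auto intro: sl_flow_zero sl_flow_add)

lemma sl_flow_cong:
  assumes f: "sl_flow p q c d y Y h" and "\<And>x. x \<in> {c..d} \<Longrightarrow> y x = y' x" "\<And>x. x \<in> {c..d} \<Longrightarrow> Y x = Y' x"
    "\<And>x. x \<in> {c<..<d} \<Longrightarrow> h x = h' x"
  shows "sl_flow p q c d y' Y' h'"
  unfolding sl_flow_def
proof (intro conjI ballI)
  show "continuous_on {c..d} y'" "continuous_on {c..d} Y'"
    using f assms by (auto simp: sl_flow_def elim: continuous_on_eq)
  fix x assume x: "x \<in> {c<..<d}"
  have "(y has_vector_derivative (1 / p x) *\<^sub>R Y x) (at x)"
    "(Y has_vector_derivative - (q x *\<^sub>R h x)) (at x)"
    using f x by (auto simp: sl_flow_def)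
  then have "(y' has_vector_derivative (1 / p x) *\<^sub>R Y x) (at x)"
    "(Y' has_vector_derivative - (q x *\<^sub>R h x)) (at x)"
    using x assms
    by (auto elim!: has_vector_derivative_transform_within_open[of _ _ _ "{c<..<d}"])
  then show "(y' has_vector_derivative (1 / p x) *\<^sub>R Y' x) (at x)"
    "(Y' has_vector_derivative - (q x *\<^sub>R h' x)) (at x)"
    using x assms by auto
qed

lemma sl_flow_reflect:
  assumes f: "sl_flow p q c d y Y h"
  shows "sl_flow (\<lambda>x. p (- x)) (\<lambda>x. q (- x)) (- d) (- c) (\<lambda>x. y (- x)) (\<lambda>x. - Y (- x)) (\<lambda>x. h (- x))"
  unfolding sl_flow_def
proof (intro conjI ballI)
  have "continuous_on {-d..-c} (\<lambda>x. y (- x))" "continuous_on {-d..-c} (\<lambda>x. Y (- x))"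
    using f by (auto intro!: continuous_on_compose2[of "{c..d}" _ _ uminus] continuous_intros simp: sl_flow_def)
  then show "continuous_on {- d..- c} (\<lambda>x. y (- x))" "continuous_on {- d..- c} (\<lambda>x. - Y (- x))"
    by (auto intro!: continuous_intros)
  fix x assume x: "x \<in> {- d<..<- c}"
  then have "(y has_vector_derivative (1 / p (- x)) *\<^sub>R Y (- x)) (at (- x))"
    "(Y has_vector_derivative - (q (- x) *\<^sub>R h (- x))) (at (- x))"
    using f by (auto simp: sl_flow_def)
  then have h: "(y has_vector_derivative (1 / p (- x)) *\<^sub>R Y (- x)) (at (- x) within range uminus)"
    "(Y has_vector_derivative - (q (- x) *\<^sub>R h (- x))) (at (- x) within range uminus)"
    by (auto intro: has_vector_derivative_at_within)
  have m: "(uminus has_vector_derivative (- 1 :: real)) (at x)"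
    by (auto intro!: derivative_eq_intros)
  have "((\<lambda>x. y (- x)) has_vector_derivative (- 1) *\<^sub>R ((1 / p (- x)) *\<^sub>R Y (- x))) (at x)"
     "((\<lambda>x. Y (- x)) has_vector_derivative (- 1) *\<^sub>R (- (q (- x) *\<^sub>R h (- x)))) (at x)"
    using vector_diff_chain_within[OF m h(1)] vector_diff_chain_within[OF m h(2)] by (simp_all add: o_def)
  then show "((\<lambda>x. y (- x)) has_vector_derivative (1 / p (- x)) *\<^sub>R - Y (- x)) (at x)"
    "((\<lambda>x. - Y (- x)) has_vector_derivative - (q (- x) *\<^sub>R h (- x))) (at x)"
    by (auto intro!: derivative_eq_intros)
qed

text \<open>
  The integrand is the derivative of the Wronskian \<open>\<phi> Y - \<Phi> y\<close>.
\<close>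

lemma sl_flow_lagrange:
  fixes y :: "real \<Rightarrow> 'a::real_normed_vector"
  assumes f: "sl_flow p q c d \<phi> \<Phi> f" and g: "sl_flow p q c d y Y g" and "c \<le> d"
  shows "((\<lambda>x. q x *\<^sub>R (f x *\<^sub>R y x - \<phi> x *\<^sub>R g x)) has_integral
     (\<phi> d *\<^sub>R Y d - \<Phi> d *\<^sub>R y d) - (\<phi> c *\<^sub>R Y c - \<Phi> c *\<^sub>R y c)) {c..d}"
proof (rule fundamental_theorem_of_calculus_interior[OF \<open>c \<le> d\<close>])
  show "continuous_on {c..d} (\<lambda>x. \<phi> x *\<^sub>R Y x - \<Phi> x *\<^sub>R y x)"
    using f g by (auto simp: sl_flow_def intro!: continuous_intros)
  fix x assume x: "x \<in> {c<..<d}"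
  have *: "(\<phi> has_real_derivative \<Phi> x / p x) (at x)" "(\<Phi> has_real_derivative - (q x * f x)) (at x)"
    "(y has_vector_derivative (1 / p x) *\<^sub>R Y x) (at x)" "(Y has_vector_derivative - (q x *\<^sub>R g x)) (at x)"
    using f g x by (auto simp: sl_flow_def has_real_derivative_iff_has_vector_derivative)
  show "((\<lambda>x. \<phi> x *\<^sub>R Y x - \<Phi> x *\<^sub>R y x) has_vector_derivative q x *\<^sub>R (f x *\<^sub>R y x - \<phi> x *\<^sub>R g x)) (at x)"
    using * by (auto intro!: derivative_eq_intros simp: algebra_simps)
qed

text \<open>
  The quadratic form of the operator: the integrand is the derivative of \<open>y Y\<close>.
\<close>

lemma sl_flow_form:
  fixes y :: "real \<Rightarrow> real"
  assumes f: "sl_flow p q c d y Y h" and "c \<le> d"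
  shows "((\<lambda>x. (Y x)\<^sup>2 / p x - q x * h x * y x) has_integral (y d * Y d - y c * Y c)) {c..d}"
proof (rule fundamental_theorem_of_calculus_interior[OF \<open>c \<le> d\<close>])
  show "continuous_on {c..d} (\<lambda>x. y x * Y x)"
    using f by (auto simp: sl_flow_def intro!: continuous_intros)
  fix x assume x: "x \<in> {c<..<d}"
  have *: "(y has_real_derivative Y x / p x) (at x)" "(Y has_real_derivative - (q x * h x)) (at x)"
    using f x by (auto simp: sl_flow_def has_real_derivative_iff_has_vector_derivative)
  show "((\<lambda>x. y x * Y x) has_vector_derivative (Y x)\<^sup>2 / p x - q x * h x * y x) (at x)"
    unfolding has_real_derivative_iff_has_vector_derivative[symmetric]
    using * by (auto intro!: derivative_eq_intros simp: algebra_simps power2_eq_square)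
qed

text \<open>
  Gronwall's argument for the energy \<open>|y|\<^sup>2 + |Y|\<^sup>2 + \<eta>\<^sup>2\<close>: the summand \<open>\<eta>\<^sup>2\<close> absorbs the forcing term, so
  that the derivative of the energy is bounded by a multiple of the energy. The values lie in an inner
  product space so that real and complex solutions are treated at once.
\<close>

lemma sl_flow_estimate:
  fixes y :: "real \<Rightarrow> 'a::real_inner"
  assumes f: "sl_flow p q c d y Y (\<lambda>x. z *\<^sub>R y x + g x)" and "c \<le> d" and init: "y c = 0" "Y c = 0"
    and p: "\<And>x. x \<in> {c<..<d} \<Longrightarrow> 0 < p x \<and> 1 / p x \<le> K"
    and q: "\<And>x. x \<in> {c<..<d} \<Longrightarrow> 0 \<le> q x \<and> q x \<le> K"
    and z: "\<bar>z\<bar> \<le> M" and g: "\<And>x. x \<in> {c<..<d} \<Longrightarrow> norm (g x) \<le> \<eta>"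
    and "0 \<le> \<eta>" "0 \<le> K" and x: "x \<in> {c..d}"
  shows "norm (y x) \<le> exp ((2 * K + K * M) * (d - c)) * \<eta> \<and>
         norm (Y x) \<le> exp ((2 * K + K * M) * (d - c)) * \<eta>"
proof -
  define A where "A = 2 * K + K * M"
  have M: "0 \<le> M" using z by linarith
  have A: "0 \<le> A" using M \<open>0 \<le> K\<close> by (simp add: A_def)
  define E where "E x = y x \<bullet> y x + Y x \<bullet> Y x + \<eta>\<^sup>2" for x
  define E' where "E' x = 2 * (y x \<bullet> ((1 / p x) *\<^sub>R Y x)) - 2 * (Y x \<bullet> (q x *\<^sub>R (z *\<^sub>R y x + g x)))" for x
  have dE: "(E has_real_derivative E' x) (at x)" if "x \<in> {c<..<d}" for x
  proof -
    have "(y has_derivative (\<lambda>t. t *\<^sub>R ((1 / p x) *\<^sub>R Y x))) (at x)"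
      "(Y has_derivative (\<lambda>t. t *\<^sub>R - (q x *\<^sub>R (z *\<^sub>R y x + g x)))) (at x)"
      using f that unfolding sl_flow_def has_vector_derivative_def by auto
    then show ?thesis
      unfolding E_def has_field_derivative_def E'_def
      by (auto intro!: derivative_eq_intros simp: fun_eq_iff inner_commute algebra_simps)
  qed
  have E': "E' x \<le> A * E x" if x: "x \<in> {c<..<d}" for x
  proof -
    let ?u = "norm (y x)" and ?v = "norm (Y x)"
    have uv: "2 * (?u * ?v) \<le> ?u\<^sup>2 + ?v\<^sup>2" "2 * (?v * \<eta>) \<le> ?v\<^sup>2 + \<eta>\<^sup>2"
      using sum_squares_bound by (auto simp: mult.assoc)
    have "2 * (y x \<bullet> ((1 / p x) *\<^sub>R Y x)) \<le> 2 * (K * (?u * ?v))"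
    proof -
      have "y x \<bullet> Y x \<le> ?u * ?v" by (rule norm_cauchy_schwarz)
      then have "(1 / p x) * (y x \<bullet> Y x) \<le> (1 / p x) * (?u * ?v)"
        using p[OF x] by (intro mult_left_mono) auto
      also have "\<dots> \<le> K * (?u * ?v)" using p[OF x] by (intro mult_right_mono) auto
      finally show ?thesis by simp
    qed
    moreover have "- 2 * (Y x \<bullet> (q x *\<^sub>R (z *\<^sub>R y x + g x))) \<le> 2 * (K * (M * (?u * ?v) + ?v * \<eta>))"
    proof -
      have "- (Y x \<bullet> (z *\<^sub>R y x + g x)) \<le> ?v * norm (z *\<^sub>R y x + g x)"
        using Cauchy_Schwarz_ineq2[of "Y x" "z *\<^sub>R y x + g x"] by linarith
      also have "\<dots> \<le> ?v * (M * ?u + \<eta>)"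
        using z g[OF x] by (intro mult_left_mono norm_triangle_le add_mono) (auto intro: mult_right_mono)
      finally have "q x * - (Y x \<bullet> (z *\<^sub>R y x + g x)) \<le> q x * (?v * (M * ?u + \<eta>))"
        using q[OF x] by (intro mult_left_mono) auto
      also have "\<dots> \<le> K * (?v * (M * ?u + \<eta>))"
        using q[OF x] M \<open>0 \<le> \<eta>\<close> by (intro mult_right_mono) auto
      finally show ?thesis by (simp add: algebra_simps)
    qed
    ultimately have "E' x \<le> (K + K * M) * (2 * (?u * ?v)) + K * (2 * (?v * \<eta>))"
      by (simp add: E'_def algebra_simps)
    also have "\<dots> \<le> (K + K * M) * (?u\<^sup>2 + ?v\<^sup>2) + K * (?v\<^sup>2 + \<eta>\<^sup>2)"
      using uv M \<open>0 \<le> K\<close> by (intro add_mono mult_left_mono) auto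
    also have "\<dots> \<le> A * (?u\<^sup>2 + ?v\<^sup>2 + \<eta>\<^sup>2)"
      using M \<open>0 \<le> K\<close> by (simp add: A_def algebra_simps)
    finally show ?thesis by (simp add: E_def power2_norm_eq_inner)
  qed
  define G where "G x = E x * exp (- (A * (x - c)))" for x
  have "G x \<le> G c"
  proof (cases "x = c")
    case False
    then have "c < x" using x by auto
    show ?thesis
    proof (rule DERIV_nonpos_imp_decreasing_open[of c x])
      fix t assume t: "c < t" "t < x"
      then have t': "t \<in> {c<..<d}" using x by auto
      have "(G has_real_derivative (E' t - A * E t) * exp (- (A * (t - c)))) (at t)"
        unfolding G_def using dE[OF t'] by (auto intro!: derivative_eq_intros simp: algebra_simps)
      moreover have "(E' t - A * E t) * exp (- (A * (t - c))) \<le> 0"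
        using E'[OF t'] by (simp add: mult_le_0_iff)
      ultimately show "\<exists>y. (G has_real_derivative y) (at t) \<and> y \<le> 0" by blast
    next
      have "continuous_on {c..x} y" "continuous_on {c..x} Y"
        using f x by (auto simp: sl_flow_def intro: continuous_on_subset)
      then show "continuous_on {c..x} G"
        unfolding G_def E_def by (intro continuous_intros)
    qed (use \<open>c < x\<close> in auto)
  qed auto
  then have "E x * exp (- (A * (x - c))) \<le> \<eta>\<^sup>2"
    using init by (simp add: G_def E_def)
  then have "exp (A * (x - c)) * (E x * exp (- (A * (x - c)))) \<le> exp (A * (x - c)) * \<eta>\<^sup>2"
    by (intro mult_left_mono) auto
  moreover have "exp t * (E x * exp (- t)) = E x" for t :: real
    by (simp add: exp_minus)
  ultimately have "E x \<le> exp (A * (x - c)) * \<eta>\<^sup>2"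
    by simp
  also have "\<dots> \<le> (exp (A * (d - c)))\<^sup>2 * \<eta>\<^sup>2"
  proof (intro mult_right_mono)
    have "A * (x - c) \<le> A * (d - c)" "0 \<le> A * (d - c)"
      using x A by (auto intro!: mult_left_mono)
    then have "exp (A * (x - c)) \<le> exp (A * (d - c) + A * (d - c))"
      by simp
    then show "exp (A * (x - c)) \<le> (exp (A * (d - c)))\<^sup>2"
      by (simp only: power2_eq_square exp_add)
  qed auto
  finally have E: "E x \<le> (exp (A * (d - c)) * \<eta>)\<^sup>2" by (simp add: power_mult_distrib)
  have "(norm (y x))\<^sup>2 \<le> E x" "(norm (Y x))\<^sup>2 \<le> E x"
    by (auto simp: E_def power2_norm_eq_inner)
  then have "(norm (y x))\<^sup>2 \<le> (exp (A * (d - c)) * \<eta>)\<^sup>2" "(norm (Y x))\<^sup>2 \<le> (exp (A * (d - c)) * \<eta>)\<^sup>2"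
    using E by linarith+
  then show ?thesis
    using \<open>0 \<le> \<eta>\<close> unfolding A_def by (auto dest!: power2_le_imp_le)
qed

section \<open>The fundamental solution as a power series in the spectral parameter\<close>

lemma integral_pos_of_continuous:
  fixes f :: "real \<Rightarrow> real"
  assumes "continuous_on {c..d} f" "c < d" "\<And>x. x \<in> {c..d} \<Longrightarrow> 0 \<le> f x" "x0 \<in> {c..d}" "f x0 \<noteq> 0"
  shows "0 < integral {c..d} f"
proof -
  have "0 \<le> integral {c..d} f"
    using assms by (intro integral_nonneg integrable_continuous_real) auto
  moreover have "integral {c..d} f \<noteq> 0"
    using integral_eq_0_iff[of c d f] assms by auto
  ultimately show ?thesis by simp
qed

text \<open>
  Two continuous derivatives in the spectral parameter suffice: the splitting of a double zero is
  governed by the second derivative of the characteristic function.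
\<close>

definition C2_fun :: "(real \<Rightarrow> real) \<Rightarrow> bool" where
  "C2_fun f \<longleftrightarrow> (\<exists>f1 f2. (\<forall>z. (f has_real_derivative f1 z) (at z)) \<and>
     (\<forall>z. (f1 has_real_derivative f2 z) (at z)) \<and> (\<forall>z. isCont f2 z))"

lemma C2_fun_powser:
  fixes a :: "nat \<Rightarrow> real"
  assumes s: "\<And>z. summable (\<lambda>n. a n * z ^ n)"
  shows "C2_fun (\<lambda>z. \<Sum>n. a n * z ^ n)"
proof -
  note s1 = termdiff_converges_all[OF s] and s2 = termdiff_converges_all[OF termdiff_converges_all[OF s]]
  show ?thesis
    unfolding C2_fun_def
  proof (rule exI[of _ "\<lambda>z. \<Sum>n. diffs a n * z ^ n"], rule exI[of _ "\<lambda>z. \<Sum>n. diffs (diffs a) n * z ^ n"], intro conjI allI)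
    show "((\<lambda>z. \<Sum>n. a n * z ^ n) has_real_derivative (\<Sum>n. diffs a n * z ^ n)) (at z)" for z
      by (rule termdiffs_strong_converges_everywhere[OF s])
    show "((\<lambda>z. \<Sum>n. diffs a n * z ^ n) has_real_derivative (\<Sum>n. diffs (diffs a) n * z ^ n)) (at z)" for z
      by (rule termdiffs_strong_converges_everywhere[OF s1])
    show "isCont (\<lambda>z. \<Sum>n. diffs (diffs a) n * z ^ n) z" for z
      by (rule DERIV_isCont[OF termdiffs_strong_converges_everywhere[OF s2]])
  qed
qed

lemma C2_fun_deriv:
  assumes "C2_fun f"
  shows "(f has_real_derivative deriv f z) (at z)" "(deriv f has_real_derivative deriv (deriv f) z) (at z)"
    "isCont (deriv (deriv f)) z" "isCont f z" "isCont (deriv f) z"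
proof -
  obtain f1 f2 where f: "\<And>z. (f has_real_derivative f1 z) (at z)"
    "\<And>z. (f1 has_real_derivative f2 z) (at z)" "\<And>z. isCont f2 z"
    using assms unfolding C2_fun_def by blast
  have eq: "deriv f = f1" "deriv f1 = f2" using f by (auto intro: DERIV_imp_deriv)
  show d: "(f has_real_derivative deriv f z) (at z)" "(deriv f has_real_derivative deriv (deriv f) z) (at z)"
    "isCont (deriv (deriv f)) z" using f by (simp_all add: eq)
  show "isCont f z" "isCont (deriv f) z" using d by (blast intro: DERIV_isCont)+
qed

lemma C2_fun_mult:
  assumes f: "C2_fun f" and g: "C2_fun g"
  shows "C2_fun (\<lambda>z. f z * g z)" "deriv (\<lambda>z. f z * g z) z = deriv f z * g z + f z * deriv g z"
    "deriv (deriv (\<lambda>z. f z * g z)) z = deriv (deriv f) z * g z + 2 * deriv f z * deriv g z + f z * deriv (deriv g) z"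
proof -
  note df = C2_fun_deriv[OF f] and dg = C2_fun_deriv[OF g]
  have 1: "((\<lambda>z. f z * g z) has_real_derivative deriv f z * g z + f z * deriv g z) (at z)" for z
    by (rule DERIV_cong, (rule derivative_intros df dg)+) simp
  have 2: "((\<lambda>z. deriv f z * g z + f z * deriv g z) has_real_derivative
      deriv (deriv f) z * g z + 2 * deriv f z * deriv g z + f z * deriv (deriv g) z) (at z)" for z
    by (rule DERIV_cong, (rule derivative_intros df dg)+) (simp add: algebra_simps)
  have 3: "isCont (\<lambda>z. deriv (deriv f) z * g z + 2 * deriv f z * deriv g z + f z * deriv (deriv g) z) z" for z
    using df dg by (intro continuous_intros)
  show "C2_fun (\<lambda>z. f z * g z)"
    unfolding C2_fun_def by (rule exI, rule exI, intro conjI allI, rule 1, rule 2, rule 3)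
  have eq: "deriv (\<lambda>z. f z * g z) = (\<lambda>z. deriv f z * g z + f z * deriv g z)"
    using 1 by (auto intro: DERIV_imp_deriv)
  show "deriv (\<lambda>z. f z * g z) z = deriv f z * g z + f z * deriv g z" by (simp add: eq)
  show "deriv (deriv (\<lambda>z. f z * g z)) z = deriv (deriv f) z * g z + 2 * deriv f z * deriv g z + f z * deriv (deriv g) z"
    unfolding eq by (rule DERIV_imp_deriv[OF 2])
qed

text \<open>
  One of the two intervals, with the junction placed at \<open>0\<close> and the Dirichlet end point at \<open>c < 0\<close>.
\<close>

locale leg =
  fixes p q :: "real \<Rightarrow> real" and c :: real
  assumes c: "c < 0"
    and cont_p: "continuous_on {c..0} p" and cont_q: "continuous_on {c..0} q"
    and p_pos: "\<And>x. x \<in> {c..0} \<Longrightarrow> 0 < p x" and q_pos: "\<And>x. x \<in> {c..0} \<Longrightarrow> 0 < q x"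
begin

lemma coefficient_bound: "\<exists>K>0. (\<forall>x\<in>{c..0}. 1 / p x \<le> K) \<and> (\<forall>x\<in>{c..0}. q x \<le> K)"
proof -
  have "continuous_on {c..0} (\<lambda>x. 1 / p x)"
    using cont_p p_pos by (intro continuous_intros) (auto simp: less_le)
  then have "bounded ((\<lambda>x. 1 / p x) ` {c..0})" "bounded (q ` {c..0})"
    using cont_q by (auto intro!: compact_imp_bounded compact_continuous_image)
  then obtain K1 K2 where "\<forall>x\<in>{c..0}. \<bar>1 / p x\<bar> \<le> K1" "\<forall>x\<in>{c..0}. \<bar>q x\<bar> \<le> K2"
    by (auto simp: bounded_iff)
  then have "1 / p x \<le> \<bar>K1\<bar> + \<bar>K2\<bar> + 1" "q x \<le> \<bar>K1\<bar> + \<bar>K2\<bar> + 1" if "x \<in> {c..0}" for x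
  proof -
    have "1 / p x \<le> K1" "q x \<le> K2"
      using that \<open>\<forall>x\<in>{c..0}. \<bar>1 / p x\<bar> \<le> K1\<close> \<open>\<forall>x\<in>{c..0}. \<bar>q x\<bar> \<le> K2\<close> abs_le_D1 by blast+
    then show "1 / p x \<le> \<bar>K1\<bar> + \<bar>K2\<bar> + 1" "q x \<le> \<bar>K1\<bar> + \<bar>K2\<bar> + 1" by linarith+
  qed
  then show ?thesis by (intro exI[of _ "\<bar>K1\<bar> + \<bar>K2\<bar> + 1"]) auto
qed

text \<open>
  Picard iterates of the system \<open>y' = Y/p\<close>, \<open>Y' = - z q y - q h\<close>, sorted by powers of \<open>z\<close>:
  \<open>flux_iter F n\<close> and \<open>value_iter F n\<close> are the coefficients of \<open>z\<^sup>n\<close> in \<open>Y\<close> and \<open>y\<close>. The starting flux \<open>F\<close> is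
  \<open>1\<close> for the fundamental solution and \<open>- \<integral> q h\<close> for a forced solution with zero initial data.
\<close>

primrec flux_iter :: "(real \<Rightarrow> real) \<Rightarrow> nat \<Rightarrow> real \<Rightarrow> real" where
  "flux_iter F 0 = F"
| "flux_iter F (Suc n) = (\<lambda>x. - integral {c..x} (\<lambda>s. q s * integral {c..s} (\<lambda>t. flux_iter F n t / p t)))"

definition value_iter :: "(real \<Rightarrow> real) \<Rightarrow> nat \<Rightarrow> real \<Rightarrow> real" where
  "value_iter F n x = integral {c..x} (\<lambda>t. flux_iter F n t / p t)"

lemma flux_iter_Suc: "flux_iter F (Suc n) = (\<lambda>x. - integral {c..x} (\<lambda>s. q s * value_iter F n s))"
  by (simp add: value_iter_def)

context
  fixes F :: "real \<Rightarrow> real" assumes F: "continuous_on {c..0} F"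
begin

lemma cont_iter: "continuous_on {c..0} (flux_iter F n) \<and> continuous_on {c..0} (value_iter F n)"
proof (induction n)
  case 0
  have "continuous_on {c..0} (\<lambda>t. F t / p t)"
    using F cont_p p_pos by (intro continuous_intros) (auto simp: less_le)
  then show ?case
    unfolding value_iter_def using F
    by (auto intro!: indefinite_integral_continuous_1 integrable_continuous_real)
next
  case (Suc n)
  have "continuous_on {c..0} (\<lambda>s. q s * value_iter F n s)"
    using Suc cont_q by (intro continuous_intros) auto
  then have 1: "continuous_on {c..0} (flux_iter F (Suc n))"
    unfolding flux_iter_Suc
    by (intro continuous_on_minus indefinite_integral_continuous_1 integrable_continuous_real)
  then have "continuous_on {c..0} (\<lambda>t. flux_iter F (Suc n) t / p t)"
    using cont_p p_pos by (intro continuous_intros) (auto simp: less_le)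
  then have "continuous_on {c..0} (value_iter F (Suc n))"
    unfolding value_iter_def
    by (intro indefinite_integral_continuous_1 integrable_continuous_real)
  with 1 show ?case by blast
qed

lemma value_iter_deriv:
  assumes "x \<in> {c..0}"
  shows "(value_iter F n has_real_derivative flux_iter F n x / p x) (at x within {c..0})"
proof -
  have "continuous_on {c..0} (\<lambda>t. flux_iter F n t / p t)"
    using cont_iter cont_p p_pos by (intro continuous_intros) (auto simp: less_le)
  then show ?thesis
    using integral_has_real_derivative[of c 0 _ x] assms by (simp add: value_iter_def[abs_def])
qed

lemma flux_iter_deriv:
  assumes "x \<in> {c..0}"
  shows "(flux_iter F (Suc n) has_real_derivative - (q x * value_iter F n x)) (at x within {c..0})"
proof -
  have "continuous_on {c..0} (\<lambda>s. q s * value_iter F n s)"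
    using cont_iter cont_q by (intro continuous_intros) auto
  then show ?thesis
    unfolding flux_iter_Suc
    using integral_has_real_derivative[of c 0 _ x] assms by (intro DERIV_minus) simp
qed

text \<open>
  Each step integrates twice and gains a factor \<open>(x - c)/(n + 1)\<close>; hence the series in \<open>z\<close> converge for
  all \<open>z\<close>, uniformly in \<open>x\<close>.
\<close>

lemma iter_bound:
  "\<exists>B\<ge>0. \<exists>D\<ge>0. \<forall>n. \<forall>x\<in>{c..0}. \<bar>flux_iter F n x\<bar> \<le> B * (D ^ n / fact n) \<and>
     \<bar>value_iter F n x\<bar> \<le> B * (D ^ n / fact n)"
proof -
  obtain K where K: "0 < K" "\<And>x. x \<in> {c..0} \<Longrightarrow> 1 / p x \<le> K" "\<And>x. x \<in> {c..0} \<Longrightarrow> q x \<le> K"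
    using coefficient_bound by blast
  have "bounded (F ` {c..0})" using F by (auto intro!: compact_imp_bounded compact_continuous_image)
  then have "\<exists>B0>0. \<forall>x\<in>{c..0}. \<bar>F x\<bar> \<le> B0"
    by (auto simp: bounded_pos)
  then obtain B0 where B0: "\<And>x. x \<in> {c..0} \<Longrightarrow> \<bar>F x\<bar> \<le> B0" "0 < B0"
    by blast
  \<comment> \<open>A step of the iteration multiplies by \<open>q\<close> and \<open>1/p\<close> and integrates twice; one of the two integrations is estimated by the length of the interval.\<close>
  define D where "D = K * K * \<bar>c\<bar>"
  have D: "0 \<le> D" using K by (simp add: D_def)
  have value_bound: "\<bar>value_iter F n x\<bar> \<le> K * \<bar>c\<bar> * (B0 * (D * (x - c)) ^ n / fact n)"
    if fb: "\<And>x. x \<in> {c..0} \<Longrightarrow> \<bar>flux_iter F n x\<bar> \<le> B0 * (D * (x - c)) ^ n / fact n" and x: "x \<in> {c..0}"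
    for n x
  proof -
    let ?m = "B0 * (D * (x - c)) ^ n / fact n"
    have m: "0 \<le> ?m" using D B0 x by (auto intro!: mult_nonneg_nonneg zero_le_power)
    have "norm (integral {c..x} (\<lambda>t. flux_iter F n t / p t)) \<le> (K * ?m) * (x - c)"
    proof (rule integral_bound)
      show "c \<le> x" using x by simp
      show "continuous_on {c..x} (\<lambda>t. flux_iter F n t / p t)"
        by (rule continuous_on_subset[of "{c..0}"])
          (use cont_iter cont_p p_pos x in \<open>auto intro!: continuous_intros simp: less_le\<close>)
      fix t assume t: "t \<in> {c..x}"
      then have t0: "t \<in> {c..0}" using x by auto
      have "\<bar>flux_iter F n t\<bar> \<le> B0 * (D * (t - c)) ^ n / fact n" by (rule fb[OF t0])
      also have "\<dots> \<le> ?m"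
        using t D B0 by (intro divide_right_mono mult_left_mono power_mono) auto
      finally have "(1 / p t) * \<bar>flux_iter F n t\<bar> \<le> K * ?m"
        using K(2)[OF t0] K(1) p_pos[OF t0] m by (intro mult_mono) auto
      then show "norm (flux_iter F n t / p t) \<le> K * ?m"
        using p_pos[OF t0] by simp
    qed
    also have "\<dots> \<le> (K * ?m) * \<bar>c\<bar>"
      using x K(1) m by (intro mult_left_mono mult_nonneg_nonneg) simp_all
    finally show ?thesis unfolding value_iter_def by (simp only: mult_ac real_norm_def)
  qed
  have flux_bound: "\<bar>flux_iter F n x\<bar> \<le> B0 * (D * (x - c)) ^ n / fact n" if "x \<in> {c..0}" for n x
    using that
  proof (induction n arbitrary: x)
    case 0
    then show ?case using B0 by simp
  next
    case (Suc n)
    have "norm (integral {c..x} (\<lambda>s. q s * value_iter F n s)) \<le>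
        integral {c..x} (\<lambda>s. B0 * D ^ Suc n / fact n * (s - c) ^ n)"
    proof (rule integral_norm_bound_integral)
      show "(\<lambda>s. q s * value_iter F n s) integrable_on {c..x}"
        by (rule integrable_continuous_real, rule continuous_on_subset[of "{c..0}"])
          (use cont_iter cont_q Suc.prems in \<open>auto intro!: continuous_intros\<close>)
      show "(\<lambda>s. B0 * D ^ Suc n / fact n * (s - c) ^ n) integrable_on {c..x}"
        by (intro integrable_continuous_real continuous_intros)
      fix s assume s: "s \<in> {c..x}"
      then have s0: "s \<in> {c..0}" using Suc.prems by auto
      have "\<bar>q s * value_iter F n s\<bar> \<le> K * (K * \<bar>c\<bar> * (B0 * (D * (s - c)) ^ n / fact n))"
        unfolding abs_mult using value_bound[OF Suc.IH s0] K(3)[OF s0] q_pos[OF s0]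
        by (intro mult_mono) auto
      also have "\<dots> = B0 * D ^ Suc n / fact n * (s - c) ^ n"
        by (simp add: D_def power_mult_distrib mult_ac)
      finally show "norm (q s * value_iter F n s) \<le> B0 * D ^ Suc n / fact n * (s - c) ^ n"
        by simp
    qed
    also have "integral {c..x} (\<lambda>s. B0 * D ^ Suc n / fact n * (s - c) ^ n) =
        B0 * D ^ Suc n / fact n * ((x - c) ^ Suc n / Suc n)"
    proof -
      have "((\<lambda>s. (s - c) ^ n) has_integral (x - c) ^ Suc n / Suc n - (c - c) ^ Suc n / Suc n) {c..x}"
      proof (rule fundamental_theorem_of_calculus)
        fix s
        have "((\<lambda>s. (s - c) ^ Suc n / real (Suc n)) has_real_derivative (s - c) ^ n) (at s within {c..x})"
          by (rule DERIV_cong, (rule derivative_intros)+) (simp_all del: of_nat_Suc)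
        then show "((\<lambda>s. (s - c) ^ Suc n / real (Suc n)) has_vector_derivative (s - c) ^ n) (at s within {c..x})"
          by (simp add: has_real_derivative_iff_has_vector_derivative)
      qed (use Suc.prems in auto)
      then have "integral {c..x} (\<lambda>s. (s - c) ^ n) = (x - c) ^ Suc n / Suc n"
        by (simp add: integral_unique)
      then show ?thesis by simp
    qed
    also have "\<dots> = B0 * (D * (x - c)) ^ Suc n / fact (Suc n)"
      by (simp add: power_mult_distrib fact_Suc mult_ac)
    finally show ?case unfolding flux_iter_Suc by (simp del: flux_iter.simps)
  qed
  have pw: "B0 * (D * (x - c)) ^ n / fact n \<le> B0 * ((D * \<bar>c\<bar>) ^ n / fact n)" if "x \<in> {c..0}" for n x
  proof -
    have "(D * (x - c)) ^ n \<le> (D * \<bar>c\<bar>) ^ n"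
      using that D by (intro power_mono mult_left_mono) auto
    then show ?thesis using B0 by (simp add: divide_right_mono)
  qed
  define B where "B = (1 + K * \<bar>c\<bar>) * B0"
  have "0 \<le> B" "0 \<le> D * \<bar>c\<bar>" using B0 K D by (auto simp: B_def)
  moreover have "\<bar>flux_iter F n x\<bar> \<le> B * ((D * \<bar>c\<bar>) ^ n / fact n) \<and>
      \<bar>value_iter F n x\<bar> \<le> B * ((D * \<bar>c\<bar>) ^ n / fact n)" if x: "x \<in> {c..0}" for n x
  proof (intro conjI)
    let ?e = "(D * \<bar>c\<bar>) ^ n / fact n"
    have e: "0 \<le> ?e" using D by simp
    have "\<bar>flux_iter F n x\<bar> \<le> B0 * ?e"
      using flux_bound[OF x, of n] pw[OF x, of n] by linarith
    also have "\<dots> \<le> B * ?e"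
      using e B0 K by (intro mult_right_mono) (auto simp: B_def algebra_simps)
    finally show "\<bar>flux_iter F n x\<bar> \<le> B * ?e" .
    have "\<bar>value_iter F n x\<bar> \<le> K * \<bar>c\<bar> * (B0 * (D * (x - c)) ^ n / fact n)"
      by (rule value_bound[OF flux_bound x])
    also have "\<dots> \<le> K * \<bar>c\<bar> * (B0 * ?e)"
      using pw[OF x, of n] K by (intro mult_left_mono) auto
    also have "\<dots> \<le> B * ?e"
    proof -
      have "0 \<le> B0 * ?e" using e B0 by (intro mult_nonneg_nonneg) auto
      moreover have "B * ?e = B0 * ?e + K * \<bar>c\<bar> * (B0 * ?e)"
        by (simp only: B_def distrib_right mult.assoc mult_1)
      ultimately show ?thesis by simp
    qed
    finally show "\<bar>value_iter F n x\<bar> \<le> B * ?e" .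
  qed
  ultimately show ?thesis by blast
qed

lemma iter_series:
  "\<exists>m. summable m \<and> (\<forall>n. \<forall>x\<in>{c..0}. \<bar>flux_iter F n x * z ^ n\<bar> \<le> m n \<and>
     \<bar>value_iter F n x * z ^ n\<bar> \<le> m n)"
proof -
  obtain B D where BD: "0 \<le> B" "0 \<le> D"
    "\<And>n x. x \<in> {c..0} \<Longrightarrow> \<bar>flux_iter F n x\<bar> \<le> B * (D ^ n / fact n)"
    "\<And>n x. x \<in> {c..0} \<Longrightarrow> \<bar>value_iter F n x\<bar> \<le> B * (D ^ n / fact n)"
    using iter_bound by blast
  have eq: "B * (D ^ n / fact n) * \<bar>z\<bar> ^ n = B * ((D * \<bar>z\<bar>) ^ n /\<^sub>R fact n)" for n
    by (simp add: power_mult_distrib field_simps)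
  show ?thesis
  proof (intro exI[of _ "\<lambda>n. B * ((D * \<bar>z\<bar>) ^ n /\<^sub>R fact n)"] conjI allI ballI)
    show "summable (\<lambda>n. B * ((D * \<bar>z\<bar>) ^ n /\<^sub>R fact n))"
      by (intro summable_mult summable_exp_generic)
    show "\<bar>flux_iter F n x * z ^ n\<bar> \<le> B * ((D * \<bar>z\<bar>) ^ n /\<^sub>R fact n)"
      "\<bar>value_iter F n x * z ^ n\<bar> \<le> B * ((D * \<bar>z\<bar>) ^ n /\<^sub>R fact n)" if "x \<in> {c..0}" for n x
      unfolding eq[symmetric] abs_mult power_abs by (intro mult_right_mono BD that; simp)+
  qed
qed

definition value_series :: "real \<Rightarrow> real \<Rightarrow> real" where
  "value_series z x = (\<Sum>n. value_iter F n x * z ^ n)"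

definition flux_series :: "real \<Rightarrow> real \<Rightarrow> real" where
  "flux_series z x = (\<Sum>n. flux_iter F n x * z ^ n)"

lemma summable_iter:
  assumes "x \<in> {c..0}"
  shows "summable (\<lambda>n. value_iter F n x * z ^ n)" "summable (\<lambda>n. flux_iter F n x * z ^ n)"
proof -
  obtain m where m: "summable m"
    "\<And>n x. x \<in> {c..0} \<Longrightarrow> \<bar>flux_iter F n x * z ^ n\<bar> \<le> m n"
    "\<And>n x. x \<in> {c..0} \<Longrightarrow> \<bar>value_iter F n x * z ^ n\<bar> \<le> m n"
    using iter_series[of z] by blast
  show "summable (\<lambda>n. value_iter F n x * z ^ n)" "summable (\<lambda>n. flux_iter F n x * z ^ n)"
    using m assms by (auto intro!: summable_comparison_test'[OF m(1), of 0])
qed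

text \<open>
  The termwise derivatives form a power series in \<open>z\<close> as well, with the coefficients of the flux, and
  it converges uniformly in \<open>x\<close>.
\<close>

lemma value_series_deriv:
  assumes "x \<in> {c..0}"
  shows "(value_series z has_real_derivative flux_series z x / p x) (at x within {c..0})"
proof -
  obtain m where m: "summable m"
    "\<And>n x. x \<in> {c..0} \<Longrightarrow> \<bar>flux_iter F n x * z ^ n\<bar> \<le> m n"
    "\<And>n x. x \<in> {c..0} \<Longrightarrow> \<bar>value_iter F n x * z ^ n\<bar> \<le> m n"
    using iter_series[of z] by blast
  obtain K where K: "0 < K" "\<And>x. x \<in> {c..0} \<Longrightarrow> 1 / p x \<le> K"
    using coefficient_bound by blast
  have u: "uniform_limit {c..0} (\<lambda>n x. \<Sum>i<n. flux_iter F i x * z ^ i / p x) (\<lambda>x. flux_series z x / p x) sequentially"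
  proof -
    have "uniform_limit {c..0} (\<lambda>n x. \<Sum>i<n. flux_iter F i x * z ^ i / p x) (\<lambda>x. \<Sum>i. flux_iter F i x * z ^ i / p x) sequentially"
    proof (rule Weierstrass_m_test)
      show "summable (\<lambda>n. K * m n)" by (intro summable_mult m)
      show "norm (flux_iter F n x * z ^ n / p x) \<le> K * m n" if x: "x \<in> {c..0}" for n x
      proof -
        have "(1 / p x) * \<bar>flux_iter F n x * z ^ n\<bar> \<le> K * m n"
          using K m x p_pos[OF x] by (intro mult_mono) auto
        then show ?thesis using p_pos[OF x] by (simp add: abs_mult)
      qed
    qed
    also have "?this \<longleftrightarrow> ?thesis"
      by (rule uniform_limit_cong') (auto simp: flux_series_def suminf_divide summable_iter)
    finally show ?thesis .
  qed
  have d: "((\<lambda>x. value_iter F n x * z ^ n) has_real_derivative flux_iter F n x * z ^ n / p x) (at x within {c..0})"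
    if "x \<in> {c..0}" for n x
    by (rule DERIV_cong, (rule derivative_intros value_iter_deriv that)+) simp
  have c0: "c \<in> {c..0}" using c by simp
  have "\<exists>g. \<forall>x\<in>{c..0}. (\<lambda>n. value_iter F n x * z ^ n) sums g x \<and>
      (g has_real_derivative flux_series z x / p x) (at x within {c..0})"
    by (rule has_field_derivative_series[OF convex_real_interval(5) d u c0 summable_iter(1)[OF c0]])
  then obtain g where g: "\<And>x. x \<in> {c..0} \<Longrightarrow> (\<lambda>n. value_iter F n x * z ^ n) sums g x"
    "\<And>x. x \<in> {c..0} \<Longrightarrow> (g has_real_derivative flux_series z x / p x) (at x within {c..0})"
    by blast
  have "value_series z x = g x" if "x \<in> {c..0}" for x
    using g(1)[OF that] by (simp add: value_series_def sums_iff)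
  then show ?thesis
    using has_field_derivative_transform_within[OF g(2)[OF assms] zero_less_one assms] by auto
qed

lemma flux_series_deriv:
  "\<exists>g. (\<forall>x\<in>{c..0}. flux_series z x = F x + g x) \<and>
    (\<forall>x\<in>{c..0}. (g has_real_derivative - (q x * (z * value_series z x))) (at x within {c..0})) \<and> g c = 0"
proof -
  obtain m where m: "summable m"
    "\<And>n x. x \<in> {c..0} \<Longrightarrow> \<bar>flux_iter F n x * z ^ n\<bar> \<le> m n"
    "\<And>n x. x \<in> {c..0} \<Longrightarrow> \<bar>value_iter F n x * z ^ n\<bar> \<le> m n"
    using iter_series[of z] by blast
  obtain K where K: "0 < K" "\<And>x. x \<in> {c..0} \<Longrightarrow> q x \<le> K"
    using coefficient_bound by blast
  have u: "uniform_limit {c..0} (\<lambda>n x. \<Sum>i<n. - (q x * z) * (value_iter F i x * z ^ i))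
      (\<lambda>x. - (q x * (z * value_series z x))) sequentially"
  proof -
    have "uniform_limit {c..0} (\<lambda>n x. \<Sum>i<n. - (q x * z) * (value_iter F i x * z ^ i))
        (\<lambda>x. \<Sum>i. - (q x * z) * (value_iter F i x * z ^ i)) sequentially"
    proof (rule Weierstrass_m_test)
      show "summable (\<lambda>n. K * \<bar>z\<bar> * m n)" by (intro summable_mult m)
      show "norm (- (q x * z) * (value_iter F n x * z ^ n)) \<le> K * \<bar>z\<bar> * m n" if x: "x \<in> {c..0}" for n x
      proof -
        have "\<bar>- (q x * z)\<bar> * \<bar>value_iter F n x * z ^ n\<bar> \<le> K * \<bar>z\<bar> * m n"
          using K m x q_pos[OF x] by (intro mult_mono) (auto simp: abs_mult intro!: mult_right_mono)
        then show ?thesis by (simp add: abs_mult)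
      qed
    qed
    also have "?this \<longleftrightarrow> ?thesis"
    proof (rule uniform_limit_cong')
      fix x assume x: "x \<in> {c..0}"
      show "(\<Sum>i. - (q x * z) * (value_iter F i x * z ^ i)) = - (q x * (z * value_series z x))"
        unfolding value_series_def by (subst suminf_mult[OF summable_iter(1)[OF x]]) (simp add: mult_ac)
    qed auto
    finally show ?thesis .
  qed
  have d: "((\<lambda>x. flux_iter F (Suc n) x * z ^ Suc n) has_real_derivative - (q x * z) * (value_iter F n x * z ^ n)) (at x within {c..0})"
    if "x \<in> {c..0}" for n x
    by (rule DERIV_cong, (rule derivative_intros flux_iter_deriv that)+) simp
  have sm: "summable (\<lambda>n. flux_iter F (Suc n) x * z ^ Suc n)" if "x \<in> {c..0}" for x
    using summable_iter(2)[OF that, of z] by (subst summable_Suc_iff)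
  have c0: "c \<in> {c..0}" using c by simp
  have "\<exists>g. \<forall>x\<in>{c..0}. (\<lambda>n. flux_iter F (Suc n) x * z ^ Suc n) sums g x \<and>
      (g has_real_derivative - (q x * (z * value_series z x))) (at x within {c..0})"
    by (rule has_field_derivative_series[OF convex_real_interval(5) d u c0 sm[OF c0]])
  then obtain g where g: "\<And>x. x \<in> {c..0} \<Longrightarrow> (\<lambda>n. flux_iter F (Suc n) x * z ^ Suc n) sums g x"
    "\<And>x. x \<in> {c..0} \<Longrightarrow> (g has_real_derivative - (q x * (z * value_series z x))) (at x within {c..0})"
    by blast
  show ?thesis
  proof (intro exI[of _ g] conjI ballI)
    show "flux_series z x = F x + g x" if x: "x \<in> {c..0}" for x
      using g(1)[OF x] suminf_split_head[OF summable_iter(2)[OF x, of z]]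
      by (simp add: flux_series_def sums_iff del: flux_iter.simps(2))
    have "flux_iter F (Suc n) c = 0" for n
      by (simp add: flux_iter_Suc del: flux_iter.simps(2))
    then have "(\<lambda>n. flux_iter F (Suc n) c * z ^ Suc n) sums 0"
      by (simp del: flux_iter.simps(2))
    from sums_unique2[OF g(1)[OF c0] this] show "g c = 0" .
  qed (use g in auto)
qed

lemma series_flow:
  assumes dF: "\<And>x. x \<in> {c<..<0} \<Longrightarrow> (F has_real_derivative - (q x * h x)) (at x)"
  shows "sl_flow p q c 0 (value_series z) (flux_series z) (\<lambda>x. z * value_series z x + h x)"
    "value_series z c = 0" "flux_series z c = F c"
proof -
  obtain g where g: "\<And>x. x \<in> {c..0} \<Longrightarrow> flux_series z x = F x + g x"
    "\<And>x. x \<in> {c..0} \<Longrightarrow> (g has_real_derivative - (q x * (z * value_series z x))) (at x within {c..0})"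
    "g c = 0"
    using flux_series_deriv[of z] by blast
  have cg: "continuous_on {c..0} (\<lambda>x. F x + g x)"
    by (rule continuous_on_add[OF F DERIV_continuous_on[OF g(2)]])
  have at_eq: "(at x within {c..0}) = at x" if "x \<in> {c<..<0}" for x
    using that by (intro at_within_interior) (auto simp: interior_atLeastAtMost_real)
  show "sl_flow p q c 0 (value_series z) (flux_series z) (\<lambda>x. z * value_series z x + h x)"
    unfolding sl_flow_def
  proof (intro conjI ballI)
    show "continuous_on {c..0} (value_series z)"
      using value_series_deriv by (rule DERIV_continuous_on)
    show "continuous_on {c..0} (flux_series z)"
      by (rule continuous_on_eq[OF cg]) (use g in auto)
    fix x assume x: "x \<in> {c<..<0}"
    show "(value_series z has_vector_derivative (1 / p x) *\<^sub>R flux_series z x) (at x)"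
      using value_series_deriv[of x z] x at_eq[OF x]
      by (simp add: has_real_derivative_iff_has_vector_derivative[symmetric])
    have "((\<lambda>x. F x + g x) has_real_derivative - (q x * (z * value_series z x + h x))) (at x)"
      using dF[OF x] g(2)[of x] x at_eq[OF x]
      by (auto intro!: derivative_eq_intros simp: algebra_simps)
    then have "(flux_series z has_real_derivative - (q x * (z * value_series z x + h x))) (at x)"
      by (rule has_field_derivative_transform_within_open[of _ _ _ "{c<..<0}"]) (use x g in auto)
    then show "(flux_series z has_vector_derivative - (q x *\<^sub>R (z * value_series z x + h x))) (at x)"
      by (simp add: has_real_derivative_iff_has_vector_derivative)
  qed
  show "value_series z c = 0" by (simp add: value_series_def value_iter_def)
  show "flux_series z c = F c" using g(1,3) c by simp
qed

end

lemma particular_solution: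
  fixes h :: "real \<Rightarrow> real"
  assumes h: "continuous_on {c..0} h"
  obtains y Y where "sl_flow p q c 0 y Y (\<lambda>x. z * y x + h x)" "y c = 0" "Y c = 0"
proof -
  define F where "F x = - integral {c..x} (\<lambda>s. q s * h s)" for x
  have qh: "continuous_on {c..0} (\<lambda>s. q s * h s)" using h cont_q by (intro continuous_intros)
  then have F: "continuous_on {c..0} F"
    unfolding F_def by (intro continuous_on_minus indefinite_integral_continuous_1 integrable_continuous_real)
  have "(F has_real_derivative - (q x * h x)) (at x)" if x: "x \<in> {c<..<0}" for x
  proof -
    have "(F has_real_derivative - (q x * h x)) (at x within {c..0})"
      unfolding F_def using integral_has_real_derivative[OF qh, of x] x by (intro DERIV_minus) simp
    then show ?thesis
      using x at_within_interior[of x "{c..0}"] by (simp add: interior_atLeastAtMost_real)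
  qed
  from series_flow[OF F this, of z] show thesis
    by (intro that[of "value_series F z" "flux_series F z"]) (auto simp: F_def)
qed

definition phi :: "real \<Rightarrow> real \<Rightarrow> real" where "phi = value_series (\<lambda>x. 1)"
definition Phi :: "real \<Rightarrow> real \<Rightarrow> real" where "Phi = flux_series (\<lambda>x. 1)"

lemma phi_flow: "sl_flow p q c 0 (phi z) (Phi z) (\<lambda>x. z * phi z x)"
  and phi_c [simp]: "phi z c = 0" and Phi_c [simp]: "Phi z c = 1"
  using series_flow[of "\<lambda>x. 1" "\<lambda>x. 0" z] by (auto simp: phi_def Phi_def)

lemma phi_end_C2: "C2_fun (\<lambda>z. phi z 0)" and Phi_end_C2: "C2_fun (\<lambda>z. Phi z 0)"
proof -
  have s: "summable (\<lambda>n. value_iter (\<lambda>x. 1) n 0 * z ^ n)" "summable (\<lambda>n. flux_iter (\<lambda>x. 1) n 0 * z ^ n)" for z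
    using summable_iter[of "\<lambda>x. 1" 0 z] c by auto
  show "C2_fun (\<lambda>z. phi z 0)" "C2_fun (\<lambda>z. Phi z 0)"
    using C2_fun_powser[OF s(1)] C2_fun_powser[OF s(2)]
    by (simp_all add: phi_def Phi_def value_series_def flux_series_def)
qed

end

section \<open>Growth, uniqueness and simplicity of the zeros of the fundamental solution\<close>

context leg
begin

lemma phi_cont: "continuous_on {c..0} (phi z)" "continuous_on {c..0} (Phi z)"
  using phi_flow by (auto simp: sl_flow_def)

definition coeff_bound :: real where
  "coeff_bound = (SOME K. K > 0 \<and> (\<forall>x\<in>{c..0}. 1 / p x \<le> K) \<and> (\<forall>x\<in>{c..0}. q x \<le> K))"

lemma coeff_bound: "0 < coeff_bound" "x \<in> {c..0} \<Longrightarrow> 1 / p x \<le> coeff_bound" "x \<in> {c..0} \<Longrightarrow> q x \<le> coeff_bound"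
  using someI_ex[OF coefficient_bound] by (auto simp: coeff_bound_def)

text \<open>
  The constant of \<open>sl_flow_estimate\<close> for spectral parameters of absolute value at most \<open>M\<close>.
\<close>

definition growth :: "real \<Rightarrow> real" where
  "growth M = exp ((2 * coeff_bound + coeff_bound * M) * (0 - c))"

lemma growth_pos: "0 < growth M"
  by (simp add: growth_def)

text \<open>
  The difference of \<open>y\<close> and the multiple of \<open>\<phi>\<close> that has the same flux at \<open>c\<close> has zero initial data and
  the forcing \<open>g\<close>, so that \<open>sl_flow_estimate\<close> applies to it.
\<close>

lemma flow_representation:
  fixes y :: "real \<Rightarrow> 'a::real_inner"
  assumes f: "sl_flow p q c 0 y Y (\<lambda>x. z *\<^sub>R y x + g x)" and yc: "y c = 0" and z: "\<bar>z\<bar> \<le> M"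
    and \<eta>: "0 \<le> \<eta>" and g: "\<And>x. x \<in> {c<..<0} \<Longrightarrow> norm (g x) \<le> \<eta>" and x: "x \<in> {c..0}"
  shows "norm (y x - phi z x *\<^sub>R Y c) \<le> growth M * \<eta>" "norm (Y x - Phi z x *\<^sub>R Y c) \<le> growth M * \<eta>"
proof -
  have "sl_flow p q c 0 (\<lambda>x. y x - phi z x *\<^sub>R Y c) (\<lambda>x. Y x - Phi z x *\<^sub>R Y c)
      (\<lambda>x. z *\<^sub>R (y x - phi z x *\<^sub>R Y c) + g x)"
    by (rule sl_flow_cong[OF sl_flow_diff[OF f sl_flow_scaleR_left[OF phi_flow]]])
      (auto simp: algebra_simps)
  from sl_flow_estimate[OF this, of coeff_bound M \<eta> x]
  show "norm (y x - phi z x *\<^sub>R Y c) \<le> growth M * \<eta>" "norm (Y x - Phi z x *\<^sub>R Y c) \<le> growth M * \<eta>"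
    unfolding growth_def using c yc coeff_bound z g \<eta> p_pos q_pos x by (auto simp: less_imp_le)
qed

lemma flow_unique:
  fixes y :: "real \<Rightarrow> 'a::real_inner"
  assumes f: "sl_flow p q c 0 y Y (\<lambda>x. z *\<^sub>R y x)" and "y c = 0" and "x \<in> {c..0}"
  shows "y x = phi z x *\<^sub>R Y c" "Y x = Phi z x *\<^sub>R Y c"
  using flow_representation[of y Y z "\<lambda>x. 0" "\<bar>z\<bar>" 0 x] assms by auto

text \<open>
  The difference of the solutions for \<open>z\<^sub>1\<close> and \<open>z\<^sub>2\<close> solves the equation for \<open>z\<^sub>1\<close> with forcing
  \<open>(z\<^sub>1 - z\<^sub>2) \<phi>\<close> and zero initial data; comparison with \<open>z\<^sub>2 = 0\<close> gives the bound.
\<close>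

lemma phi_lipschitz:
  "\<exists>C\<ge>0. \<forall>z1 z2. \<bar>z1\<bar> \<le> M \<longrightarrow> \<bar>z2\<bar> \<le> M \<longrightarrow> (\<forall>x\<in>{c..0}.
     \<bar>phi z1 x\<bar> \<le> C \<and> \<bar>Phi z1 x\<bar> \<le> C \<and>
     \<bar>phi z1 x - phi z2 x\<bar> \<le> C * \<bar>z1 - z2\<bar> \<and> \<bar>Phi z1 x - Phi z2 x\<bar> \<le> C * \<bar>z1 - z2\<bar>)"
proof -
  define C where "C = growth M"
  have C: "0 \<le> C" by (simp add: C_def less_imp_le growth_pos)
  have "bounded (phi 0 ` {c..0})" "bounded (Phi 0 ` {c..0})"
    using phi_cont by (auto intro!: compact_imp_bounded compact_continuous_image)
  then have "\<exists>B1>0. \<forall>x\<in>{c..0}. \<bar>phi 0 x\<bar> \<le> B1" "\<exists>B2>0. \<forall>x\<in>{c..0}. \<bar>Phi 0 x\<bar> \<le> B2"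
    by (auto simp: bounded_pos)
  then obtain B1 B2 where B: "B1 > 0" "\<And>x. x \<in> {c..0} \<Longrightarrow> \<bar>phi 0 x\<bar> \<le> B1"
    "B2 > 0" "\<And>x. x \<in> {c..0} \<Longrightarrow> \<bar>Phi 0 x\<bar> \<le> B2"
    by blast
  \<comment> \<open>Applied with \<open>z2 = 0\<close> to obtain the uniform bound, and with that bound to obtain the Lipschitz estimate.\<close>
  have diff: "\<bar>phi z1 x - phi z2 x\<bar> \<le> C * (\<bar>z1 - z2\<bar> * B) \<and> \<bar>Phi z1 x - Phi z2 x\<bar> \<le> C * (\<bar>z1 - z2\<bar> * B)"
    if z1: "\<bar>z1\<bar> \<le> M" and B: "\<forall>x\<in>{c..0}. \<bar>phi z2 x\<bar> \<le> B" and "0 \<le> B" and x: "x \<in> {c..0}" for z1 z2 B x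
  proof -
    have "sl_flow p q c 0 (\<lambda>x. phi z1 x - phi z2 x) (\<lambda>x. Phi z1 x - Phi z2 x)
        (\<lambda>x. z1 *\<^sub>R (phi z1 x - phi z2 x) + (z1 - z2) * phi z2 x)"
      by (rule sl_flow_cong[OF sl_flow_diff[OF phi_flow[of z1] phi_flow[of z2]]]) (auto simp: algebra_simps)
    from flow_representation[OF this _ z1, of "\<bar>z1 - z2\<bar> * B" x]
    show ?thesis
      using x B \<open>0 \<le> B\<close> by (simp add: abs_mult mult_left_mono C_def)
  qed
  define D where "D = max (B1 + C * (\<bar>M\<bar> * B1)) (B2 + C * (\<bar>M\<bar> * B1))"
  have bound: "\<bar>phi z x\<bar> \<le> D \<and> \<bar>Phi z x\<bar> \<le> D" if z: "\<bar>z\<bar> \<le> M" and x: "x \<in> {c..0}" for z x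
  proof -
    have "\<bar>phi z x - phi 0 x\<bar> \<le> C * (\<bar>z - 0\<bar> * B1) \<and> \<bar>Phi z x - Phi 0 x\<bar> \<le> C * (\<bar>z - 0\<bar> * B1)"
      using z B x by (intro diff) auto
    moreover have "C * (\<bar>z - 0\<bar> * B1) \<le> C * (\<bar>M\<bar> * B1)"
      using z B C by (intro mult_left_mono mult_right_mono) auto
    ultimately have "\<bar>phi z x\<bar> \<le> B1 + C * (\<bar>M\<bar> * B1)" "\<bar>Phi z x\<bar> \<le> B2 + C * (\<bar>M\<bar> * B1)"
      using B(2)[OF x] B(4)[OF x] by linarith+
    then show ?thesis unfolding D_def by (simp add: le_max_iff_disj)
  qed
  have D: "0 \<le> D" using B C by (simp add: D_def le_max_iff_disj)
  show ?thesis
  proof (intro exI[of _ "D + C * D"] conjI allI impI ballI)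
    show "0 \<le> D + C * D" using C D by simp
    fix z1 z2 x assume z: "\<bar>z1\<bar> \<le> M" "\<bar>z2\<bar> \<le> M" and x: "x \<in> {c..0}"
    have CD: "0 \<le> C * D" using C D by simp
    show "\<bar>phi z1 x\<bar> \<le> D + C * D" "\<bar>Phi z1 x\<bar> \<le> D + C * D"
      using bound[OF z(1) x] CD by auto
    have "\<bar>phi z1 x - phi z2 x\<bar> \<le> C * (\<bar>z1 - z2\<bar> * D) \<and> \<bar>Phi z1 x - Phi z2 x\<bar> \<le> C * (\<bar>z1 - z2\<bar> * D)"
      using z x D bound by (intro diff) auto
    moreover have "C * (\<bar>z1 - z2\<bar> * D) \<le> (D + C * D) * \<bar>z1 - z2\<bar>"
      using D by (simp add: algebra_simps)
    ultimately show "\<bar>phi z1 x - phi z2 x\<bar> \<le> (D + C * D) * \<bar>z1 - z2\<bar>"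
      "\<bar>Phi z1 x - Phi z2 x\<bar> \<le> (D + C * D) * \<bar>z1 - z2\<bar>" by linarith+
  qed
qed

lemma phi_nonzero: "\<exists>x\<in>{c<..<0}. phi z x \<noteq> 0"
proof (rule ccontr)
  assume "\<not> ?thesis"
  then have zero: "phi z x = 0" if "x \<in> {c<..<0}" for x using that by blast
  have Phi0: "Phi z x = 0" if x: "x \<in> {c<..<0}" for x
  proof -
    have "(phi z has_real_derivative Phi z x / p x) (at x)"
      using phi_flow[of z] x by (simp add: sl_flow_def has_real_derivative_iff_has_vector_derivative)
    moreover have "(phi z has_real_derivative 0) (at x)"
      by (rule has_field_derivative_transform_within_open[of "\<lambda>x. 0" _ _ "{c<..<0}"]) (use x zero in auto)
    ultimately have "Phi z x / p x = 0" by (rule DERIV_unique)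
    then show ?thesis using p_pos[of x] x by auto
  qed
  have "(Phi z \<longlongrightarrow> Phi z c) (at c within {c..0})"
    using phi_cont(2)[of z] c by (auto simp: continuous_on_def simp del: Phi_c)
  then have "(Phi z \<longlongrightarrow> Phi z c) (at c within {c<..<0})"
    by (rule tendsto_within_subset) auto
  moreover have "(Phi z \<longlongrightarrow> 0) (at c within {c<..<0})"
    by (rule tendsto_eventually) (use Phi0 in \<open>auto simp: eventually_at_filter\<close>)
  moreover have "at c within {c<..<0} \<noteq> bot"
    using c by (simp add: at_within_eq_bot_iff)
  ultimately have "Phi z c = 0" by (metis tendsto_unique)
  then show False by simp
qed

lemma lagrange_phi:
  "integral {c..0} (\<lambda>x. q x * (phi z x * phi \<zeta> x)) * (z - \<zeta>) = phi z 0 * Phi \<zeta> 0 - Phi z 0 * phi \<zeta> 0"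
proof -
  have "((\<lambda>x. q x *\<^sub>R ((z * phi z x) *\<^sub>R phi \<zeta> x - phi z x *\<^sub>R (\<zeta> * phi \<zeta> x))) has_integral
     (phi z 0 *\<^sub>R Phi \<zeta> 0 - Phi z 0 *\<^sub>R phi \<zeta> 0) - (phi z c *\<^sub>R Phi \<zeta> c - Phi z c *\<^sub>R phi \<zeta> c)) {c..0}"
    by (rule sl_flow_lagrange[OF phi_flow phi_flow]) (use c in auto)
  also have "(\<lambda>x. q x *\<^sub>R ((z * phi z x) *\<^sub>R phi \<zeta> x - phi z x *\<^sub>R (\<zeta> * phi \<zeta> x))) =
     (\<lambda>x. q x * (phi z x * phi \<zeta> x) * (z - \<zeta>))"
    by (auto simp: fun_eq_iff algebra_simps)
  finally show ?thesis by (auto dest: integral_unique)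
qed

lemma phi_mass_pos: "0 < integral {c..0} (\<lambda>x. q x * (phi z x)\<^sup>2)"
proof -
  obtain x0 where x0: "x0 \<in> {c<..<0}" "phi z x0 \<noteq> 0" using phi_nonzero by blast
  then have "q x0 * (phi z x0)\<^sup>2 \<noteq> 0" using q_pos[of x0] by simp
  then show ?thesis
    using x0 c q_pos cont_q phi_cont
    by (intro integral_pos_of_continuous[where ?x0.0=x0]) (auto intro!: continuous_intros simp: less_imp_le)
qed

text \<open>
  Divide \<open>lagrange_phi\<close> by \<open>\<zeta> - z\<close> and let \<open>\<zeta>\<close> tend to \<open>z\<close>: up to the sign, this limit is the
  derivative of the combination of end values that occurs there, and at a zero one of its two terms drops out.
\<close>

lemma mass_tendsto:
  "((\<lambda>\<zeta>. integral {c..0} (\<lambda>x. q x * (phi z x * phi \<zeta> x))) \<longlongrightarrow> integral {c..0} (\<lambda>x. q x * (phi z x)\<^sup>2)) (at z)"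
proof (rule LIM_zero_cancel)
  obtain C where C: "C \<ge> 0" "\<And>z1 z2 x. \<bar>z1\<bar> \<le> \<bar>z\<bar> + 1 \<Longrightarrow> \<bar>z2\<bar> \<le> \<bar>z\<bar> + 1 \<Longrightarrow> x \<in> {c..0} \<Longrightarrow>
     \<bar>phi z1 x\<bar> \<le> C \<and> \<bar>phi z1 x - phi z2 x\<bar> \<le> C * \<bar>z1 - z2\<bar>"
    using phi_lipschitz[of "\<bar>z\<bar> + 1"] by blast
  obtain K where K: "0 < K" "\<forall>x\<in>{c..0}. q x \<le> K" using coefficient_bound by blast
  show "((\<lambda>\<zeta>. integral {c..0} (\<lambda>x. q x * (phi z x * phi \<zeta> x)) - integral {c..0} (\<lambda>x. q x * (phi z x)\<^sup>2)) \<longlongrightarrow> 0) (at z)"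
  proof (rule Lim_null_comparison)
    show "\<forall>\<^sub>F \<zeta> in at z. norm (integral {c..0} (\<lambda>x. q x * (phi z x * phi \<zeta> x)) - integral {c..0} (\<lambda>x. q x * (phi z x)\<^sup>2))
        \<le> K * (C * (C * \<bar>\<zeta> - z\<bar>)) * (0 - c)"
      unfolding eventually_at
    proof (intro exI[of _ 1] conjI ballI impI)
      fix \<zeta> assume "\<zeta> \<noteq> z \<and> dist \<zeta> z < 1"
      then have \<zeta>: "\<bar>\<zeta>\<bar> \<le> \<bar>z\<bar> + 1" by (auto simp: dist_real_def)
      have "integral {c..0} (\<lambda>x. q x * (phi z x * phi \<zeta> x)) - integral {c..0} (\<lambda>x. q x * (phi z x)\<^sup>2)
          = integral {c..0} (\<lambda>x. q x * (phi z x * (phi \<zeta> x - phi z x)))"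
        using cont_q phi_cont
        by (subst integral_diff[symmetric])
          (auto intro!: integrable_continuous_real continuous_intros simp: algebra_simps power2_eq_square)
      also have "norm \<dots> \<le> K * (C * (C * \<bar>\<zeta> - z\<bar>)) * (0 - c)"
      proof (rule integral_bound)
        show "continuous_on {c..0} (\<lambda>x. q x * (phi z x * (phi \<zeta> x - phi z x)))"
          using cont_q phi_cont by (intro continuous_intros)
        fix x assume x: "x \<in> {c..0}"
        show "norm (q x * (phi z x * (phi \<zeta> x - phi z x))) \<le> K * (C * (C * \<bar>\<zeta> - z\<bar>))"
          unfolding real_norm_def abs_mult
          using C(1) C(2)[of z z x] C(2)[of \<zeta> z x] x \<zeta> K q_pos[OF x]
          by (intro mult_mono) auto
      qed (use c in auto)
      finally show "norm (integral {c..0} (\<lambda>x. q x * (phi z x * phi \<zeta> x)) - integral {c..0} (\<lambda>x. q x * (phi z x)\<^sup>2))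
        \<le> K * (C * (C * \<bar>\<zeta> - z\<bar>)) * (0 - c)" .
    qed simp
    have "((\<lambda>\<zeta>. K * (C * (C * \<bar>\<zeta> - z\<bar>)) * (0 - c)) \<longlongrightarrow> K * (C * (C * \<bar>z - z\<bar>)) * (0 - c)) (at z)"
      by (intro tendsto_intros)
    then show "((\<lambda>\<zeta>. K * (C * (C * \<bar>\<zeta> - z\<bar>)) * (0 - c)) \<longlongrightarrow> 0) (at z)" by simp
  qed
qed

text \<open>
  The product equals \<open>- \<integral> q \<phi>\<^sup>2\<close>.
\<close>

lemma Phi_zero_simple:
  assumes z: "Phi z 0 = 0"
  shows "deriv (\<lambda>z. Phi z 0) z * phi z 0 < 0"
proof -
  define D where "D = deriv (\<lambda>z. Phi z 0) z"
  have D: "((\<lambda>z. Phi z 0) has_real_derivative D) (at z)"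
    unfolding D_def by (rule C2_fun_deriv[OF Phi_end_C2])
  have "((\<lambda>\<zeta>. (Phi \<zeta> 0 - Phi z 0) / (\<zeta> - z) * phi z 0) \<longlongrightarrow> D * phi z 0) (at z)"
    using D by (intro tendsto_intros) (simp add: has_field_derivative_iff)
  moreover have "((\<lambda>\<zeta>. (Phi \<zeta> 0 - Phi z 0) / (\<zeta> - z) * phi z 0) \<longlongrightarrow>
      - integral {c..0} (\<lambda>x. q x * (phi z x)\<^sup>2)) (at z)"
  proof (rule Lim_transform_eventually[OF tendsto_minus[OF mass_tendsto]])
    show "\<forall>\<^sub>F \<zeta> in at z. - integral {c..0} (\<lambda>x. q x * (phi z x * phi \<zeta> x)) = (Phi \<zeta> 0 - Phi z 0) / (\<zeta> - z) * phi z 0"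
      unfolding eventually_at_filter
      by (rule always_eventually) (use z lagrange_phi[of z] in \<open>auto simp: field_simps\<close>)
  qed
  ultimately have "D * phi z 0 = - integral {c..0} (\<lambda>x. q x * (phi z x)\<^sup>2)"
    by (rule LIM_unique)
  then show ?thesis using phi_mass_pos[of z] by (simp add: D_def)
qed

lemma phi_nonzero_of_Phi_zero: "Phi z 0 = 0 \<Longrightarrow> phi z 0 \<noteq> 0"
  using Phi_zero_simple[of z] by auto

text \<open>
  The product equals \<open>\<integral> q \<phi>\<^sup>2\<close>. The sign is opposite to that in \<open>Phi_zero_simple\<close>, and this is what
  makes a double zero split into two real zeros instead of a complex pair.
\<close>

lemma phi_zero_simple:
  assumes z: "phi z 0 = 0"
  shows "deriv (\<lambda>z. phi z 0) z * Phi z 0 > 0"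
proof -
  define D where "D = deriv (\<lambda>z. phi z 0) z"
  have D: "((\<lambda>z. phi z 0) has_real_derivative D) (at z)"
    unfolding D_def by (rule C2_fun_deriv[OF phi_end_C2])
  have "((\<lambda>\<zeta>. (phi \<zeta> 0 - phi z 0) / (\<zeta> - z) * Phi z 0) \<longlongrightarrow> D * Phi z 0) (at z)"
    using D by (intro tendsto_intros) (simp add: has_field_derivative_iff)
  moreover have "((\<lambda>\<zeta>. (phi \<zeta> 0 - phi z 0) / (\<zeta> - z) * Phi z 0) \<longlongrightarrow>
      integral {c..0} (\<lambda>x. q x * (phi z x)\<^sup>2)) (at z)"
  proof (rule Lim_transform_eventually[OF mass_tendsto])
    show "\<forall>\<^sub>F \<zeta> in at z. integral {c..0} (\<lambda>x. q x * (phi z x * phi \<zeta> x)) = (phi \<zeta> 0 - phi z 0) / (\<zeta> - z) * Phi z 0"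
      unfolding eventually_at_filter
      by (rule always_eventually) (use z lagrange_phi[of z] in \<open>auto simp: field_simps\<close>)
  qed
  ultimately have "D * Phi z 0 = integral {c..0} (\<lambda>x. q x * (phi z x)\<^sup>2)"
    by (rule LIM_unique)
  then show ?thesis using phi_mass_pos[of z] by (simp add: D_def)
qed

text \<open>
  For \<open>z \<le> 0\<close> the quadratic form \<open>\<integral> (\<Phi>\<^sup>2/p - z q \<phi>\<^sup>2)\<close> is positive, and it equals \<open>\<phi>\<Phi>\<close> at \<open>0\<close>.
\<close>

lemma ends_same_sign:
  assumes "z \<le> 0"
  shows "0 < phi z 0 * Phi z 0"
proof -
  have "((\<lambda>x. (Phi z x)\<^sup>2 / p x - q x * (z * phi z x) * phi z x) has_integral (phi z 0 * Phi z 0 - phi z c * Phi z c)) {c..0}"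
    by (rule sl_flow_form[OF phi_flow]) (use c in auto)
  moreover have "0 < integral {c..0} (\<lambda>x. (Phi z x)\<^sup>2 / p x - q x * (z * phi z x) * phi z x)"
  proof (rule integral_pos_of_continuous[of _ _ _ c])
    show "continuous_on {c..0} (\<lambda>x. (Phi z x)\<^sup>2 / p x - q x * (z * phi z x) * phi z x)"
      using cont_q cont_p phi_cont p_pos by (intro continuous_intros) (auto simp: less_le)
    show "0 \<le> (Phi z x)\<^sup>2 / p x - q x * (z * phi z x) * phi z x" if x: "x \<in> {c..0}" for x
    proof -
      have "q x * (z * phi z x) * phi z x = z * (q x * (phi z x)\<^sup>2)" by (simp add: power2_eq_square)
      also have "\<dots> \<le> 0" using assms q_pos[OF x] by (intro mult_nonpos_nonneg) auto
      finally have "q x * (z * phi z x) * phi z x \<le> 0" .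
      moreover have "0 \<le> (Phi z x)\<^sup>2 / p x" using p_pos[OF x] by simp
      ultimately show ?thesis by linarith
    qed
    show "(Phi z c)\<^sup>2 / p c - q c * (z * phi z c) * phi z c \<noteq> 0" using p_pos[of c] c by simp
  qed (use c in auto)
  ultimately show ?thesis by (simp add: integral_unique)
qed

end

section \<open>Operators and eigenvalue problems in terms of first-order systems\<close>

lemma dI_eq:
  assumes "c < d" "x \<in> {c..d}" "(u has_vector_derivative D) (at x within {c..d})"
  shows "dI c d u x = D"
  using vector_derivative_within_cbox[of c d x u D] assms by (simp add: dI_def)

lemma at_within_interval_interior: "x \<in> {c<..<d} \<Longrightarrow> at x within {c..d} = at (x::real)"
  by (intro at_within_interior) (auto simp: interior_atLeastAtMost_real)

lemma SL_regular_flow: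
  assumes reg: "SL_regular p c d u" and eq: "\<And>x. x \<in> {c<..<d} \<Longrightarrow> SL p c d u x = - (q x *\<^sub>R h x)"
    and p: "\<And>x. x \<in> {c..d} \<Longrightarrow> 0 < p x"
  shows "sl_flow p q c d u (\<lambda>x. p x *\<^sub>R dI c d u x) h"
  unfolding sl_flow_def
proof (intro conjI ballI)
  show "continuous_on {c..d} u" "continuous_on {c..d} (\<lambda>x. p x *\<^sub>R dI c d u x)"
    using reg by (auto simp: SL_regular_def intro: differentiable_imp_continuous_on)
  fix x assume x: "x \<in> {c<..<d}"
  then have "u differentiable (at x within {c..d})" "(\<lambda>x. p x *\<^sub>R dI c d u x) differentiable (at x within {c..d})"
    using reg by (auto simp: SL_regular_def differentiable_on_def)
  then have "(u has_vector_derivative dI c d u x) (at x within {c..d})"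
    "((\<lambda>x. p x *\<^sub>R dI c d u x) has_vector_derivative SL p c d u x) (at x within {c..d})"
    unfolding dI_def SL_def by (auto simp: vector_derivative_works[symmetric])
  then show "(u has_vector_derivative (1 / p x) *\<^sub>R (p x *\<^sub>R dI c d u x)) (at x)"
    "((\<lambda>x. p x *\<^sub>R dI c d u x) has_vector_derivative - (q x *\<^sub>R h x)) (at x)"
    using eq[OF x] p[of x] x by (auto simp: at_within_interval_interior)
qed

lemma primitive_has_derivative:
  fixes u :: "real \<Rightarrow> 'a::banach"
  assumes "\<And>x. x \<in> {c..d} \<Longrightarrow> (g has_integral (u x - u c)) {c..x}" "continuous_on {c..d} g" "x \<in> {c..d}"
  shows "(u has_vector_derivative g x) (at x within {c..d})"
proof -
  have "((\<lambda>x. u c + integral {c..x} g) has_vector_derivative 0 + g x) (at x within {c..d})"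
    using integral_has_vector_derivative[OF assms(2,3)] by (intro has_vector_derivative_add) auto
  then have d: "((\<lambda>x. u c + integral {c..x} g) has_vector_derivative g x) (at x within {c..d})" by simp
  have "u c + integral {c..s} g = u s" if "s \<in> {c..d}" for s
    using assms(1)[OF that] by (simp add: integral_unique)
  then show ?thesis
    by (intro has_vector_derivative_transform_within[OF d zero_less_one assms(3)])
qed

lemma sl_flow_within:
  fixes u :: "real \<Rightarrow> 'a::banach"
  assumes f: "sl_flow p q c d u Y h" and cont: "continuous_on {c..d} p" "continuous_on {c..d} q" "continuous_on {c..d} h"
    and p: "\<And>x. x \<in> {c..d} \<Longrightarrow> 0 < p x" and x: "x \<in> {c..d}"
  shows "(u has_vector_derivative (1 / p x) *\<^sub>R Y x) (at x within {c..d})"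
    "(Y has_vector_derivative - (q x *\<^sub>R h x)) (at x within {c..d})"
proof -
  have 1: "((\<lambda>t. (1 / p t) *\<^sub>R Y t) has_integral (u s - u c)) {c..s}"
    and 2: "((\<lambda>t. - (q t *\<^sub>R h t)) has_integral (Y s - Y c)) {c..s}" if "s \<in> {c..d}" for s
    using f that
    by (auto simp: sl_flow_def intro!: fundamental_theorem_of_calculus_interior intro: continuous_on_subset)
  have "continuous_on {c..d} (\<lambda>t. (1 / p t) *\<^sub>R Y t)"
    using f cont p by (intro continuous_intros) (auto simp: sl_flow_def less_le)
  moreover have "continuous_on {c..d} (\<lambda>t. - (q t *\<^sub>R h t))"
    using cont by (intro continuous_intros)
  ultimately show "(u has_vector_derivative (1 / p x) *\<^sub>R Y x) (at x within {c..d})"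
    "(Y has_vector_derivative - (q x *\<^sub>R h x)) (at x within {c..d})"
    using primitive_has_derivative[OF 1 _ x] primitive_has_derivative[OF 2 _ x] by auto
qed

lemma sl_flow_SL:
  fixes u :: "real \<Rightarrow> 'a::banach"
  assumes f: "sl_flow p q c d u Y h" and cont: "continuous_on {c..d} p" "continuous_on {c..d} q" "continuous_on {c..d} h"
    and p: "\<And>x. x \<in> {c..d} \<Longrightarrow> 0 < p x" and cd: "c < d"
  shows "SL_regular p c d u" "\<And>x. x \<in> {c..d} \<Longrightarrow> SL p c d u x = - (q x *\<^sub>R h x)"
    "\<And>x. x \<in> {c..d} \<Longrightarrow> p x *\<^sub>R dI c d u x = Y x"
proof -
  note d = sl_flow_within[OF f cont p]
  show flux: "p x *\<^sub>R dI c d u x = Y x" if "x \<in> {c..d}" for x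
    using dI_eq[OF cd that d(1)[OF _ that]] p[OF that] by simp
  have d2: "((\<lambda>x. p x *\<^sub>R dI c d u x) has_vector_derivative - (q x *\<^sub>R h x)) (at x within {c..d})"
    if "x \<in> {c..d}" for x
    using has_vector_derivative_transform_within[OF d(2)[OF _ that] zero_less_one that] flux by simp
  show "SL_regular p c d u"
    unfolding SL_regular_def differentiable_on_def
    using d(1) d2 differentiableI_vector by blast
  show "SL p c d u x = - (q x *\<^sub>R h x)" if "x \<in> {c..d}" for x
    unfolding SL_def by (rule dI_eq[OF cd that d2[OF that]])
qed

lemma has_L2_deriv_continuous:
  fixes u :: "real \<Rightarrow> 'a::banach"
  assumes "has_L2_deriv c d u g"
  shows "continuous_on {c..d} u"
proof (cases "c \<le> d")
  case True
  then have "g integrable_on {c..d}" using assms by (auto simp: has_L2_deriv_def)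
  then have "continuous_on {c..d} (\<lambda>x. u c + integral {c..x} g)"
    by (intro continuous_intros indefinite_integral_continuous_1)
  then show ?thesis
  proof (rule continuous_on_eq)
    fix x assume "x \<in> {c..d}"
    then have "(g has_integral (u x - u c)) {c..x}" using assms by (auto simp: has_L2_deriv_def)
    then show "u c + integral {c..x} g = u x" by (simp add: integral_unique)
  qed
qed auto

lemma SL_op_continuous:
  fixes u :: "real \<Rightarrow> 'a::banach"
  shows "SL_op p q c d u f \<Longrightarrow> continuous_on {c..d} u"
  by (auto simp: SL_op_def H2_def dest: has_L2_deriv_continuous)

text \<open>
  For a continuous right-hand side the weak formulation is the classical one: an \<open>H\<^sup>2\<close> function is the
  primitive of a continuous function, and its flux is the primitive of a continuous function.
\<close>

lemma SL_op_flow: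
  fixes u :: "real \<Rightarrow> 'a::banach"
  assumes op: "SL_op p q c d u f" and f: "continuous_on {c..d} f" and q: "continuous_on {c..d} q"
    and p: "\<And>x. x \<in> {c..d} \<Longrightarrow> 0 < p x" and cd: "c < d"
  shows "sl_flow p q c d u (\<lambda>x. p x *\<^sub>R dI c d u x) f"
proof -
  obtain g where g: "g \<in> H1 c d" "has_L2_deriv c d u g"
    using op by (auto simp: SL_op_def H2_def)
  have cg: "continuous_on {c..d} g" using g(1) by (auto simp: H1_def dest: has_L2_deriv_continuous)
  have du: "(u has_vector_derivative g x) (at x within {c..d})" if "x \<in> {c..d}" for x
    using g(2) that by (intro primitive_has_derivative[OF _ cg that]) (auto simp: has_L2_deriv_def)
  have dI: "dI c d u x = g x" if "x \<in> {c..d}" for x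
    using dI_eq[OF cd that du[OF that]] .
  have L2: "has_L2_deriv c d (\<lambda>x. p x *\<^sub>R dI c d u x) (\<lambda>x. - (q x *\<^sub>R f x))"
    using op by (simp add: SL_op_def)
  have dY: "((\<lambda>x. p x *\<^sub>R dI c d u x) has_vector_derivative - (q x *\<^sub>R f x)) (at x within {c..d})"
    if x: "x \<in> {c..d}" for x
  proof (rule primitive_has_derivative[OF _ _ x])
    show "continuous_on {c..d} (\<lambda>x. - (q x *\<^sub>R f x))" using q f by (intro continuous_intros)
  qed (use L2 in \<open>auto simp: has_L2_deriv_def\<close>)
  show ?thesis
    unfolding sl_flow_def
  proof (intro conjI ballI)
    show "continuous_on {c..d} u" "continuous_on {c..d} (\<lambda>x. p x *\<^sub>R dI c d u x)"
      using g(2) L2 by (auto dest: has_L2_deriv_continuous)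
    fix x assume x: "x \<in> {c<..<d}"
    then have x': "x \<in> {c..d}" by auto
    show "(u has_vector_derivative (1 / p x) *\<^sub>R (p x *\<^sub>R dI c d u x)) (at x)"
      "((\<lambda>x. p x *\<^sub>R dI c d u x) has_vector_derivative - (q x *\<^sub>R f x)) (at x)"
      using du[OF x'] dY[OF x'] dI[OF x'] p[OF x'] x by (simp_all add: at_within_interval_interior)
  qed
qed

lemma L2_on_continuous:
  fixes f :: "real \<Rightarrow> 'a::euclidean_space"
  assumes "continuous_on {c..d} f"
  shows "L2_on c d f"
  unfolding L2_on_def
proof
  show "f \<in> borel_measurable (lebesgue_on {c..d})"
    using assms by (intro continuous_imp_measurable_on_sets_lebesgue) auto
  show "integrable (lebesgue_on {c..d}) (\<lambda>x. (norm (f x))\<^sup>2)"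
    using assms by (intro continuous_imp_integrable_real continuous_intros)
qed

lemma has_L2_deriv_C1:
  fixes u :: "real \<Rightarrow> 'a::euclidean_space"
  assumes "\<And>x. x \<in> {c..d} \<Longrightarrow> (u has_vector_derivative g x) (at x within {c..d})" "continuous_on {c..d} g"
  shows "has_L2_deriv c d u g"
  unfolding has_L2_deriv_def
proof (intro conjI ballI L2_on_continuous assms(2))
  fix x assume x: "x \<in> {c..d}"
  show "(g has_integral u x - u c) {c..x}"
  proof (rule fundamental_theorem_of_calculus)
    fix s assume "s \<in> {c..x}"
    then show "(u has_vector_derivative g s) (at s within {c..x})"
      using x by (intro has_vector_derivative_within_subset[OF assms(1)[of s]]) auto
  qed (use x in auto)
qed

text \<open>
  The converse of \<open>SL_op_flow\<close>. The derivative \<open>y' = Y/p\<close> is itself differentiable because \<open>p\<close> is,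
  and this makes \<open>y\<close> an \<open>H\<^sup>2\<close> function.
\<close>

lemma sl_flow_SL_op:
  fixes u :: "real \<Rightarrow> 'a::euclidean_space"
  assumes f: "sl_flow p q c d u Y h" and cont: "continuous_on {c..d} q" "continuous_on {c..d} h"
    and p: "\<And>x. x \<in> {c..d} \<Longrightarrow> 0 < p x" and cd: "c < d"
    and dp: "\<And>x. x \<in> {c..d} \<Longrightarrow> (p has_real_derivative p' x) (at x within {c..d})"
    and cp': "continuous_on {c..d} p'"
  shows "SL_op p q c d u h"
proof -
  have cp: "continuous_on {c..d} p" using dp by (rule DERIV_continuous_on)
  note d = sl_flow_within[OF f cp cont p]
  have cY: "continuous_on {c..d} Y" using f by (simp add: sl_flow_def)
  have cg: "continuous_on {c..d} (\<lambda>x. (1 / p x) *\<^sub>R Y x)"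
    using cp cY p by (intro continuous_intros) (auto simp: less_le)
  have "has_L2_deriv c d (\<lambda>x. (1 / p x) *\<^sub>R Y x)
      (\<lambda>x. (1 / p x) *\<^sub>R (- (q x *\<^sub>R h x)) + (- p' x / (p x)\<^sup>2) *\<^sub>R Y x)"
  proof (rule has_L2_deriv_C1)
    show "continuous_on {c..d} (\<lambda>x. (1 / p x) *\<^sub>R (- (q x *\<^sub>R h x)) + (- p' x / (p x)\<^sup>2) *\<^sub>R Y x)"
      using cp cY cp' cont p by (intro continuous_intros) (auto simp: less_le)
    fix x assume x: "x \<in> {c..d}"
    have "((\<lambda>x. 1 / p x) has_real_derivative (- p' x / (p x)\<^sup>2)) (at x within {c..d})"
      using dp[OF x] p[OF x] by (auto intro!: derivative_eq_intros simp: power2_eq_square)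
    from has_vector_derivative_scaleR[OF this d(2)[OF _ x]]
    show "((\<lambda>x. (1 / p x) *\<^sub>R Y x) has_vector_derivative
        (1 / p x) *\<^sub>R (- (q x *\<^sub>R h x)) + (- p' x / (p x)\<^sup>2) *\<^sub>R Y x) (at x within {c..d})"
      by simp
  qed
  then have H1: "(\<lambda>x. (1 / p x) *\<^sub>R Y x) \<in> H1 c d" by (auto simp: H1_def)
  have "has_L2_deriv c d u (\<lambda>x. (1 / p x) *\<^sub>R Y x)"
    by (rule has_L2_deriv_C1[OF d(1) cg]) auto
  then have H2: "u \<in> H2 c d" using H1 by (auto simp: H2_def)
  have flux: "p x *\<^sub>R dI c d u x = Y x" if "x \<in> {c..d}" for x
    by (rule sl_flow_SL(3)[OF f cp cont p cd that])
  have "has_L2_deriv c d (\<lambda>x. p x *\<^sub>R dI c d u x) (\<lambda>x. - (q x *\<^sub>R h x))"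
  proof (rule has_L2_deriv_C1)
    show "continuous_on {c..d} (\<lambda>x. - (q x *\<^sub>R h x))" using cont by (intro continuous_intros)
    show "((\<lambda>x. p x *\<^sub>R dI c d u x) has_vector_derivative - (q x *\<^sub>R h x)) (at x within {c..d})"
      if "x \<in> {c..d}" for x
      using has_vector_derivative_transform_within[OF d(2)[OF _ that] zero_less_one that] flux by simp
  qed
  then show ?thesis
    using H2 cont(2) by (simp add: SL_op_def L2_on_continuous)
qed

lemma smooth_interval_C1:
  assumes "smooth_interval c d f"
  obtains f' where "\<And>x. x \<in> {c..d} \<Longrightarrow> (f has_real_derivative f' x) (at x within {c..d})"
    "continuous_on {c..d} f'" "continuous_on {c..d} f"
proof -
  obtain F where F: "F 0 = f" "\<forall>n. \<forall>x\<in>{c..d}. (F n has_real_derivative F (Suc n) x) (at x within {c..d})"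
    using assms unfolding smooth_interval_def by blast
  show thesis
  proof (rule that)
    show "\<And>x. x \<in> {c..d} \<Longrightarrow> (f has_real_derivative F 1 x) (at x within {c..d})"
      using F(2)[rule_format, of _ 0] F(1) by simp
    show "continuous_on {c..d} (F 1)" using F(2) by (intro DERIV_continuous_on[of _ _ "F (Suc 1)"]) auto
    show "continuous_on {c..d} f" using F by (intro DERIV_continuous_on[of _ f "F 1"]) force
  qed
qed

locale two_legs =
  fixes a b :: real and k r \<kappa> \<rho> :: "real \<Rightarrow> real"
  assumes interval: "a < 0" "0 < b"
    and smooth: "smooth_interval a 0 k" "smooth_interval a 0 r"
      "smooth_interval 0 b \<kappa>" "smooth_interval 0 b \<rho>"
    and positive: "\<And>x. x \<in> {a..0} \<Longrightarrow> k x > 0" "\<And>x. x \<in> {a..0} \<Longrightarrow> r x > 0"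
      "\<And>x. x \<in> {0..b} \<Longrightarrow> \<kappa> x > 0" "\<And>x. x \<in> {0..b} \<Longrightarrow> \<rho> x > 0"
begin

lemma coefficients_continuous:
  "continuous_on {a..0} k" "continuous_on {a..0} r" "continuous_on {0..b} \<kappa>" "continuous_on {0..b} \<rho>"
  using smooth by (metis smooth_interval_C1)+

sublocale L: leg k r a
  using interval coefficients_continuous positive by unfold_locales

sublocale R: leg "\<lambda>x. \<kappa> (- x)" "\<lambda>x. \<rho> (- x)" "- b"
proof
  show "continuous_on {- b..0} (\<lambda>x. \<kappa> (- x))" "continuous_on {- b..0} (\<lambda>x. \<rho> (- x))"
    using coefficients_continuous
    by (auto intro!: continuous_on_compose2[of "{0..b}" _ _ uminus] continuous_intros)
qed (use interval positive in auto)

lemma reflect_right: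
  "sl_flow \<kappa> \<rho> 0 b y Y h \<Longrightarrow>
   sl_flow (\<lambda>x. \<kappa> (- x)) (\<lambda>x. \<rho> (- x)) (- b) 0 (\<lambda>x. y (- x)) (\<lambda>x. - Y (- x)) (\<lambda>x. h (- x))"
  using sl_flow_reflect[of \<kappa> \<rho> 0 b y Y h] by simp

lemma unreflect_right:
  "sl_flow (\<lambda>x. \<kappa> (- x)) (\<lambda>x. \<rho> (- x)) (- b) 0 y Y h \<Longrightarrow>
   sl_flow \<kappa> \<rho> 0 b (\<lambda>x. y (- x)) (\<lambda>x. - Y (- x)) (\<lambda>x. h (- x))"
  using sl_flow_reflect[of "\<lambda>x. \<kappa> (- x)" "\<lambda>x. \<rho> (- x)" "- b" 0 y Y h] by simp

definition char_fun :: "real \<Rightarrow> real \<Rightarrow> real" where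
  "char_fun \<epsilon> z = L.Phi z 0 * R.phi z 0 + \<epsilon> * (R.Phi z 0 * L.phi z 0)"

text \<open>
  By uniqueness an eigenfunction is a multiple of the fundamental solution on each leg. The
  reflection turns the flux \<open>\<kappa> u'\<close> into \<open>- \<kappa> u'\<close>, which explains the minus sign in \<open>\<beta>\<close> and the plus
  sign in the characteristic function.
\<close>

lemma perturbed_eigenfunction_legs:
  fixes u :: "real \<Rightarrow> real"
  assumes e: "perturbed_eigenfunction a b k r \<kappa> \<rho> \<epsilon> l u" and "0 < \<epsilon>"
  defines "\<alpha> \<equiv> k a * dI a 0 u a" and "\<beta> \<equiv> - (\<kappa> b * dI 0 b u b)"
  shows "sl_flow k r a 0 u (\<lambda>x. k x * dI a 0 u x) (\<lambda>x. l / \<epsilon> * u x)"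
    "sl_flow \<kappa> \<rho> 0 b u (\<lambda>x. \<kappa> x * dI 0 b u x) (\<lambda>x. l / \<epsilon> * u x)"
    "\<And>x. x \<in> {a..0} \<Longrightarrow> u x = \<alpha> * L.phi (l / \<epsilon>) x \<and> k x * dI a 0 u x = \<alpha> * L.Phi (l / \<epsilon>) x"
    "\<And>x. x \<in> {0..b} \<Longrightarrow> u x = \<beta> * R.phi (l / \<epsilon>) (- x) \<and> - (\<kappa> x * dI 0 b u x) = \<beta> * R.Phi (l / \<epsilon>) (- x)"
    "\<beta> \<noteq> 0 \<Longrightarrow> char_fun \<epsilon> (l / \<epsilon>) = 0"
proof -
  have e': "SL_regular k a 0 u" "SL_regular \<kappa> 0 b u"
     "\<And>x. x\<in>{a<..<0} \<Longrightarrow> SL k a 0 u x + inverse \<epsilon> * l * r x * u x = 0"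
     "\<And>x. x\<in>{0<..<b} \<Longrightarrow> \<epsilon> * SL \<kappa> 0 b u x + l * \<rho> x * u x = 0"
     "k 0 * dI a 0 u 0 = \<epsilon> * (\<kappa> 0 * dI 0 b u 0)" "u a = 0" "u b = 0"
    using e by (auto simp: perturbed_eigenfunction_def)
  show 1: "sl_flow k r a 0 u (\<lambda>x. k x * dI a 0 u x) (\<lambda>x. l / \<epsilon> * u x)"
    using SL_regular_flow[OF e'(1), of r "\<lambda>x. l / \<epsilon> * u x"] e'(3) positive
    by (force simp: field_simps)
  have "SL \<kappa> 0 b u x = - (\<rho> x *\<^sub>R (l / \<epsilon> * u x))" if "x \<in> {0<..<b}" for x
    using e'(4)[OF that] \<open>0 < \<epsilon>\<close> by (simp add: field_simps)
  then show 2: "sl_flow \<kappa> \<rho> 0 b u (\<lambda>x. \<kappa> x * dI 0 b u x) (\<lambda>x. l / \<epsilon> * u x)"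
    using SL_regular_flow[OF e'(2), of \<rho> "\<lambda>x. l / \<epsilon> * u x"] positive by simp
  show 3: "u x = \<alpha> * L.phi (l / \<epsilon>) x \<and> k x * dI a 0 u x = \<alpha> * L.Phi (l / \<epsilon>) x" if "x \<in> {a..0}" for x
    using L.flow_unique[of u "\<lambda>x. k x * dI a 0 u x" "l / \<epsilon>" x] 1 e' that by (simp add: \<alpha>_def mult.commute)
  show 4: "u x = \<beta> * R.phi (l / \<epsilon>) (- x) \<and> - (\<kappa> x * dI 0 b u x) = \<beta> * R.Phi (l / \<epsilon>) (- x)" if "x \<in> {0..b}" for x
    using R.flow_unique[of "\<lambda>x. u (- x)" "\<lambda>x. - (\<kappa> (- x) * dI 0 b u (- x))" "l / \<epsilon>" "- x"]
      reflect_right[OF 2] e' that by (simp add: \<beta>_def mult.commute)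
  let ?z = "l / \<epsilon>"
  have v: "\<alpha> * L.phi ?z 0 = \<beta> * R.phi ?z 0" using 3[of 0] 4[of 0] interval by simp
  have f: "\<alpha> * L.Phi ?z 0 = - \<epsilon> * (\<beta> * R.Phi ?z 0)"
  proof -
    have "\<kappa> 0 * dI 0 b u 0 = - (\<beta> * R.Phi ?z 0)" using 4[of 0] interval by auto
    then show ?thesis using 3[of 0] interval e'(5) by auto
  qed
  assume "\<beta> \<noteq> 0"
  have "\<beta> * char_fun \<epsilon> ?z = L.Phi ?z 0 * (\<beta> * R.phi ?z 0) + \<epsilon> * (\<beta> * R.Phi ?z 0) * L.phi ?z 0"
    by (simp add: char_fun_def algebra_simps)
  also have "\<dots> = (\<alpha> * L.Phi ?z 0 + \<epsilon> * (\<beta> * R.Phi ?z 0)) * L.phi ?z 0"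
    by (subst v[symmetric]) (simp add: algebra_simps)
  also have "\<dots> = 0" unfolding f by simp
  finally show "char_fun \<epsilon> ?z = 0" using \<open>\<beta> \<noteq> 0\<close> by simp
qed

text \<open>
  The two matching conditions at \<open>0\<close> form a homogeneous linear system for the factors on the two legs
  whose determinant is the characteristic function; a nontrivial solution is written down in each
  case.
\<close>

lemma char_fun_zero_eigenvalue:
  assumes "char_fun \<epsilon> z = 0" "0 < \<epsilon>"
  shows "complex_of_real (\<epsilon> * z) \<in> perturbed_spectrum a b k r \<kappa> \<rho> \<epsilon>"
proof -
  obtain \<alpha> \<beta> where ab: "\<alpha> * L.phi z 0 = \<beta> * R.phi z 0" "\<alpha> * L.Phi z 0 = - \<epsilon> * (\<beta> * R.Phi z 0)"
    "\<alpha> \<noteq> 0 \<or> \<beta> \<noteq> 0"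
  proof (cases "L.phi z 0 = 0")
    case False
    show ?thesis
      by (rule that[of "R.phi z 0" "L.phi z 0"]) (use assms False in \<open>auto simp: char_fun_def algebra_simps\<close>)
  next
    case phi0: True
    show ?thesis
    proof (cases "L.Phi z 0 = 0")
      case True
      show ?thesis by (rule that[of 1 0]) (use phi0 True in auto)
    next
      case False
      then have "R.phi z 0 = 0" using assms phi0 by (simp add: char_fun_def)
      then show ?thesis
        by (intro that[of "- \<epsilon> * R.Phi z 0" "L.Phi z 0"]) (use phi0 False in auto)
    qed
  qed
  define u where "u x = complex_of_real (if x < 0 then \<alpha> * L.phi z x else \<beta> * R.phi z (- x))" for x
  have uL: "u x = L.phi z x *\<^sub>R complex_of_real \<alpha>" if "x \<in> {a..0}" for x
    using that ab(1) by (cases "x = 0") (auto simp: u_def scaleR_conv_of_real mult.commute simp flip: of_real_mult)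
  have uR: "u x = R.phi z (- x) *\<^sub>R complex_of_real \<beta>" if "x \<in> {0..b}" for x
    using that by (auto simp: u_def scaleR_conv_of_real)
  have 1: "sl_flow k r a 0 u (\<lambda>x. L.Phi z x *\<^sub>R complex_of_real \<alpha>) (\<lambda>x. z *\<^sub>R u x)"
    by (rule sl_flow_cong[OF sl_flow_scaleR_left[OF L.phi_flow[of z], of "complex_of_real \<alpha>"]]) (auto simp: uL)
  have 2: "sl_flow \<kappa> \<rho> 0 b u (\<lambda>x. - (R.Phi z (- x) *\<^sub>R complex_of_real \<beta>)) (\<lambda>x. z *\<^sub>R u x)"
    by (rule sl_flow_cong[OF unreflect_right[OF sl_flow_scaleR_left[OF R.phi_flow[of z], of "complex_of_real \<beta>"]]])
      (auto simp: uR)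
  have c1: "continuous_on {a..0} (\<lambda>x. z *\<^sub>R u x)" and c2: "continuous_on {0..b} (\<lambda>x. z *\<^sub>R u x)"
    using 1 2 by (auto simp: sl_flow_def intro!: continuous_intros)
  note S1 = sl_flow_SL[OF 1 coefficients_continuous(1,2) c1 positive(1) interval(1)]
    and S2 = sl_flow_SL[OF 2 coefficients_continuous(3,4) c2 positive(3) interval(2)]
  have "perturbed_eigenfunction a b k r \<kappa> \<rho> \<epsilon> (complex_of_real (\<epsilon> * z)) u"
    unfolding perturbed_eigenfunction_def
  proof (intro conjI ballI)
    show "SL k a 0 u x + inverse (complex_of_real \<epsilon>) * complex_of_real (\<epsilon> * z) * complex_of_real (r x) * u x = 0"
      if "x \<in> {a<..<0}" for x
      using S1(2)[of x] that \<open>0 < \<epsilon>\<close> by (simp add: scaleR_conv_of_real)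
    show "complex_of_real \<epsilon> * SL \<kappa> 0 b u x + complex_of_real (\<epsilon> * z) * complex_of_real (\<rho> x) * u x = 0"
      if "x \<in> {0<..<b}" for x
      using S2(2)[of x] that by (simp add: scaleR_conv_of_real)
    show "k 0 *\<^sub>R dI a 0 u 0 = \<epsilon> *\<^sub>R \<kappa> 0 *\<^sub>R dI 0 b u 0"
      using S1(3)[of 0] S2(3)[of 0] interval arg_cong[OF ab(2), of complex_of_real]
      by (simp add: scaleR_conv_of_real mult_ac)
    show "u a = 0" "u b = 0" using uL[of a] uR[of b] interval by auto
    show "\<exists>x\<in>{a..b}. u x \<noteq> 0"
    proof (cases "\<alpha> = 0")
      case False
      obtain x where "x \<in> {a<..<0}" "L.phi z x \<noteq> 0" using L.phi_nonzero by blast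
      then show ?thesis using uL[of x] False interval by (intro bexI[of _ x]) auto
    next
      case True
      then have "\<beta> \<noteq> 0" using ab by simp
      obtain x where "x \<in> {-b<..<0}" "R.phi z x \<noteq> 0" using R.phi_nonzero by blast
      then show ?thesis using uR[of "-x"] \<open>\<beta> \<noteq> 0\<close> interval by (intro bexI[of _ "-x"]) auto
    qed
  qed (use S1 S2 in auto)
  then show ?thesis unfolding perturbed_spectrum_def by blast
qed

text \<open>
  For \<open>z \<le> 0\<close> both summands of the characteristic function have the sign of \<open>\<phi>\<^sub>L \<phi>\<^sub>R\<close>. The case \<open>\<epsilon> = 0\<close>
  covers the zeros of the limit problem.
\<close>

lemma char_fun_positive_zeros:
  assumes "char_fun \<epsilon> z = 0" "0 \<le> \<epsilon>"
  shows "0 < z"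
proof (rule ccontr)
  assume "\<not> ?thesis"
  then have z: "z \<le> 0" by simp
  note s = L.ends_same_sign[OF z] R.ends_same_sign[OF z]
  have "char_fun \<epsilon> z * (L.phi z 0 * R.phi z 0) =
      (L.phi z 0 * L.Phi z 0) * (R.phi z 0)\<^sup>2 + \<epsilon> * ((R.phi z 0 * R.Phi z 0) * (L.phi z 0)\<^sup>2)"
    by (simp add: char_fun_def power2_eq_square algebra_simps)
  moreover have "0 < (L.phi z 0 * L.Phi z 0) * (R.phi z 0)\<^sup>2"
    using s by (intro mult_pos_pos[OF s(1)]) auto
  moreover have "0 \<le> \<epsilon> * ((R.phi z 0 * R.Phi z 0) * (L.phi z 0)\<^sup>2)"
    by (rule mult_nonneg_nonneg[OF assms(2) mult_nonneg_nonneg[OF less_imp_le[OF s(2)] zero_le_power2]])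
  ultimately show False using assms(1) by simp
qed

end

section \<open>Zeros of a perturbed characteristic function\<close>

text \<open>
  The slopes of the chords of a convex function increase. Hence the chord from the zero \<open>s\<close> to any
  other point has at least the slope \<open>- H 0 / s\<close> of the chord from \<open>0\<close> to \<open>s\<close>; in particular \<open>s\<close> is the
  only zero.
\<close>

lemma convex_right_zero:
  fixes H :: "real \<Rightarrow> real"
  assumes cvx: "convex_on {0..\<delta>} H" and cont: "continuous_on {0..\<delta>} H" and "0 < \<delta>" "H 0 < 0" "0 < H \<delta>"
  shows "\<exists>s\<in>{0<..<\<delta>}. H s = 0 \<and> (\<forall>t\<in>{0..\<delta>}. \<bar>t - s\<bar> * - H 0 \<le> s * \<bar>H t\<bar>)"
proof -
  obtain s where s: "0 \<le> s" "s \<le> \<delta>" "H s = 0"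
    using IVT'[of H 0 0 \<delta>] assms by auto
  then have s': "0 < s" "s < \<delta>" using assms by (auto simp: less_le)
  have "\<bar>t - s\<bar> * - H 0 \<le> s * \<bar>H t\<bar>" if t: "t \<in> {0..\<delta>}" for t
  proof (cases "t \<le> s")
    case True
    have "H ((1 - t / s) *\<^sub>R 0 + (t / s) *\<^sub>R s) \<le> (1 - t / s) * H 0 + (t / s) * H s"
      using t True s s' by (intro convex_onD[OF cvx]) auto
    then have "H t \<le> (1 - t / s) * H 0" using s s' by simp
    then have "s * H t \<le> s * ((1 - t / s) * H 0)" using s' by (intro mult_left_mono) auto
    also have "s * ((1 - t / s) * H 0) = (s - t) * H 0" using s' by (simp add: field_simps)
    finally have "(s - t) * - H 0 \<le> s * - H t" by simp
    also have "\<dots> \<le> s * \<bar>H t\<bar>" using s' by (intro mult_left_mono) auto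
    finally show ?thesis using True by simp
  next
    case False
    then have ts: "0 < t" "s < t" using s' by auto
    have "H ((1 - s / t) *\<^sub>R 0 + (s / t) *\<^sub>R t) \<le> (1 - s / t) * H 0 + (s / t) * H t"
      using t ts s s' by (intro convex_onD[OF cvx]) auto
    then have "0 \<le> (1 - s / t) * H 0 + (s / t) * H t" using s ts by simp
    then have "0 \<le> t * ((1 - s / t) * H 0 + (s / t) * H t)" using ts by simp
    also have "\<dots> = (t - s) * H 0 + s * H t" using ts by (simp add: field_simps)
    finally have "(t - s) * - H 0 \<le> s * H t" by simp
    also have "\<dots> \<le> s * \<bar>H t\<bar>" using s' by (intro mult_left_mono) auto
    finally show ?thesis using False by simp
  qed
  then show ?thesis using s s' by (intro bexI[of _ s]) auto
qed

text \<open>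
  Near \<open>0\<close> the function \<open>G + \<epsilon> S\<close> is convex, has the value \<open>\<epsilon> S 0 < 0\<close> at \<open>0\<close>, and is positive at any
  fixed small \<open>\<delta>\<close>. The parabola \<open>g s\<^sup>2 / 2 \<le> G s\<close> bounds its zero by a multiple of \<open>\<surd>\<epsilon>\<close>, and
  \<open>convex_right_zero\<close> gives a slope of order \<open>\<epsilon> / \<surd>\<epsilon>\<close>.
\<close>

lemma half_parabola_zero:
  fixes G S :: "real \<Rightarrow> real"
  assumes dG: "\<And>z. (G has_real_derivative G1 z) (at z)" "\<And>z. (G1 has_real_derivative G2 z) (at z)" "isCont G2 0"
    and dS: "\<And>z. (S has_real_derivative S1 z) (at z)" "\<And>z. (S1 has_real_derivative S2 z) (at z)" "isCont S2 0"
    and G0: "G 0 = 0" "G1 0 = 0" "0 < G2 0" and S0: "S 0 < 0"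
  shows "\<exists>\<delta>0>0. \<exists>C>0. \<exists>c>0. \<forall>\<delta>. 0 < \<delta> \<and> \<delta> \<le> \<delta>0 \<longrightarrow> (\<forall>\<^sub>F \<epsilon> in at_right 0.
     \<exists>s\<in>{0<..<\<delta>}. G s + \<epsilon> * S s = 0 \<and> s \<le> C * sqrt \<epsilon> \<and>
       (\<forall>t\<in>{0..\<delta>}. c * sqrt \<epsilon> * \<bar>t - s\<bar> \<le> \<bar>G t + \<epsilon> * S t\<bar>))"
proof -
  define g where "g = G2 0 / 2"
  have g: "0 < g" using G0 by (simp add: g_def)
  define B where "B = \<bar>S2 0\<bar> + \<bar>S 0\<bar> + 1"
  have B: "0 < B" by (simp add: B_def)
  have "isCont S 0" using dS(1) by (rule DERIV_isCont)
  then have lim: "(G2 \<longlongrightarrow> G2 0) (nhds 0)" "(S2 \<longlongrightarrow> S2 0) (nhds 0)" "(S \<longlongrightarrow> S 0) (nhds 0)"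
    using dG(3) dS(3) unfolding isCont_def tendsto_at_iff_tendsto_nhds by auto
  have "g < G2 0" using G0 by (simp add: g_def)
  from order_tendstoD(1)[OF lim(1) this] have "\<forall>\<^sub>F z in nhds 0. g < G2 z" .
  moreover have "\<forall>\<^sub>F z in nhds 0. \<bar>S2 z\<bar> < B" "\<forall>\<^sub>F z in nhds 0. \<bar>S z\<bar> < B"
    by (auto intro!: order_tendstoD(2)[OF tendsto_rabs[OF lim(2)]]
        order_tendstoD(2)[OF tendsto_rabs[OF lim(3)]] simp: B_def)
  ultimately have "\<forall>\<^sub>F z in nhds 0. g < G2 z \<and> \<bar>S2 z\<bar> < B \<and> \<bar>S z\<bar> < B"
    by eventually_elim auto
  then obtain d where d: "0 < d" "\<And>z. dist z 0 < d \<Longrightarrow> g < G2 z \<and> \<bar>S2 z\<bar> < B \<and> \<bar>S z\<bar> < B"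
    unfolding eventually_nhds_metric by blast
  \<comment> \<open>Two integrations of \<open>g < G2\<close>, where \<open>g\<close> is half the value of \<open>G2\<close> at \<open>0\<close>.\<close>
  have quad: "g / 2 * z\<^sup>2 \<le> G z" if z: "0 \<le> z" "z < d" for z
  proof -
    have K1: "0 \<le> G1 s - g * s" if s: "0 \<le> s" "s < d" for s
    proof -
      have "(\<lambda>s. G1 s - g * s) 0 \<le> (\<lambda>s. G1 s - g * s) s"
      proof (rule DERIV_nonneg_imp_nondecreasing[OF s(1)])
        fix x assume "0 \<le> x" "x \<le> s"
        then have "((\<lambda>s. G1 s - g * s) has_real_derivative G2 x - g) (at x)" "0 \<le> G2 x - g"
          using d(2)[of x] s by (auto intro!: derivative_eq_intros dG simp: less_imp_le)
        then show "\<exists>y. ((\<lambda>s. G1 s - g * s) has_real_derivative y) (at x) \<and> 0 \<le> y" by blast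
      qed
      then show ?thesis using G0 by simp
    qed
    have "(\<lambda>s. G s - g / 2 * s\<^sup>2) 0 \<le> (\<lambda>s. G s - g / 2 * s\<^sup>2) z"
    proof (rule DERIV_nonneg_imp_nondecreasing[OF z(1)])
      fix x assume "0 \<le> x" "x \<le> z"
      then have "((\<lambda>s. G s - g / 2 * s\<^sup>2) has_real_derivative G1 x - g * x) (at x)" "0 \<le> G1 x - g * x"
        using K1[of x] z by (auto intro!: derivative_eq_intros dG)
      then show "\<exists>y. ((\<lambda>s. G s - g / 2 * s\<^sup>2) has_real_derivative y) (at x) \<and> 0 \<le> y" by blast
    qed
    then show ?thesis using G0 by simp
  qed
  \<comment> \<open>At the zero \<open>s\<close> one has \<open>g s\<^sup>2 / 2 \<le> G s = - \<epsilon> S s \<le> \<epsilon> B\<close>, that is, \<open>s \<le> C \<surd>\<epsilon>\<close>.\<close>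
  define C where "C = sqrt (2 * B / g)"
  have C: "0 < C" using g B by (simp add: C_def)
  define c where "c = - S 0 / C"
  have c: "0 < c" using C S0 by (simp add: c_def divide_neg_pos)
  have main: "\<forall>\<^sub>F \<epsilon> in at_right 0. \<exists>s\<in>{0<..<\<delta>}. G s + \<epsilon> * S s = 0 \<and> s \<le> C * sqrt \<epsilon> \<and>
       (\<forall>t\<in>{0..\<delta>}. c * sqrt \<epsilon> * \<bar>t - s\<bar> \<le> \<bar>G t + \<epsilon> * S t\<bar>)" if \<delta>: "0 < \<delta>" "\<delta> < d" for \<delta>
  proof -
    have "\<forall>\<^sub>F \<epsilon> in at_right (0::real). 0 < \<epsilon>" "\<forall>\<^sub>F \<epsilon> in at_right 0. \<epsilon> < g / B"
      "\<forall>\<^sub>F \<epsilon> in at_right 0. \<epsilon> < g / 2 * \<delta>\<^sup>2 / B"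
      using g B \<delta> by (auto intro!: order_tendstoD(2)[OF tendsto_ident_at] eventually_at_right_less)
    then show ?thesis
    proof eventually_elim
      case (elim \<epsilon>)
      then have \<epsilon>: "0 < \<epsilon>" "\<epsilon> * B < g" "\<epsilon> * B < g / 2 * \<delta>\<^sup>2"
        using B by (auto simp: pos_less_divide_eq)
      define H where "H z = G z + \<epsilon> * S z" for z
      have in_d: "dist z 0 < d" if "z \<in> {0..\<delta>}" for z using that \<delta> by auto
      have "convex_on {0..\<delta>} H"
      proof (rule f''_ge0_imp_convex)
        show "(H has_real_derivative G1 x + \<epsilon> * S1 x) (at x)" for x
          unfolding H_def by (auto intro!: derivative_eq_intros dG dS)
        show "((\<lambda>x. G1 x + \<epsilon> * S1 x) has_real_derivative G2 x + \<epsilon> * S2 x) (at x)" for x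
          by (auto intro!: derivative_eq_intros dG dS)
        fix x assume "x \<in> {0..\<delta>}"
        then have x: "g < G2 x" "\<bar>S2 x\<bar> < B" using d(2) in_d by auto
        have "\<epsilon> * - S2 x \<le> \<epsilon> * B" using x \<epsilon> by (intro mult_left_mono) auto
        then show "0 \<le> G2 x + \<epsilon> * S2 x" using x \<epsilon> by simp
      qed auto
      moreover have "continuous_on {0..\<delta>} H"
        unfolding H_def
        by (intro continuous_intros DERIV_continuous_on[OF has_field_derivative_at_within[OF dG(1)]]
            DERIV_continuous_on[OF has_field_derivative_at_within[OF dS(1)]])
      moreover have "H 0 < 0" using \<epsilon> S0 G0 by (simp add: H_def mult_pos_neg)
      moreover have "0 < H \<delta>"
      proof -
        have "\<epsilon> * - S \<delta> \<le> \<epsilon> * B" using d(2)[of \<delta>] \<delta> \<epsilon> by (intro mult_left_mono) auto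
        then show ?thesis using quad[of \<delta>] \<delta> \<epsilon> by (simp add: H_def)
      qed
      ultimately obtain s where s: "s \<in> {0<..<\<delta>}" "H s = 0" "\<forall>t\<in>{0..\<delta>}. \<bar>t - s\<bar> * - H 0 \<le> s * \<bar>H t\<bar>"
        using convex_right_zero[of \<delta> H] \<delta> by blast
      have "s\<^sup>2 \<le> (C * sqrt \<epsilon>)\<^sup>2"
      proof -
        have "g / 2 * s\<^sup>2 \<le> G s" using s \<delta> by (intro quad) auto
        also have "G s = \<epsilon> * - S s" using s by (simp add: H_def)
        also have "\<dots> \<le> \<epsilon> * B" using d(2)[of s] s \<delta> \<epsilon> by (intro mult_left_mono) auto
        finally have "s\<^sup>2 \<le> 2 * B / g * \<epsilon>" using g by (simp add: field_simps)
        then show ?thesis using g B \<epsilon> by (simp add: C_def power_mult_distrib)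
      qed
      then have sC: "s \<le> C * sqrt \<epsilon>"
        by (rule power2_le_imp_le) (use C \<epsilon> in auto)
      have "c * sqrt \<epsilon> * \<bar>t - s\<bar> \<le> \<bar>H t\<bar>" if t: "t \<in> {0..\<delta>}" for t
      proof -
        have "\<bar>t - s\<bar> * (\<epsilon> * - S 0) \<le> s * \<bar>H t\<bar>" using s(3) t G0 by (auto simp: H_def)
        also have "\<dots> \<le> C * sqrt \<epsilon> * \<bar>H t\<bar>" using sC by (intro mult_right_mono) auto
        finally have "\<bar>t - s\<bar> * (sqrt \<epsilon> * sqrt \<epsilon> * - S 0) \<le> C * sqrt \<epsilon> * \<bar>H t\<bar>" using \<epsilon> by simp
        then have "sqrt \<epsilon> * (\<bar>t - s\<bar> * (sqrt \<epsilon> * - S 0)) \<le> sqrt \<epsilon> * (C * \<bar>H t\<bar>)"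
          by (simp only: mult_ac)
        then have "\<bar>t - s\<bar> * (sqrt \<epsilon> * - S 0) \<le> C * \<bar>H t\<bar>"
          by (rule mult_left_le_imp_le) (use \<epsilon> in simp)
        then show ?thesis using C by (simp add: c_def field_simps)
      qed
      then show ?case using s sC unfolding H_def by blast
    qed
  qed
  have "0 < d / 2" using d by simp
  moreover have "\<forall>\<delta>. 0 < \<delta> \<and> \<delta> \<le> d / 2 \<longrightarrow> (\<forall>\<^sub>F \<epsilon> in at_right 0. \<exists>s\<in>{0<..<\<delta>}. G s + \<epsilon> * S s = 0 \<and> s \<le> C * sqrt \<epsilon> \<and>
       (\<forall>t\<in>{0..\<delta>}. c * sqrt \<epsilon> * \<bar>t - s\<bar> \<le> \<bar>G t + \<epsilon> * S t\<bar>))"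
    using main d by auto
  ultimately show ?thesis using C c by blast
qed

definition zeros_near :: "(real \<Rightarrow> real) \<Rightarrow> (real \<Rightarrow> real) \<Rightarrow> real \<Rightarrow> real \<Rightarrow> real \<Rightarrow> real set" where
  "zeros_near G S \<epsilon> z \<delta> = {t \<in> {z - \<delta>..z + \<delta>}. G t + \<epsilon> * S t = 0}"

text \<open>
  How small \<open>\<epsilon>\<close> has to be may depend on the radius \<open>\<delta>\<close>. Hence \<open>N\<close> is the number of zeros that
  converge to \<open>z\<close>, and the radius can still be adapted to the other zeros.
\<close>

definition zero_count :: "(real \<Rightarrow> real) \<Rightarrow> (real \<Rightarrow> real) \<Rightarrow> real \<Rightarrow> nat \<Rightarrow> bool" where
  "zero_count G S z N \<longleftrightarrow> (\<exists>\<delta>0>0. \<forall>\<delta>. 0 < \<delta> \<and> \<delta> \<le> \<delta>0 \<longrightarrow>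
     (\<forall>\<^sub>F \<epsilon> in at_right 0. finite (zeros_near G S \<epsilon> z \<delta>) \<and> card (zeros_near G S \<epsilon> z \<delta>) = N))"

lemma zero_count_uminus: "zero_count (\<lambda>z. - G z) (\<lambda>z. - S z) z N \<longleftrightarrow> zero_count G S z N"
proof -
  have "zeros_near (\<lambda>z. - G z) (\<lambda>z. - S z) \<epsilon> z \<delta> = zeros_near G S \<epsilon> z \<delta>" for \<epsilon> z \<delta>
  proof -
    have "- G t + \<epsilon> * - S t = 0 \<longleftrightarrow> G t + \<epsilon> * S t = 0" for t by auto
    then show ?thesis unfolding zeros_near_def by simp
  qed
  then show ?thesis unfolding zero_count_def by simp
qed

text \<open>
  The last two conjuncts are the inverse estimates: on either side of \<open>z0\<close> a small value of \<open>G + \<epsilon> S\<close>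
  forces \<open>t\<close> to be close to the zero on that side.
\<close>

definition split_pair ::
    "(real \<Rightarrow> real) \<Rightarrow> (real \<Rightarrow> real) \<Rightarrow> real \<Rightarrow> real \<Rightarrow> real \<Rightarrow> real \<Rightarrow> real \<Rightarrow> real \<Rightarrow> real \<Rightarrow> bool" where
  "split_pair G S z0 \<delta> C c \<epsilon> z1 z2 \<longleftrightarrow>
     z0 - \<delta> < z1 \<and> z1 < z0 \<and> z0 < z2 \<and> z2 < z0 + \<delta> \<and> zeros_near G S \<epsilon> z0 \<delta> = {z1, z2} \<and>
     \<bar>z1 - z0\<bar> \<le> C * sqrt \<epsilon> \<and> \<bar>z2 - z0\<bar> \<le> C * sqrt \<epsilon> \<and>
     (\<forall>t\<in>{z0 - \<delta>..z0}. c * sqrt \<epsilon> * \<bar>t - z1\<bar> \<le> \<bar>G t + \<epsilon> * S t\<bar>) \<and>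
     (\<forall>t\<in>{z0..z0 + \<delta>}. c * sqrt \<epsilon> * \<bar>t - z2\<bar> \<le> \<bar>G t + \<epsilon> * S t\<bar>)"

definition splits_at :: "(real \<Rightarrow> real) \<Rightarrow> (real \<Rightarrow> real) \<Rightarrow> real \<Rightarrow> bool" where
  "splits_at G S z0 \<longleftrightarrow> (\<exists>\<delta>0>0. \<exists>C>0. \<exists>c>0. \<forall>\<delta>. 0 < \<delta> \<and> \<delta> \<le> \<delta>0 \<longrightarrow>
     (\<forall>\<^sub>F \<epsilon> in at_right 0. \<exists>z1 z2. split_pair G S z0 \<delta> C c \<epsilon> z1 z2))"

text \<open>
  \<open>half_parabola_zero\<close>, applied on both sides of \<open>z0\<close>. The inverse estimates exclude further zeros.
\<close>

lemma double_zero_split_pos: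
  fixes G S :: "real \<Rightarrow> real"
  assumes dG: "\<And>z. (G has_real_derivative G1 z) (at z)" "\<And>z. (G1 has_real_derivative G2 z) (at z)" "\<And>z. isCont G2 z"
    and dS: "\<And>z. (S has_real_derivative S1 z) (at z)" "\<And>z. (S1 has_real_derivative S2 z) (at z)" "\<And>z. isCont S2 z"
    and G0: "G z0 = 0" "G1 z0 = 0" "0 < G2 z0" and S0: "S z0 < 0"
  shows "splits_at G S z0"
proof -
  let ?P = "\<lambda>\<sigma> \<delta>0 C c. 0 < \<delta>0 \<and> 0 < C \<and> 0 < c \<and> (\<forall>\<delta>. 0 < \<delta> \<and> \<delta> \<le> \<delta>0 \<longrightarrow> (\<forall>\<^sub>F \<epsilon> in at_right 0.
     \<exists>s\<in>{0<..<\<delta>}. G (z0 + \<sigma> * s) + \<epsilon> * S (z0 + \<sigma> * s) = 0 \<and> s \<le> C * sqrt \<epsilon> \<and>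
       (\<forall>t\<in>{0..\<delta>}. c * sqrt \<epsilon> * \<bar>t - s\<bar> \<le> \<bar>G (z0 + \<sigma> * t) + \<epsilon> * S (z0 + \<sigma> * t)\<bar>)))"
  \<comment> \<open>Reflection in \<open>z0\<close> reduces the left side to the right one.\<close>
  have side: "\<exists>\<delta>0 C c. ?P \<sigma> \<delta>0 C c" if \<sigma>: "\<sigma> = 1 \<or> \<sigma> = -1" for \<sigma> :: real
  proof -
    have D: "((\<lambda>s. f (z0 + \<sigma> * s)) has_real_derivative \<sigma> * f' (z0 + \<sigma> * s)) (at s)"
      if "\<And>z. (f has_real_derivative f' z) (at z)" for f f' s
    proof -
      have "((\<lambda>s. z0 + \<sigma> * s) has_real_derivative \<sigma>) (at s)" by (auto intro!: derivative_eq_intros)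
      from DERIV_chain2[OF that this] show ?thesis by (simp add: mult.commute)
    qed
    have D2: "((\<lambda>s. \<sigma> * f (z0 + \<sigma> * s)) has_real_derivative f' (z0 + \<sigma> * s)) (at s)"
      if "\<And>z. (f has_real_derivative f' z) (at z)" for f f' s
      using DERIV_cmult[OF D[OF that, of s], of \<sigma>] \<sigma> by auto
    have I: "isCont (\<lambda>s. f (z0 + \<sigma> * s)) 0" if "\<And>z. isCont f z" for f :: "real \<Rightarrow> real"
      using isCont_o2[of 0 "\<lambda>s. z0 + \<sigma> * s" f] that by auto
    show ?thesis
      using half_parabola_zero[OF D[OF dG(1)] D2[OF dG(2)] I[OF dG(3)] D[OF dS(1)] D2[OF dS(2)] I[OF dS(3)]] G0 S0
      by auto
  qed
  obtain \<delta>1 C1 c1 where R: "?P 1 \<delta>1 C1 c1" using side[of 1] by blast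
  obtain \<delta>2 C2 c2 where L: "?P (-1) \<delta>2 C2 c2" using side[of "-1"] by blast
  define \<delta>0 where "\<delta>0 = min \<delta>1 \<delta>2"
  define C where "C = max C1 C2"
  define c where "c = min c1 c2"
  have main: "\<forall>\<^sub>F \<epsilon> in at_right 0. \<exists>z1 z2. split_pair G S z0 \<delta> C c \<epsilon> z1 z2"
    if \<delta>: "0 < \<delta>" "\<delta> \<le> \<delta>0" for \<delta>
  proof -
    from R \<delta> have "\<forall>\<^sub>F \<epsilon> in at_right 0.
     \<exists>s\<in>{0<..<\<delta>}. G (z0 + 1 * s) + \<epsilon> * S (z0 + 1 * s) = 0 \<and> s \<le> C1 * sqrt \<epsilon> \<and>
       (\<forall>t\<in>{0..\<delta>}. c1 * sqrt \<epsilon> * \<bar>t - s\<bar> \<le> \<bar>G (z0 + 1 * t) + \<epsilon> * S (z0 + 1 * t)\<bar>)"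
      unfolding \<delta>0_def by auto
    moreover from L \<delta> have "\<forall>\<^sub>F \<epsilon> in at_right 0.
     \<exists>s\<in>{0<..<\<delta>}. G (z0 + (-1) * s) + \<epsilon> * S (z0 + (-1) * s) = 0 \<and> s \<le> C2 * sqrt \<epsilon> \<and>
       (\<forall>t\<in>{0..\<delta>}. c2 * sqrt \<epsilon> * \<bar>t - s\<bar> \<le> \<bar>G (z0 + (-1) * t) + \<epsilon> * S (z0 + (-1) * t)\<bar>)"
      unfolding \<delta>0_def by auto
    moreover have "\<forall>\<^sub>F \<epsilon> in at_right (0::real). 0 < \<epsilon>" by (rule eventually_at_right_less)
    ultimately show ?thesis
    proof eventually_elim
      case (elim \<epsilon>)
      obtain s where s: "s \<in> {0<..<\<delta>}" "G (z0 + s) + \<epsilon> * S (z0 + s) = 0" "s \<le> C1 * sqrt \<epsilon>"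
        "\<forall>t\<in>{0..\<delta>}. c1 * sqrt \<epsilon> * \<bar>t - s\<bar> \<le> \<bar>G (z0 + t) + \<epsilon> * S (z0 + t)\<bar>"
        using elim(1) by auto
      obtain l where l: "l \<in> {0<..<\<delta>}" "G (z0 - l) + \<epsilon> * S (z0 - l) = 0" "l \<le> C2 * sqrt \<epsilon>"
        "\<forall>t\<in>{0..\<delta>}. c2 * sqrt \<epsilon> * \<bar>t - l\<bar> \<le> \<bar>G (z0 - t) + \<epsilon> * S (z0 - t)\<bar>"
        using elim(2) by auto
      have \<epsilon>: "0 < sqrt \<epsilon>" using elim by simp
      have Rb: "c * sqrt \<epsilon> * \<bar>t - (z0 + s)\<bar> \<le> \<bar>G t + \<epsilon> * S t\<bar>" if t: "t \<in> {z0..z0 + \<delta>}" for t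
      proof -
        have "c * sqrt \<epsilon> * \<bar>t - (z0 + s)\<bar> \<le> c1 * sqrt \<epsilon> * \<bar>t - (z0 + s)\<bar>"
          using \<epsilon> by (intro mult_right_mono) (auto simp: c_def)
        also have "\<dots> \<le> \<bar>G t + \<epsilon> * S t\<bar>" using s(4)[rule_format, of "t - z0"] t by (simp add: algebra_simps)
        finally show ?thesis .
      qed
      have Lb: "c * sqrt \<epsilon> * \<bar>t - (z0 - l)\<bar> \<le> \<bar>G t + \<epsilon> * S t\<bar>" if t: "t \<in> {z0 - \<delta>..z0}" for t
      proof -
        have "c * sqrt \<epsilon> * \<bar>t - (z0 - l)\<bar> \<le> c2 * sqrt \<epsilon> * \<bar>t - (z0 - l)\<bar>"
          using \<epsilon> by (intro mult_right_mono) (auto simp: c_def)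
        also have "\<dots> \<le> \<bar>G t + \<epsilon> * S t\<bar>"
        proof -
          have "\<bar>t - (z0 - l)\<bar> = \<bar>(z0 - t) - l\<bar>" by simp
          then show ?thesis using l(4)[rule_format, of "z0 - t"] t by simp
        qed
        finally show ?thesis .
      qed
      have c: "0 < c" using R L by (simp add: c_def)
      have "zeros_near G S \<epsilon> z0 \<delta> = {z0 - l, z0 + s}"
      proof
        show "{z0 - l, z0 + s} \<subseteq> zeros_near G S \<epsilon> z0 \<delta>"
          using s l by (auto simp: zeros_near_def)
        show "zeros_near G S \<epsilon> z0 \<delta> \<subseteq> {z0 - l, z0 + s}"
        proof
          fix t assume "t \<in> zeros_near G S \<epsilon> z0 \<delta>"
          then have t: "z0 - \<delta> \<le> t" "t \<le> z0 + \<delta>" "G t + \<epsilon> * S t = 0" by (auto simp: zeros_near_def)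
          show "t \<in> {z0 - l, z0 + s}"
          proof (cases "z0 \<le> t")
            case True
            then have "c * sqrt \<epsilon> * \<bar>t - (z0 + s)\<bar> \<le> 0" using Rb[of t] t by simp
            then show ?thesis using c \<epsilon> by (simp add: mult_le_0_iff)
          next
            case False
            then have "c * sqrt \<epsilon> * \<bar>t - (z0 - l)\<bar> \<le> 0" using Lb[of t] t by simp
            then show ?thesis using c \<epsilon> by (simp add: mult_le_0_iff)
          qed
        qed
      qed
      moreover have "s \<le> C * sqrt \<epsilon>" "l \<le> C * sqrt \<epsilon>"
      proof -
        have "C1 * sqrt \<epsilon> \<le> C * sqrt \<epsilon>" "C2 * sqrt \<epsilon> \<le> C * sqrt \<epsilon>"
          using \<epsilon> by (auto simp: C_def intro!: mult_right_mono)
        then show "s \<le> C * sqrt \<epsilon>" "l \<le> C * sqrt \<epsilon>" using s l by linarith+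
      qed
      ultimately show ?case
        using s l Rb Lb unfolding split_pair_def by (intro exI[of _ "z0 - l"] exI[of _ "z0 + s"]) auto
    qed
  qed
  have "0 < \<delta>0" "0 < C" "0 < c" using R L by (auto simp: \<delta>0_def C_def c_def)
  then show ?thesis unfolding splits_at_def using main by blast
qed

lemma double_zero_split:
  assumes G: "C2_fun G" and S: "C2_fun S" and G0: "G z0 = 0" "deriv G z0 = 0" "deriv (deriv G) z0 * S z0 < 0"
  shows "splits_at G S z0"
proof (cases "0 < deriv (deriv G) z0")
  case True
  then show ?thesis
    using double_zero_split_pos[OF C2_fun_deriv(1-3)[OF G] C2_fun_deriv(1-3)[OF S] G0(1,2)] G0(3)
    by (auto simp: mult_less_0_iff)
next
  case False
  have m: "isCont (\<lambda>z. - deriv (deriv f) z) z" if "C2_fun f" for f :: "real \<Rightarrow> real" and z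
    using C2_fun_deriv(3)[OF that] by (intro continuous_intros)
  have "- G t + \<epsilon> * - S t = 0 \<longleftrightarrow> G t + \<epsilon> * S t = 0" for t \<epsilon> by auto
  moreover have "\<bar>- G t + \<epsilon> * - S t\<bar> = \<bar>G t + \<epsilon> * S t\<bar>" for t \<epsilon>
    using abs_minus_cancel[of "G t + \<epsilon> * S t"] by simp
  ultimately have "splits_at (\<lambda>z. - G z) (\<lambda>z. - S z) z0 = splits_at G S z0"
    unfolding splits_at_def split_pair_def zeros_near_def by (simp only:)
  moreover have "splits_at (\<lambda>z. - G z) (\<lambda>z. - S z) z0"
    by (rule double_zero_split_pos[OF DERIV_minus[OF C2_fun_deriv(1)[OF G]] DERIV_minus[OF C2_fun_deriv(2)[OF G]] m[OF G]
        DERIV_minus[OF C2_fun_deriv(1)[OF S]] DERIV_minus[OF C2_fun_deriv(2)[OF S]] m[OF S]])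
      (use G0 False in \<open>auto simp: mult_less_0_iff\<close>)
  ultimately show ?thesis by simp
qed

text \<open>
  Near a simple zero the derivative of \<open>G + \<epsilon> S\<close> is positive, so there is at most one zero; the signs at
  the two end points of a fixed small interval are those of \<open>G\<close>, so there is one.
\<close>

lemma zero_count_simple_pos:
  fixes G S :: "real \<Rightarrow> real"
  assumes dG: "\<And>z. (G has_real_derivative G1 z) (at z)" "isCont G1 z0"
    and dS: "\<And>z. (S has_real_derivative S1 z) (at z)" "isCont S1 z0"
    and G0: "G z0 = 0" "0 < G1 z0"
  shows "zero_count G S z0 1"
proof -
  define g where "g = G1 z0 / 2"
  have g: "0 < g" using G0 by (simp add: g_def)
  define B where "B = \<bar>S1 z0\<bar> + 1"
  have B: "0 < B" by (simp add: B_def)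
  have lim: "(G1 \<longlongrightarrow> G1 z0) (nhds z0)" "(S1 \<longlongrightarrow> S1 z0) (nhds z0)"
    using dG(2) dS(2) unfolding isCont_def tendsto_at_iff_tendsto_nhds by auto
  have "g < G1 z0" using G0 by (simp add: g_def)
  from order_tendstoD(1)[OF lim(1) this] have "\<forall>\<^sub>F z in nhds z0. g < G1 z" .
  moreover have "\<forall>\<^sub>F z in nhds z0. \<bar>S1 z\<bar> < B"
    by (auto intro!: order_tendstoD(2)[OF tendsto_rabs[OF lim(2)]] simp: B_def)
  ultimately have "\<forall>\<^sub>F z in nhds z0. g < G1 z \<and> \<bar>S1 z\<bar> < B"
    by eventually_elim auto
  then obtain d where d: "0 < d" "\<And>z. dist z z0 < d \<Longrightarrow> g < G1 z \<and> \<bar>S1 z\<bar> < B"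
    unfolding eventually_nhds_metric by blast
  have main: "\<forall>\<^sub>F \<epsilon> in at_right 0. finite (zeros_near G S \<epsilon> z0 \<delta>) \<and> card (zeros_near G S \<epsilon> z0 \<delta>) = 1"
    if \<delta>: "0 < \<delta>" "\<delta> < d" for \<delta>
  proof -
    have Ginc: "G x < G y" if xy: "z0 - \<delta> \<le> x" "x < y" "y \<le> z0 + \<delta>" for x y
    proof (rule DERIV_pos_imp_increasing[OF xy(2)])
      fix t assume "x \<le> t" "t \<le> y"
      then have "g < G1 t" using d(2)[of t] xy \<delta> by (auto simp: dist_real_def)
      then show "\<exists>y. (G has_real_derivative y) (at t) \<and> 0 < y" using dG(1)[of t] g by force
    qed
    have "G z0 < G (z0 + \<delta>)" "G (z0 - \<delta>) < G z0" using \<delta> by (auto intro!: Ginc)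
    moreover have lim: "((\<lambda>\<epsilon>. G z + \<epsilon> * S z) \<longlongrightarrow> G z) (at_right 0)" for z
      by (auto intro!: tendsto_eq_intros)
    ultimately have "\<forall>\<^sub>F \<epsilon> in at_right 0. 0 < G (z0 + \<delta>) + \<epsilon> * S (z0 + \<delta>)"
      "\<forall>\<^sub>F \<epsilon> in at_right 0. G (z0 - \<delta>) + \<epsilon> * S (z0 - \<delta>) < 0"
      using G0 by (auto intro: order_tendstoD[OF lim])
    moreover have "\<forall>\<^sub>F \<epsilon> in at_right (0::real). 0 < \<epsilon>" "\<forall>\<^sub>F \<epsilon> in at_right 0. \<epsilon> < g / B"
      using g B by (auto intro!: order_tendstoD(2)[OF tendsto_ident_at] eventually_at_right_less)
    ultimately show ?thesis
    proof eventually_elim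
      case (elim \<epsilon>)
      then have \<epsilon>: "0 < \<epsilon>" "\<epsilon> * B < g" using B by (auto simp: pos_less_divide_eq)
      define H where "H z = G z + \<epsilon> * S z" for z
      have dH: "(H has_real_derivative G1 x + \<epsilon> * S1 x) (at x)" for x
        unfolding H_def by (auto intro!: derivative_eq_intros dG dS)
      have inc: "H x < H y" if xy: "z0 - \<delta> \<le> x" "x < y" "y \<le> z0 + \<delta>" for x y
      proof (rule DERIV_pos_imp_increasing[OF xy(2)])
        fix t assume t: "x \<le> t" "t \<le> y"
        then have "g < G1 t" "\<bar>S1 t\<bar> < B" using d(2)[of t] xy \<delta> by (auto simp: dist_real_def)
        moreover have "\<epsilon> * - S1 t \<le> \<epsilon> * B" using calculation \<epsilon> by (intro mult_left_mono) auto
        ultimately have "0 < G1 t + \<epsilon> * S1 t" using \<epsilon> by simp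
        then show "\<exists>y. (H has_real_derivative y) (at t) \<and> 0 < y" using dH by blast
      qed
      have "continuous_on {z0 - \<delta>..z0 + \<delta>} H"
        by (rule DERIV_continuous_on[OF has_field_derivative_at_within[OF dH]])
      then obtain x where x: "z0 - \<delta> \<le> x" "x \<le> z0 + \<delta>" "H x = 0"
        using IVT'[of H "z0 - \<delta>" 0 "z0 + \<delta>"] elim \<delta> by (auto simp: H_def)
      have "zeros_near G S \<epsilon> z0 \<delta> = {x}"
        unfolding zeros_near_def H_def[symmetric]
      proof (intro set_eqI iffI)
        fix t assume "t \<in> {t \<in> {z0 - \<delta>..z0 + \<delta>}. H t = 0}"
        then have "z0 - \<delta> \<le> t" "t \<le> z0 + \<delta>" "H t = 0" by auto
        then show "t \<in> {x}" using x inc[of t x] inc[of x t] by (cases t x rule: linorder_cases) auto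
      qed (use x in auto)
      then show ?case by simp
    qed
  qed
  show ?thesis
    unfolding zero_count_def using main d by (intro exI[of _ "d / 2"]) auto
qed

lemma zero_count_simple:
  assumes G: "C2_fun G" and S: "C2_fun S" and G0: "G z0 = 0" "deriv G z0 \<noteq> 0"
  shows "zero_count G S z0 1"
proof (cases "0 < deriv G z0")
  case True
  then show ?thesis
    using zero_count_simple_pos[OF C2_fun_deriv(1,5)[OF G] C2_fun_deriv(1,5)[OF S] G0(1)] by simp
next
  case False
  have "zero_count (\<lambda>z. - G z) (\<lambda>z. - S z) z0 1"
    by (rule zero_count_simple_pos[OF DERIV_minus[OF C2_fun_deriv(1)[OF G]] _ DERIV_minus[OF C2_fun_deriv(1)[OF S]]])
      (use False G0 C2_fun_deriv(5)[OF G] C2_fun_deriv(5)[OF S] in \<open>auto intro!: continuous_intros\<close>)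
  then show ?thesis by (simp add: zero_count_uminus)
qed

text \<open>
  Away from the finitely many zeros of \<open>G\<close> the function \<open>|G|\<close> is bounded below on a compact set, so
  a small perturbation creates no zeros there.
\<close>

lemma zero_count_below:
  fixes G S :: "real \<Rightarrow> real"
  assumes cont: "continuous_on UNIV G" "continuous_on UNIV S"
    and Z: "Z = {z \<in> {lo..m}. G z = 0}" "finite Z" "m \<in> Z" "lo \<notin> Z"
    and N: "\<And>z. z \<in> Z - {m} \<Longrightarrow> zero_count G S z (N z)"
  shows "\<exists>\<delta>0>0. \<forall>\<delta>. 0 < \<delta> \<and> \<delta> \<le> \<delta>0 \<longrightarrow> (\<forall>\<^sub>F \<epsilon> in at_right 0.
    finite {t \<in> {lo..<m - \<delta>}. G t + \<epsilon> * S t = 0} \<and>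
    card {t \<in> {lo..<m - \<delta>}. G t + \<epsilon> * S t = 0} = (\<Sum>z\<in>Z - {m}. N z))"
proof -
  let ?Z = "Z - {m}"
  have "\<exists>f. \<forall>z\<in>?Z. 0 < f z \<and> (\<forall>\<delta>. 0 < \<delta> \<and> \<delta> \<le> f z \<longrightarrow>
     (\<forall>\<^sub>F \<epsilon> in at_right 0. finite (zeros_near G S \<epsilon> z \<delta>) \<and> card (zeros_near G S \<epsilon> z \<delta>) = N z))"
    using N unfolding zero_count_def by (intro bchoice) blast
  then obtain f where f: "\<And>z. z \<in> ?Z \<Longrightarrow> 0 < f z" "\<And>z \<delta>. z \<in> ?Z \<Longrightarrow> 0 < \<delta> \<Longrightarrow> \<delta> \<le> f z \<Longrightarrow>
     (\<forall>\<^sub>F \<epsilon> in at_right 0. finite (zeros_near G S \<epsilon> z \<delta>) \<and> card (zeros_near G S \<epsilon> z \<delta>) = N z)"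
    by blast
  \<comment> \<open>The minimum of this finite set is a common radius: the balls around the zeros are disjoint, stay above \<open>lo\<close>, and are small enough for the local counts.\<close>
  define W where "W = insert 1 (f ` ?Z \<union> (\<lambda>z. (z - lo) / 2) ` Z \<union>
      (\<lambda>(z, w). \<bar>z - w\<bar> / 3) ` {(z, w) \<in> Z \<times> Z. z \<noteq> w})"
  have "finite {(z, w) \<in> Z \<times> Z. z \<noteq> w}"
    by (rule finite_subset[of _ "Z \<times> Z"]) (use Z in auto)
  then have finW: "finite W" using Z by (simp add: W_def)
  \<comment> \<open>The radii are positive because \<open>lo\<close> is not a zero.\<close>
  have posW: "0 < w" if "w \<in> W" for w
  proof -
    have "lo < z" if "z \<in> Z" for z
    proof -
      have "lo \<le> z" "z \<noteq> lo" using that Z by auto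
      then show ?thesis by simp
    qed
    then show ?thesis using that f(1) by (auto simp: W_def)
  qed
  define e where "e = Min W"
  have e0: "0 < e" unfolding e_def using finW posW by (subst Min_gr_iff) (auto simp: W_def)
  have eW: "e \<le> w" if "w \<in> W" for w unfolding e_def using finW that by (rule Min_le)
  have ef: "e \<le> f z" if "z \<in> ?Z" for z using that by (intro eW) (auto simp: W_def)
  have elo: "lo < z - e" if "z \<in> Z" for z
  proof -
    have "e \<le> (z - lo) / 2" using that by (intro eW) (auto simp: W_def)
    then show ?thesis using e0 by simp
  qed
  have esep: "2 * e < \<bar>z - w\<bar>" if "z \<in> Z" "w \<in> Z" "z \<noteq> w" for z w
  proof -
    have "e \<le> \<bar>z - w\<bar> / 3" using that by (intro eW) (auto simp: W_def)
    then show ?thesis using e0 by simp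
  qed
  have main: "\<forall>\<^sub>F \<epsilon> in at_right 0.
    finite {t \<in> {lo..<m - \<delta>}. G t + \<epsilon> * S t = 0} \<and>
    card {t \<in> {lo..<m - \<delta>}. G t + \<epsilon> * S t = 0} = (\<Sum>z\<in>?Z. N z)" if \<delta>: "0 < \<delta>" "\<delta> \<le> e" for \<delta>
  proof -
    define K where "K = {lo..m - \<delta>} - (\<Union>z\<in>?Z. ball z e)"
    have K: "compact K" unfolding K_def by (intro compact_diff compact_Icc open_UN ballI open_ball)
    have "\<exists>\<eta>>0. \<forall>t\<in>K. \<eta> \<le> \<bar>G t\<bar>"
    proof (cases "K = {}")
      case True
      then show ?thesis by (intro exI[of _ 1]) auto
    next
      case False
      have "continuous_on K (\<lambda>t. \<bar>G t\<bar>)" by (intro continuous_intros continuous_on_subset[OF cont(1)]) auto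
      then obtain x where x: "x \<in> K" "\<forall>y\<in>K. \<bar>G x\<bar> \<le> \<bar>G y\<bar>"
        using continuous_attains_inf[OF K False] by blast
      have "G x \<noteq> 0"
      proof
        assume "G x = 0"
        then have "x \<in> ?Z" using x(1) Z \<delta> by (auto simp: K_def)
        then have "x \<in> (\<Union>z\<in>?Z. ball z e)" using e0 by (intro UN_I[of x]) auto
        then show False using x(1) unfolding K_def by blast
      qed
      then show ?thesis using x by (intro exI[of _ "\<bar>G x\<bar>"]) auto
    qed
    then obtain \<eta> where \<eta>: "0 < \<eta>" "\<And>t. t \<in> K \<Longrightarrow> \<eta> \<le> \<bar>G t\<bar>" by blast
    have "bounded (S ` {lo..m})"
      by (intro compact_imp_bounded compact_continuous_image continuous_on_subset[OF cont(2)]) auto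
    then have "\<exists>B>0. \<forall>t\<in>{lo..m}. \<bar>S t\<bar> \<le> B" by (auto simp: bounded_pos)
    then obtain B where B: "0 < B" "\<And>t. t \<in> {lo..m} \<Longrightarrow> \<bar>S t\<bar> \<le> B" by blast
    have "\<forall>\<^sub>F \<epsilon> in at_right 0. \<forall>z\<in>?Z. finite (zeros_near G S \<epsilon> z e) \<and> card (zeros_near G S \<epsilon> z e) = N z"
      using Z f(2) ef e0 by (intro eventually_ball_finite) auto
    moreover have "\<forall>\<^sub>F \<epsilon> in at_right (0::real). 0 < \<epsilon>" "\<forall>\<^sub>F \<epsilon> in at_right 0. \<epsilon> < \<eta> / B"
      using \<eta> B by (auto intro!: order_tendstoD(2)[OF tendsto_ident_at] eventually_at_right_less)
    ultimately show ?thesis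
    proof eventually_elim
      case (elim \<epsilon>)
      then have \<epsilon>: "0 < \<epsilon>" "\<epsilon> * B < \<eta>" using B by (auto simp: pos_less_divide_eq)
      have eq: "{t \<in> {lo..<m - \<delta>}. G t + \<epsilon> * S t = 0} = (\<Union>z\<in>?Z. zeros_near G S \<epsilon> z e)"
      proof (intro set_eqI iffI)
        fix t assume "t \<in> {t \<in> {lo..<m - \<delta>}. G t + \<epsilon> * S t = 0}"
        then have t: "lo \<le> t" "t < m - \<delta>" "G t + \<epsilon> * S t = 0" by auto
        have "t \<notin> K"
        proof
          assume "t \<in> K"
          then have "\<eta> \<le> \<bar>G t\<bar>" by (rule \<eta>)
          also have "\<bar>G t\<bar> = \<epsilon> * \<bar>S t\<bar>" 
          proof -
            have "G t = - (\<epsilon> * S t)" using t(3) by simp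
            then show ?thesis using \<epsilon> by (simp add: abs_mult)
          qed
          also have "\<dots> \<le> \<epsilon> * B" using B(2)[of t] t \<delta> \<epsilon> by (intro mult_left_mono) auto
          finally show False using \<epsilon> by simp
        qed
        then obtain z where "z \<in> ?Z" "t \<in> ball z e" using t by (auto simp: K_def)
        then show "t \<in> (\<Union>z\<in>?Z. zeros_near G S \<epsilon> z e)"
          using t by (intro UN_I[of z]) (auto simp: zeros_near_def dist_real_def)
      next
        fix t assume "t \<in> (\<Union>z\<in>?Z. zeros_near G S \<epsilon> z e)"
        then obtain z where z: "z \<in> ?Z" "t \<in> {z - e..z + e}" "G t + \<epsilon> * S t = 0" by (auto simp: zeros_near_def)
        have "lo < z - e" using z elo by auto
        moreover have "z + 2 * e < m"
        proof -
          have "z \<le> m" using z Z by auto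
          then show ?thesis using esep[of z m] z Z(3) by auto
        qed
        ultimately show "t \<in> {t \<in> {lo..<m - \<delta>}. G t + \<epsilon> * S t = 0}" using z \<delta> by auto
      qed
      have "card (\<Union>z\<in>?Z. zeros_near G S \<epsilon> z e) = (\<Sum>z\<in>?Z. card (zeros_near G S \<epsilon> z e))"
      proof (rule card_UN_disjoint)
        show "\<forall>i\<in>?Z. \<forall>j\<in>?Z. i \<noteq> j \<longrightarrow> zeros_near G S \<epsilon> i e \<inter> zeros_near G S \<epsilon> j e = {}"
        proof (intro ballI impI)
          fix i j assume "i \<in> ?Z" "j \<in> ?Z" "i \<noteq> j"
          then have "2 * e < \<bar>i - j\<bar>" by (intro esep) auto
          then show "zeros_near G S \<epsilon> i e \<inter> zeros_near G S \<epsilon> j e = {}" by (auto simp: zeros_near_def)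
        qed
      qed (use elim Z in auto)
      then show ?case unfolding eq using elim Z by auto
    qed
  qed
  show ?thesis using main e0 by blast
qed

text \<open>
  Passes from counting zeros to numbering them: a strictly increasing sequence lists its values in
  order, so that the number of values below \<open>t\<close> determines the index of the first one that is not.
\<close>

lemma enumeration_index:
  fixes l :: "nat \<Rightarrow> real"
  assumes l: "strict_mono_on {1..} l" and "1 \<le> j"
    and below: "finite {x \<in> l ` {1..}. x < t}" "card {x \<in> l ` {1..}. x < t} = j - 1"
    and mid: "{x \<in> l ` {1..}. t \<le> x \<and> x \<le> s} = {z1, z2}" "z1 < z2"
  shows "l j = z1" "l (j + 1) = z2"
proof -
  define A where "A = {n \<in> {1..}. l n < t}"
  have inj: "inj_on l {1..}" using l by (rule strict_mono_on_imp_inj_on)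
  have im: "l ` A = {x \<in> l ` {1..}. x < t}" by (auto simp: A_def)
  have injA: "inj_on l A" using inj by (rule inj_on_subset) (auto simp: A_def)
  have finA: "finite A" using below(1) im injA finite_imageD by metis
  have cardA: "card A = j - 1" using below(2) im card_image[OF injA] by simp
  have mono: "l x \<le> l y" if "1 \<le> x" "x \<le> y" for x y
    using l that by (cases "x = y") (auto simp: strict_mono_on_def less_imp_le)
  have jA: "j \<notin> A"
  proof
    assume j: "j \<in> A"
    have "{1..j} \<subseteq> A"
    proof
      fix n assume "n \<in> {1..j}"
      then show "n \<in> A" using j mono[of n j] by (auto simp: A_def)
    qed
    then have "card {1..j} \<le> card A" using finA by (rule card_mono[rotated])
    then show False using cardA \<open>1 \<le> j\<close> by simp
  qed
  have geA: "j \<le> n" if "1 \<le> n" "n \<notin> A" for n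
  proof (rule ccontr)
    assume "\<not> j \<le> n"
    have "A \<subseteq> {1..<n}"
    proof
      fix i assume i: "i \<in> A"
      show "i \<in> {1..<n}"
      proof (rule ccontr)
        assume "i \<notin> {1..<n}"
        then have "n \<le> i" using i by (auto simp: A_def)
        then show False using mono[of n i] that i by (auto simp: A_def)
      qed
    qed
    then have "card A \<le> card {1..<n}" by (intro card_mono) auto
    then show False using cardA that \<open>\<not> j \<le> n\<close> by simp
  qed
  have lj: "t \<le> l j" using jA \<open>1 \<le> j\<close> by (auto simp: A_def)
  have "z1 \<in> l ` {1..}" "t \<le> z1" "z1 \<le> s" "z2 \<in> l ` {1..}" "z2 \<le> s" using mid by blast+
  then obtain n1 n2 where n: "1 \<le> n1" "z1 = l n1" "1 \<le> n2" "z2 = l n2" by auto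
  have "j \<le> n1" using n \<open>t \<le> z1\<close> by (intro geA) (auto simp: A_def)
  have n12: "n1 < n2" using mono[of n2 n1] n mid(2) by (meson linorder_not_le)
  have "l j \<le> z1" using mono[of j n1] \<open>j \<le> n1\<close> \<open>1 \<le> j\<close> n by simp
  then have "l j \<in> {x \<in> l ` {1..}. t \<le> x \<and> x \<le> s}" using lj \<open>z1 \<le> s\<close> \<open>1 \<le> j\<close> by auto
  then have "l j \<in> {z1, z2}" unfolding mid(1) .
  then show 1: "l j = z1" using \<open>l j \<le> z1\<close> mid(2) by auto
  have "l (j + 1) \<le> z2" using mono[of "j + 1" n2] \<open>j \<le> n1\<close> n12 n by simp
  moreover have "l j < l (j + 1)" using l \<open>1 \<le> j\<close> by (auto simp: strict_mono_on_def)
  ultimately have "l (j + 1) \<in> {x \<in> l ` {1..}. t \<le> x \<and> x \<le> s}" using lj \<open>z2 \<le> s\<close> by auto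
  then have "l (j + 1) \<in> {z1, z2}" unfolding mid(1) .
  then show "l (j + 1) = z2" using \<open>l j < l (j + 1)\<close> 1 by auto
qed

lemma simple_zeros_finite:
  fixes f :: "real \<Rightarrow> real"
  assumes d: "\<And>z. (f has_real_derivative f' z) (at z)" and simple: "\<And>z. f z = 0 \<Longrightarrow> f' z \<noteq> 0"
  shows "finite {z \<in> {a..b}. f z = 0}"
proof (rule ccontr)
  assume "infinite {z \<in> {a..b}. f z = 0}"
  moreover have "{z \<in> {a..b}. f z = 0} \<subseteq> {a..b}" by auto
  ultimately obtain x where x: "x islimpt {z \<in> {a..b}. f z = 0}"
    using Heine_Borel_imp_Bolzano_Weierstrass[OF compact_Icc] by blast
  have c: "continuous_on UNIV f" by (rule DERIV_continuous_on[OF has_field_derivative_at_within[OF d]])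
  have fx: "f x = 0"
  proof -
    have "closed {z. f z = 0}" using c by (intro closed_Collect_eq) auto
    then show ?thesis using x islimpt_subset[of x _ "{z. f z = 0}"] closed_limpt by blast
  qed
  have "((\<lambda>y. (f y - f x) / (y - x)) \<longlongrightarrow> f' x) (at x)" using d by (simp add: has_field_derivative_iff)
  then have "\<forall>\<^sub>F y in at x. (f y - f x) / (y - x) \<noteq> 0"
    using simple[OF fx] by (rule tendsto_imp_eventually_ne)
  then have "\<forall>\<^sub>F y in at x. y \<notin> {z \<in> {a..b}. f z = 0}" by eventually_elim (use fx in auto)
  then show False using x by (simp only: islimpt_iff_eventually) simp
qed

section \<open>Root spaces of the limit operator\<close>

context leg
begin

text \<open>
  The solvability condition for a forcing proportional to \<open>\<phi>\<close>, from which it follows that there are no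
  root functions of higher order for the problem on a single leg.
\<close>

lemma forced_lagrange:
  fixes y :: "real \<Rightarrow> 'a::banach"
  assumes "sl_flow p q c 0 y Y (\<lambda>x. z *\<^sub>R y x + phi z x *\<^sub>R e)" "y c = 0"
  shows "phi z 0 *\<^sub>R Y 0 - Phi z 0 *\<^sub>R y 0 = - (integral {c..0} (\<lambda>x. q x * (phi z x)\<^sup>2) *\<^sub>R e)"
proof -
  have 1: "((\<lambda>x. q x *\<^sub>R ((z * phi z x) *\<^sub>R y x - phi z x *\<^sub>R (z *\<^sub>R y x + phi z x *\<^sub>R e))) has_integral
     (phi z 0 *\<^sub>R Y 0 - Phi z 0 *\<^sub>R y 0) - (phi z c *\<^sub>R Y c - Phi z c *\<^sub>R y c)) {c..0}"
    by (rule sl_flow_lagrange[OF phi_flow assms(1)]) (use c in auto)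
  have eq: "(\<lambda>x. q x *\<^sub>R ((z * phi z x) *\<^sub>R y x - phi z x *\<^sub>R (z *\<^sub>R y x + phi z x *\<^sub>R e))) =
      (\<lambda>x. - ((q x * (phi z x)\<^sup>2) *\<^sub>R e))"
    by (auto simp: fun_eq_iff algebra_simps power2_eq_square)
  have 2: "((\<lambda>x. - ((q x * (phi z x)\<^sup>2) *\<^sub>R e)) has_integral
      - (integral {c..0} (\<lambda>x. q x * (phi z x)\<^sup>2) *\<^sub>R e)) {c..0}"
  proof (intro has_integral_neg has_integral_scaleR_left integrable_integral integrable_continuous_real)
    show "continuous_on {c..0} (\<lambda>x. q x * (phi z x)\<^sup>2)"
      using cont_q phi_cont by (intro continuous_intros)
  qed
  show ?thesis using has_integral_unique[OF 1[unfolded eq] 2] assms(2) by simp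
qed

lemma resonance_flux:
  fixes y :: "real \<Rightarrow> 'a::banach"
  assumes "sl_flow p q c 0 y Y (\<lambda>x. z *\<^sub>R y x + phi z x *\<^sub>R e)" "y c = 0" "Phi z 0 = 0" "Y 0 = 0"
  shows "e = 0"
  using forced_lagrange[OF assms(1,2)] assms(3,4) phi_mass_pos[of z] by auto

lemma resonance_value:
  fixes y :: "real \<Rightarrow> 'a::banach"
  assumes "sl_flow p q c 0 y Y (\<lambda>x. z *\<^sub>R y x + phi z x *\<^sub>R e)" "y c = 0" "phi z 0 = 0" "y 0 = 0"
  shows "e = 0"
  using forced_lagrange[OF assms(1,2)] assms(3,4) phi_mass_pos[of z] by auto

end

context two_legs
begin

abbreviation "limit_op \<equiv> A_op a b k r \<kappa> \<rho> :: (real \<Rightarrow> complex) \<times> (real \<Rightarrow> complex) \<Rightarrow> _ \<Rightarrow> bool"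

lemma limit_op_flows:
  fixes u f :: "(real \<Rightarrow> complex) \<times> (real \<Rightarrow> complex)"
  assumes A: "limit_op u (pair_scale (complex_of_real z) u + f)"
    and f: "continuous_on {a..0} (fst f)" "continuous_on {0..b} (snd f)"
  obtains U V where "sl_flow k r a 0 (fst u) U (\<lambda>x. z *\<^sub>R fst u x + fst f x)"
    "sl_flow (\<lambda>x. \<kappa> (- x)) (\<lambda>x. \<rho> (- x)) (- b) 0 (\<lambda>x. snd u (- x)) V (\<lambda>x. z *\<^sub>R snd u (- x) + snd f (- x))"
    "fst u a = 0" "U 0 = 0" "snd u b = 0" "fst u 0 = snd u 0"
proof -
  have h: "fst (pair_scale (complex_of_real z) u + f) = (\<lambda>x. z *\<^sub>R fst u x + fst f x)"
    "snd (pair_scale (complex_of_real z) u + f) = (\<lambda>x. z *\<^sub>R snd u x + snd f x)"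
    by (auto simp: pair_scale_def fun_eq_iff scaleR_conv_of_real)
  have A': "SL_op k r a 0 (fst u) (\<lambda>x. z *\<^sub>R fst u x + fst f x)"
    "SL_op \<kappa> \<rho> 0 b (snd u) (\<lambda>x. z *\<^sub>R snd u x + snd f x)"
    "fst u a = 0" "dI a 0 (fst u) 0 = 0" "snd u b = 0" "fst u 0 = snd u 0"
    using A unfolding A_op_def h by auto
  have c: "continuous_on {a..0} (\<lambda>x. z *\<^sub>R fst u x + fst f x)" "continuous_on {0..b} (\<lambda>x. z *\<^sub>R snd u x + snd f x)"
    using SL_op_continuous[OF A'(1)] SL_op_continuous[OF A'(2)] f by (auto intro!: continuous_intros)
  show thesis
    by (rule that[OF SL_op_flow[OF A'(1) c(1) coefficients_continuous(2) positive(1) interval(1)]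
          reflect_right[OF SL_op_flow[OF A'(2) c(2) coefficients_continuous(4) positive(3) interval(2)]]])
      (use A' in auto)
qed

lemma flows_limit_op:
  fixes u f :: "(real \<Rightarrow> complex) \<times> (real \<Rightarrow> complex)"
  assumes U: "sl_flow k r a 0 (fst u) U (\<lambda>x. z *\<^sub>R fst u x + fst f x)"
    and V: "sl_flow (\<lambda>x. \<kappa> (- x)) (\<lambda>x. \<rho> (- x)) (- b) 0 (\<lambda>x. snd u (- x)) V (\<lambda>x. z *\<^sub>R snd u (- x) + snd f (- x))"
    and bc: "fst u a = 0" "U 0 = 0" "snd u b = 0" "fst u 0 = snd u 0"
    and f: "continuous_on {a..0} (fst f)" "continuous_on {0..b} (snd f)"
  shows "limit_op u (pair_scale (complex_of_real z) u + f)"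
proof -
  have h: "fst (pair_scale (complex_of_real z) u + f) = (\<lambda>x. z *\<^sub>R fst u x + fst f x)"
    "snd (pair_scale (complex_of_real z) u + f) = (\<lambda>x. z *\<^sub>R snd u x + snd f x)"
    by (auto simp: pair_scale_def fun_eq_iff scaleR_conv_of_real)
  obtain k' where k': "\<And>x. x \<in> {a..0} \<Longrightarrow> (k has_real_derivative k' x) (at x within {a..0})" "continuous_on {a..0} k'"
    using smooth_interval_C1[OF smooth(1)] by metis
  obtain \<kappa>' where \<kappa>': "\<And>x. x \<in> {0..b} \<Longrightarrow> (\<kappa> has_real_derivative \<kappa>' x) (at x within {0..b})" "continuous_on {0..b} \<kappa>'"
    using smooth_interval_C1[OF smooth(3)] by metis
  have V': "sl_flow \<kappa> \<rho> 0 b (snd u) (\<lambda>x. - V (- x)) (\<lambda>x. z *\<^sub>R snd u x + snd f x)"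
    using unreflect_right[OF V] by simp
  have c: "continuous_on {a..0} (\<lambda>x. z *\<^sub>R fst u x + fst f x)" "continuous_on {0..b} (\<lambda>x. z *\<^sub>R snd u x + snd f x)"
    using U V' f by (auto simp: sl_flow_def intro!: continuous_intros)
  have "k 0 *\<^sub>R dI a 0 (fst u) 0 = U 0"
    by (rule sl_flow_SL(3)[OF U coefficients_continuous(1,2) c(1) positive(1) interval(1)]) (use interval in auto)
  then have "dI a 0 (fst u) 0 = 0" using bc positive(1)[of 0] interval by auto
  moreover have "SL_op k r a 0 (fst u) (\<lambda>x. z *\<^sub>R fst u x + fst f x)"
    by (rule sl_flow_SL_op[OF U coefficients_continuous(2) c(1) positive(1) interval(1) k'])
  moreover have "SL_op \<kappa> \<rho> 0 b (snd u) (\<lambda>x. z *\<^sub>R snd u x + snd f x)"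
    by (rule sl_flow_SL_op[OF V' coefficients_continuous(4) c(2) positive(3) interval(2) \<kappa>'])
  ultimately show ?thesis unfolding A_op_def h using bc by auto
qed

text \<open>
  Members of \<open>root_space\<close> vanish off the intervals, and \<open>cut\<close> produces such representatives from functions
  on the two legs, the second one given on the reflected interval.
\<close>

definition supported :: "(real \<Rightarrow> complex) \<times> (real \<Rightarrow> complex) \<Rightarrow> bool" where
  "supported u \<longleftrightarrow> (\<forall>x. x \<notin> {a..0} \<longrightarrow> fst u x = 0) \<and> (\<forall>x. x \<notin> {0..b} \<longrightarrow> snd u x = 0)"

definition cut :: "(real \<Rightarrow> real) \<Rightarrow> (real \<Rightarrow> real) \<Rightarrow> (real \<Rightarrow> complex) \<times> (real \<Rightarrow> complex)" where
  "cut f g = ((\<lambda>x. if x \<in> {a..0} then complex_of_real (f x) else 0),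
              (\<lambda>x. if x \<in> {0..b} then complex_of_real (g (- x)) else 0))"

lemma supported_cut: "supported (cut f g)"
  by (simp add: supported_def cut_def)

lemma cut_limit_op:
  assumes U: "sl_flow k r a 0 f U (\<lambda>x. z * f x + f0 x)"
    and V: "sl_flow (\<lambda>x. \<kappa> (- x)) (\<lambda>x. \<rho> (- x)) (- b) 0 g V (\<lambda>x. z * g x + g0 x)"
    and bc: "f a = 0" "U 0 = 0" "g (- b) = 0" "f 0 = g 0"
    and c: "continuous_on {a..0} f0" "continuous_on {-b..0} g0"
  shows "limit_op (cut f g) (pair_scale (complex_of_real z) (cut f g) + cut f0 g0)"
proof (rule flows_limit_op)
  show "sl_flow k r a 0 (fst (cut f g)) (\<lambda>x. U x *\<^sub>R 1) (\<lambda>x. z *\<^sub>R fst (cut f g) x + fst (cut f0 g0) x)"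
    by (rule sl_flow_cong[OF sl_flow_scaleR_left[OF U, of "1 :: complex"]]) (auto simp: cut_def scaleR_conv_of_real)
  show "sl_flow (\<lambda>x. \<kappa> (- x)) (\<lambda>x. \<rho> (- x)) (- b) 0 (\<lambda>x. snd (cut f g) (- x)) (\<lambda>x. V x *\<^sub>R 1)
      (\<lambda>x. z *\<^sub>R snd (cut f g) (- x) + snd (cut f0 g0) (- x))"
    by (rule sl_flow_cong[OF sl_flow_scaleR_left[OF V, of "1 :: complex"]]) (auto simp: cut_def scaleR_conv_of_real)
  show "continuous_on {a..0} (fst (cut f0 g0))"
    by (rule continuous_on_eq[of _ "\<lambda>x. complex_of_real (f0 x)"]) (use c in \<open>auto simp: cut_def intro!: continuous_intros\<close>)
  have "continuous_on {0..b} (\<lambda>x. g0 (- x))"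
    using c(2) by (auto intro!: continuous_on_compose2[of "{-b..0}" g0 _ uminus] continuous_intros)
  then have "continuous_on {0..b} (\<lambda>x. complex_of_real (g0 (- x)))" by (intro continuous_intros)
  then show "continuous_on {0..b} (snd (cut f0 g0))"
    by (rule continuous_on_eq) (auto simp: cut_def)
qed (use bc interval in \<open>auto simp: cut_def\<close>)

lemma root_space_Suc:
  "u \<in> root_space a b limit_op z (Suc n) \<longleftrightarrow> supported u \<and> (\<exists>f\<in>root_space a b limit_op z n. limit_op u (pair_scale z u + f))"
  by (simp add: supported_def)

interpretation vs: vector_space "pair_scale :: complex \<Rightarrow> (real \<Rightarrow> complex) \<times> (real \<Rightarrow> complex) \<Rightarrow> _"
  by (rule vector_space_pair_scale)

text \<open>
  Induction on the order of the root functions. With the span of explicit root functions for \<open>V\<close>,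
  this bounds the algebraic multiplicity from above.
\<close>

lemma root_space_subset:
  assumes zero: "0 \<in> V"
    and cont: "\<And>f. f \<in> V \<Longrightarrow> continuous_on {a..0} (fst f) \<and> continuous_on {0..b} (snd f)"
    and step: "\<And>f u. f \<in> V \<Longrightarrow> supported u \<Longrightarrow> limit_op u (pair_scale z u + f) \<Longrightarrow> u \<in> V"
  shows "(\<Union>n. root_space a b limit_op z n) \<subseteq> V"
proof -
  have "root_space a b limit_op z n \<subseteq> V" for n
  proof (induction n)
    case 0
    then show ?case using zero by simp
  next
    case (Suc n)
    show ?case
    proof
      fix u assume "u \<in> root_space a b limit_op z (Suc n)"
      then obtain f where "supported u" "f \<in> root_space a b limit_op z n" "limit_op u (pair_scale z u + f)"
        unfolding root_space_Suc by blast
      then show "u \<in> V" using step Suc by blast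
    qed
  qed
  then show ?thesis by blast
qed

lemma root_space_1:
  "supported u \<Longrightarrow> limit_op u (pair_scale z u + 0) \<Longrightarrow> u \<in> (\<Union>n. root_space a b limit_op z n)"
  by (rule UN_I[of 1]) (auto simp: root_space_Suc simp del: root_space.simps(2))

lemma root_space_2:
  assumes "supported u" "limit_op u (pair_scale z u + f)" "supported f" "limit_op f (pair_scale z f + 0)"
  shows "u \<in> (\<Union>n. root_space a b limit_op z n)"
  using assms by (intro UN_I[of 2]) (auto simp: numeral_2_eq_2 root_space_Suc simp del: root_space.simps(2))

lemma cut_zero: "cut (\<lambda>x. 0) (\<lambda>x. 0) = 0"
  by (auto simp: cut_def zero_prod_def fun_eq_iff)

lemma supported_eqI:
  assumes "supported u" "supported v" "\<And>x. x \<in> {a..0} \<Longrightarrow> fst u x = fst v x"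
    "\<And>x. x \<in> {-b..0} \<Longrightarrow> snd u (- x) = snd v (- x)"
  shows "u = v"
proof (rule prod_eqI)
  show "fst u = fst v" using assms(1-3) unfolding supported_def by (metis ext)
  have "snd u x = snd v x" if "x \<in> {0..b}" for x using assms(4)[of "- x"] that by simp
  then show "snd u = snd v" using assms(1,2) unfolding supported_def by (metis ext)
qed

lemma supported_scale: "supported u \<Longrightarrow> supported (pair_scale c u)"
  by (simp add: supported_def pair_scale_def)

lemma supported_add: "supported u \<Longrightarrow> supported v \<Longrightarrow> supported (u + v)"
  by (simp add: supported_def)

lemma cut_continuous:
  assumes "continuous_on {a..0} f" "continuous_on {-b..0} g"
  shows "continuous_on {a..0} (fst (cut f g))" "continuous_on {0..b} (snd (cut f g))"
proof -
  show "continuous_on {a..0} (fst (cut f g))"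
    by (rule continuous_on_eq[of _ "\<lambda>x. complex_of_real (f x)"]) (use assms in \<open>auto simp: cut_def intro!: continuous_intros\<close>)
  have "continuous_on {0..b} (\<lambda>x. g (- x))"
    using assms(2) by (auto intro!: continuous_on_compose2[of "{-b..0}" g _ uminus] continuous_intros)
  then have "continuous_on {0..b} (\<lambda>x. complex_of_real (g (- x)))" by (intro continuous_intros)
  then show "continuous_on {0..b} (snd (cut f g))"
    by (rule continuous_on_eq) (auto simp: cut_def)
qed

lemma cut_nonzero:
  assumes "\<exists>x\<in>{-b<..<0}. g x \<noteq> 0"
  shows "cut f g \<noteq> 0"
proof
  assume "cut f g = 0"
  then have *: "snd (cut f g) x = 0" for x by (simp add: zero_fun_def)
  obtain x where "x \<in> {-b<..<0}" "g x \<noteq> 0" using assms by blast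
  then show False using *[of "- x"] by (simp add: cut_def)
qed

lemma fst_cut_nonzero:
  assumes "\<exists>x\<in>{a<..<0}. f x \<noteq> 0" "fst v = 0"
  shows "cut f g \<noteq> v"
proof
  assume "cut f g = v"
  then have *: "fst (cut f g) x = 0" for x using assms(2) by (simp add: zero_fun_def)
  obtain x where "x \<in> {a<..<0}" "f x \<noteq> 0" using assms by blast
  then show False using *[of x] by (simp add: cut_def)
qed

text \<open>
  Since \<open>\<Phi>\<^sub>L\<close> does not vanish, the left component of a root function is zero. The right component then
  vanishes at \<open>0\<close>, and \<open>resonance_value\<close> excludes a chain of length two.
\<close>

lemma multiplicity_right_only:
  assumes P: "L.Phi z 0 \<noteq> 0" and Q: "R.phi z 0 = 0"
  shows "algebraic_multiplicity a b limit_op (complex_of_real z) = 1"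
proof -
  define e where "e = cut (\<lambda>x. 0) (R.phi z)"
  have "limit_op e (pair_scale (complex_of_real z) e + cut (\<lambda>x. 0) (\<lambda>x. 0))"
    unfolding e_def
    by (rule cut_limit_op[where U="\<lambda>x. 0" and V="R.Phi z"])
      (use R.phi_flow[of z] sl_flow_zero Q in \<open>auto\<close>)
  then have e_root: "e \<in> (\<Union>n. root_space a b limit_op (complex_of_real z) n)"
    unfolding cut_zero by (intro root_space_1) (auto simp: e_def supported_cut)
  have cont: "continuous_on {a..0} (fst f) \<and> continuous_on {0..b} (snd f)" if "f \<in> vs.span {e}" for f
  proof -
    obtain c where "f = pair_scale c e" using \<open>f \<in> _\<close> by (auto simp: vs.span_singleton)
    then show ?thesis
      using cut_continuous[of "\<lambda>x. 0" "R.phi z"] R.phi_cont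
      by (auto simp: pair_scale_def e_def intro!: continuous_intros)
  qed
  have "(\<Union>n. root_space a b limit_op (complex_of_real z) n) \<subseteq> vs.span {e}"
  proof (rule root_space_subset[OF vs.span_zero cont])
    fix f u assume f: "f \<in> vs.span {e}" and u: "supported u" and A: "limit_op u (pair_scale (complex_of_real z) u + f)"
    obtain c where c: "f = pair_scale c e" using f by (auto simp: vs.span_singleton)
    obtain U V where UV: "sl_flow k r a 0 (fst u) U (\<lambda>x. z *\<^sub>R fst u x + fst f x)"
      "sl_flow (\<lambda>x. \<kappa> (- x)) (\<lambda>x. \<rho> (- x)) (- b) 0 (\<lambda>x. snd u (- x)) V (\<lambda>x. z *\<^sub>R snd u (- x) + snd f (- x))"
      "fst u a = 0" "U 0 = 0" "snd u b = 0" "fst u 0 = snd u 0"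
      by (rule limit_op_flows[OF A conjunct1[OF cont[OF f]] conjunct2[OF cont[OF f]]]) (rule that)
    have U: "sl_flow k r a 0 (fst u) U (\<lambda>x. z *\<^sub>R fst u x)"
      by (rule sl_flow_cong[OF UV(1)]) (auto simp: c e_def cut_def pair_scale_def)
    have "U a = 0" using L.flow_unique(2)[OF U UV(3), of 0] UV(4) P interval by simp
    then have fst0: "fst u x = 0" if "x \<in> {a..0}" for x
      using L.flow_unique(1)[OF U UV(3) that] by simp
    have V: "sl_flow (\<lambda>x. \<kappa> (- x)) (\<lambda>x. \<rho> (- x)) (- b) 0 (\<lambda>x. snd u (- x)) V (\<lambda>x. z *\<^sub>R snd u (- x) + R.phi z x *\<^sub>R c)"
      by (rule sl_flow_cong[OF UV(2)]) (auto simp: c e_def cut_def pair_scale_def scaleR_conv_of_real mult.commute)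
    have "c = 0" by (rule R.resonance_value[OF V]) (use UV Q fst0[of 0] interval in auto)
    then have V': "sl_flow (\<lambda>x. \<kappa> (- x)) (\<lambda>x. \<rho> (- x)) (- b) 0 (\<lambda>x. snd u (- x)) V (\<lambda>x. z *\<^sub>R snd u (- x))"
      using V by simp
    have "u = pair_scale (V (- b)) e"
    proof (rule supported_eqI)
      show "fst u x = fst (pair_scale (V (- b)) e) x" if "x \<in> {a..0}" for x
        using fst0[OF that] by (simp add: pair_scale_def e_def cut_def)
      show "snd u (- x) = snd (pair_scale (V (- b)) e) (- x)" if "x \<in> {-b..0}" for x
        using R.flow_unique(1)[OF V' _ that] UV(5) that
        by (simp add: pair_scale_def e_def cut_def scaleR_conv_of_real mult.commute)
    qed (use u in \<open>auto simp: e_def intro!: supported_scale supported_cut\<close>)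
    then show "u \<in> vs.span {e}" by (auto simp: vs.span_singleton)
  qed
  moreover have "e \<noteq> 0" unfolding e_def by (rule cut_nonzero[OF R.phi_nonzero])
  ultimately show ?thesis
    unfolding algebraic_multiplicity_def using e_root
    by (intro vs.dim_unique[of "{e}"]) auto
qed

lemma multiplicity_none:
  assumes P: "L.Phi z 0 \<noteq> 0" and Q: "R.phi z 0 \<noteq> 0"
  shows "algebraic_multiplicity a b limit_op (complex_of_real z) = 0"
proof -
  have "(\<Union>n. root_space a b limit_op (complex_of_real z) n) \<subseteq> {0}"
  proof (rule root_space_subset)
    fix f u :: "(real \<Rightarrow> complex) \<times> (real \<Rightarrow> complex)"
    assume f: "f \<in> {0}" and u: "supported u" and A: "limit_op u (pair_scale (complex_of_real z) u + f)"
    obtain U V where UV: "sl_flow k r a 0 (fst u) U (\<lambda>x. z *\<^sub>R fst u x + fst f x)"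
      "sl_flow (\<lambda>x. \<kappa> (- x)) (\<lambda>x. \<rho> (- x)) (- b) 0 (\<lambda>x. snd u (- x)) V (\<lambda>x. z *\<^sub>R snd u (- x) + snd f (- x))"
      "fst u a = 0" "U 0 = 0" "snd u b = 0" "fst u 0 = snd u 0"
      using limit_op_flows[OF A] f by (auto simp: zero_fun_def)
    have U: "sl_flow k r a 0 (fst u) U (\<lambda>x. z *\<^sub>R fst u x)"
      and V: "sl_flow (\<lambda>x. \<kappa> (- x)) (\<lambda>x. \<rho> (- x)) (- b) 0 (\<lambda>x. snd u (- x)) V (\<lambda>x. z *\<^sub>R snd u (- x))"
      using UV f by (auto simp: zero_fun_def)
    have "U a = 0" using L.flow_unique(2)[OF U UV(3), of 0] UV(4) P interval by simp
    then have fst0: "fst u x = 0" if "x \<in> {a..0}" for x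
      using L.flow_unique(1)[OF U UV(3) that] by simp
    have "V (- b) = 0" using R.flow_unique(1)[OF V, of 0] UV fst0[of 0] Q interval by simp
    then have "snd u (- x) = 0" if "x \<in> {-b..0}" for x
      using R.flow_unique(1)[OF V _ that] UV(5) by simp
    then have "u = 0" using u fst0 by (intro supported_eqI) (auto simp: supported_def)
    then show "u \<in> {0}" by simp
  qed (auto simp: zero_fun_def)
  then show ?thesis
    unfolding algebraic_multiplicity_def by (intro vs.dim_unique[of "{}"]) (auto simp: vs.independent_empty)
qed

text \<open>
  Since \<open>\<phi>\<^sub>R\<close> does not vanish, every solution on the left has exactly one continuation to the right;
  \<open>resonance_flux\<close> excludes a chain of length two.
\<close>

lemma multiplicity_left_only:
  assumes P: "L.Phi z 0 = 0" and Q: "R.phi z 0 \<noteq> 0"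
  shows "algebraic_multiplicity a b limit_op (complex_of_real z) = 1"
proof -
  define s where "s = L.phi z 0 / R.phi z 0"
  define e where "e = cut (L.phi z) (\<lambda>x. s * R.phi z x)"
  have "limit_op e (pair_scale (complex_of_real z) e + cut (\<lambda>x. 0) (\<lambda>x. 0))"
    unfolding e_def
  proof (rule cut_limit_op[where U="L.Phi z" and V="\<lambda>x. s * R.Phi z x"])
    show "sl_flow k r a 0 (L.phi z) (L.Phi z) (\<lambda>x. z * L.phi z x + 0)"
      using L.phi_flow[of z] by simp
    show "sl_flow (\<lambda>x. \<kappa> (- x)) (\<lambda>x. \<rho> (- x)) (- b) 0 (\<lambda>x. s * R.phi z x) (\<lambda>x. s * R.Phi z x) (\<lambda>x. z * (s * R.phi z x) + 0)"
      using sl_flow_scaleR[OF R.phi_flow[of z], of s] by (simp add: mult_ac)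
  qed (use P Q in \<open>auto simp: s_def\<close>)
  then have e_root: "e \<in> (\<Union>n. root_space a b limit_op (complex_of_real z) n)"
    unfolding cut_zero by (intro root_space_1) (auto simp: e_def supported_cut)
  have cont: "continuous_on {a..0} (fst f) \<and> continuous_on {0..b} (snd f)" if "f \<in> vs.span {e}" for f
  proof -
    obtain c where "f = pair_scale c e" using \<open>f \<in> _\<close> by (auto simp: vs.span_singleton)
    moreover have "continuous_on {- b..0} (\<lambda>x. s * R.phi z x)" using R.phi_cont by (intro continuous_intros)
    ultimately show ?thesis
      using cut_continuous[OF L.phi_cont(1), of "\<lambda>x. s * R.phi z x"]
      by (auto simp: pair_scale_def e_def intro!: continuous_intros)
  qed
  have "(\<Union>n. root_space a b limit_op (complex_of_real z) n) \<subseteq> vs.span {e}"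
  proof (rule root_space_subset[OF vs.span_zero cont])
    fix f u assume f: "f \<in> vs.span {e}" and u: "supported u" and A: "limit_op u (pair_scale (complex_of_real z) u + f)"
    obtain c where c: "f = pair_scale c e" using f by (auto simp: vs.span_singleton)
    obtain U V where UV: "sl_flow k r a 0 (fst u) U (\<lambda>x. z *\<^sub>R fst u x + fst f x)"
      "sl_flow (\<lambda>x. \<kappa> (- x)) (\<lambda>x. \<rho> (- x)) (- b) 0 (\<lambda>x. snd u (- x)) V (\<lambda>x. z *\<^sub>R snd u (- x) + snd f (- x))"
      "fst u a = 0" "U 0 = 0" "snd u b = 0" "fst u 0 = snd u 0"
      by (rule limit_op_flows[OF A conjunct1[OF cont[OF f]] conjunct2[OF cont[OF f]]]) (rule that)
    have U: "sl_flow k r a 0 (fst u) U (\<lambda>x. z *\<^sub>R fst u x + L.phi z x *\<^sub>R c)"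
      by (rule sl_flow_cong[OF UV(1)]) (auto simp: c e_def cut_def pair_scale_def scaleR_conv_of_real mult.commute)
    have "c = 0" by (rule L.resonance_flux[OF U]) (use UV P in auto)
    then have f0: "f = 0" by (simp add: c pair_scale_def zero_prod_def fun_eq_iff)
    have U': "sl_flow k r a 0 (fst u) U (\<lambda>x. z *\<^sub>R fst u x)"
      and V': "sl_flow (\<lambda>x. \<kappa> (- x)) (\<lambda>x. \<rho> (- x)) (- b) 0 (\<lambda>x. snd u (- x)) V (\<lambda>x. z *\<^sub>R snd u (- x))"
      using UV(1,2) f0 by (auto simp: zero_fun_def)
    note rep = L.flow_unique(1)[OF U' UV(3)] R.flow_unique(1)[OF V']
    have ends: "R.phi z 0 *\<^sub>R V (- b) = L.phi z 0 *\<^sub>R U a"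
      using rep(1)[of 0] rep(2)[of 0] UV interval by simp
    have "V (- b) = (1 / R.phi z 0) *\<^sub>R (R.phi z 0 *\<^sub>R V (- b))" using Q by simp
    then have Vb: "V (- b) = s *\<^sub>R U a" unfolding ends by (simp add: s_def)
    have "u = pair_scale (U a) e"
    proof (rule supported_eqI)
      show "fst u x = fst (pair_scale (U a) e) x" if "x \<in> {a..0}" for x
        using rep(1)[OF that] that by (simp add: pair_scale_def e_def cut_def scaleR_conv_of_real mult.commute)
      show "snd u (- x) = snd (pair_scale (U a) e) (- x)" if "x \<in> {-b..0}" for x
        using rep(2)[OF _ that] UV(5) that Vb
        by (simp add: pair_scale_def e_def cut_def scaleR_conv_of_real mult_ac)
    qed (use u in \<open>auto simp: e_def intro!: supported_scale supported_cut\<close>)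
    then show "u \<in> vs.span {e}" by (auto simp: vs.span_singleton)
  qed
  moreover have "e \<noteq> 0" unfolding e_def by (rule fst_cut_nonzero[OF L.phi_nonzero]) simp
  ultimately show ?thesis
    unfolding algebraic_multiplicity_def using e_root
    by (intro vs.dim_unique[of "{e}"]) auto
qed

text \<open>
  The eigenfunction is \<open>e1 = (0, \<phi>\<^sub>R)\<close>, and \<open>e2 = (\<phi>\<^sub>L, s y)\<close> is adjoined to a multiple of it, where \<open>y\<close> is a
  forced solution on the right; by \<open>resonance_value\<close> it does not vanish at \<open>0\<close>, so a multiple of it
  continues \<open>\<phi>\<^sub>L\<close>. The chain stops here, as \<open>resonance_flux\<close> excludes a forcing with a left
  component.
\<close>

lemma multiplicity_both:
  assumes P: "L.Phi z 0 = 0" and Q: "R.phi z 0 = 0"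
  shows "algebraic_multiplicity a b limit_op (complex_of_real z) = 2"
proof -
  obtain y Y where y: "sl_flow (\<lambda>x. \<kappa> (- x)) (\<lambda>x. \<rho> (- x)) (- b) 0 y Y (\<lambda>x. z * y x + R.phi z x)"
    "y (- b) = 0" "Y (- b) = 0"
    using R.particular_solution[OF R.phi_cont(1), of z z] by metis
  have y0: "y 0 \<noteq> 0"
  proof
    assume "y 0 = 0"
    then have "(1::real) = 0"
      using y Q by (intro R.resonance_value[of y Y z 1]) auto
    then show False by simp
  qed
  define s where "s = L.phi z 0 / y 0"
  define e1 where "e1 = cut (\<lambda>x. 0) (R.phi z)"
  define e2 where "e2 = cut (L.phi z) (\<lambda>x. s * y x)"
  have fs: "sl_flow (\<lambda>x. \<kappa> (- x)) (\<lambda>x. \<rho> (- x)) (- b) 0 (\<lambda>x. s * y x) (\<lambda>x. s * Y x) (\<lambda>x. z * (s * y x) + s * R.phi z x)"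
    using sl_flow_scaleR[OF y(1), of s] by (simp add: algebra_simps)
  have e1: "limit_op e1 (pair_scale (complex_of_real z) e1 + 0)"
    unfolding e1_def cut_zero[symmetric]
    by (rule cut_limit_op[where U="\<lambda>x. 0" and V="R.Phi z"]) (use R.phi_flow[of z] sl_flow_zero Q in auto)
  then have e1_root: "e1 \<in> (\<Union>n. root_space a b limit_op (complex_of_real z) n)"
    by (intro root_space_1) (auto simp: e1_def supported_cut)
  have e2: "limit_op e2 (pair_scale (complex_of_real z) e2 + cut (\<lambda>x. 0) (\<lambda>x. s * R.phi z x))"
    unfolding e2_def
  proof (rule cut_limit_op[OF _ fs, where U="L.Phi z"])
    show "sl_flow k r a 0 (L.phi z) (L.Phi z) (\<lambda>x. z * L.phi z x + 0)"
      using L.phi_flow[of z] by simp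
  qed (use P Q y y0 R.phi_cont in \<open>auto simp: s_def intro!: continuous_intros\<close>)
  have "limit_op (cut (\<lambda>x. 0) (\<lambda>x. s * R.phi z x)) (pair_scale (complex_of_real z) (cut (\<lambda>x. 0) (\<lambda>x. s * R.phi z x)) + 0)"
    unfolding cut_zero[symmetric]
    by (rule cut_limit_op[where U="\<lambda>x. 0" and V="\<lambda>x. s * R.Phi z x"])
      (use sl_flow_scaleR[OF R.phi_flow[of z], of s] sl_flow_zero Q in \<open>auto simp: mult_ac\<close>)
  then have e2_root: "e2 \<in> (\<Union>n. root_space a b limit_op (complex_of_real z) n)"
    using e2 by (intro root_space_2) (auto simp: e2_def supported_cut)
  have span: "\<exists>c d. f = pair_scale c e2 + pair_scale d e1" if "f \<in> vs.span {e2, e1}" for f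
    using that by (simp add: vs.span_insert vs.span_singleton) (metis add_diff_cancel_left' diff_add_cancel add.commute)
  have cont: "continuous_on {a..0} (fst f) \<and> continuous_on {0..b} (snd f)" if "f \<in> vs.span {e2, e1}" for f
  proof -
    obtain c d where f: "f = pair_scale c e2 + pair_scale d e1" using span[OF \<open>f \<in> _\<close>] by blast
    have cy: "continuous_on {-b..0} (\<lambda>x. s * y x)" using y(1) by (auto simp: sl_flow_def intro!: continuous_intros)
    show ?thesis
      using cut_continuous[OF L.phi_cont(1) cy] cut_continuous[OF continuous_on_const[of _ 0] R.phi_cont(1)]
      by (auto simp: f pair_scale_def e1_def e2_def plus_fun_def intro!: continuous_intros)
  qed
  have "(\<Union>n. root_space a b limit_op (complex_of_real z) n) \<subseteq> vs.span {e2, e1}"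
  proof (rule root_space_subset[OF vs.span_zero cont])
    fix f u assume f: "f \<in> vs.span {e2, e1}" and u: "supported u" and A: "limit_op u (pair_scale (complex_of_real z) u + f)"
    obtain c d where f': "f = pair_scale c e2 + pair_scale d e1" using span[OF f] by blast
    obtain U V where UV: "sl_flow k r a 0 (fst u) U (\<lambda>x. z *\<^sub>R fst u x + fst f x)"
      "sl_flow (\<lambda>x. \<kappa> (- x)) (\<lambda>x. \<rho> (- x)) (- b) 0 (\<lambda>x. snd u (- x)) V (\<lambda>x. z *\<^sub>R snd u (- x) + snd f (- x))"
      "fst u a = 0" "U 0 = 0" "snd u b = 0" "fst u 0 = snd u 0"
      by (rule limit_op_flows[OF A conjunct1[OF cont[OF f]] conjunct2[OF cont[OF f]]]) (rule that)
    have U: "sl_flow k r a 0 (fst u) U (\<lambda>x. z *\<^sub>R fst u x + L.phi z x *\<^sub>R c)"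
      by (rule sl_flow_cong[OF UV(1)]) (auto simp: f' e1_def e2_def cut_def pair_scale_def scaleR_conv_of_real mult.commute)
    have c0: "c = 0" by (rule L.resonance_flux[OF U]) (use UV P in auto)
    have U': "sl_flow k r a 0 (fst u) U (\<lambda>x. z *\<^sub>R fst u x)" using U c0 by simp
    note repL = L.flow_unique(1)[OF U' UV(3)]
    let ?y = "\<lambda>x. snd u (- x) - (s * y x) *\<^sub>R U a"
    have V: "sl_flow (\<lambda>x. \<kappa> (- x)) (\<lambda>x. \<rho> (- x)) (- b) 0 ?y (\<lambda>x. V x - (s * Y x) *\<^sub>R U a)
        (\<lambda>x. z *\<^sub>R ?y x + R.phi z x *\<^sub>R (d - s *\<^sub>R U a))"
      by (rule sl_flow_cong[OF sl_flow_diff[OF UV(2) sl_flow_scaleR_left[OF fs, of "U a"]]])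
        (auto simp: f' c0 e1_def e2_def cut_def pair_scale_def scaleR_conv_of_real algebra_simps)
    \<comment> \<open>\<open>u\<close> and the multiple of \<open>y\<close> continue the same function on the left.\<close>
    have y0': "?y 0 = 0" using repL[of 0] UV(6) interval y0 by (simp add: s_def)
    have yb: "?y (- b) = 0" using UV(5) y by simp
    have "d - s *\<^sub>R U a = 0" by (rule R.resonance_value[OF V yb Q y0'])
    then have V': "sl_flow (\<lambda>x. \<kappa> (- x)) (\<lambda>x. \<rho> (- x)) (- b) 0 ?y (\<lambda>x. V x - (s * Y x) *\<^sub>R U a) (\<lambda>x. z *\<^sub>R ?y x)"
      using V by simp
    note repR = R.flow_unique(1)[OF V' yb]
    have "u = pair_scale (U a) e2 + pair_scale (V (- b)) e1"
    proof (rule supported_eqI)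
      show "fst u x = fst (pair_scale (U a) e2 + pair_scale (V (- b)) e1) x" if "x \<in> {a..0}" for x
        using repL[OF that] that by (simp add: pair_scale_def e1_def e2_def cut_def scaleR_conv_of_real mult.commute)
      show "snd u (- x) = snd (pair_scale (U a) e2 + pair_scale (V (- b)) e1) (- x)" if "x \<in> {-b..0}" for x
        using repR[OF that] y(3) that
        by (simp add: pair_scale_def e1_def e2_def cut_def scaleR_conv_of_real algebra_simps)
    qed (use u in \<open>auto simp: e1_def e2_def intro!: supported_add supported_scale supported_cut\<close>)
    moreover have "e2 \<in> vs.span {e2, e1}" "e1 \<in> vs.span {e2, e1}"
      by (rule vs.span_base, simp)+
    ultimately show "u \<in> vs.span {e2, e1}"
      by (simp only: vs.span_add vs.span_scale)
  qed
  moreover have "e1 \<noteq> 0" unfolding e1_def by (rule cut_nonzero[OF R.phi_nonzero])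
  moreover have "e2 \<notin> vs.span {e1}"
  proof
    assume "e2 \<in> vs.span {e1}"
    then obtain c where "e2 = pair_scale c e1" by (auto simp: vs.span_singleton)
    moreover have "e2 \<noteq> pair_scale c e1" unfolding e2_def
      by (rule fst_cut_nonzero[OF L.phi_nonzero]) (auto simp: e1_def cut_def pair_scale_def fun_eq_iff)
    ultimately show False by simp
  qed
  moreover from this have "e2 \<noteq> e1" using vs.span_base[of e1 "{e1}"] by auto
  ultimately show ?thesis
    unfolding algebraic_multiplicity_def using e1_root e2_root
    by (intro vs.dim_unique[of "{e2, e1}"]) (auto simp: vs.independent_insert)
qed

lemma multiplicity:
  "algebraic_multiplicity a b limit_op (complex_of_real z) =
     (if L.Phi z 0 = 0 then 1 else 0) + (if R.phi z 0 = 0 then 1 else 0)"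
  using multiplicity_none multiplicity_left_only multiplicity_right_only multiplicity_both by auto

end

section \<open>Location of the two split eigenvalues\<close>

context two_legs
begin

abbreviation limit_char :: "real \<Rightarrow> real" where "limit_char z \<equiv> L.Phi z 0 * R.phi z 0"
abbreviation coupling :: "real \<Rightarrow> real" where "coupling z \<equiv> R.Phi z 0 * L.phi z 0"

lemma limit_char_C2: "C2_fun limit_char" and coupling_C2: "C2_fun coupling"
  by (intro C2_fun_mult L.phi_end_C2 L.Phi_end_C2 R.phi_end_C2 R.Phi_end_C2)+

text \<open>
  The second derivative of \<open>\<Phi>\<^sub>L \<phi>\<^sub>R\<close> at a common zero is \<open>2 \<Phi>\<^sub>L' \<phi>\<^sub>R'\<close>, and its product with \<open>\<Phi>\<^sub>R \<phi>\<^sub>L\<close> is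
  negative by the two sign lemmas.
\<close>

lemma split_at_double_zero:
  assumes P: "L.Phi m 0 = 0" and Q: "R.phi m 0 = 0"
  shows "splits_at limit_char coupling m"
proof (rule double_zero_split[OF limit_char_C2 coupling_C2])
  let ?P' = "deriv (\<lambda>z. L.Phi z 0) m" and ?Q' = "deriv (\<lambda>z. R.phi z 0) m"
  note d = C2_fun_mult(2,3)[OF L.Phi_end_C2 R.phi_end_C2, of m]
  show "deriv limit_char m = 0" using d(1) P Q by simp
  have "(?P' * L.phi m 0) * (?Q' * R.Phi m 0) < 0"
    by (rule mult_neg_pos[OF L.Phi_zero_simple[OF P] R.phi_zero_simple[OF Q]])
  then show "deriv (deriv limit_char) m * coupling m < 0"
    unfolding d(2) P Q by (simp add: algebra_simps)
qed (use P in simp)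

lemma zero_count_char_fun:
  assumes "limit_char z = 0"
  shows "zero_count limit_char coupling z ((if L.Phi z 0 = 0 then 1 else 0) + (if R.phi z 0 = 0 then 1 else 0))"
proof (cases "L.Phi z 0 = 0 \<and> R.phi z 0 = 0")
  case True
  obtain \<delta>0 C c where d: "0 < \<delta>0" "\<forall>\<delta>. 0 < \<delta> \<and> \<delta> \<le> \<delta>0 \<longrightarrow>
     (\<forall>\<^sub>F \<epsilon> in at_right 0. \<exists>z1 z2. split_pair limit_char coupling z \<delta> C c \<epsilon> z1 z2)"
    using split_at_double_zero[of z] True unfolding splits_at_def by blast
  have "\<forall>\<^sub>F \<epsilon> in at_right 0. finite (zeros_near limit_char coupling \<epsilon> z \<delta>) \<and> card (zeros_near limit_char coupling \<epsilon> z \<delta>) = 2"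
    if "0 < \<delta>" "\<delta> \<le> \<delta>0" for \<delta>
    using d(2)[rule_format, OF conjI[OF that]] by eventually_elim (auto simp: split_pair_def)
  then have "zero_count limit_char coupling z 2" using d(1) unfolding zero_count_def by blast
  then show ?thesis using True by (simp add: numeral_2_eq_2)
next
  case False
  have "deriv limit_char z \<noteq> 0"
    using C2_fun_mult(2)[OF L.Phi_end_C2 R.phi_end_C2, of z] L.Phi_zero_simple[of z] R.phi_zero_simple[of z] False assms
    by auto
  then have "zero_count limit_char coupling z 1" by (intro zero_count_simple limit_char_C2 coupling_C2 assms)
  then show ?thesis using False assms by auto
qed

lemma limit_zeros_finite: "finite {z \<in> {lo..hi}. limit_char z = 0}"
proof -
  have "finite {z \<in> {lo..hi}. L.Phi z 0 = 0}"
    by (rule simple_zeros_finite[OF C2_fun_deriv(1)[OF L.Phi_end_C2]]) (use L.Phi_zero_simple in force)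
  moreover have "finite {z \<in> {lo..hi}. R.phi z 0 = 0}"
    by (rule simple_zeros_finite[OF C2_fun_deriv(1)[OF R.phi_end_C2]]) (use R.phi_zero_simple in force)
  moreover have "{z \<in> {lo..hi}. limit_char z = 0} = {z \<in> {lo..hi}. L.Phi z 0 = 0} \<union> {z \<in> {lo..hi}. R.phi z 0 = 0}"
    by auto
  ultimately show ?thesis by simp
qed

text \<open>
  The indices below \<open>j\<close> are partitioned according to the value of \<open>\<mu>\<close>, and each class has as many elements
  as the algebraic multiplicity of that value.
\<close>

lemma limit_zeros_below_count:
  assumes \<mu>: "enumerates_limit_spectrum a b k r \<kappa> \<rho> \<mu>" and j: "1 \<le> j" "\<mu> j = m" "\<mu> (j + 1) = m"
    and P: "L.Phi m 0 = 0" and Q: "R.phi m 0 = 0"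
  shows "(\<Sum>z\<in>{z \<in> {0..m}. limit_char z = 0} - {m}. (if L.Phi z 0 = 0 then 1 else 0) + (if R.phi z 0 = 0 then 1 else 0)) = j - 1"
    (is "(\<Sum>z\<in>?Z. ?N z) = _")
proof -
  have mono: "mono_on {1..} \<mu>" using \<mu> by (simp add: enumerates_limit_spectrum_def)
  define I where "I z = {n \<in> {1..}. \<mu> n = z}" for z
  have I: "finite (I z)" "card (I z) = ?N z" for z
    using \<mu> multiplicity[of z] unfolding enumerates_limit_spectrum_def I_def
    by (auto dest!: spec[of _ "complex_of_real z"])
  have Im: "I m = {j, j + 1}"
  proof -
    have "{j, j + 1} \<subseteq> I m" using j by (auto simp: I_def)
    moreover have "card (I m) = card {j, j + 1}" using I(2)[of m] P Q by simp
    ultimately show ?thesis using card_subset_eq[OF I(1)] by metis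
  qed
  have "{1..<j} = (\<Union>z\<in>?Z. I z)"
  proof (intro set_eqI iffI)
    fix n assume n: "n \<in> {1..<j}"
    have "\<mu> n \<le> m" using mono_onD[OF mono, of n j] n j by auto
    moreover have "\<mu> n \<noteq> m"
    proof
      assume "\<mu> n = m"
      then have "n \<in> I m" using n by (auto simp: I_def)
      then show False using n by (auto simp: Im)
    qed
    moreover have nI: "n \<in> I (\<mu> n)" using n by (auto simp: I_def)
    then have "?N (\<mu> n) \<noteq> 0" using I[of "\<mu> n"] by (metis card_0_eq empty_iff)
    then have "limit_char (\<mu> n) = 0" by (auto split: if_splits)
    moreover from this have "0 < \<mu> n" by (intro char_fun_positive_zeros[of 0]) (auto simp: char_fun_def)
    ultimately show "n \<in> (\<Union>z\<in>?Z. I z)" using nI by (intro UN_I[of "\<mu> n"]) auto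
  next
    fix n assume "n \<in> (\<Union>z\<in>?Z. I z)"
    then obtain z where z: "z \<le> m" "z \<noteq> m" "1 \<le> n" "\<mu> n = z" by (auto simp: I_def)
    have "\<not> j \<le> n" using mono_onD[OF mono, of j n] z j by force
    then show "n \<in> {1..<j}" using z by simp
  qed
  moreover have "card (\<Union>z\<in>?Z. I z) = (\<Sum>z\<in>?Z. card (I z))"
    by (rule card_UN_disjoint) (use limit_zeros_finite I in \<open>auto simp: I_def\<close>)
  ultimately show ?thesis using I(2) by (metis (no_types, lifting) card_atLeastLessThan sum.cong)
qed

text \<open>
  The eigenvalues divided by \<open>\<epsilon>\<close> are exactly the zeros of the characteristic function. Those below
  \<open>m - \<delta>\<close> are as many as the limit eigenvalues below \<open>m\<close>, hence \<open>j - 1\<close>, and the next two are the split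
  pair.
\<close>

lemma double_eigenvalue_splits:
  fixes u :: "real \<Rightarrow> nat \<Rightarrow> real \<Rightarrow> real"
  assumes lam: "\<And>\<epsilon>. \<epsilon> > 0 \<Longrightarrow> enumerates_perturbed_spectrum a b k r \<kappa> \<rho> \<epsilon> (lam \<epsilon>)"
    and u: "\<And>\<epsilon> n. \<epsilon> > 0 \<Longrightarrow> n \<ge> 1 \<Longrightarrow> perturbed_eigenfunction a b k r \<kappa> \<rho> \<epsilon> (lam \<epsilon> n) (u \<epsilon> n)"
      "\<And>\<epsilon> n. \<epsilon> > 0 \<Longrightarrow> n \<ge> 1 \<Longrightarrow> dI 0 b (u \<epsilon> n) b > 0"
    and \<mu>: "enumerates_limit_spectrum a b k r \<kappa> \<rho> \<mu>" and j: "1 \<le> j" "\<mu> j = m" "\<mu> (j + 1) = m"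
    and P: "L.Phi m 0 = 0" and Q: "R.phi m 0 = 0"
  shows "\<exists>\<delta>>0. \<exists>C>0. \<exists>c>0. \<forall>\<^sub>F \<epsilon> in at_right 0.
       \<bar>lam \<epsilon> j / \<epsilon> - m\<bar> \<le> C * sqrt \<epsilon> \<and> \<bar>lam \<epsilon> (j + 1) / \<epsilon> - m\<bar> \<le> C * sqrt \<epsilon> \<and>
       (\<forall>t\<in>{m - \<delta>..m}. c * sqrt \<epsilon> * \<bar>t - lam \<epsilon> j / \<epsilon>\<bar> \<le> \<bar>char_fun \<epsilon> t\<bar>) \<and>
       (\<forall>t\<in>{m..m + \<delta>}. c * sqrt \<epsilon> * \<bar>t - lam \<epsilon> (j + 1) / \<epsilon>\<bar> \<le> \<bar>char_fun \<epsilon> t\<bar>)"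
proof -
  let ?Z = "{z \<in> {0..m}. limit_char z = 0}"
  let ?N = "\<lambda>z. (if L.Phi z 0 = 0 then 1 else 0) + (if R.phi z 0 = 0 then 1 else (0::nat))"
  have pos0: "0 < z" if "limit_char z = 0" for z
    by (rule char_fun_positive_zeros[of 0]) (use that in \<open>auto simp: char_fun_def\<close>)
  obtain \<delta>1 C c where D: "0 < \<delta>1" "0 < C" "0 < c" "\<forall>\<delta>. 0 < \<delta> \<and> \<delta> \<le> \<delta>1 \<longrightarrow>
     (\<forall>\<^sub>F \<epsilon> in at_right 0. \<exists>z1 z2. split_pair limit_char coupling m \<delta> C c \<epsilon> z1 z2)"
    using split_at_double_zero[OF P Q] unfolding splits_at_def by blast
  have cont: "continuous_on UNIV limit_char" "continuous_on UNIV coupling"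
    using C2_fun_deriv(4)[OF limit_char_C2] C2_fun_deriv(4)[OF coupling_C2] by (auto intro: continuous_at_imp_continuous_on)
  have "m \<in> ?Z" using P pos0[of m] by auto
  moreover have "0 \<notin> ?Z" using pos0[of 0] by auto
  ultimately obtain \<delta>2 where E: "0 < \<delta>2" "\<forall>\<delta>. 0 < \<delta> \<and> \<delta> \<le> \<delta>2 \<longrightarrow> (\<forall>\<^sub>F \<epsilon> in at_right 0.
    finite {t \<in> {0..<m - \<delta>}. limit_char t + \<epsilon> * coupling t = 0} \<and>
    card {t \<in> {0..<m - \<delta>}. limit_char t + \<epsilon> * coupling t = 0} = (\<Sum>z\<in>?Z - {m}. ?N z))"
    using zero_count_below[OF cont refl limit_zeros_finite, of m 0 ?N] zero_count_char_fun by auto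
  define \<delta> where "\<delta> = min \<delta>1 \<delta>2"
  have \<delta>: "0 < \<delta>" "\<delta> \<le> \<delta>1" "\<delta> \<le> \<delta>2" using D E by (auto simp: \<delta>_def)
  have "\<forall>\<^sub>F \<epsilon> in at_right (0::real). 0 < \<epsilon>" by (rule eventually_at_right_less)
  with D(4)[rule_format, OF conjI[OF \<delta>(1,2)]] E(2)[rule_format, OF conjI[OF \<delta>(1,3)]]
  have "\<forall>\<^sub>F \<epsilon> in at_right 0.
       \<bar>lam \<epsilon> j / \<epsilon> - m\<bar> \<le> C * sqrt \<epsilon> \<and> \<bar>lam \<epsilon> (j + 1) / \<epsilon> - m\<bar> \<le> C * sqrt \<epsilon> \<and>
       (\<forall>t\<in>{m - \<delta>..m}. c * sqrt \<epsilon> * \<bar>t - lam \<epsilon> j / \<epsilon>\<bar> \<le> \<bar>char_fun \<epsilon> t\<bar>) \<and>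
       (\<forall>t\<in>{m..m + \<delta>}. c * sqrt \<epsilon> * \<bar>t - lam \<epsilon> (j + 1) / \<epsilon>\<bar> \<le> \<bar>char_fun \<epsilon> t\<bar>)"
  proof eventually_elim
    case (elim \<epsilon>)
    then obtain z1 z2 where z: "m - \<delta> < z1" "z1 < m" "m < z2" "z2 < m + \<delta>" "zeros_near limit_char coupling \<epsilon> m \<delta> = {z1, z2}"
       "\<bar>z1 - m\<bar> \<le> C * sqrt \<epsilon>" "\<bar>z2 - m\<bar> \<le> C * sqrt \<epsilon>"
       "\<forall>t\<in>{m - \<delta>..m}. c * sqrt \<epsilon> * \<bar>t - z1\<bar> \<le> \<bar>limit_char t + \<epsilon> * coupling t\<bar>"
       "\<forall>t\<in>{m..m + \<delta>}. c * sqrt \<epsilon> * \<bar>t - z2\<bar> \<le> \<bar>limit_char t + \<epsilon> * coupling t\<bar>" unfolding split_pair_def by blast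
    have F: "char_fun \<epsilon> t = limit_char t + \<epsilon> * coupling t" for t by (simp add: char_fun_def)
    have \<epsilon>: "0 < \<epsilon>" by (rule elim)
    note enum = lam[OF \<epsilon>, unfolded enumerates_perturbed_spectrum_def]
    define l where "l n = lam \<epsilon> n / \<epsilon>" for n
    have lmono: "strict_mono_on {1..} l"
      using enum \<epsilon> by (auto simp: strict_mono_on_def l_def divide_strict_right_mono)
    have range: "l ` {1..} = {t. char_fun \<epsilon> t = 0}"
    proof (intro set_eqI iffI)
      fix t assume "t \<in> l ` {1..}"
      then obtain n where n: "1 \<le> n" "t = lam \<epsilon> n / \<epsilon>" by (auto simp: l_def)
      have "- (\<kappa> b * dI 0 b (u \<epsilon> n) b) \<noteq> 0"
        using u(2)[OF \<epsilon> n(1)] positive(3)[of b] interval by auto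
      then show "t \<in> {t. char_fun \<epsilon> t = 0}"
        using perturbed_eigenfunction_legs(5)[OF u(1)[OF \<epsilon> n(1)] \<epsilon>] n by simp
    next
      fix t assume "t \<in> {t. char_fun \<epsilon> t = 0}"
      then have "complex_of_real (\<epsilon> * t) \<in> (\<lambda>n. complex_of_real (lam \<epsilon> n)) ` {1..}"
        using char_fun_zero_eigenvalue[of \<epsilon> t] \<epsilon> enum by simp
      then obtain n where "1 \<le> n" "\<epsilon> * t = lam \<epsilon> n" by (auto simp del: of_real_mult)
      then show "t \<in> l ` {1..}" using \<epsilon> by (intro image_eqI[of _ _ n]) (auto simp: l_def field_simps)
    qed
    have below: "{x \<in> l ` {1..}. x < m - \<delta>} = {t \<in> {0..<m - \<delta>}. limit_char t + \<epsilon> * coupling t = 0}"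
      unfolding range F[symmetric] using char_fun_positive_zeros[of \<epsilon>] \<epsilon> by (auto simp: less_imp_le)
    have mid: "{x \<in> l ` {1..}. m - \<delta> \<le> x \<and> x \<le> m + \<delta>} = {z1, z2}"
      unfolding range z(5)[symmetric] zeros_near_def F by auto
    have "l j = z1" "l (j + 1) = z2"
    proof (rule_tac [!] enumeration_index[OF lmono j(1) _ _ mid])
      show "finite {x \<in> l ` {1..}. x < m - \<delta>}" "finite {x \<in> l ` {1..}. x < m - \<delta>}"
        "card {x \<in> l ` {1..}. x < m - \<delta>} = j - 1" "card {x \<in> l ` {1..}. x < m - \<delta>} = j - 1"
        using elim limit_zeros_below_count[OF \<mu> j P Q] unfolding below by auto
    qed (use z in auto)
    then show ?case using z unfolding F by (simp add: l_def)
  qed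
  then show ?thesis using \<delta> D by blast
qed

end

section \<open>Formal series, quasi-modes and the expansion of the eigenvalues\<close>

lemma convolution_reindex:
  fixes f :: "nat \<Rightarrow> nat \<Rightarrow> real"
  shows "(\<Sum>i\<le>N. \<Sum>l=1..i. f l (i - l)) = (\<Sum>(l, i)\<in>{(l, i) \<in> {1..N} \<times> {..N}. l + i \<le> N}. f l i)"
proof -
  have "(\<Sum>i\<le>N. \<Sum>l=1..i. f l (i - l)) = (\<Sum>(i, l)\<in>(SIGMA i:{..N}. {1..i}). f l (i - l))"
    by (subst sum.Sigma) auto
  also have "\<dots> = (\<Sum>(l, i)\<in>{(l, i) \<in> {1..N} \<times> {..N}. l + i \<le> N}. f l i)"
    by (rule sum.reindex_bij_witness[where j="\<lambda>(i, l). (l, i - l)" and i="\<lambda>(l, i). (i + l, l)"]) auto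
  finally show ?thesis .
qed

text \<open>
  In the product of the two truncated series only the terms of total order above \<open>N\<close> fail to match the
  convolution sums.
\<close>

lemma truncated_product_error:
  fixes y :: "nat \<Rightarrow> real" and \<nu> :: "nat \<Rightarrow> real" and t m :: real
  assumes t: "\<bar>t\<bar> \<le> 1"
  shows "\<bar>(\<Sum>i\<le>N. t ^ i * (m * y i + (\<Sum>l=1..i. \<nu> l * y (i - l)))) - (m + (\<Sum>l=1..N. t ^ l * \<nu> l)) * (\<Sum>i\<le>N. t ^ i * y i)\<bar>
    \<le> (\<Sum>l=1..N. \<bar>\<nu> l\<bar>) * (\<Sum>i\<le>N. \<bar>y i\<bar>) * \<bar>t\<bar> ^ (N + 1)"
proof -
  let ?a = "\<lambda>l i. t ^ (l + i) * (\<nu> l * y i)"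
  let ?A = "{1..N} \<times> {..N}"
  let ?B = "{(l, i) \<in> ?A. l + i \<le> N}"
  have "(\<Sum>i\<le>N. t ^ i * (m * y i + (\<Sum>l=1..i. \<nu> l * y (i - l)))) =
      m * (\<Sum>i\<le>N. t ^ i * y i) + (\<Sum>i\<le>N. \<Sum>l=1..i. t ^ i * (\<nu> l * y (i - l)))"
    by (simp add: distrib_left sum.distrib sum_distrib_left mult_ac)
  also have "(\<Sum>i\<le>N. \<Sum>l=1..i. t ^ i * (\<nu> l * y (i - l))) = (\<Sum>i\<le>N. \<Sum>l=1..i. ?a l (i - l))"
    by (intro sum.cong refl) auto
  also have "\<dots> = (\<Sum>(l, i)\<in>?B. ?a l i)" by (rule convolution_reindex)
  finally have 1: "(\<Sum>i\<le>N. t ^ i * (m * y i + (\<Sum>l=1..i. \<nu> l * y (i - l)))) =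
      m * (\<Sum>i\<le>N. t ^ i * y i) + (\<Sum>(l, i)\<in>?B. ?a l i)" .
  have 2: "(\<Sum>l=1..N. t ^ l * \<nu> l) * (\<Sum>i\<le>N. t ^ i * y i) = (\<Sum>(l, i)\<in>?A. ?a l i)"
    unfolding sum_product sum.cartesian_product by (intro sum.cong refl) (auto simp: power_add)
  have 3: "(\<Sum>(l, i)\<in>?A. ?a l i) = (\<Sum>(l, i)\<in>?B. ?a l i) + (\<Sum>(l, i)\<in>?A - ?B. ?a l i)"
    by (subst sum.subset_diff[of ?B ?A]) auto
  have "\<bar>\<Sum>(l, i)\<in>?A - ?B. ?a l i\<bar> \<le> (\<Sum>(l, i)\<in>?A - ?B. \<bar>t\<bar> ^ (N + 1) * (\<bar>\<nu> l\<bar> * \<bar>y i\<bar>))"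
  proof (rule sum_norm_le[of _ "\<lambda>(l, i). ?a l i", unfolded real_norm_def])
    fix x assume x: "x \<in> ?A - ?B"
    obtain l i where li: "x = (l, i)" by force
    then have "N + 1 \<le> l + i" using x by auto
    then have "\<bar>t\<bar> ^ (l + i) \<le> \<bar>t\<bar> ^ (N + 1)" using t by (intro power_decreasing) auto
    then show "\<bar>case x of (l, i) \<Rightarrow> ?a l i\<bar> \<le> (case x of (l, i) \<Rightarrow> \<bar>t\<bar> ^ (N + 1) * (\<bar>\<nu> l\<bar> * \<bar>y i\<bar>))"
      unfolding li prod.case abs_mult power_abs by (intro mult_right_mono) auto
  qed
  also have "\<dots> \<le> (\<Sum>(l, i)\<in>?A. \<bar>t\<bar> ^ (N + 1) * (\<bar>\<nu> l\<bar> * \<bar>y i\<bar>))"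
    by (rule sum_mono2) (auto intro!: mult_nonneg_nonneg)
  also have "\<dots> = (\<Sum>(l, i)\<in>?A. \<bar>\<nu> l\<bar> * \<bar>y i\<bar>) * \<bar>t\<bar> ^ (N + 1)"
    unfolding sum_distrib_right by (intro sum.cong refl) (auto simp: mult_ac)
  also have "(\<Sum>(l, i)\<in>?A. \<bar>\<nu> l\<bar> * \<bar>y i\<bar>) = (\<Sum>l=1..N. \<bar>\<nu> l\<bar>) * (\<Sum>i\<le>N. \<bar>y i\<bar>)"
    unfolding sum_product sum.cartesian_product ..
  finally have "\<bar>\<Sum>(l, i)\<in>?A - ?B. ?a l i\<bar> \<le> (\<Sum>l=1..N. \<bar>\<nu> l\<bar>) * (\<Sum>i\<le>N. \<bar>y i\<bar>) * \<bar>t\<bar> ^ (N + 1)" .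
  then show ?thesis unfolding 1 distrib_right 2 3 by simp
qed

lemma abs_power_sum_le:
  fixes t :: real
  assumes "\<bar>t\<bar> \<le> 1"
  shows "\<bar>\<Sum>i\<in>I. t ^ i * f i\<bar> \<le> (\<Sum>i\<in>I. \<bar>f i\<bar>)"
proof -
  have "\<bar>\<Sum>i\<in>I. t ^ i * f i\<bar> \<le> (\<Sum>i\<in>I. \<bar>t ^ i * f i\<bar>)" by (rule sum_abs)
  also have "\<dots> \<le> (\<Sum>i\<in>I. \<bar>f i\<bar>)"
    using assms by (intro sum_mono) (auto simp: abs_mult power_abs intro!: mult_left_le_one_le power_le_one)
  finally show ?thesis .
qed

context leg
begin

text \<open>
  The truncated series solves the equation with the truncated eigenvalue up to the error of
  \<open>truncated_product_error\<close>; \<open>flow_representation\<close> then compares it with the fundamental solution.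
\<close>

lemma formal_series_error:
  fixes y Y :: "nat \<Rightarrow> real \<Rightarrow> real" and \<nu> :: "nat \<Rightarrow> real"
  assumes f: "\<And>i. sl_flow p q c 0 (y i) (Y i) (\<lambda>x. m * y i x + (\<Sum>l=1..i. \<nu> l * y (i - l) x))"
    and yc: "\<And>i. y i c = 0"
  shows "\<exists>C\<ge>0. \<forall>t. \<bar>t\<bar> \<le> 1 \<longrightarrow> (\<forall>x\<in>{c..0}.
     \<bar>(\<Sum>i\<le>N. t ^ i * y i x) - (\<Sum>i\<le>N. t ^ i * Y i c) * phi (m + (\<Sum>l=1..N. t ^ l * \<nu> l)) x\<bar> \<le> C * \<bar>t\<bar> ^ (N + 1) \<and>
     \<bar>(\<Sum>i\<le>N. t ^ i * Y i x) - (\<Sum>i\<le>N. t ^ i * Y i c) * Phi (m + (\<Sum>l=1..N. t ^ l * \<nu> l)) x\<bar> \<le> C * \<bar>t\<bar> ^ (N + 1))"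
proof -
  define M where "M = \<bar>m\<bar> + (\<Sum>l=1..N. \<bar>\<nu> l\<bar>)"
  define C where "C = growth M"
  have C: "0 \<le> C" by (simp add: C_def less_imp_le growth_pos)
  have "\<exists>B. \<forall>i. \<forall>x\<in>{c..0}. \<bar>y i x\<bar> \<le> B i"
  proof (intro choice allI)
    fix i
    have "bounded (y i ` {c..0})"
      using f[of i] by (auto intro!: compact_imp_bounded compact_continuous_image simp: sl_flow_def)
    then show "\<exists>B. \<forall>x\<in>{c..0}. \<bar>y i x\<bar> \<le> B" by (auto simp: bounded_iff)
  qed
  then obtain B where B: "\<And>i x. x \<in> {c..0} \<Longrightarrow> \<bar>y i x\<bar> \<le> B i" by blast
  define D where "D = (\<Sum>l=1..N. \<bar>\<nu> l\<bar>) * (\<Sum>i\<le>N. B i)"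
  have B0: "0 \<le> B i" for i using B[of c i] c by auto
  have D: "0 \<le> D" unfolding D_def using B0 by (intro mult_nonneg_nonneg sum_nonneg) auto
  show ?thesis
  proof (intro exI[of _ "C * D"] conjI allI impI)
    show "0 \<le> C * D" using C D by simp
    fix t :: real assume t: "\<bar>t\<bar> \<le> 1"
    define z where "z = m + (\<Sum>l=1..N. t ^ l * \<nu> l)"
    have z: "\<bar>z\<bar> \<le> M" using abs_power_sum_le[OF t, of \<nu> "{1..N}"] by (simp add: z_def M_def)
    define g where "g x = (\<Sum>i\<le>N. t ^ i * (m * y i x + (\<Sum>l=1..i. \<nu> l * y (i - l) x))) - z * (\<Sum>i\<le>N. t ^ i * y i x)" for x
    have g: "norm (g x) \<le> D * \<bar>t\<bar> ^ (N + 1)" if x: "x \<in> {c<..<0}" for x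
    proof -
      have "\<bar>g x\<bar> \<le> (\<Sum>l=1..N. \<bar>\<nu> l\<bar>) * (\<Sum>i\<le>N. \<bar>y i x\<bar>) * \<bar>t\<bar> ^ (N + 1)"
        unfolding g_def z_def by (rule truncated_product_error[OF t])
      also have "\<dots> \<le> D * \<bar>t\<bar> ^ (N + 1)"
        unfolding D_def using B x by (intro mult_right_mono mult_left_mono sum_mono sum_nonneg) auto
      finally show ?thesis by simp
    qed
    have "sl_flow p q c 0 (\<lambda>x. \<Sum>i\<le>N. t ^ i * y i x) (\<lambda>x. \<Sum>i\<le>N. t ^ i * Y i x) (\<lambda>x. z *\<^sub>R (\<Sum>i\<le>N. t ^ i * y i x) + g x)"
      by (rule sl_flow_cong[OF sl_flow_sum[of "{..N}", OF sl_flow_scaleR[OF f, of "t ^ _"]]]) (auto simp: g_def)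
    from flow_representation[OF this _ z, of "D * \<bar>t\<bar> ^ (N + 1)"] g yc D
    show "\<forall>x\<in>{c..0}.
     \<bar>(\<Sum>i\<le>N. t ^ i * y i x) - (\<Sum>i\<le>N. t ^ i * Y i c) * phi (m + (\<Sum>l=1..N. t ^ l * \<nu> l)) x\<bar> \<le> C * D * \<bar>t\<bar> ^ (N + 1) \<and>
     \<bar>(\<Sum>i\<le>N. t ^ i * Y i x) - (\<Sum>i\<le>N. t ^ i * Y i c) * Phi (m + (\<Sum>l=1..N. t ^ l * \<nu> l)) x\<bar> \<le> C * D * \<bar>t\<bar> ^ (N + 1)"
      unfolding z_def[symmetric] C_def by (simp add: mult_ac)
  qed
qed

end

text \<open>
  The coefficients of the formal expansion near a common zero \<open>m\<close>, in terms of flows, with \<open>VY\<close> and \<open>WY\<close>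
  the fluxes of \<open>vs\<close> and \<open>ws\<close>. The convention \<open>ws 0 = 0\<close> gives the equations on the two legs the same
  form. Powers of \<open>t = \<plusminus>\<surd>\<epsilon>\<close> multiply the coefficients, so \<open>\<epsilon> = t\<^sup>2\<close> shifts the flux condition by two
  orders.
\<close>

locale expansion = two_legs +
  fixes m :: real and \<nu> :: "nat \<Rightarrow> real" and vs ws VY WY :: "nat \<Rightarrow> real \<Rightarrow> real"
  assumes P: "L.Phi m 0 = 0" and Q: "R.phi m 0 = 0"
    and vs_flow: "\<And>i. sl_flow \<kappa> \<rho> 0 b (vs i) (VY i) (\<lambda>x. m * vs i x + (\<Sum>l=1..i. \<nu> l * vs (i - l) x))"
    and ws_flow: "\<And>i. sl_flow k r a 0 (ws i) (WY i) (\<lambda>x. m * ws i x + (\<Sum>l=1..i. \<nu> l * ws (i - l) x))"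
    and vs_b: "\<And>i. vs i b = 0" and ws_a: "\<And>i. ws i a = 0"
    and match: "\<And>i. vs i 0 = ws i 0"
    and flux: "\<And>i. WY (i + 2) 0 = VY i 0" "WY 0 0 = 0" "WY 1 0 = 0"
    and ws_0: "\<And>x. x \<in> {a..0} \<Longrightarrow> ws 0 x = 0"
    and \<nu>1: "0 < \<nu> 1" and VY0: "0 < VY 0 b"
begin

text \<open>
  The truncated eigenvalue, and the fluxes of the truncated series at the outer end points, by which
  the fundamental solutions have to be multiplied. On the right the reflection changes the sign.
\<close>

definition eigenvalue_sum :: "nat \<Rightarrow> real \<Rightarrow> real" where "eigenvalue_sum N t = m + (\<Sum>l=1..N. t ^ l * \<nu> l)"
definition left_slope :: "nat \<Rightarrow> real \<Rightarrow> real" where "left_slope N t = (\<Sum>i\<le>N. t ^ i * WY i a)"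
definition right_slope :: "nat \<Rightarrow> real \<Rightarrow> real" where "right_slope N t = (\<Sum>i\<le>N. t ^ i * - VY i b)"

lemma left_series: "\<exists>C\<ge>0. \<forall>t. \<bar>t\<bar> \<le> 1 \<longrightarrow> (\<forall>x\<in>{a..0}.
     \<bar>(\<Sum>i\<le>N. t ^ i * ws i x) - left_slope N t * L.phi (eigenvalue_sum N t) x\<bar> \<le> C * \<bar>t\<bar> ^ (N + 1) \<and>
     \<bar>(\<Sum>i\<le>N. t ^ i * WY i x) - left_slope N t * L.Phi (eigenvalue_sum N t) x\<bar> \<le> C * \<bar>t\<bar> ^ (N + 1))"
  unfolding left_slope_def eigenvalue_sum_def by (rule L.formal_series_error[OF ws_flow ws_a])

lemma right_series: "\<exists>C\<ge>0. \<forall>t. \<bar>t\<bar> \<le> 1 \<longrightarrow> (\<forall>x\<in>{0..b}.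
     \<bar>(\<Sum>i\<le>N. t ^ i * vs i x) - right_slope N t * R.phi (eigenvalue_sum N t) (- x)\<bar> \<le> C * \<bar>t\<bar> ^ (N + 1) \<and>
     \<bar>- (\<Sum>i\<le>N. t ^ i * VY i x) - right_slope N t * R.Phi (eigenvalue_sum N t) (- x)\<bar> \<le> C * \<bar>t\<bar> ^ (N + 1))"
proof -
  have "sl_flow (\<lambda>x. \<kappa> (- x)) (\<lambda>x. \<rho> (- x)) (- b) 0 (\<lambda>x. vs i (- x)) (\<lambda>x. - VY i (- x))
      (\<lambda>x. m * vs i (- x) + (\<Sum>l=1..i. \<nu> l * vs (i - l) (- x)))" for i
    by (rule reflect_right[OF vs_flow])
  from R.formal_series_error[OF this, of N] vs_b
  obtain C where C: "0 \<le> C" "\<forall>t. \<bar>t\<bar> \<le> 1 \<longrightarrow> (\<forall>x\<in>{-b..0}.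
     \<bar>(\<Sum>i\<le>N. t ^ i * vs i (- x)) - right_slope N t * R.phi (eigenvalue_sum N t) x\<bar> \<le> C * \<bar>t\<bar> ^ (N + 1) \<and>
     \<bar>(\<Sum>i\<le>N. t ^ i * - VY i (- x)) - right_slope N t * R.Phi (eigenvalue_sum N t) x\<bar> \<le> C * \<bar>t\<bar> ^ (N + 1))"
    unfolding right_slope_def eigenvalue_sum_def by auto
  show ?thesis
  proof (intro exI[of _ C] conjI allI impI ballI)
    fix t :: real and x assume "\<bar>t\<bar> \<le> 1" "x \<in> {0..b}"
    then have "- x \<in> {-b..0}" "\<bar>t\<bar> \<le> 1" by auto
    from C(2)[rule_format, OF this(2,1)]
    show "\<bar>(\<Sum>i\<le>N. t ^ i * vs i x) - right_slope N t * R.phi (eigenvalue_sum N t) (- x)\<bar> \<le> C * \<bar>t\<bar> ^ (N + 1)"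
     "\<bar>- (\<Sum>i\<le>N. t ^ i * VY i x) - right_slope N t * R.Phi (eigenvalue_sum N t) (- x)\<bar> \<le> C * \<bar>t\<bar> ^ (N + 1)"
      by (simp_all add: sum_negf)
  qed (rule C)
qed

text \<open>
  Shifting the index by two shows that the flux condition holds exactly for the full series; truncation
  leaves two terms.
\<close>

lemma flux_defect:
  "(\<Sum>i\<le>N. t ^ i * WY i 0) - t\<^sup>2 * (\<Sum>i\<le>N. t ^ i * VY i 0) =
     - (t ^ (N + 1) * (WY (N + 1) 0 + t * WY (N + 2) 0))"
proof (induction N)
  case 0
  then show ?case using flux(1)[of 0] flux(2,3) by (simp add: power2_eq_square numeral_2_eq_2)
next
  case (Suc N)
  have "VY (Suc N) 0 = WY (Suc N + 2) 0" using flux(1)[of "Suc N"] by simp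
  then show ?case using Suc by (simp add: algebra_simps power2_eq_square)
qed

lemma eigenvalue_sum_bound: "\<bar>t\<bar> \<le> 1 \<Longrightarrow> \<bar>eigenvalue_sum N t\<bar> \<le> \<bar>m\<bar> + (\<Sum>l=1..N. \<bar>\<nu> l\<bar>)"
  using abs_power_sum_le[of t \<nu> "{1..N}"] by (simp add: eigenvalue_sum_def)

text \<open>
  Inserting the truncated series, which are multiples of the fundamental solutions up to
  \<open>O(t\<^sup>N\<^sup>+\<^sup>1)\<close>, into the matching conditions at \<open>0\<close> and eliminating the left multiple shows that the
  characteristic function is small at the truncated eigenvalue.
\<close>

lemma quasi_mode:
  "\<exists>C\<ge>0. \<forall>t. \<bar>t\<bar> \<le> 1 \<longrightarrow> \<bar>right_slope N t * char_fun (t\<^sup>2) (eigenvalue_sum N t)\<bar> \<le> C * \<bar>t\<bar> ^ (N + 1)"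
proof -
  obtain C1 where C1: "0 \<le> C1" "\<forall>t. \<bar>t\<bar> \<le> 1 \<longrightarrow> (\<forall>x\<in>{a..0}.
     \<bar>(\<Sum>i\<le>N. t ^ i * ws i x) - left_slope N t * L.phi (eigenvalue_sum N t) x\<bar> \<le> C1 * \<bar>t\<bar> ^ (N + 1) \<and>
     \<bar>(\<Sum>i\<le>N. t ^ i * WY i x) - left_slope N t * L.Phi (eigenvalue_sum N t) x\<bar> \<le> C1 * \<bar>t\<bar> ^ (N + 1))"
    using left_series by blast
  obtain C2 where C2: "0 \<le> C2" "\<forall>t. \<bar>t\<bar> \<le> 1 \<longrightarrow> (\<forall>x\<in>{0..b}.
     \<bar>(\<Sum>i\<le>N. t ^ i * vs i x) - right_slope N t * R.phi (eigenvalue_sum N t) (- x)\<bar> \<le> C2 * \<bar>t\<bar> ^ (N + 1) \<and>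
     \<bar>- (\<Sum>i\<le>N. t ^ i * VY i x) - right_slope N t * R.Phi (eigenvalue_sum N t) (- x)\<bar> \<le> C2 * \<bar>t\<bar> ^ (N + 1))"
    using right_series by blast
  obtain K where K: "0 \<le> K" "\<forall>z1 z2. \<bar>z1\<bar> \<le> \<bar>m\<bar> + (\<Sum>l=1..N. \<bar>\<nu> l\<bar>) \<longrightarrow> \<bar>z2\<bar> \<le> \<bar>m\<bar> + (\<Sum>l=1..N. \<bar>\<nu> l\<bar>) \<longrightarrow> (\<forall>x\<in>{a..0}.
     \<bar>L.phi z1 x\<bar> \<le> K \<and> \<bar>L.Phi z1 x\<bar> \<le> K \<and>
     \<bar>L.phi z1 x - L.phi z2 x\<bar> \<le> K * \<bar>z1 - z2\<bar> \<and> \<bar>L.Phi z1 x - L.Phi z2 x\<bar> \<le> K * \<bar>z1 - z2\<bar>)"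
    using L.phi_lipschitz by blast
  define D where "D = K * (C1 + C2) + K * (C1 + (\<bar>WY (N + 1) 0\<bar> + \<bar>WY (N + 2) 0\<bar>) + C2)"
  show ?thesis
  proof (intro exI[of _ D] conjI allI impI)
    show "0 \<le> D" using K C1 C2 by (simp add: D_def)
    fix t :: real assume t: "\<bar>t\<bar> \<le> 1"
    define \<tau> where "\<tau> = \<bar>t\<bar> ^ (N + 1)"
    have \<tau>: "0 \<le> \<tau>" by (simp add: \<tau>_def)
    define Z where "Z = eigenvalue_sum N t"
    have Z: "\<bar>Z\<bar> \<le> \<bar>m\<bar> + (\<Sum>l=1..N. \<bar>\<nu> l\<bar>)" unfolding Z_def by (rule eigenvalue_sum_bound[OF t])
    define A where "A = left_slope N t"
    define B where "B = right_slope N t"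
    define W0 where "W0 = (\<Sum>i\<le>N. t ^ i * ws i 0)"
    have V0: "(\<Sum>i\<le>N. t ^ i * vs i 0) = W0" by (simp add: W0_def match)
    define WF where "WF = (\<Sum>i\<le>N. t ^ i * WY i 0)"
    define VF where "VF = (\<Sum>i\<le>N. t ^ i * VY i 0)"
    define e1 where "e1 = B * R.phi Z 0 - W0"
    define e2 where "e2 = B * R.Phi Z 0 + VF"
    define e3 where "e3 = A * L.phi Z 0 - W0"
    define e4 where "e4 = A * L.Phi Z 0 - WF"
    define e5 where "e5 = WF - t\<^sup>2 * VF"
    have zero: "0 \<in> {a..0}" "0 \<in> {0..b}" using interval by auto
    have e: "\<bar>e1\<bar> \<le> C2 * \<tau>" "\<bar>e2\<bar> \<le> C2 * \<tau>" "\<bar>e3\<bar> \<le> C1 * \<tau>" "\<bar>e4\<bar> \<le> C1 * \<tau>"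
    proof -
      have "\<bar>e1\<bar> = \<bar>W0 - B * R.phi Z 0\<bar>" "\<bar>e2\<bar> = \<bar>- VF - B * R.Phi Z 0\<bar>"
        "\<bar>e3\<bar> = \<bar>W0 - A * L.phi Z 0\<bar>" "\<bar>e4\<bar> = \<bar>WF - A * L.Phi Z 0\<bar>"
        unfolding e1_def e2_def e3_def e4_def by linarith+
      moreover note C1(2)[rule_format, OF t zero(1), folded \<tau>_def A_def Z_def W0_def WF_def]
      moreover note C2(2)[rule_format, OF t zero(2), folded \<tau>_def, unfolded V0 minus_zero, folded B_def Z_def VF_def]
      ultimately show "\<bar>e1\<bar> \<le> C2 * \<tau>" "\<bar>e2\<bar> \<le> C2 * \<tau>" "\<bar>e3\<bar> \<le> C1 * \<tau>" "\<bar>e4\<bar> \<le> C1 * \<tau>"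
        by (simp_all only:)
    qed
    have e5: "\<bar>e5\<bar> \<le> (\<bar>WY (N + 1) 0\<bar> + \<bar>WY (N + 2) 0\<bar>) * \<tau>"
    proof -
      have "\<bar>WY (N + 1) 0 + t * WY (N + 2) 0\<bar> \<le> \<bar>WY (N + 1) 0\<bar> + \<bar>WY (N + 2) 0\<bar>"
      proof -
        have "\<bar>t * WY (N + 2) 0\<bar> \<le> \<bar>WY (N + 2) 0\<bar>" using t by (simp add: abs_mult mult_left_le_one_le)
        then show ?thesis by linarith
      qed
      then have "\<tau> * \<bar>WY (N + 1) 0 + t * WY (N + 2) 0\<bar> \<le> \<tau> * (\<bar>WY (N + 1) 0\<bar> + \<bar>WY (N + 2) 0\<bar>)"
        using \<tau> by (intro mult_left_mono) auto
      moreover have "\<bar>e5\<bar> = \<tau> * \<bar>WY (N + 1) 0 + t * WY (N + 2) 0\<bar>"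
        unfolding e5_def WF_def VF_def flux_defect by (simp add: abs_mult \<tau>_def power_abs)
      ultimately show ?thesis by (simp add: mult.commute)
    qed
    have Y: "\<bar>L.phi Z 0\<bar> \<le> K" "\<bar>L.Phi Z 0\<bar> \<le> K" using K(2) Z interval by auto
    \<comment> \<open>The leading terms cancel by the two matching conditions.\<close>
    have id: "B * char_fun (t\<^sup>2) Z = L.Phi Z 0 * (e1 - e3) + L.phi Z 0 * (e4 + e5 + t\<^sup>2 * e2)"
      unfolding e1_def e2_def e3_def e4_def e5_def char_fun_def by (simp add: algebra_simps)
    have t2: "\<bar>t\<^sup>2 * e2\<bar> \<le> C2 * \<tau>"
    proof -
      have "\<bar>t\<^sup>2 * e2\<bar> \<le> \<bar>e2\<bar>" using t by (simp add: abs_mult mult_left_le_one_le abs_square_le_1)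
      then show ?thesis using e(2) by linarith
    qed
    have "\<bar>e1 - e3\<bar> \<le> C2 * \<tau> + C1 * \<tau>" using e(1,3) by linarith
    then have "\<bar>L.Phi Z 0\<bar> * \<bar>e1 - e3\<bar> \<le> K * (C2 * \<tau> + C1 * \<tau>)"
      using Y(2) K(1) by (intro mult_mono) auto
    moreover have "K * (C2 * \<tau> + C1 * \<tau>) = K * ((C1 + C2) * \<tau>)" by (simp add: algebra_simps)
    ultimately have "\<bar>L.Phi Z 0 * (e1 - e3)\<bar> \<le> K * ((C1 + C2) * \<tau>)" by (simp only: abs_mult)
    moreover have "\<bar>L.phi Z 0 * (e4 + e5 + t\<^sup>2 * e2)\<bar> \<le> K * ((C1 + (\<bar>WY (N + 1) 0\<bar> + \<bar>WY (N + 2) 0\<bar>) + C2) * \<tau>)"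
      unfolding abs_mult
    proof (intro mult_mono Y K)
      have "\<bar>e4 + e5 + t\<^sup>2 * e2\<bar> \<le> \<bar>e4\<bar> + \<bar>e5\<bar> + \<bar>t\<^sup>2 * e2\<bar>" by linarith
      then show "\<bar>e4 + e5 + t\<^sup>2 * e2\<bar> \<le> (C1 + (\<bar>WY (N + 1) 0\<bar> + \<bar>WY (N + 2) 0\<bar>) + C2) * \<tau>"
        using e(4) e5 t2 by (simp add: distrib_right)
    qed auto
    ultimately have "\<bar>B * char_fun (t\<^sup>2) Z\<bar> \<le> D * \<tau>"
      unfolding id D_def by (simp add: distrib_right) (use abs_triangle_ineq in \<open>simp add: algebra_simps\<close>)
    then show "\<bar>right_slope N t * char_fun (t\<^sup>2) (eigenvalue_sum N t)\<bar> \<le> D * \<bar>t\<bar> ^ (N + 1)"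
      by (simp add: B_def Z_def \<tau>_def)
  qed
qed

lemma right_slope_0: "right_slope N 0 = - VY 0 b"
  by (simp add: right_slope_def sum.atMost_shift)

lemma right_slope_tendsto:
  assumes "(t \<longlongrightarrow> 0) F"
  shows "((\<lambda>\<epsilon>. right_slope N (t \<epsilon>)) \<longlongrightarrow> - VY 0 b) F"
proof -
  have "((\<lambda>\<epsilon>. right_slope N (t \<epsilon>)) \<longlongrightarrow> right_slope N 0) F"
    unfolding right_slope_def by (intro tendsto_intros assms)
  then show ?thesis by (simp add: right_slope_0)
qed

lemma signed_sqrt_tendsto: "((\<lambda>\<epsilon>. \<sigma> * sqrt \<epsilon>) \<longlongrightarrow> 0) (at_right 0)"
  by (auto intro!: tendsto_eq_intros)

lemma signed_sqrt_small:
  assumes "\<sigma> = 1 \<or> \<sigma> = -1"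
  shows "\<forall>\<^sub>F \<epsilon> in at_right 0. 0 < \<epsilon> \<and> \<bar>\<sigma> * sqrt \<epsilon>\<bar> \<le> 1 \<and> \<bar>\<sigma> * sqrt \<epsilon>\<bar> = sqrt \<epsilon> \<and> (\<sigma> * sqrt \<epsilon>)\<^sup>2 = \<epsilon>"
proof -
  have "\<forall>\<^sub>F \<epsilon> in at_right (0::real). 0 < \<epsilon>" "\<forall>\<^sub>F \<epsilon> in at_right (0::real). \<epsilon> < 1"
    by (auto intro!: order_tendstoD(2)[OF tendsto_ident_at] eventually_at_right_less)
  then show ?thesis
    by eventually_elim (use assms in \<open>auto simp: abs_mult power_mult_distrib\<close>)
qed

text \<open>
  The series of order \<open>N = n + 1\<close> has characteristic value \<open>O(t\<^sup>N\<^sup>+\<^sup>1)\<close>; the slope in the inverse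
  estimate costs one factor \<open>\<surd>\<epsilon>\<close>, and the last term \<open>t\<^sup>n\<^sup>+\<^sup>1 \<nu>\<^sub>n\<^sub>+\<^sub>1\<close> is itself of the admitted order. The inverse
  estimate is available on one side of \<open>m\<close> only; since \<open>\<nu>\<^sub>1 > 0\<close>, the truncated eigenvalue lies on the side
  given by the sign \<open>\<sigma>\<close> of \<open>t\<close>.
\<close>

lemma eigenvalue_expansion_error:
  assumes \<sigma>: "\<sigma> = 1 \<or> \<sigma> = -1" and "0 < \<delta>" "0 < c"
    and loc: "\<forall>\<^sub>F \<epsilon> in at_right 0. \<forall>t. 0 \<le> \<sigma> * (t - m) \<longrightarrow> \<sigma> * (t - m) \<le> \<delta> \<longrightarrow>
        c * sqrt \<epsilon> * \<bar>t - \<zeta> \<epsilon>\<bar> \<le> \<bar>char_fun \<epsilon> t\<bar>"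
  shows "\<exists>C. \<forall>\<^sub>F \<epsilon> in at_right 0. \<bar>\<zeta> \<epsilon> - eigenvalue_sum n (\<sigma> * sqrt \<epsilon>)\<bar> \<le> C * sqrt \<epsilon> ^ (n + 1)"
proof -
  let ?N = "n + 1"
  obtain C where C: "0 \<le> C" "\<And>t. \<bar>t\<bar> \<le> 1 \<Longrightarrow> \<bar>right_slope ?N t * char_fun (t\<^sup>2) (eigenvalue_sum ?N t)\<bar> \<le> C * \<bar>t\<bar> ^ (?N + 1)"
    using quasi_mode[of ?N] by blast
  have shape: "eigenvalue_sum ?N t - m = t * (\<nu> 1 + (\<Sum>l=2..?N. t ^ (l - 1) * \<nu> l))" for t
  proof -
    have "(\<Sum>l=1..?N. t ^ l * \<nu> l) = t * \<nu> 1 + (\<Sum>l=2..?N. t ^ l * \<nu> l)"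
      by (subst sum.atLeast_Suc_atMost) (auto simp: numeral_2_eq_2)
    also have "(\<Sum>l=2..?N. t ^ l * \<nu> l) = t * (\<Sum>l=2..?N. t ^ (l - 1) * \<nu> l)"
      unfolding sum_distrib_left
    proof (intro sum.cong refl)
      fix l assume "l \<in> {2..?N}"
      then have "t ^ l = t * t ^ (l - 1)" by (cases l) auto
      then show "t ^ l * \<nu> l = t * (t ^ (l - 1) * \<nu> l)" by simp
    qed
    finally show ?thesis by (simp add: eigenvalue_sum_def algebra_simps)
  qed
  have pos: "\<forall>\<^sub>F \<epsilon> in at_right 0. 0 < \<nu> 1 + (\<Sum>l=2..?N. (\<sigma> * sqrt \<epsilon>) ^ (l - 1) * \<nu> l)"
  proof (rule order_tendstoD(1)[OF _ \<nu>1])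
    have "((\<lambda>\<epsilon>. \<nu> 1 + (\<Sum>l=2..?N. (\<sigma> * sqrt \<epsilon>) ^ (l - 1) * \<nu> l)) \<longlongrightarrow> \<nu> 1 + (\<Sum>l=2..?N. 0 ^ (l - 1) * \<nu> l)) (at_right 0)"
      by (intro tendsto_intros signed_sqrt_tendsto)
    also have "(\<Sum>l=2..?N. 0 ^ (l - 1) * \<nu> l) = 0" by (intro sum.neutral) (auto simp: power_0_left)
    finally show "((\<lambda>\<epsilon>. \<nu> 1 + (\<Sum>l=2..?N. (\<sigma> * sqrt \<epsilon>) ^ (l - 1) * \<nu> l)) \<longlongrightarrow> \<nu> 1) (at_right 0)" by simp
  qed
  have near: "\<forall>\<^sub>F \<epsilon> in at_right 0. \<bar>eigenvalue_sum ?N (\<sigma> * sqrt \<epsilon>) - m\<bar> < \<delta>"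
  proof (rule order_tendstoD(2)[OF _ \<open>0 < \<delta>\<close>])
    have "((\<lambda>\<epsilon>. \<bar>eigenvalue_sum ?N (\<sigma> * sqrt \<epsilon>) - m\<bar>) \<longlongrightarrow> \<bar>0 * (\<nu> 1 + (\<Sum>l=2..?N. 0 ^ (l - 1) * \<nu> l))\<bar>) (at_right 0)"
      unfolding shape by (intro tendsto_intros signed_sqrt_tendsto)
    then show "((\<lambda>\<epsilon>. \<bar>eigenvalue_sum ?N (\<sigma> * sqrt \<epsilon>) - m\<bar>) \<longlongrightarrow> 0) (at_right 0)" by simp
  qed
  have beta: "\<forall>\<^sub>F \<epsilon> in at_right 0. right_slope ?N (\<sigma> * sqrt \<epsilon>) < - (VY 0 b / 2)"
    by (rule order_tendstoD(2)[OF right_slope_tendsto[OF signed_sqrt_tendsto]]) (use VY0 in simp)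
  define D where "D = 2 * C / (c * VY 0 b)"
  have "\<forall>\<^sub>F \<epsilon> in at_right 0. \<bar>\<zeta> \<epsilon> - eigenvalue_sum n (\<sigma> * sqrt \<epsilon>)\<bar> \<le> (D + \<bar>\<nu> ?N\<bar>) * sqrt \<epsilon> ^ (n + 1)"
    using pos near beta loc signed_sqrt_small[OF \<sigma>]
  proof eventually_elim
    case (elim \<epsilon>)
    define t where "t = \<sigma> * sqrt \<epsilon>"
    have \<epsilon>: "0 < \<epsilon>" "\<bar>t\<bar> \<le> 1" "\<bar>t\<bar> = sqrt \<epsilon>" "t\<^sup>2 = \<epsilon>" using elim by (auto simp: t_def)
    define Z where "Z = eigenvalue_sum ?N t"
    have "\<sigma> * (Z - m) = sqrt \<epsilon> * (\<nu> 1 + (\<Sum>l=2..?N. (\<sigma> * sqrt \<epsilon>) ^ (l - 1) * \<nu> l))"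
      unfolding Z_def shape t_def using \<sigma> by auto
    then have "0 \<le> \<sigma> * (Z - m)" using elim \<epsilon> by simp
    moreover have "\<sigma> * (Z - m) \<le> \<delta>" using elim(2) \<sigma> unfolding Z_def t_def by auto
    ultimately have 1: "c * sqrt \<epsilon> * \<bar>Z - \<zeta> \<epsilon>\<bar> \<le> \<bar>char_fun \<epsilon> Z\<bar>" using elim(4) by blast
    have "VY 0 b / 2 * \<bar>char_fun \<epsilon> Z\<bar> \<le> \<bar>right_slope ?N t * char_fun \<epsilon> Z\<bar>"
      unfolding abs_mult using elim(3) VY0 by (intro mult_right_mono) (auto simp: t_def)
    also have "\<dots> \<le> C * sqrt \<epsilon> ^ (?N + 1)" using C(2)[OF \<epsilon>(2)] unfolding \<epsilon>(3,4) Z_def .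
    finally have 2: "VY 0 b / 2 * \<bar>char_fun \<epsilon> Z\<bar> \<le> C * sqrt \<epsilon> ^ (?N + 1)" .
    have "VY 0 b / 2 * (c * sqrt \<epsilon> * \<bar>Z - \<zeta> \<epsilon>\<bar>) \<le> VY 0 b / 2 * \<bar>char_fun \<epsilon> Z\<bar>"
      using 1 VY0 by (intro mult_left_mono) auto
    also note 2
    finally have "sqrt \<epsilon> * (VY 0 b / 2 * c * \<bar>Z - \<zeta> \<epsilon>\<bar>) \<le> sqrt \<epsilon> * (C * sqrt \<epsilon> ^ ?N)"
      by (simp add: mult_ac)
    then have "VY 0 b / 2 * c * \<bar>Z - \<zeta> \<epsilon>\<bar> \<le> C * sqrt \<epsilon> ^ ?N"
      by (rule mult_left_le_imp_le) (use \<epsilon> in simp)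
    then have 3: "\<bar>Z - \<zeta> \<epsilon>\<bar> \<le> D * sqrt \<epsilon> ^ ?N"
      using VY0 \<open>0 < c\<close> by (simp add: D_def field_simps)
    have "Z - eigenvalue_sum n t = t ^ ?N * \<nu> ?N" by (simp add: Z_def eigenvalue_sum_def)
    then have 4: "\<bar>Z - eigenvalue_sum n t\<bar> = \<bar>\<nu> ?N\<bar> * sqrt \<epsilon> ^ ?N" using \<epsilon>(3) by (simp add: abs_mult power_abs)
    have "\<bar>\<zeta> \<epsilon> - eigenvalue_sum n t\<bar> \<le> \<bar>Z - \<zeta> \<epsilon>\<bar> + \<bar>Z - eigenvalue_sum n t\<bar>" by linarith
    also have "\<dots> \<le> (D + \<bar>\<nu> ?N\<bar>) * sqrt \<epsilon> ^ ?N" using 3 4 by (simp add: distrib_right)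
    finally show ?case unfolding t_def .
  qed
  then show ?thesis by blast
qed

end

section \<open>Comparison of the eigenfunctions with the truncated series\<close>

context two_legs
begin

text \<open>
  The derivatives are the fluxes divided by the coefficients, which are bounded below. The factor \<open>K\<close> has to
  be the same for all flows, because the flows to which this is applied depend on \<open>\<epsilon>\<close>.
\<close>

lemma pw_C1_bound_flows:
  "\<exists>K\<ge>1. \<forall>y1 Y1 h1 y2 Y2 h2 f \<eta>. sl_flow k r a 0 y1 Y1 h1 \<longrightarrow> sl_flow \<kappa> \<rho> 0 b y2 Y2 h2 \<longrightarrow> y1 0 = y2 0 \<longrightarrow>
    (\<forall>x\<in>{a..0}. \<bar>y1 x\<bar> \<le> \<eta> \<and> \<bar>Y1 x\<bar> \<le> \<eta>) \<longrightarrow> (\<forall>x\<in>{0..b}. \<bar>y2 x\<bar> \<le> \<eta> \<and> \<bar>Y2 x\<bar> \<le> \<eta>) \<longrightarrow>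
    (\<forall>x\<in>{a..0}. f x = y1 x) \<longrightarrow> (\<forall>x\<in>{0..b}. f x = y2 x) \<longrightarrow> pw_C1_bound a b f (K * \<eta>)"
proof -
  obtain K1 where K1: "0 < K1" "\<forall>x\<in>{a..0}. 1 / k x \<le> K1" using L.coefficient_bound by blast
  obtain K2 where K2: "0 < K2" "\<forall>x\<in>{-b..0}. 1 / \<kappa> (- x) \<le> K2" using R.coefficient_bound by blast
  define K where "K = max 1 (max K1 K2)"
  have K: "1 \<le> K" "K1 \<le> K" "K2 \<le> K" by (auto simp: K_def)
  have main: "pw_C1_bound a b f (K * \<eta>)"
    if f1: "sl_flow k r a 0 y1 Y1 h1" and f2: "sl_flow \<kappa> \<rho> 0 b y2 Y2 h2" and "y1 0 = y2 0"
      and b1: "\<forall>x\<in>{a..0}. \<bar>y1 x\<bar> \<le> \<eta> \<and> \<bar>Y1 x\<bar> \<le> \<eta>" and b2: "\<forall>x\<in>{0..b}. \<bar>y2 x\<bar> \<le> \<eta> \<and> \<bar>Y2 x\<bar> \<le> \<eta>"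
      and "\<forall>x\<in>{a..0}. f x = y1 x" "\<forall>x\<in>{0..b}. f x = y2 x" for y1 Y1 h1 y2 Y2 h2 f \<eta>
  proof -
    have \<eta>: "0 \<le> \<eta>" using b1 interval by (metis abs_ge_zero atLeastAtMost_iff less_imp_le order_refl order_trans)
    have le: "\<eta> \<le> K * \<eta>" using K \<eta> by (simp add: mult_right_le_one_le mult_le_cancel_right1)
    have c: "continuous_on {a..0} (\<lambda>x. Y1 x / k x)" "continuous_on {0..b} (\<lambda>x. Y2 x / \<kappa> x)"
      using f1 f2 coefficients_continuous positive
      by (auto simp: sl_flow_def less_le intro!: continuous_intros)
    show ?thesis
    proof (rule pw_C1_bound_glue[of a b y1 y2 "\<lambda>x. Y1 x / k x" "\<lambda>x. Y2 x / \<kappa> x"])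
      show "(y1 has_real_derivative Y1 x / k x) (at x)" if "x \<in> {a<..<0}" for x
        using f1 that by (simp add: sl_flow_def has_real_derivative_iff_has_vector_derivative)
      show "(y2 has_real_derivative Y2 x / \<kappa> x) (at x)" if "x \<in> {0<..<b}" for x
        using f2 that by (simp add: sl_flow_def has_real_derivative_iff_has_vector_derivative)
      show "\<bar>y1 x\<bar> \<le> K * \<eta> \<and> \<bar>Y1 x / k x\<bar> \<le> K * \<eta>" if x: "x \<in> {a..0}" for x
      proof
        show "\<bar>y1 x\<bar> \<le> K * \<eta>" using b1 x le by fastforce
        have "(1 / k x) * \<bar>Y1 x\<bar> \<le> K * \<eta>"
          using K1 K b1 x positive(1)[OF x] by (intro mult_mono) (auto intro: order.trans)
        then show "\<bar>Y1 x / k x\<bar> \<le> K * \<eta>" using positive(1)[OF x] by simp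
      qed
      show "\<bar>y2 x\<bar> \<le> K * \<eta> \<and> \<bar>Y2 x / \<kappa> x\<bar> \<le> K * \<eta>" if x: "x \<in> {0..b}" for x
      proof
        show "\<bar>y2 x\<bar> \<le> K * \<eta>" using b2 x le by fastforce
        have "1 / \<kappa> x \<le> K" using K2(2)[rule_format, of "- x"] K x by auto
        then have "(1 / \<kappa> x) * \<bar>Y2 x\<bar> \<le> K * \<eta>"
          using K b2 x positive(3)[OF x] by (intro mult_mono) auto
        then show "\<bar>Y2 x / \<kappa> x\<bar> \<le> K * \<eta>" using positive(3)[OF x] by simp
      qed
    qed (use that c interval in \<open>auto simp: sl_flow_def\<close>)
  qed
  show ?thesis using K(1) main by blast
qed

definition weighted_integral :: "(real \<Rightarrow> real) \<Rightarrow> real" where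
  "weighted_integral f = integral {a..b} (\<lambda>x. glue (r, \<rho>) x * f x)"

lemma weighted_integrable:
  assumes f: "continuous_on {a..b} f"
  shows "(\<lambda>x. glue (r, \<rho>) x * f x) integrable_on {a..b}"
proof (rule Henstock_Kurzweil_Integration.integrable_combine[of a 0 b])
  have "(\<lambda>x. r x * f x) integrable_on {a..0}"
    using coefficients_continuous interval
    by (intro integrable_continuous_real continuous_on_mult continuous_on_subset[OF f]) auto
  then show "(\<lambda>x. glue (r, \<rho>) x * f x) integrable_on {a..0}"
    by (rule integrable_spike[where S="{0}"]) (auto simp: glue_def)
  have "(\<lambda>x. \<rho> x * f x) integrable_on {0..b}"
    using coefficients_continuous interval
    by (intro integrable_continuous_real continuous_on_mult continuous_on_subset[OF f]) auto
  then show "(\<lambda>x. glue (r, \<rho>) x * f x) integrable_on {0..b}"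
    by (rule integrable_eq) (auto simp: glue_def)
qed (use interval in auto)

lemma weighted_integral_add:
  "continuous_on {a..b} f \<Longrightarrow> continuous_on {a..b} g \<Longrightarrow> weighted_integral (\<lambda>x. f x + g x) = weighted_integral f + weighted_integral g"
  using integral_add[OF weighted_integrable weighted_integrable, of f g] by (simp add: weighted_integral_def distrib_left)

lemma weighted_integral_scale: "weighted_integral (\<lambda>x. c * f x) = c * weighted_integral f"
  unfolding weighted_integral_def by (subst integral_mult_right[symmetric]) (simp add: mult_ac)

lemma weighted_integral_cong: "(\<And>x. x \<in> {a..b} \<Longrightarrow> f x = g x) \<Longrightarrow> weighted_integral f = weighted_integral g"
  unfolding weighted_integral_def by (intro integral_cong) simp

lemma weighted_integral_bound:
  "\<exists>K>0. \<forall>f \<eta>. continuous_on {a..b} f \<longrightarrow> (\<forall>x\<in>{a..b}. \<bar>f x\<bar> \<le> \<eta>) \<longrightarrow> \<bar>weighted_integral f\<bar> \<le> K * \<eta>"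
proof -
  obtain K1 where K1: "0 < K1" "\<forall>x\<in>{a..0}. r x \<le> K1" using L.coefficient_bound by blast
  obtain K2 where K2: "0 < K2" "\<forall>x\<in>{-b..0}. \<rho> (- x) \<le> K2" using R.coefficient_bound by blast
  have R: "0 \<le> glue (r, \<rho>) x \<and> glue (r, \<rho>) x \<le> K1 + K2" if "x \<in> {a..b}" for x
  proof (cases "x < 0")
    case True
    then show ?thesis using K1 K2 positive(2)[of x] that by (force simp: glue_def)
  next
    case False
    then have "\<rho> x \<le> K2" using K2(2)[rule_format, of "- x"] that by auto
    then show ?thesis using K1 K2 positive(4)[of x] that False by (auto simp: glue_def)
  qed
  show ?thesis
  proof (intro exI[of _ "(K1 + K2) * (b - a)"] conjI allI impI)
    show "0 < (K1 + K2) * (b - a)" using K1 K2 interval by simp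
    fix f :: "real \<Rightarrow> real" and \<eta> assume f: "continuous_on {a..b} f" "\<forall>x\<in>{a..b}. \<bar>f x\<bar> \<le> \<eta>"
    have "norm (integral {a..b} (\<lambda>x. glue (r, \<rho>) x * f x)) \<le> integral {a..b} (\<lambda>x. (K1 + K2) * \<eta>)"
    proof (rule integral_norm_bound_integral)
      show "(\<lambda>x. glue (r, \<rho>) x * f x) integrable_on {a..b}" by (rule weighted_integrable[OF f(1)])
      show "norm (glue (r, \<rho>) x * f x) \<le> (K1 + K2) * \<eta>" if "x \<in> {a..b}" for x
        unfolding real_norm_def abs_mult using R[OF that] f that K1 K2 by (intro mult_mono) auto
    qed auto
    then show "\<bar>weighted_integral f\<bar> \<le> (K1 + K2) * (b - a) * \<eta>"
      using interval by (simp add: weighted_integral_def mult_ac)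
  qed
qed

lemma weighted_integral_square_diff:
  "\<exists>K>0. \<forall>f g d B. continuous_on {a..b} f \<longrightarrow> continuous_on {a..b} g \<longrightarrow>
     (\<forall>x\<in>{a..b}. \<bar>f x - g x\<bar> \<le> d) \<longrightarrow> (\<forall>x\<in>{a..b}. \<bar>g x\<bar> \<le> B) \<longrightarrow>
     \<bar>weighted_integral (\<lambda>x. (f x)\<^sup>2) - weighted_integral (\<lambda>x. (g x)\<^sup>2)\<bar> \<le> K * (d * (d + 2 * B))"
proof -
  obtain K where K: "0 < K" "\<forall>f \<eta>. continuous_on {a..b} f \<longrightarrow> (\<forall>x\<in>{a..b}. \<bar>f x\<bar> \<le> \<eta>) \<longrightarrow> \<bar>weighted_integral f\<bar> \<le> K * \<eta>"
    using weighted_integral_bound by (elim exE conjE) (rule that)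
  show ?thesis
  proof (intro exI[of _ K] conjI allI impI K(1))
    fix f g :: "real \<Rightarrow> real" and d B
    assume c: "continuous_on {a..b} f" "continuous_on {a..b} g"
      and d: "\<forall>x\<in>{a..b}. \<bar>f x - g x\<bar> \<le> d" and B: "\<forall>x\<in>{a..b}. \<bar>g x\<bar> \<le> B"
    have "weighted_integral (\<lambda>x. (f x)\<^sup>2) = weighted_integral (\<lambda>x. (g x)\<^sup>2) + weighted_integral (\<lambda>x. (f x - g x) * (f x - g x + 2 * g x))"
      by (subst weighted_integral_add[symmetric]) (use c in \<open>auto intro!: continuous_intros weighted_integral_cong simp: power2_eq_square algebra_simps\<close>)
    moreover have "\<bar>weighted_integral (\<lambda>x. (f x - g x) * (f x - g x + 2 * g x))\<bar> \<le> K * (d * (d + 2 * B))"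
    proof (rule K(2)[rule_format])
      show "continuous_on {a..b} (\<lambda>x. (f x - g x) * (f x - g x + 2 * g x))" using c by (intro continuous_intros)
      fix x assume x: "x \<in> {a..b}"
      have "\<bar>f x - g x + 2 * g x\<bar> \<le> d + 2 * B" using bspec[OF d x] bspec[OF B x] by linarith
      then show "\<bar>(f x - g x) * (f x - g x + 2 * g x)\<bar> \<le> d * (d + 2 * B)"
        unfolding abs_mult using bspec[OF d x] by (intro mult_mono) auto
    qed
    ultimately show "\<bar>weighted_integral (\<lambda>x. (f x)\<^sup>2) - weighted_integral (\<lambda>x. (g x)\<^sup>2)\<bar> \<le> K * (d * (d + 2 * B))" by simp
  qed
qed

end

lemma abs_combine_le:
  fixes p q r :: real
  assumes "\<bar>p\<bar> \<le> A" "\<bar>q\<bar> \<le> B"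
  shows "\<bar>p - q\<bar> \<le> A + B" "\<bar>- p + q\<bar> \<le> A + B"
    "\<bar>r\<bar> \<le> C \<Longrightarrow> \<bar>p + q - r\<bar> \<le> A + B + C" "\<bar>r\<bar> \<le> C \<Longrightarrow> \<bar>p + q + r\<bar> \<le> A + B + C"
  using assms by linarith+

context expansion
begin

definition profile :: "nat \<Rightarrow> real \<Rightarrow> real" where "profile i = glue (ws i, vs i)"
definition profile_sum :: "nat \<Rightarrow> real \<Rightarrow> real \<Rightarrow> real" where "profile_sum n t x = (\<Sum>i\<le>n. t ^ i * profile i x)"

lemma profile_left: "x \<in> {a..0} \<Longrightarrow> profile i x = ws i x"
  using match[of i] by (cases "x = 0") (auto simp: profile_def glue_def)

lemma profile_right: "x \<in> {0..b} \<Longrightarrow> profile i x = vs i x"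
  by (auto simp: profile_def glue_def)

lemma profile_sum_left: "x \<in> {a..0} \<Longrightarrow> profile_sum n t x = (\<Sum>i\<le>n. t ^ i * ws i x)"
  by (simp add: profile_sum_def profile_left)

lemma profile_sum_right: "x \<in> {0..b} \<Longrightarrow> profile_sum n t x = (\<Sum>i\<le>n. t ^ i * vs i x)"
  by (simp add: profile_sum_def profile_right)

lemma flow_bounded:
  fixes y :: "real \<Rightarrow> real"
  assumes "sl_flow p q c d y Y h"
  shows "\<exists>B\<ge>0. \<forall>x\<in>{c..d}. \<bar>y x\<bar> \<le> B \<and> \<bar>Y x\<bar> \<le> B"
proof -
  have "bounded (y ` {c..d})" "bounded (Y ` {c..d})"
    using assms by (auto intro!: compact_imp_bounded compact_continuous_image simp: sl_flow_def)
  then have "\<exists>B1>0. \<forall>x\<in>{c..d}. \<bar>y x\<bar> \<le> B1" "\<exists>B2>0. \<forall>x\<in>{c..d}. \<bar>Y x\<bar> \<le> B2"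
    by (auto simp: bounded_pos)
  then obtain B1 B2 where B: "B1 > 0" "B2 > 0" "\<forall>x\<in>{c..d}. \<bar>y x\<bar> \<le> B1" "\<forall>x\<in>{c..d}. \<bar>Y x\<bar> \<le> B2" by blast
  show ?thesis
  proof (intro exI[of _ "B1 + B2"] conjI ballI)
    fix x assume x: "x \<in> {c..d}"
    show "\<bar>y x\<bar> \<le> B1 + B2" "\<bar>Y x\<bar> \<le> B1 + B2" using B(1,2) bspec[OF B(3) x] bspec[OF B(4) x] by linarith+
  qed (use B in simp)
qed

lemma profile_bound: "\<exists>B\<ge>0. pw_C1_bound a b (profile i) B"
proof -
  obtain K where K: "1 \<le> K" "\<forall>y1 Y1 h1 y2 Y2 h2 f \<eta>. sl_flow k r a 0 y1 Y1 h1 \<longrightarrow> sl_flow \<kappa> \<rho> 0 b y2 Y2 h2 \<longrightarrow> y1 0 = y2 0 \<longrightarrow>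
    (\<forall>x\<in>{a..0}. \<bar>y1 x\<bar> \<le> \<eta> \<and> \<bar>Y1 x\<bar> \<le> \<eta>) \<longrightarrow> (\<forall>x\<in>{0..b}. \<bar>y2 x\<bar> \<le> \<eta> \<and> \<bar>Y2 x\<bar> \<le> \<eta>) \<longrightarrow>
    (\<forall>x\<in>{a..0}. f x = y1 x) \<longrightarrow> (\<forall>x\<in>{0..b}. f x = y2 x) \<longrightarrow> pw_C1_bound a b f (K * \<eta>)"
    using pw_C1_bound_flows by (elim exE conjE) (rule that)
  obtain B1 where B1: "B1 \<ge> 0" "\<forall>x\<in>{a..0}. \<bar>ws i x\<bar> \<le> B1 \<and> \<bar>WY i x\<bar> \<le> B1" using flow_bounded[OF ws_flow] by blast
  obtain B2 where B2: "B2 \<ge> 0" "\<forall>x\<in>{0..b}. \<bar>vs i x\<bar> \<le> B2 \<and> \<bar>VY i x\<bar> \<le> B2" using flow_bounded[OF vs_flow] by blast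
  have l: "\<bar>ws i x\<bar> \<le> B1 + B2 \<and> \<bar>WY i x\<bar> \<le> B1 + B2" if "x \<in> {a..0}" for x
    using bspec[OF B1(2) that] B2(1) by auto
  have r: "\<bar>vs i x\<bar> \<le> B1 + B2 \<and> \<bar>VY i x\<bar> \<le> B1 + B2" if "x \<in> {0..b}" for x
    using bspec[OF B2(2) that] B1(1) by auto
  have "pw_C1_bound a b (profile i) (K * (B1 + B2))"
    by (rule K(2)[rule_format, OF ws_flow vs_flow match[symmetric]]) (use l r profile_left profile_right in blast)+
  then show ?thesis using K B1 B2 by (intro exI[of _ "K * (B1 + B2)"]) auto
qed

lemma profile_continuous: "continuous_on {a..b} (profile i)"
  using profile_bound[of i] by (auto simp: pw_C1_bound_def)

lemma profile_sum_continuous: "continuous_on {a..b} (profile_sum n t)"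
  unfolding profile_sum_def by (intro continuous_intros profile_continuous)

text \<open>
  The factor \<open>s\<close> makes the flux at \<open>b\<close> agree with that of the truncated series. On the right leg the
  difference is then due to the eigenvalue error and the truncation alone. On the left leg the multiples
  of \<open>\<phi>\<close> are compared through the common value at \<open>0\<close>, which is possible because \<open>\<phi>\<^sub>L\<close> does not vanish
  there.
\<close>

lemma eigenfunction_error:
  assumes \<sigma>: "\<sigma> = 1 \<or> \<sigma> = -1"
    and u: "\<And>\<epsilon>. \<epsilon> > 0 \<Longrightarrow> perturbed_eigenfunction a b k r \<kappa> \<rho> \<epsilon> (l \<epsilon>) (u \<epsilon>)"
      "\<And>\<epsilon>. \<epsilon> > 0 \<Longrightarrow> dI 0 b (u \<epsilon>) b > 0"
    and z: "\<forall>\<^sub>F \<epsilon> in at_right 0. \<bar>l \<epsilon> / \<epsilon> - eigenvalue_sum n (\<sigma> * sqrt \<epsilon>)\<bar> \<le> Cz * sqrt \<epsilon> ^ (n + 1)"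
  defines "s \<equiv> \<lambda>\<epsilon>. right_slope n (\<sigma> * sqrt \<epsilon>) / - (\<kappa> b * dI 0 b (u \<epsilon>) b)"
  shows "\<exists>C\<ge>0. \<forall>\<^sub>F \<epsilon> in at_right 0. 0 < s \<epsilon> \<and>
     pw_C1_bound a b (\<lambda>x. s \<epsilon> * u \<epsilon> x - profile_sum n (\<sigma> * sqrt \<epsilon>) x) (C * sqrt \<epsilon> ^ (n + 1))"
proof -
  obtain C1 where C1: "0 \<le> C1" "\<forall>t. \<bar>t\<bar> \<le> 1 \<longrightarrow> (\<forall>x\<in>{a..0}.
     \<bar>(\<Sum>i\<le>n. t ^ i * ws i x) - left_slope n t * L.phi (eigenvalue_sum n t) x\<bar> \<le> C1 * \<bar>t\<bar> ^ (n + 1) \<and>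
     \<bar>(\<Sum>i\<le>n. t ^ i * WY i x) - left_slope n t * L.Phi (eigenvalue_sum n t) x\<bar> \<le> C1 * \<bar>t\<bar> ^ (n + 1))"
    using left_series by blast
  obtain C2 where C2: "0 \<le> C2" "\<forall>t. \<bar>t\<bar> \<le> 1 \<longrightarrow> (\<forall>x\<in>{0..b}.
     \<bar>(\<Sum>i\<le>n. t ^ i * vs i x) - right_slope n t * R.phi (eigenvalue_sum n t) (- x)\<bar> \<le> C2 * \<bar>t\<bar> ^ (n + 1) \<and>
     \<bar>- (\<Sum>i\<le>n. t ^ i * VY i x) - right_slope n t * R.Phi (eigenvalue_sum n t) (- x)\<bar> \<le> C2 * \<bar>t\<bar> ^ (n + 1))"
    using right_series by blast
  \<comment> \<open>A common bound for the true and the truncated eigenvalue.\<close>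
  define M where "M = \<bar>m\<bar> + (\<Sum>l=1..n. \<bar>\<nu> l\<bar>) + \<bar>Cz\<bar>"
  obtain K1 where K1: "0 \<le> K1" "\<forall>z1 z2. \<bar>z1\<bar> \<le> M \<longrightarrow> \<bar>z2\<bar> \<le> M \<longrightarrow> (\<forall>x\<in>{a..0}.
     \<bar>L.phi z1 x\<bar> \<le> K1 \<and> \<bar>L.Phi z1 x\<bar> \<le> K1 \<and>
     \<bar>L.phi z1 x - L.phi z2 x\<bar> \<le> K1 * \<bar>z1 - z2\<bar> \<and> \<bar>L.Phi z1 x - L.Phi z2 x\<bar> \<le> K1 * \<bar>z1 - z2\<bar>)"
    using L.phi_lipschitz by blast
  obtain K2 where K2: "0 \<le> K2" "\<forall>z1 z2. \<bar>z1\<bar> \<le> M \<longrightarrow> \<bar>z2\<bar> \<le> M \<longrightarrow> (\<forall>x\<in>{-b..0}.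
     \<bar>R.phi z1 x\<bar> \<le> K2 \<and> \<bar>R.Phi z1 x\<bar> \<le> K2 \<and>
     \<bar>R.phi z1 x - R.phi z2 x\<bar> \<le> K2 * \<bar>z1 - z2\<bar> \<and> \<bar>R.Phi z1 x - R.Phi z2 x\<bar> \<le> K2 * \<bar>z1 - z2\<bar>)"
    using R.phi_lipschitz by blast
  obtain K where K: "1 \<le> K" "\<forall>y1 Y1 h1 y2 Y2 h2 f \<eta>. sl_flow k r a 0 y1 Y1 h1 \<longrightarrow> sl_flow \<kappa> \<rho> 0 b y2 Y2 h2 \<longrightarrow> y1 0 = y2 0 \<longrightarrow>
    (\<forall>x\<in>{a..0}. \<bar>y1 x\<bar> \<le> \<eta> \<and> \<bar>Y1 x\<bar> \<le> \<eta>) \<longrightarrow> (\<forall>x\<in>{0..b}. \<bar>y2 x\<bar> \<le> \<eta> \<and> \<bar>Y2 x\<bar> \<le> \<eta>) \<longrightarrow>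
    (\<forall>x\<in>{a..0}. f x = y1 x) \<longrightarrow> (\<forall>x\<in>{0..b}. f x = y2 x) \<longrightarrow> pw_C1_bound a b f (K * \<eta>)"
    using pw_C1_bound_flows by (elim exE conjE) (rule that)
  define A where "A = (\<Sum>i\<le>n. \<bar>WY i a\<bar>)"
  define B where "B = (\<Sum>i\<le>n. \<bar>- VY i b\<bar>)"
  have AB: "0 \<le> A" "0 \<le> B" by (auto simp: A_def B_def intro: sum_nonneg)
  \<comment> \<open>\<open>E2\<close> and \<open>E1\<close> are the error constants on the right and on the left leg, and \<open>E0\<close> is that of the multiple of \<open>\<phi>\<close> on the left.\<close>
  define E2 where "E2 = B * (K2 * \<bar>Cz\<bar>) + C2"
  have E2: "0 \<le> E2" using AB K2 C2 by (simp add: E2_def)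
  \<comment> \<open>A lower bound for \<open>|\<phi>\<^sub>L|\<close> at \<open>0\<close> for spectral parameters near \<open>m\<close>.\<close>
  define y where "y = \<bar>L.phi m 0\<bar> / 2"
  have y: "0 < y" using L.phi_nonzero_of_Phi_zero[OF P] by (auto simp: y_def)
  define E0 where "E0 = (E2 + C1 + A * (K1 * \<bar>Cz\<bar>)) / y"
  have E0: "0 \<le> E0" unfolding E0_def using AB K1 C1 E2 y by (intro divide_nonneg_pos add_nonneg_nonneg mult_nonneg_nonneg) auto
  define E1 where "E1 = E0 * K1 + A * (K1 * \<bar>Cz\<bar>) + C1"
  have E1: "0 \<le> E1" unfolding E1_def using E0 K1 AB C1 by (intro add_nonneg_nonneg mult_nonneg_nonneg) auto
  have zlim: "((\<lambda>\<epsilon>. l \<epsilon> / \<epsilon>) \<longlongrightarrow> m) (at_right 0)"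
  proof (rule LIM_zero_cancel, rule Lim_null_comparison)
    show "\<forall>\<^sub>F \<epsilon> in at_right 0. norm (l \<epsilon> / \<epsilon> - m) \<le> Cz * sqrt \<epsilon> ^ (n + 1) + \<bar>eigenvalue_sum n (\<sigma> * sqrt \<epsilon>) - m\<bar>"
      using z by eventually_elim auto
    have "((\<lambda>\<epsilon>. Cz * sqrt \<epsilon> ^ (n + 1) + \<bar>eigenvalue_sum n (\<sigma> * sqrt \<epsilon>) - m\<bar>) \<longlongrightarrow> Cz * sqrt 0 ^ (n + 1) + \<bar>eigenvalue_sum n 0 - m\<bar>) (at_right 0)"
      unfolding eigenvalue_sum_def by (intro tendsto_intros signed_sqrt_tendsto)
    moreover have "eigenvalue_sum n 0 = m" by (auto simp: eigenvalue_sum_def power_0_left intro!: sum.neutral)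
    ultimately show "((\<lambda>\<epsilon>. Cz * sqrt \<epsilon> ^ (n + 1) + \<bar>eigenvalue_sum n (\<sigma> * sqrt \<epsilon>) - m\<bar>) \<longlongrightarrow> 0) (at_right 0)" by simp
  qed
  have "((\<lambda>\<epsilon>. \<bar>L.phi (l \<epsilon> / \<epsilon>) 0\<bar>) \<longlongrightarrow> \<bar>L.phi m 0\<bar>) (at_right 0)"
  proof (intro tendsto_rabs isCont_tendsto_compose[of m "\<lambda>z. L.phi z 0", OF _ zlim])
    show "isCont (\<lambda>z. L.phi z 0) m" by (rule C2_fun_deriv[OF L.phi_end_C2])
  qed
  then have yev: "\<forall>\<^sub>F \<epsilon> in at_right 0. y < \<bar>L.phi (l \<epsilon> / \<epsilon>) 0\<bar>"
    by (rule order_tendstoD(1)) (use y in \<open>simp add: y_def\<close>)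
  have bev: "\<forall>\<^sub>F \<epsilon> in at_right 0. right_slope n (\<sigma> * sqrt \<epsilon>) < 0"
    by (rule order_tendstoD(2)[OF right_slope_tendsto[OF signed_sqrt_tendsto]]) (use VY0 in simp)
  have "\<forall>\<^sub>F \<epsilon> in at_right 0. 0 < s \<epsilon> \<and>
     pw_C1_bound a b (\<lambda>x. s \<epsilon> * u \<epsilon> x - profile_sum n (\<sigma> * sqrt \<epsilon>) x) (K * (E1 + E2) * sqrt \<epsilon> ^ (n + 1))"
    using yev bev z signed_sqrt_small[OF \<sigma>]
  proof eventually_elim
    case (elim \<epsilon>)
    define t where "t = \<sigma> * sqrt \<epsilon>"
    define \<tau> where "\<tau> = sqrt \<epsilon> ^ (n + 1)"
    define \<zeta> where "\<zeta> = l \<epsilon> / \<epsilon>"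
    define Z where "Z = eigenvalue_sum n t"
    have \<epsilon>: "0 < \<epsilon>" "\<bar>t\<bar> \<le> 1" "\<bar>t\<bar> = sqrt \<epsilon>" using elim by (auto simp: t_def)
    have \<tau>: "0 \<le> \<tau>" "\<tau> \<le> 1" "\<bar>t\<bar> ^ (n + 1) = \<tau>"
      using \<epsilon> power_le_one[of "sqrt \<epsilon>" "n + 1"] by (auto simp: \<tau>_def)
    have zz: "\<bar>\<zeta> - Z\<bar> \<le> \<bar>Cz\<bar> * \<tau>"
    proof -
      have "\<bar>\<zeta> - Z\<bar> \<le> Cz * \<tau>" using elim(3) by (simp add: \<zeta>_def Z_def t_def \<tau>_def)
      also have "\<dots> \<le> \<bar>Cz\<bar> * \<tau>" using \<tau> by (intro mult_right_mono) auto
      finally show ?thesis .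
    qed
    have ZM: "\<bar>Z\<bar> \<le> M" using eigenvalue_sum_bound[OF \<epsilon>(2), of n] by (simp add: Z_def M_def)
    have \<zeta>M: "\<bar>\<zeta>\<bar> \<le> M"
    proof -
      have "\<bar>Cz\<bar> * \<tau> \<le> \<bar>Cz\<bar> * 1" using \<tau> by (intro mult_left_mono) auto
      then show ?thesis using zz eigenvalue_sum_bound[OF \<epsilon>(2), of n] unfolding M_def Z_def by linarith
    qed
    define \<beta>u where "\<beta>u = - (\<kappa> b * dI 0 b (u \<epsilon>) b)"
    define \<alpha>u where "\<alpha>u = k a * dI a 0 (u \<epsilon>) a"
    have \<beta>u: "\<beta>u < 0" using u(2)[OF \<epsilon>(1)] positive(3)[of b] interval by (simp add: \<beta>u_def)
    define S where "S = s \<epsilon>"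
    have S_eq: "S = right_slope n t / \<beta>u" by (simp only: S_def s_def \<beta>u_def t_def)
    then have S: "S * \<beta>u = right_slope n t" using \<beta>u by simp
    have Spos: "0 < S" unfolding S_eq using elim(2) \<beta>u by (simp add: t_def divide_neg_neg)
    note legs = perturbed_eigenfunction_legs[OF u(1)[OF \<epsilon>(1)] \<epsilon>(1), folded \<alpha>u_def \<beta>u_def \<zeta>_def]
    let ?\<alpha> = "left_slope n t" and ?\<beta> = "right_slope n t"
    have \<alpha>A: "\<bar>?\<alpha>\<bar> \<le> A" and \<beta>B: "\<bar>?\<beta>\<bar> \<le> B"
      unfolding left_slope_def right_slope_def A_def B_def by (rule abs_power_sum_le[OF \<epsilon>(2)])+
    define y2 where "y2 x = S * u \<epsilon> x - (\<Sum>i\<le>n. t ^ i * vs i x)" for x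
    define Y2 where "Y2 x = S * (\<kappa> x * dI 0 b (u \<epsilon>) x) - (\<Sum>i\<le>n. t ^ i * VY i x)" for x
    have b2: "\<bar>y2 x\<bar> \<le> E2 * \<tau> \<and> \<bar>Y2 x\<bar> \<le> E2 * \<tau>" if x: "x \<in> {0..b}" for x
    proof -
      have mx: "- x \<in> {-b..0}" using x by auto
      note lip = K2(2)[rule_format, OF \<zeta>M ZM mx]
      note ser = C2(2)[rule_format, OF \<epsilon>(2) x, folded Z_def, unfolded \<tau>(3)]
      have br: "\<bar>?\<beta> * (f - g)\<bar> \<le> B * (K2 * \<bar>Cz\<bar>) * \<tau>" if "\<bar>f - g\<bar> \<le> K2 * \<bar>\<zeta> - Z\<bar>" for f g
      proof -
        have "\<bar>f - g\<bar> \<le> K2 * (\<bar>Cz\<bar> * \<tau>)" using that mult_left_mono[OF zz K2(1)] by linarith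
        then have "\<bar>?\<beta> * (f - g)\<bar> \<le> B * (K2 * (\<bar>Cz\<bar> * \<tau>))"
          unfolding abs_mult using \<beta>B AB by (intro mult_mono) auto
        then show ?thesis by (simp add: mult_ac)
      qed
      have "S * u \<epsilon> x = ?\<beta> * R.phi \<zeta> (- x)" using legs(4)[OF x] S by (simp add: mult.assoc[symmetric])
      then have "y2 x = ?\<beta> * (R.phi \<zeta> (- x) - R.phi Z (- x)) - ((\<Sum>i\<le>n. t ^ i * vs i x) - ?\<beta> * R.phi Z (- x))"
        by (simp add: y2_def algebra_simps)
      then have 1: "\<bar>y2 x\<bar> \<le> E2 * \<tau>"
        unfolding E2_def distrib_right using lip ser by (simp only: abs_combine_le(1) br)
      have "S * - (\<kappa> x * dI 0 b (u \<epsilon>) x) = ?\<beta> * R.Phi \<zeta> (- x)"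
        using legs(4)[OF x] S by (simp add: mult.assoc[symmetric])
      then have "Y2 x = - (?\<beta> * (R.Phi \<zeta> (- x) - R.Phi Z (- x))) + (- (\<Sum>i\<le>n. t ^ i * VY i x) - ?\<beta> * R.Phi Z (- x))"
        by (simp add: Y2_def algebra_simps)
      then have 2: "\<bar>Y2 x\<bar> \<le> E2 * \<tau>"
        unfolding E2_def distrib_right using lip ser by (simp only: abs_combine_le(2) br)
      show ?thesis using 1 2 by blast
    qed
    \<comment> \<open>Both left functions continue functions on the right that are already known to be close.\<close>
    have al: "\<bar>S * \<alpha>u - ?\<alpha>\<bar> \<le> E0 * \<tau>"
    proof -
      have z0: "0 \<in> {a..0}" "0 \<in> {0..b}" using interval by auto
      note lip = K1(2)[rule_format, OF ZM \<zeta>M z0(1)]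
      note ser = C1(2)[rule_format, OF \<epsilon>(2) z0(1), folded Z_def, unfolded \<tau>(3)]
      have "y2 0 = S * \<alpha>u * L.phi \<zeta> 0 - (\<Sum>i\<le>n. t ^ i * ws i 0)"
        using legs(3)[OF z0(1)] by (simp add: y2_def match)
      then have "(S * \<alpha>u - ?\<alpha>) * L.phi \<zeta> 0 = y2 0 + ((\<Sum>i\<le>n. t ^ i * ws i 0) - ?\<alpha> * L.phi Z 0) + ?\<alpha> * (L.phi Z 0 - L.phi \<zeta> 0)"
        by (simp add: algebra_simps)
      moreover have "\<bar>?\<alpha> * (L.phi Z 0 - L.phi \<zeta> 0)\<bar> \<le> A * (K1 * \<bar>Cz\<bar>) * \<tau>"
      proof -
        have "\<bar>L.phi Z 0 - L.phi \<zeta> 0\<bar> \<le> K1 * (\<bar>Cz\<bar> * \<tau>)"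
          using lip mult_left_mono[OF zz K1(1)] by (simp add: abs_minus_commute)
        then have "\<bar>?\<alpha> * (L.phi Z 0 - L.phi \<zeta> 0)\<bar> \<le> A * (K1 * (\<bar>Cz\<bar> * \<tau>))"
          unfolding abs_mult using \<alpha>A AB by (intro mult_mono) auto
        then show ?thesis by (simp add: mult_ac)
      qed
      ultimately have "\<bar>(S * \<alpha>u - ?\<alpha>) * L.phi \<zeta> 0\<bar> \<le> (E2 + C1 + A * (K1 * \<bar>Cz\<bar>)) * \<tau>"
        unfolding distrib_right using b2[OF z0(2)] ser by (simp only: abs_combine_le(4))
      moreover have "\<bar>S * \<alpha>u - ?\<alpha>\<bar> * y \<le> \<bar>(S * \<alpha>u - ?\<alpha>) * L.phi \<zeta> 0\<bar>"
        unfolding abs_mult using elim(1) by (intro mult_left_mono) (auto simp: \<zeta>_def)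
      ultimately have "\<bar>S * \<alpha>u - ?\<alpha>\<bar> * y \<le> (E2 + C1 + A * (K1 * \<bar>Cz\<bar>)) * \<tau>" by linarith
      then show ?thesis using y by (simp add: E0_def field_simps)
    qed
    define y1 where "y1 x = S * u \<epsilon> x - (\<Sum>i\<le>n. t ^ i * ws i x)" for x
    define Y1 where "Y1 x = S * (k x * dI a 0 (u \<epsilon>) x) - (\<Sum>i\<le>n. t ^ i * WY i x)" for x
    have b1: "\<bar>y1 x\<bar> \<le> E1 * \<tau> \<and> \<bar>Y1 x\<bar> \<le> E1 * \<tau>" if x: "x \<in> {a..0}" for x
    proof -
      note lip = K1(2)[rule_format, OF \<zeta>M ZM x]
      note ser = C1(2)[rule_format, OF \<epsilon>(2) x, folded Z_def, unfolded \<tau>(3)]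
      have br: "\<bar>?\<alpha> * (f - g)\<bar> \<le> A * (K1 * \<bar>Cz\<bar>) * \<tau>" if "\<bar>f - g\<bar> \<le> K1 * \<bar>\<zeta> - Z\<bar>" for f g
      proof -
        have "\<bar>f - g\<bar> \<le> K1 * (\<bar>Cz\<bar> * \<tau>)" using that mult_left_mono[OF zz K1(1)] by linarith
        then have "\<bar>?\<alpha> * (f - g)\<bar> \<le> A * (K1 * (\<bar>Cz\<bar> * \<tau>))"
          unfolding abs_mult using \<alpha>A AB by (intro mult_mono) auto
        then show ?thesis by (simp add: mult_ac)
      qed
      have br2: "\<bar>(S * \<alpha>u - ?\<alpha>) * f\<bar> \<le> E0 * K1 * \<tau>" if "\<bar>f\<bar> \<le> K1" for f
      proof -
        have "\<bar>(S * \<alpha>u - ?\<alpha>) * f\<bar> \<le> (E0 * \<tau>) * K1"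
          unfolding abs_mult using al that E0 \<tau> by (intro mult_mono) auto
        then show ?thesis by (simp add: mult_ac)
      qed
      have "y1 x = (S * \<alpha>u - ?\<alpha>) * L.phi \<zeta> x + ?\<alpha> * (L.phi \<zeta> x - L.phi Z x) - ((\<Sum>i\<le>n. t ^ i * ws i x) - ?\<alpha> * L.phi Z x)"
        using legs(3)[OF x] by (simp add: y1_def algebra_simps)
      then have 1: "\<bar>y1 x\<bar> \<le> E1 * \<tau>"
        unfolding E1_def distrib_right using lip ser by (simp only: abs_combine_le(3) br br2)
      have "Y1 x = (S * \<alpha>u - ?\<alpha>) * L.Phi \<zeta> x + ?\<alpha> * (L.Phi \<zeta> x - L.Phi Z x) - ((\<Sum>i\<le>n. t ^ i * WY i x) - ?\<alpha> * L.Phi Z x)"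
        using legs(3)[OF x] by (simp add: Y1_def algebra_simps)
      then have 2: "\<bar>Y1 x\<bar> \<le> E1 * \<tau>"
        unfolding E1_def distrib_right using lip ser by (simp only: abs_combine_le(3) br br2)
      show ?thesis using 1 2 by blast
    qed
    have "sl_flow k r a 0 (\<lambda>x. \<Sum>i\<le>n. t ^ i *\<^sub>R ws i x) (\<lambda>x. \<Sum>i\<le>n. t ^ i *\<^sub>R WY i x)
        (\<lambda>x. \<Sum>i\<le>n. t ^ i *\<^sub>R (m * ws i x + (\<Sum>l=1..i. \<nu> l * ws (i - l) x)))"
      by (rule sl_flow_sum[OF sl_flow_scaleR[OF ws_flow]])
    then have f1: "\<exists>h. sl_flow k r a 0 y1 Y1 h"
      unfolding y1_def Y1_def using sl_flow_diff[OF sl_flow_scaleR[OF legs(1), of S]] by auto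
    have "sl_flow \<kappa> \<rho> 0 b (\<lambda>x. \<Sum>i\<le>n. t ^ i *\<^sub>R vs i x) (\<lambda>x. \<Sum>i\<le>n. t ^ i *\<^sub>R VY i x)
        (\<lambda>x. \<Sum>i\<le>n. t ^ i *\<^sub>R (m * vs i x + (\<Sum>l=1..i. \<nu> l * vs (i - l) x)))"
      by (rule sl_flow_sum[OF sl_flow_scaleR[OF vs_flow]])
    then have f2: "\<exists>h. sl_flow \<kappa> \<rho> 0 b y2 Y2 h"
      unfolding y2_def Y2_def using sl_flow_diff[OF sl_flow_scaleR[OF legs(2), of S]] by auto
    obtain h1 h2 where h: "sl_flow k r a 0 y1 Y1 h1" "sl_flow \<kappa> \<rho> 0 b y2 Y2 h2" using f1 f2 by blast
    have "E1 * \<tau> \<le> (E1 + E2) * \<tau>" "E2 * \<tau> \<le> (E1 + E2) * \<tau>" using E1 E2 \<tau> by (auto intro: mult_right_mono)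
    then have bb: "\<forall>x\<in>{a..0}. \<bar>y1 x\<bar> \<le> (E1 + E2) * \<tau> \<and> \<bar>Y1 x\<bar> \<le> (E1 + E2) * \<tau>"
      "\<forall>x\<in>{0..b}. \<bar>y2 x\<bar> \<le> (E1 + E2) * \<tau> \<and> \<bar>Y2 x\<bar> \<le> (E1 + E2) * \<tau>"
      using b1 b2 by (meson order.trans)+
    have "pw_C1_bound a b (\<lambda>x. S * u \<epsilon> x - profile_sum n t x) (K * ((E1 + E2) * \<tau>))"
      by (rule K(2)[rule_format, OF h]) (use bb in \<open>auto simp: y1_def y2_def match profile_sum_left profile_sum_right\<close>)
    then show ?case using Spos by (simp add: S_def t_def \<tau>_def mult.assoc)
  qed
  then show ?thesis using K(1) E1 E2 by (intro exI[of _ "K * (E1 + E2)"]) auto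
qed

end

section \<open>Normalization, convergence and the adjoined function\<close>

context expansion
begin

definition is_branch :: "real \<Rightarrow> (real \<Rightarrow> real) \<Rightarrow> (real \<Rightarrow> real \<Rightarrow> real) \<Rightarrow> bool" where
  "is_branch \<sigma> l u \<longleftrightarrow> (\<sigma> = 1 \<or> \<sigma> = -1) \<and>
     (\<forall>\<epsilon>>0. perturbed_eigenfunction a b k r \<kappa> \<rho> \<epsilon> (l \<epsilon>) (u \<epsilon>) \<and> dI 0 b (u \<epsilon>) b > 0 \<and> weighted_integral (\<lambda>x. (u \<epsilon> x)\<^sup>2) = 1) \<and>
     (\<forall>n. \<exists>C. \<forall>\<^sub>F \<epsilon> in at_right 0. \<bar>l \<epsilon> / \<epsilon> - eigenvalue_sum n (\<sigma> * sqrt \<epsilon>)\<bar> \<le> C * sqrt \<epsilon> ^ (n + 1))"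

lemma weighted_integral_split:
  assumes "continuous_on {a..b} f"
  shows "weighted_integral f = integral {a..0} (\<lambda>x. r x * f x) + integral {0..b} (\<lambda>x. \<rho> x * f x)"
proof -
  have "weighted_integral f = integral {a..0} (\<lambda>x. glue (r, \<rho>) x * f x) + integral {0..b} (\<lambda>x. glue (r, \<rho>) x * f x)"
    unfolding weighted_integral_def using interval by (intro Henstock_Kurzweil_Integration.integral_combine[symmetric] weighted_integrable assms) auto
  also have "integral {a..0} (\<lambda>x. glue (r, \<rho>) x * f x) = integral {a..0} (\<lambda>x. r x * f x)"
    by (rule integral_spike[of "{0}"]) (auto simp: glue_def)
  also have "integral {0..b} (\<lambda>x. glue (r, \<rho>) x * f x) = integral {0..b} (\<lambda>x. \<rho> x * f x)"
    by (rule integral_cong) (auto simp: glue_def)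
  finally show ?thesis .
qed

definition overlap :: real where "overlap = weighted_integral (\<lambda>x. profile 0 x * profile 1 x)"

lemma profile_sum_bounds:
  "\<exists>B\<ge>0. \<forall>t. \<bar>t\<bar> \<le> 1 \<longrightarrow> (\<forall>x\<in>{a..b}. \<bar>profile_sum n t x\<bar> \<le> B \<and> \<bar>profile_sum n t x - profile 0 x\<bar> \<le> \<bar>t\<bar> * B)"
proof -
  have "\<exists>B. \<forall>i. B i \<ge> 0 \<and> pw_C1_bound a b (profile i) (B i)"
    using profile_bound by (intro choice) auto
  then obtain B where B: "\<And>i. B i \<ge> 0" "\<And>i x. x \<in> {a..b} \<Longrightarrow> \<bar>profile i x\<bar> \<le> B i"
    unfolding pw_C1_bound_def by blast
  show ?thesis
  proof (intro exI[of _ "\<Sum>i\<le>n. B i"] conjI allI impI ballI)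
    show "0 \<le> (\<Sum>i\<le>n. B i)" using B by (intro sum_nonneg) auto
    fix t :: real and x assume t: "\<bar>t\<bar> \<le> 1" and x: "x \<in> {a..b}"
    have "\<bar>profile_sum n t x\<bar> \<le> (\<Sum>i\<le>n. \<bar>profile i x\<bar>)" unfolding profile_sum_def by (rule abs_power_sum_le[OF t])
    also have "\<dots> \<le> (\<Sum>i\<le>n. B i)" using B x by (intro sum_mono) auto
    finally show "\<bar>profile_sum n t x\<bar> \<le> (\<Sum>i\<le>n. B i)" .
    have "profile_sum n t x - profile 0 x = t * (\<Sum>i=1..n. t ^ (i - 1) * profile i x)"
    proof -
      have "profile_sum n t x = profile 0 x + (\<Sum>i=1..n. t ^ i * profile i x)"
        unfolding profile_sum_def by (simp add: atMost_atLeast0 sum.atLeast_Suc_atMost)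
      also have "(\<Sum>i=1..n. t ^ i * profile i x) = t * (\<Sum>i=1..n. t ^ (i - 1) * profile i x)"
        unfolding sum_distrib_left
      proof (intro sum.cong refl)
        fix i assume "i \<in> {1..n}"
        then show "t ^ i * profile i x = t * (t ^ (i - 1) * profile i x)" by (cases i) auto
      qed
      finally show ?thesis by simp
    qed
    moreover have "\<bar>\<Sum>i=1..n. t ^ (i - 1) * profile i x\<bar> \<le> (\<Sum>i\<le>n. B i)"
    proof -
      have "\<bar>\<Sum>i=1..n. t ^ (i - 1) * profile i x\<bar> \<le> (\<Sum>i=1..n. \<bar>t ^ (i - 1) * profile i x\<bar>)" by (rule sum_abs)
      also have "\<dots> \<le> (\<Sum>i=1..n. B i)"
      proof (rule sum_mono)
        fix i
        have "\<bar>t\<bar> ^ (i - 1) \<le> 1" using t by (intro power_le_one) auto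
        then have "\<bar>t\<bar> ^ (i - 1) * \<bar>profile i x\<bar> \<le> 1 * B i" using B x by (intro mult_mono) auto
        then show "\<bar>t ^ (i - 1) * profile i x\<bar> \<le> B i" by (simp add: abs_mult power_abs)
      qed
      also have "\<dots> \<le> (\<Sum>i\<le>n. B i)" using B by (intro sum_mono2) auto
      finally show ?thesis .
    qed
    ultimately show "\<bar>profile_sum n t x - profile 0 x\<bar> \<le> \<bar>t\<bar> * (\<Sum>i\<le>n. B i)"
      by (simp add: abs_mult mult_left_mono)
  qed
qed

text \<open>
  As the eigenfunction is normalized, \<open>s\<^sup>2\<close> is the weighted square integral of \<open>s u\<close>, which differs little from
  that of the truncated series. The latter tends to that of \<open>U\<^sub>0\<close>, which is \<open>1\<close>.
\<close>

lemma branch_rescaled: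
  assumes br: "is_branch \<sigma> l u" and N1: "weighted_integral (\<lambda>x. (profile 0 x)\<^sup>2) = 1"
  shows "\<exists>s C. 0 \<le> C \<and> (s \<longlongrightarrow> 1) (at_right 0) \<and>
     (\<forall>\<^sub>F \<epsilon> in at_right 0. 0 < s \<epsilon> \<and> pw_C1_bound a b (\<lambda>x. s \<epsilon> * u \<epsilon> x - profile_sum n (\<sigma> * sqrt \<epsilon>) x) (C * sqrt \<epsilon> ^ (n + 1))) \<and>
     (\<exists>D. \<forall>\<^sub>F \<epsilon> in at_right 0. \<bar>(s \<epsilon>)\<^sup>2 - weighted_integral (\<lambda>x. (profile_sum n (\<sigma> * sqrt \<epsilon>) x)\<^sup>2)\<bar> \<le> D * sqrt \<epsilon> ^ (n + 1))"
proof -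
  have \<sigma>: "\<sigma> = 1 \<or> \<sigma> = -1" using br by (simp add: is_branch_def)
  obtain Cz where Cz: "\<forall>\<^sub>F \<epsilon> in at_right 0. \<bar>l \<epsilon> / \<epsilon> - eigenvalue_sum n (\<sigma> * sqrt \<epsilon>)\<bar> \<le> Cz * sqrt \<epsilon> ^ (n + 1)"
    using br unfolding is_branch_def by blast
  define s where "s \<epsilon> = right_slope n (\<sigma> * sqrt \<epsilon>) / - (\<kappa> b * dI 0 b (u \<epsilon>) b)" for \<epsilon>
  have "\<exists>C\<ge>0. \<forall>\<^sub>F \<epsilon> in at_right 0. 0 < s \<epsilon> \<and>
     pw_C1_bound a b (\<lambda>x. s \<epsilon> * u \<epsilon> x - profile_sum n (\<sigma> * sqrt \<epsilon>) x) (C * sqrt \<epsilon> ^ (n + 1))"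
    unfolding s_def by (rule eigenfunction_error[OF \<sigma> _ _ Cz]) (use br in \<open>auto simp: is_branch_def\<close>)
  then obtain C where C: "0 \<le> C" "\<forall>\<^sub>F \<epsilon> in at_right 0. 0 < s \<epsilon> \<and>
     pw_C1_bound a b (\<lambda>x. s \<epsilon> * u \<epsilon> x - profile_sum n (\<sigma> * sqrt \<epsilon>) x) (C * sqrt \<epsilon> ^ (n + 1))" by blast
  obtain B where B: "B \<ge> 0" "\<And>t x. \<bar>t\<bar> \<le> 1 \<Longrightarrow> x \<in> {a..b} \<Longrightarrow> \<bar>profile_sum n t x\<bar> \<le> B \<and> \<bar>profile_sum n t x - profile 0 x\<bar> \<le> \<bar>t\<bar> * B"
    using profile_sum_bounds by blast
  have B0: "\<bar>profile 0 x\<bar> \<le> B" if "x \<in> {a..b}" for x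
  proof -
    have "profile_sum n 0 x = profile 0 x" "\<bar>profile_sum n 0 x\<bar> \<le> B" using B(2)[of 0 x] that by auto
    then show ?thesis by simp
  qed
  obtain K where K: "0 < K" "\<forall>f g d B. continuous_on {a..b} f \<longrightarrow> continuous_on {a..b} g \<longrightarrow>
     (\<forall>x\<in>{a..b}. \<bar>f x - g x\<bar> \<le> d) \<longrightarrow> (\<forall>x\<in>{a..b}. \<bar>g x\<bar> \<le> B) \<longrightarrow>
     \<bar>weighted_integral (\<lambda>x. (f x)\<^sup>2) - weighted_integral (\<lambda>x. (g x)\<^sup>2)\<bar> \<le> K * (d * (d + 2 * B))"
    using weighted_integral_square_diff by (elim exE conjE) (rule that)
  have sq: "\<forall>\<^sub>F \<epsilon> in at_right 0. \<bar>(s \<epsilon>)\<^sup>2 - weighted_integral (\<lambda>x. (profile_sum n (\<sigma> * sqrt \<epsilon>) x)\<^sup>2)\<bar> \<le> (K * (C * (C + 2 * B))) * sqrt \<epsilon> ^ (n + 1)"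
    using C(2) signed_sqrt_small[OF \<sigma>]
  proof eventually_elim
    case (elim \<epsilon>)
    define t where "t = \<sigma> * sqrt \<epsilon>"
    define \<tau> where "\<tau> = sqrt \<epsilon> ^ (n + 1)"
    have \<tau>: "0 \<le> \<tau>" "\<tau> \<le> 1" using elim power_le_one[of "sqrt \<epsilon>" "n + 1"] by (auto simp: \<tau>_def)
    have e: "pw_C1_bound a b (\<lambda>x. s \<epsilon> * u \<epsilon> x - profile_sum n t x) (C * \<tau>)" using elim by (simp add: t_def \<tau>_def)
    have "continuous_on {a..b} (\<lambda>x. s \<epsilon> * u \<epsilon> x - profile_sum n t x)" using e by (simp add: pw_C1_bound_def)
    then have "continuous_on {a..b} (\<lambda>x. (s \<epsilon> * u \<epsilon> x - profile_sum n t x) + profile_sum n t x)"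
      by (rule continuous_on_add[OF _ profile_sum_continuous])
    then have c: "continuous_on {a..b} (\<lambda>x. s \<epsilon> * u \<epsilon> x)" by simp
    have "\<bar>weighted_integral (\<lambda>x. (s \<epsilon> * u \<epsilon> x)\<^sup>2) - weighted_integral (\<lambda>x. (profile_sum n t x)\<^sup>2)\<bar> \<le> K * ((C * \<tau>) * (C * \<tau> + 2 * B))"
      by (rule K(2)[rule_format, OF c profile_sum_continuous]) (use e B elim in \<open>auto simp: pw_C1_bound_def t_def\<close>)
    also have "\<dots> \<le> K * ((C * \<tau>) * (C * 1 + 2 * B))"
      using K C B \<tau> by (intro mult_left_mono add_right_mono) auto
    also have "\<dots> = (K * (C * (C + 2 * B))) * \<tau>" by simp
    also have "weighted_integral (\<lambda>x. (s \<epsilon> * u \<epsilon> x)\<^sup>2) = (s \<epsilon>)\<^sup>2"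
    proof -
      have "weighted_integral (\<lambda>x. (s \<epsilon>)\<^sup>2 * (u \<epsilon> x)\<^sup>2) = (s \<epsilon>)\<^sup>2 * weighted_integral (\<lambda>x. (u \<epsilon> x)\<^sup>2)" by (rule weighted_integral_scale)
      then show ?thesis using br elim by (simp add: is_branch_def power_mult_distrib)
    qed
    finally show ?case by (simp add: t_def \<tau>_def)
  qed
  have "((\<lambda>\<epsilon>. (s \<epsilon>)\<^sup>2) \<longlongrightarrow> 1) (at_right 0)"
  proof (rule LIM_zero_cancel, rule Lim_null_comparison)
    show "\<forall>\<^sub>F \<epsilon> in at_right 0. norm ((s \<epsilon>)\<^sup>2 - 1) \<le> (K * (C * (C + 2 * B))) * sqrt \<epsilon> ^ (n + 1) + K * ((sqrt \<epsilon> * B) * (sqrt \<epsilon> * B + 2 * B))"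
      using sq signed_sqrt_small[OF \<sigma>]
    proof eventually_elim
      case (elim \<epsilon>)
      have "\<bar>weighted_integral (\<lambda>x. (profile_sum n (\<sigma> * sqrt \<epsilon>) x)\<^sup>2) - weighted_integral (\<lambda>x. (profile 0 x)\<^sup>2)\<bar> \<le> K * ((sqrt \<epsilon> * B) * (sqrt \<epsilon> * B + 2 * B))"
      proof (rule K(2)[rule_format, OF profile_sum_continuous profile_continuous])
        show "\<bar>profile_sum n (\<sigma> * sqrt \<epsilon>) x - profile 0 x\<bar> \<le> sqrt \<epsilon> * B" if "x \<in> {a..b}" for x
          using B(2)[of "\<sigma> * sqrt \<epsilon>" x] that elim(2) by metis
      qed (rule B0)
      then show ?case using elim(1) unfolding N1 real_norm_def by linarith
    qed
    have "((\<lambda>\<epsilon>. (K * (C * (C + 2 * B))) * sqrt \<epsilon> ^ (n + 1) + K * ((sqrt \<epsilon> * B) * (sqrt \<epsilon> * B + 2 * B))) \<longlongrightarrow>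
      (K * (C * (C + 2 * B))) * sqrt 0 ^ (n + 1) + K * ((sqrt 0 * B) * (sqrt 0 * B + 2 * B))) (at_right 0)"
      by (intro tendsto_intros)
    then show "((\<lambda>\<epsilon>. (K * (C * (C + 2 * B))) * sqrt \<epsilon> ^ (n + 1) + K * ((sqrt \<epsilon> * B) * (sqrt \<epsilon> * B + 2 * B))) \<longlongrightarrow> 0) (at_right 0)"
      by simp
  qed
  then have "((\<lambda>\<epsilon>. sqrt ((s \<epsilon>)\<^sup>2)) \<longlongrightarrow> sqrt 1) (at_right 0)" by (rule tendsto_real_sqrt)
  moreover have "\<forall>\<^sub>F \<epsilon> in at_right 0. sqrt ((s \<epsilon>)\<^sup>2) = s \<epsilon>"
    using C(2) by eventually_elim auto
  ultimately have "(s \<longlongrightarrow> 1) (at_right 0)" using Lim_transform_eventually by fastforce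
  then show ?thesis using C sq by blast
qed

lemma branch_expansion:
  assumes br: "is_branch \<sigma> l u" and N1: "weighted_integral (\<lambda>x. (profile 0 x)\<^sup>2) = 1"
  shows "\<exists>\<theta> C. 0 \<le> C \<and> (\<theta> \<longlongrightarrow> 1) (at_right 0) \<and>
     (\<forall>\<^sub>F \<epsilon> in at_right 0. pw_C1_bound a b (\<lambda>x. u \<epsilon> x - \<theta> \<epsilon> * profile_sum n (\<sigma> * sqrt \<epsilon>) x) (C * sqrt \<epsilon> ^ (n + 1)))"
proof -
  obtain s C where s: "0 \<le> C" "(s \<longlongrightarrow> 1) (at_right 0)"
     "\<forall>\<^sub>F \<epsilon> in at_right 0. 0 < s \<epsilon> \<and> pw_C1_bound a b (\<lambda>x. s \<epsilon> * u \<epsilon> x - profile_sum n (\<sigma> * sqrt \<epsilon>) x) (C * sqrt \<epsilon> ^ (n + 1))"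
    using branch_rescaled[OF br N1, of n] by blast
  have \<theta>: "((\<lambda>\<epsilon>. 1 / s \<epsilon>) \<longlongrightarrow> 1) (at_right 0)"
    using tendsto_divide[OF tendsto_const[of 1] s(2)] by simp
  then have "\<forall>\<^sub>F \<epsilon> in at_right 0. 1 / s \<epsilon> < 2" by (rule order_tendstoD(2)) simp
  then have "\<forall>\<^sub>F \<epsilon> in at_right 0. pw_C1_bound a b (\<lambda>x. u \<epsilon> x - (1 / s \<epsilon>) * profile_sum n (\<sigma> * sqrt \<epsilon>) x) ((2 * C) * sqrt \<epsilon> ^ (n + 1))"
    using s(3) eventually_at_right_less[of "0::real"]
  proof eventually_elim
    case (elim \<epsilon>)
    have "pw_C1_bound a b (\<lambda>x. (1 / s \<epsilon>) * (s \<epsilon> * u \<epsilon> x - profile_sum n (\<sigma> * sqrt \<epsilon>) x)) (\<bar>1 / s \<epsilon>\<bar> * (C * sqrt \<epsilon> ^ (n + 1)))"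
      using elim by (intro pw_C1_bound_scale) auto
    moreover have "(1 / s \<epsilon>) * (s \<epsilon> * u \<epsilon> x - profile_sum n (\<sigma> * sqrt \<epsilon>) x) = u \<epsilon> x - (1 / s \<epsilon>) * profile_sum n (\<sigma> * sqrt \<epsilon>) x" for x
      using elim by (simp add: field_simps)
    moreover have "\<bar>1 / s \<epsilon>\<bar> * (C * sqrt \<epsilon> ^ (n + 1)) \<le> 2 * (C * sqrt \<epsilon> ^ (n + 1))"
      using elim s(1) by (intro mult_right_mono) auto
    ultimately show ?case using pw_C1_bound_mono by (simp only: mult.assoc)
  qed
  then show ?thesis using \<theta> s(1) by (intro exI[of _ "\<lambda>\<epsilon>. 1 / s \<epsilon>"] exI[of _ "2 * C"]) auto
qed

lemma branch_converges:
  assumes br: "is_branch \<sigma> l u" and N1: "weighted_integral (\<lambda>x. (profile 0 x)\<^sup>2) = 1"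
  shows "converges_H1 a b u (profile 0)"
proof -
  obtain \<theta> C where \<theta>: "0 \<le> C" "(\<theta> \<longlongrightarrow> 1) (at_right 0)"
     "\<forall>\<^sub>F \<epsilon> in at_right 0. pw_C1_bound a b (\<lambda>x. u \<epsilon> x - \<theta> \<epsilon> * profile_sum 0 (\<sigma> * sqrt \<epsilon>) x) (C * sqrt \<epsilon> ^ (0 + 1))"
    using branch_expansion[OF br N1, of 0] by blast
  obtain B where B: "0 \<le> B" "pw_C1_bound a b (profile 0) B" using profile_bound by blast
  show ?thesis
  proof (rule converges_H1I[OF interval B(2)])
    show "\<forall>\<^sub>F \<epsilon> in at_right 0. pw_C1_bound a b (\<lambda>x. u \<epsilon> x - profile 0 x) (C * sqrt \<epsilon> + \<bar>\<theta> \<epsilon> - 1\<bar> * B)"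
      using \<theta>(3)
    proof eventually_elim
      case (elim \<epsilon>)
      have "pw_C1_bound a b (\<lambda>x. (u \<epsilon> x - \<theta> \<epsilon> * profile_sum 0 (\<sigma> * sqrt \<epsilon>) x) + (\<theta> \<epsilon> - 1) * profile 0 x) (C * sqrt \<epsilon> ^ (0 + 1) + \<bar>\<theta> \<epsilon> - 1\<bar> * B)"
        by (intro pw_C1_bound_add pw_C1_bound_scale elim B)
      moreover have "(u \<epsilon> x - \<theta> \<epsilon> * profile_sum 0 (\<sigma> * sqrt \<epsilon>) x) + (\<theta> \<epsilon> - 1) * profile 0 x = u \<epsilon> x - profile 0 x" for x
        by (simp add: profile_sum_def algebra_simps)
      ultimately show ?case by simp
    qed
    have "((\<lambda>\<epsilon>. C * sqrt \<epsilon> + \<bar>\<theta> \<epsilon> - 1\<bar> * B) \<longlongrightarrow> C * sqrt 0 + \<bar>1 - 1\<bar> * B) (at_right 0)"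
      by (intro tendsto_intros \<theta>(2))
    then show "((\<lambda>\<epsilon>. C * sqrt \<epsilon> + \<bar>\<theta> \<epsilon> - 1\<bar> * B) \<longlongrightarrow> 0) (at_right 0)" by simp
  qed
qed

lemma profile_sum_1: "profile_sum 1 t x = profile 0 x + t * profile 1 x"
  by (simp add: profile_sum_def)

lemma weighted_integral_profile_sum_1:
  assumes N1: "weighted_integral (\<lambda>x. (profile 0 x)\<^sup>2) = 1"
  shows "weighted_integral (\<lambda>x. (profile_sum 1 t x)\<^sup>2) = 1 + 2 * t * overlap + t\<^sup>2 * weighted_integral (\<lambda>x. (profile 1 x)\<^sup>2)"
proof -
  have "weighted_integral (\<lambda>x. (profile_sum 1 t x)\<^sup>2) = weighted_integral (\<lambda>x. (profile 0 x)\<^sup>2 + ((2 * t) * (profile 0 x * profile 1 x) + t\<^sup>2 * (profile 1 x)\<^sup>2))"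
    by (rule weighted_integral_cong) (simp only: profile_sum_1 power2_eq_square, simp add: algebra_simps)
  also have "\<dots> = weighted_integral (\<lambda>x. (profile 0 x)\<^sup>2) + (weighted_integral (\<lambda>x. (2 * t) * (profile 0 x * profile 1 x)) + weighted_integral (\<lambda>x. t\<^sup>2 * (profile 1 x)\<^sup>2))"
    by (subst weighted_integral_add, (intro continuous_intros profile_continuous)+)+ simp
  finally show ?thesis by (simp add: weighted_integral_scale N1 overlap_def)
qed

text \<open>
  With factors \<open>p\<close> and \<open>q\<close> for the two branches, the difference of the eigenfunctions is
  \<open>(1/p - 1/q) U\<^sub>0 + \<surd>\<epsilon> (1/p + 1/q) U\<^sub>1 + O(\<epsilon>)\<close>. Both factors tend to \<open>1\<close>, and
  \<open>p\<^sup>2 - q\<^sup>2 = 4 \<surd>\<epsilon> \<integral> R U\<^sub>0 U\<^sub>1 + O(\<epsilon>)\<close> determines the limit of \<open>(1/p - 1/q)/\<surd>\<epsilon>\<close>.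
\<close>

lemma branch_difference:
  assumes br: "is_branch 1 l1 u1" "is_branch (-1) l2 u2" and N1: "weighted_integral (\<lambda>x. (profile 0 x)\<^sup>2) = 1"
  shows "converges_H1 a b (\<lambda>\<epsilon> x. (u1 \<epsilon> x - u2 \<epsilon> x) / sqrt \<epsilon>) (\<lambda>x. 2 * (profile 1 x - overlap * profile 0 x))"
proof -
  obtain p C1 D1 where p: "0 \<le> C1" "(p \<longlongrightarrow> 1) (at_right 0)"
     "\<forall>\<^sub>F \<epsilon> in at_right 0. 0 < p \<epsilon> \<and> pw_C1_bound a b (\<lambda>x. p \<epsilon> * u1 \<epsilon> x - profile_sum 1 (1 * sqrt \<epsilon>) x) (C1 * sqrt \<epsilon> ^ (1 + 1))"
     "\<forall>\<^sub>F \<epsilon> in at_right 0. \<bar>(p \<epsilon>)\<^sup>2 - weighted_integral (\<lambda>x. (profile_sum 1 (1 * sqrt \<epsilon>) x)\<^sup>2)\<bar> \<le> D1 * sqrt \<epsilon> ^ (1 + 1)"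
    using branch_rescaled[OF br(1) N1, of 1] by blast
  obtain q C2 D2 where q: "0 \<le> C2" "(q \<longlongrightarrow> 1) (at_right 0)"
     "\<forall>\<^sub>F \<epsilon> in at_right 0. 0 < q \<epsilon> \<and> pw_C1_bound a b (\<lambda>x. q \<epsilon> * u2 \<epsilon> x - profile_sum 1 (-1 * sqrt \<epsilon>) x) (C2 * sqrt \<epsilon> ^ (1 + 1))"
     "\<forall>\<^sub>F \<epsilon> in at_right 0. \<bar>(q \<epsilon>)\<^sup>2 - weighted_integral (\<lambda>x. (profile_sum 1 (-1 * sqrt \<epsilon>) x)\<^sup>2)\<bar> \<le> D2 * sqrt \<epsilon> ^ (1 + 1)"
    using branch_rescaled[OF br(2) N1, of 1] by blast
  obtain B0 where B0: "0 \<le> B0" "pw_C1_bound a b (profile 0) B0" using profile_bound by blast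
  obtain B1 where B1: "0 \<le> B1" "pw_C1_bound a b (profile 1) B1" using profile_bound by blast
  \<comment> \<open>In the difference of the two square integrals only the term linear in \<open>t\<close> remains.\<close>
  have sq: "((\<lambda>\<epsilon>. ((p \<epsilon>)\<^sup>2 - (q \<epsilon>)\<^sup>2) / sqrt \<epsilon>) \<longlongrightarrow> 4 * overlap) (at_right 0)"
  proof (rule LIM_zero_cancel, rule Lim_null_comparison)
    show "\<forall>\<^sub>F \<epsilon> in at_right 0. norm (((p \<epsilon>)\<^sup>2 - (q \<epsilon>)\<^sup>2) / sqrt \<epsilon> - 4 * overlap) \<le> (D1 + D2) * sqrt \<epsilon>"
      using p(4) q(4) eventually_at_right_less[of "0::real"]
    proof eventually_elim
      case (elim \<epsilon>)
      have \<epsilon>: "0 < sqrt \<epsilon>" using elim by simp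
      have "\<bar>((p \<epsilon>)\<^sup>2 - (q \<epsilon>)\<^sup>2) - 4 * overlap * sqrt \<epsilon>\<bar> \<le> (D1 + D2) * (sqrt \<epsilon>)\<^sup>2"
        using elim(1,2) unfolding weighted_integral_profile_sum_1[OF N1] by (simp add: power2_eq_square algebra_simps abs_le_iff)
      then have "\<bar>((p \<epsilon>)\<^sup>2 - (q \<epsilon>)\<^sup>2) - 4 * overlap * sqrt \<epsilon>\<bar> / sqrt \<epsilon> \<le> (D1 + D2) * (sqrt \<epsilon>)\<^sup>2 / sqrt \<epsilon>"
        using \<epsilon> by (intro divide_right_mono) auto
      moreover have "\<bar>((p \<epsilon>)\<^sup>2 - (q \<epsilon>)\<^sup>2) - 4 * overlap * sqrt \<epsilon>\<bar> / sqrt \<epsilon> = \<bar>((p \<epsilon>)\<^sup>2 - (q \<epsilon>)\<^sup>2) / sqrt \<epsilon> - 4 * overlap\<bar>"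
        using \<epsilon> abs_divide[of "((p \<epsilon>)\<^sup>2 - (q \<epsilon>)\<^sup>2) - 4 * overlap * sqrt \<epsilon>" "sqrt \<epsilon>"]
        by (simp add: diff_divide_distrib)
      moreover have "(D1 + D2) * (sqrt \<epsilon>)\<^sup>2 / sqrt \<epsilon> = (D1 + D2) * sqrt \<epsilon>"
        using \<epsilon> unfolding power2_eq_square by (simp only: mult.assoc[symmetric] nonzero_mult_div_cancel_right)
      ultimately show ?case by simp
    qed
    have "((\<lambda>\<epsilon>. (D1 + D2) * sqrt \<epsilon>) \<longlongrightarrow> (D1 + D2) * sqrt 0) (at_right 0)" by (intro tendsto_intros)
    then show "((\<lambda>\<epsilon>. (D1 + D2) * sqrt \<epsilon>) \<longlongrightarrow> 0) (at_right 0)" by simp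
  qed
  \<comment> \<open>The factor of \<open>U\<^sub>0\<close>, with limit \<open>- 2 \<integral> R U\<^sub>0 U\<^sub>1\<close>.\<close>
  define d where "d \<epsilon> = (1 / p \<epsilon> - 1 / q \<epsilon>) / sqrt \<epsilon>" for \<epsilon>
  have "((\<lambda>\<epsilon>. - (((p \<epsilon>)\<^sup>2 - (q \<epsilon>)\<^sup>2) / sqrt \<epsilon>) / ((p \<epsilon> + q \<epsilon>) * (p \<epsilon> * q \<epsilon>))) \<longlongrightarrow> - (4 * overlap) / ((1 + 1) * (1 * 1))) (at_right 0)"
    by (intro tendsto_intros sq p(2) q(2)) simp
  moreover have "\<forall>\<^sub>F \<epsilon> in at_right 0. - (((p \<epsilon>)\<^sup>2 - (q \<epsilon>)\<^sup>2) / sqrt \<epsilon>) / ((p \<epsilon> + q \<epsilon>) * (p \<epsilon> * q \<epsilon>)) = d \<epsilon>"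
    using p(3) q(3) eventually_at_right_less[of "0::real"]
  proof eventually_elim
    case (elim \<epsilon>)
    then have pq: "0 < p \<epsilon>" "0 < q \<epsilon>" "0 < sqrt \<epsilon>" "0 < p \<epsilon> + q \<epsilon>" by auto
    have eq: "(p \<epsilon>)\<^sup>2 - (q \<epsilon>)\<^sup>2 = (p \<epsilon> + q \<epsilon>) * (p \<epsilon> - q \<epsilon>)" by (simp add: power2_eq_square algebra_simps)
    have "- ((S * (P - Q)) / T) / (S * (P * Q)) = (1 / P - 1 / Q) / T"
      if "0 < S" "0 < P" "0 < Q" "0 < T" for S P Q T :: real
      using that by (simp add: field_simps)
    from this[OF pq(4,1,2,3)] show ?case unfolding eq d_def .
  qed
  ultimately have d: "(d \<longlongrightarrow> - 2 * overlap) (at_right 0)" using Lim_transform_eventually by fastforce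
  have ip: "((\<lambda>\<epsilon>. 1 / p \<epsilon>) \<longlongrightarrow> 1) (at_right 0)" and iq: "((\<lambda>\<epsilon>. 1 / q \<epsilon>) \<longlongrightarrow> 1) (at_right 0)"
    using tendsto_divide[OF tendsto_const[of 1] p(2)] tendsto_divide[OF tendsto_const[of 1] q(2)] by auto
  let ?\<eta> = "\<lambda>\<epsilon>. \<bar>d \<epsilon> + 2 * overlap\<bar> * B0 + \<bar>1 / p \<epsilon> + 1 / q \<epsilon> - 2\<bar> * B1 +
     \<bar>1 / p \<epsilon>\<bar> * (C1 * sqrt \<epsilon>) + \<bar>- 1 / q \<epsilon>\<bar> * (C2 * sqrt \<epsilon>)"
  have lim: "pw_C1_bound a b (\<lambda>x. 2 * (profile 1 x - overlap * profile 0 x)) (\<bar>2\<bar> * (B1 + \<bar>- overlap\<bar> * B0))"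
    using pw_C1_bound_scale[OF pw_C1_bound_add[OF B1(2) pw_C1_bound_scale[OF B0(2), of "- overlap"]], of 2] by simp
  show ?thesis
  proof (rule converges_H1I[OF interval lim])
    show "\<forall>\<^sub>F \<epsilon> in at_right 0. pw_C1_bound a b (\<lambda>x. (u1 \<epsilon> x - u2 \<epsilon> x) / sqrt \<epsilon> - 2 * (profile 1 x - overlap * profile 0 x)) (?\<eta> \<epsilon>)"
      using p(3) q(3) eventually_at_right_less[of "0::real"]
    proof eventually_elim
      case (elim \<epsilon>)
      define t where "t = sqrt \<epsilon>"
      have t: "0 < t" "t\<^sup>2 = \<epsilon>" using elim by (auto simp: t_def)
      have pq: "0 < p \<epsilon>" "0 < q \<epsilon>" using elim by auto
      let ?e1 = "\<lambda>x. p \<epsilon> * u1 \<epsilon> x - profile_sum 1 t x" and ?e2 = "\<lambda>x. q \<epsilon> * u2 \<epsilon> x - profile_sum 1 (- t) x"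
      have "pw_C1_bound a b (\<lambda>x. (1 / t) * ?e1 x) (\<bar>1 / t\<bar> * (C1 * t\<^sup>2))"
        "pw_C1_bound a b (\<lambda>x. (1 / t) * ?e2 x) (\<bar>1 / t\<bar> * (C2 * t\<^sup>2))"
        using elim by (intro pw_C1_bound_scale; simp add: t_def numeral_2_eq_2)+
      moreover have "\<bar>1 / t\<bar> * (c * t\<^sup>2) = c * t" for c
      proof -
        have "\<bar>1 / t\<bar> * (c * (t * t)) = c * t" using t(1) by simp
        then show ?thesis by (simp only: power2_eq_square)
      qed
      ultimately have e: "pw_C1_bound a b (\<lambda>x. (1 / t) * ?e1 x) (C1 * t)" "pw_C1_bound a b (\<lambda>x. (1 / t) * ?e2 x) (C2 * t)"
        by simp_all
      have "pw_C1_bound a b (\<lambda>x. ((d \<epsilon> + 2 * overlap) * profile 0 x + (1 / p \<epsilon> + 1 / q \<epsilon> - 2) * profile 1 x +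
          (1 / p \<epsilon>) * ((1 / t) * ?e1 x)) + (- 1 / q \<epsilon>) * ((1 / t) * ?e2 x))
        (\<bar>d \<epsilon> + 2 * overlap\<bar> * B0 + \<bar>1 / p \<epsilon> + 1 / q \<epsilon> - 2\<bar> * B1 + \<bar>1 / p \<epsilon>\<bar> * (C1 * t) + \<bar>- 1 / q \<epsilon>\<bar> * (C2 * t))"
        by (intro pw_C1_bound_add pw_C1_bound_scale B0 B1 e)
      moreover have "((d \<epsilon> + 2 * overlap) * profile 0 x + (1 / p \<epsilon> + 1 / q \<epsilon> - 2) * profile 1 x +
          (1 / p \<epsilon>) * ((1 / t) * ?e1 x)) + (- 1 / q \<epsilon>) * ((1 / t) * ?e2 x) =
          (u1 \<epsilon> x - u2 \<epsilon> x) / sqrt \<epsilon> - 2 * (profile 1 x - overlap * profile 0 x)" for x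
        using t pq unfolding profile_sum_1 d_def t_def[symmetric] by (simp add: field_simps)
      ultimately show ?case by (simp add: t_def)
    qed
    have "(?\<eta> \<longlongrightarrow> \<bar>- 2 * overlap + 2 * overlap\<bar> * B0 + \<bar>1 + 1 - 2\<bar> * B1 + \<bar>1\<bar> * (C1 * sqrt 0) + \<bar>- 1 / 1\<bar> * (C2 * sqrt 0)) (at_right 0)"
      by (intro tendsto_intros d ip iq q(2)) simp
    then show "(?\<eta> \<longlongrightarrow> 0) (at_right 0)" by simp
  qed
qed

text \<open>
  The function \<open>U\<^sub>1/\<nu>\<^sub>1\<close> satisfies the equations of the adjoined function. On the right, the difference
  of two solutions is a multiple of \<open>v\<close> and vanishes at \<open>0\<close>; hence the left components have the same value
  at \<open>0\<close> and coincide. The orthogonality fixes the multiple of \<open>v\<close>.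
\<close>

lemma adjoined_function:
  fixes y1 y2 :: "real \<Rightarrow> real"
  assumes f1: "sl_flow k r a 0 y1 Y1 (\<lambda>x. m * y1 x)" and f2: "sl_flow \<kappa> \<rho> 0 b y2 Y2 (\<lambda>x. m * y2 x + vs 0 x)"
    and bc: "y1 a = 0" "y2 b = 0" "y1 0 = y2 0"
    and N1: "weighted_integral (\<lambda>x. (profile 0 x)\<^sup>2) = 1" and orth: "weighted_integral (\<lambda>x. profile 0 x * glue (y1, y2) x) = 0"
    and x: "x \<in> {a..b}"
  shows "glue (y1, y2) x = (profile 1 x - overlap * profile 0 x) / \<nu> 1"
proof -
  have "sl_flow (\<lambda>x. \<kappa> (- x)) (\<lambda>x. \<rho> (- x)) (- b) 0 (\<lambda>x. vs 0 (- x)) (\<lambda>x. - VY 0 (- x)) (\<lambda>x. m * vs 0 (- x))"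
    using reflect_right[OF vs_flow[of 0]] by simp
  then have v0: "vs 0 (- x) = R.phi m x * - VY 0 b" if "x \<in> {-b..0}" for x
    using R.flow_unique(1)[of "\<lambda>x. vs 0 (- x)" "\<lambda>x. - VY 0 (- x)" m x] that vs_b by simp
  have "sl_flow \<kappa> \<rho> 0 b (\<lambda>x. y2 x - (1 / \<nu> 1) *\<^sub>R vs 1 x) (\<lambda>x. Y2 x - (1 / \<nu> 1) *\<^sub>R VY 1 x) (\<lambda>x. m * (y2 x - (1 / \<nu> 1) *\<^sub>R vs 1 x))"
    by (rule sl_flow_cong[OF sl_flow_diff[OF f2 sl_flow_scaleR[OF vs_flow[of 1], of "1 / \<nu> 1"]]]) (use \<nu>1 in \<open>auto simp: field_simps\<close>)
  from reflect_right[OF this] vs_b bc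
  have d1: "y2 (- x) - vs 1 (- x) / \<nu> 1 = R.phi m x * - (Y2 b - VY 1 b / \<nu> 1)" if "x \<in> {-b..0}" for x
    using R.flow_unique(1)[of "\<lambda>x. y2 (- x) - vs 1 (- x) / \<nu> 1" "\<lambda>x. - (Y2 (- x) - VY 1 (- x) / \<nu> 1)" m x] that by simp
  define d where "d = (Y2 b - VY 1 b / \<nu> 1) / VY 0 b"
  have right: "y2 x = vs 1 x / \<nu> 1 + d * vs 0 x" if "x \<in> {0..b}" for x
  proof -
    have "d * vs 0 x = R.phi m (- x) * - (Y2 b - VY 1 b / \<nu> 1)"
      using v0[of "- x"] that VY0 by (simp add: d_def) (simp add: algebra_simps)
    then show ?thesis using d1[of "- x"] that by simp
  qed
  have z: "0 \<in> {a..0}" "0 \<in> {-b..0}" "0 \<in> {0..b}" using interval by auto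
  have "y1 0 = ws 1 0 / \<nu> 1" using right[OF z(3)] bc v0[OF z(2)] Q match by simp
  have wf: "sl_flow k r a 0 (ws 1) (WY 1) (\<lambda>x. m * ws 1 x)"
    by (rule sl_flow_cong[OF ws_flow[of 1]]) (auto simp: ws_0)
  have w1: "ws 1 x = L.phi m x * WY 1 a" "y1 x = L.phi m x * Y1 a" if "x \<in> {a..0}" for x
    using L.flow_unique(1)[of "ws 1" "WY 1" m x] L.flow_unique(1)[of y1 Y1 m x] wf f1 ws_a bc that by auto
  have "L.phi m 0 \<noteq> 0" by (rule L.phi_nonzero_of_Phi_zero[OF P])
  then have "Y1 a = WY 1 a / \<nu> 1"
    using \<open>y1 0 = ws 1 0 / \<nu> 1\<close> w1[OF z(1)] \<nu>1 by (simp add: field_simps)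
  then have left: "y1 x = ws 1 x / \<nu> 1" if "x \<in> {a..0}" for x using w1[OF that] by simp
  have rep: "glue (y1, y2) x = (1 / \<nu> 1) * profile 1 x + d * profile 0 x" if x: "x \<in> {a..b}" for x
  proof (cases "x < 0")
    case True
    then have "x \<in> {a..0}" using x by auto
    then show ?thesis using left ws_0 True by (simp add: glue_def profile_def)
  next
    case False
    then have "x \<in> {0..b}" using x by auto
    then show ?thesis using right False by (simp add: glue_def profile_def)
  qed
  have "0 = weighted_integral (\<lambda>x. (1 / \<nu> 1) * (profile 0 x * profile 1 x) + d * (profile 0 x)\<^sup>2)"
    unfolding orth[symmetric] by (rule weighted_integral_cong) (simp add: rep power2_eq_square algebra_simps)
  also have "\<dots> = (1 / \<nu> 1) * overlap + d"
    by (subst weighted_integral_add, (intro continuous_intros profile_continuous)+)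
      (simp only: weighted_integral_scale N1 overlap_def mult_1_right)
  finally have "d = - overlap / \<nu> 1" by simp
  then show ?thesis using rep[OF x] by (simp add: diff_divide_distrib)
qed

end

section \<open>Splitting of a double eigenvalue\<close>

theorem theorem6:
  fixes a b :: real
    and k r \<kappa> \<rho> R :: "real \<Rightarrow> real"
    and lam :: "real \<Rightarrow> nat \<Rightarrow> real"
    and u :: "real \<Rightarrow> nat \<Rightarrow> real \<Rightarrow> real"
    and \<mu> :: "nat \<Rightarrow> real"
    and j :: nat
    and v w :: "real \<Rightarrow> real"
    and \<omega> :: real
    and U Ustar :: "(real \<Rightarrow> real) \<times> (real \<Rightarrow> real)"
    and \<nu>p \<nu>m :: "nat \<Rightarrow> real"
    and vp wp vm wm :: "nat \<Rightarrow> real \<Rightarrow> real"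
  assumes interval: "a < 0" "0 < b"
    and smooth: "smooth_interval a 0 k" "smooth_interval a 0 r"
      "smooth_interval 0 b \<kappa>" "smooth_interval 0 b \<rho>"
    and positive: "\<And>x. x \<in> {a..0} \<Longrightarrow> k x > 0" "\<And>x. x \<in> {a..0} \<Longrightarrow> r x > 0"
      "\<And>x. x \<in> {0..b} \<Longrightarrow> \<kappa> x > 0" "\<And>x. x \<in> {0..b} \<Longrightarrow> \<rho> x > 0"
    and weight: "R = glue (r, \<rho>)"
    and perturbed_eigenvalues:
      "\<And>\<epsilon>. \<epsilon> > 0 \<Longrightarrow> enumerates_perturbed_spectrum a b k r \<kappa> \<rho> \<epsilon> (lam \<epsilon>)"
    and perturbed_eigenfunctions:
      "\<And>\<epsilon> n. \<epsilon> > 0 \<Longrightarrow> n \<ge> 1 \<Longrightarrow> perturbed_eigenfunction a b k r \<kappa> \<rho> \<epsilon> (lam \<epsilon> n) (u \<epsilon> n)"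
      "\<And>\<epsilon> n. \<epsilon> > 0 \<Longrightarrow> n \<ge> 1 \<Longrightarrow> integral {a..b} (\<lambda>x. R x * (u \<epsilon> n x)\<^sup>2) = 1"
      "\<And>\<epsilon> n. \<epsilon> > 0 \<Longrightarrow> n \<ge> 1 \<Longrightarrow> dI 0 b (u \<epsilon> n) b > 0"
    and limit_eigenvalues: "enumerates_limit_spectrum a b k r \<kappa> \<rho> \<mu>"
    and double: "j \<ge> 1" "\<mu> j = \<mu> (j + 1)"
      "complex_of_real (\<mu> j) \<in> spectrum_of r a 0 (A1 a k r) \<inter> spectrum_of \<rho> 0 b (A2_hat b \<kappa> \<rho>)"
    and v: "A2_hat b \<kappa> \<rho> v (\<lambda>x. \<mu> j * v x)" "integral {0..b} (\<lambda>x. \<rho> x * (v x)\<^sup>2) = 1"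
      "dI 0 b v b > 0"
    and w: "A1 a k r w (\<lambda>x. \<mu> j * w x)" "integral {a..0} (\<lambda>x. r x * (w x)\<^sup>2) = 1"
      "w 0 * dI 0 b v 0 > 0"
    and omega: "\<omega> = \<kappa> 0 * w 0 * dI 0 b v 0"
    and U: "U = ((\<lambda>x. 0), v)"
    and Ustar: "A_op a b k r \<kappa> \<rho> Ustar (pair_scale (\<mu> j) Ustar + U)"
      "integral {a..b} (\<lambda>x. R x * glue U x * glue Ustar x) = 0"
    and plus: "plus_branch a b k r \<kappa> \<rho> (\<mu> j) \<omega> v w \<nu>p vp wp"
    and minus: "\<nu>m = (\<lambda>n. (-1) ^ n * \<nu>p n)" "vm = (\<lambda>n x. (-1) ^ n * vp n x)"
      "wm = (\<lambda>n x. (-1) ^ n * wp n x)"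
  shows "converges_H1 a b (\<lambda>\<epsilon>. u \<epsilon> j) (glue U)
    \<and> converges_H1 a b (\<lambda>\<epsilon>. u \<epsilon> (j + 1)) (glue U)
    \<and> (\<exists>\<gamma>. \<gamma> \<noteq> 0 \<and>
         converges_H1 a b (\<lambda>\<epsilon> x. (u \<epsilon> (j + 1) x - u \<epsilon> j x) / sqrt \<epsilon>) (\<lambda>x. \<gamma> * glue Ustar x))
    \<and> has_expansion a b (\<mu> j) \<nu>m vm wm (\<lambda>\<epsilon>. lam \<epsilon> j / \<epsilon>) (\<lambda>\<epsilon>. u \<epsilon> j)
    \<and> has_expansion a b (\<mu> j) \<nu>p vp wp (\<lambda>\<epsilon>. lam \<epsilon> (j + 1) / \<epsilon>) (\<lambda>\<epsilon>. u \<epsilon> (j + 1))"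
proof -
  define m where "m = \<mu> j"
  interpret two_legs a b k r \<kappa> \<rho>
    by unfold_locales (use interval smooth positive in auto)
  have v_op: "SL_op \<kappa> \<rho> 0 b v (\<lambda>x. m * v x)" "v 0 = 0" "v b = 0"
    using v(1) by (auto simp: A2_hat_def m_def)
  have w_op: "SL_op k r a 0 w (\<lambda>x. m * w x)" "w a = 0" "dI a 0 w 0 = 0"
    using w(1) by (auto simp: A1_def m_def)
  have v_flow: "sl_flow \<kappa> \<rho> 0 b v (\<lambda>x. \<kappa> x *\<^sub>R dI 0 b v x) (\<lambda>x. m * v x)"
    using SL_op_continuous[OF v_op(1)] coefficients_continuous positive interval
    by (intro SL_op_flow[OF v_op(1)]) (auto intro!: continuous_intros)
  have w_flow: "sl_flow k r a 0 w (\<lambda>x. k x *\<^sub>R dI a 0 w x) (\<lambda>x. m * w x)"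
    using SL_op_continuous[OF w_op(1)] coefficients_continuous positive interval
    by (intro SL_op_flow[OF w_op(1)]) (auto intro!: continuous_intros)
  \<comment> \<open>The construction leaves \<open>wp 0\<close> undetermined.\<close>
  define ws where "ws i = (if i = 0 then (\<lambda>x. 0) else wp i)" for i
  define VY where "VY i x = \<kappa> x * dI 0 b (vp i) x" for i x
  define WY where "WY i = (if i = 0 then (\<lambda>x. 0) else if i = 1 then (\<lambda>x. - (k x * dI a 0 w x))
      else (\<lambda>x. k x * dI a 0 (wp i) x))" for i
  have start: "\<nu>p 1 = \<omega>" "vp 0 = v" "wp 1 = (\<lambda>x. - w x)"
    and step: "\<And>n. n \<ge> 1 \<Longrightarrow> SL_regular \<kappa> 0 b (vp n) \<and>
        (\<forall>x\<in>{0<..<b}. SL \<kappa> 0 b (vp n) x + m * \<rho> x * vp n x = - \<rho> x * (\<Sum>i=1..n. \<nu>p i * vp (n - i) x)) \<and>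
        vp n 0 = wp n 0 \<and> vp n b = 0 \<and> SL_regular k a 0 (wp (n + 1)) \<and>
        (\<forall>x\<in>{a<..<0}. SL k a 0 (wp (n + 1)) x + m * r x * wp (n + 1) x
                         = - r x * (\<Sum>i=1..n. \<nu>p i * wp (n + 1 - i) x)) \<and>
        wp (n + 1) a = 0 \<and> k 0 * dI a 0 (wp (n + 1)) 0 = \<kappa> 0 * dI 0 b (vp (n - 1)) 0"
    using plus unfolding plus_branch_def m_def by blast+
  have vp_flow: "sl_flow \<kappa> \<rho> 0 b (vp i) (VY i) (\<lambda>x. m * vp i x + (\<Sum>l=1..i. \<nu>p l * vp (i - l) x))" for i
  proof (cases "i = 0")
    case True
    then show ?thesis using v_flow by (simp add: VY_def[abs_def] start)
  next
    case False
    then have i: "i \<ge> 1" by simp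
    have "SL \<kappa> 0 b (vp i) x = - (\<rho> x *\<^sub>R (m * vp i x + (\<Sum>l=1..i. \<nu>p l * vp (i - l) x)))" if "x \<in> {0<..<b}" for x
    proof -
      have "SL \<kappa> 0 b (vp i) x + m * \<rho> x * vp i x = - \<rho> x * (\<Sum>l=1..i. \<nu>p l * vp (i - l) x)"
        using step[OF i] that by blast
      then show ?thesis by (simp add: distrib_left mult_ac)
    qed
    then show ?thesis
      using SL_regular_flow[of \<kappa> 0 b "vp i" \<rho> "\<lambda>x. m * vp i x + (\<Sum>l=1..i. \<nu>p l * vp (i - l) x)"] step[OF i] positive
      by (simp add: VY_def[abs_def])
  qed
  have ws_flow: "sl_flow k r a 0 (ws i) (WY i) (\<lambda>x. m * ws i x + (\<Sum>l=1..i. \<nu>p l * ws (i - l) x))" for i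
  proof -
    consider "i = 0" | "i = 1" | n where "i = n + 1" "n \<ge> 1"
      by (cases i; cases "i - 1") auto
    then show ?thesis
    proof cases
      case 1
      then show ?thesis by (simp add: ws_def WY_def sl_flow_zero)
    next
      case 2
      then show ?thesis
        using sl_flow_scaleR[OF w_flow, of "-1"] start by (simp add: ws_def WY_def)
    next
      case 3
      have sum: "(\<Sum>l=1..i. \<nu>p l * ws (i - l) x) = (\<Sum>l=1..n. \<nu>p l * wp (n + 1 - l) x)" for x
      proof -
        have "(\<Sum>l=1..i. \<nu>p l * ws (i - l) x) = (\<Sum>l=1..n. \<nu>p l * ws (n + 1 - l) x)"
          by (simp add: 3 ws_def)
        also have "\<dots> = (\<Sum>l=1..n. \<nu>p l * wp (n + 1 - l) x)"
          by (intro sum.cong refl) (auto simp: ws_def)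
        finally show ?thesis .
      qed
      have "SL k a 0 (wp i) x = - (r x *\<^sub>R (m * wp i x + (\<Sum>l=1..n. \<nu>p l * wp (n + 1 - l) x)))" if "x \<in> {a<..<0}" for x
      proof -
        have "SL k a 0 (wp i) x + m * r x * wp i x = - r x * (\<Sum>l=1..n. \<nu>p l * wp (n + 1 - l) x)"
          using step[OF 3(2)] that unfolding 3(1) by blast
        then show ?thesis by (simp add: distrib_left mult_ac)
      qed
      then show ?thesis
        unfolding sum
        using SL_regular_flow[of k a 0 "wp i" r "\<lambda>x. m * wp i x + (\<Sum>l=1..n. \<nu>p l * wp (n + 1 - l) x)"] step[OF 3(2)] positive 3
        by (simp add: ws_def WY_def)
    qed
  qed
  have w0: "w 0 \<noteq> 0" using w(3) by auto
  have P: "L.Phi m 0 = 0"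
  proof -
    have "w 0 = L.phi m 0 * (k a * dI a 0 w a)" "k 0 * dI a 0 w 0 = L.Phi m 0 * (k a * dI a 0 w a)"
      using L.flow_unique[of w "\<lambda>x. k x *\<^sub>R dI a 0 w x" m 0] w_flow w_op interval by auto
    then show ?thesis using w0 w_op by auto
  qed
  have Q: "R.phi m 0 = 0"
  proof -
    have "v 0 = R.phi m 0 * - (\<kappa> b * dI 0 b v b)"
      using R.flow_unique(1)[of "\<lambda>x. v (- x)" "\<lambda>x. - (\<kappa> (- x) *\<^sub>R dI 0 b v (- x))" m 0] reflect_right[OF v_flow] v_op interval
      by auto
    then show ?thesis using v_op v(3) positive(3)[of b] interval by auto
  qed
  interpret expansion a b k r \<kappa> \<rho> m \<nu>p vp ws VY WY
  proof
    show "L.Phi m 0 = 0" "R.phi m 0 = 0" by (rule P, rule Q)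
    show "sl_flow \<kappa> \<rho> 0 b (vp i) (VY i) (\<lambda>x. m * vp i x + (\<Sum>l=1..i. \<nu>p l * vp (i - l) x))" for i
      by (rule vp_flow)
    show "sl_flow k r a 0 (ws i) (WY i) (\<lambda>x. m * ws i x + (\<Sum>l=1..i. \<nu>p l * ws (i - l) x))" for i
      by (rule ws_flow)
    show "vp i b = 0" for i using step[of i] start v_op by (cases "i = 0") auto
    show "ws i a = 0" for i
      using step[of "i - 1"] start w_op by (cases "i \<le> 1") (auto simp: ws_def le_Suc_eq)
    show "vp i 0 = ws i 0" for i using step[of i] start v_op by (cases "i = 0") (auto simp: ws_def)
    show "WY (i + 2) 0 = VY i 0" for i using step[of "i + 1"] by (simp add: WY_def VY_def)
    show "WY 0 0 = 0" "WY 1 0 = 0" using w_op by (auto simp: WY_def)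
    show "ws 0 x = 0" for x by (simp add: ws_def)
    show "0 < \<nu>p 1" using start omega w(3) positive(3)[of 0] interval by (simp add: mult.assoc)
    show "0 < VY 0 b" using start v(3) positive(3)[of b] interval by (simp add: VY_def)
  qed
  have profile_0: "profile 0 x = glue U x" for x by (simp add: profile_def ws_def start U)
  have N1: "weighted_integral (\<lambda>x. (profile 0 x)\<^sup>2) = 1"
  proof -
    have "weighted_integral (\<lambda>x. (profile 0 x)\<^sup>2) = integral {a..0} (\<lambda>x. r x * (profile 0 x)\<^sup>2) + integral {0..b} (\<lambda>x. \<rho> x * (profile 0 x)\<^sup>2)"
      by (intro weighted_integral_split continuous_intros profile_continuous)
    also have "integral {a..0} (\<lambda>x. r x * (profile 0 x)\<^sup>2) = integral {a..0} (\<lambda>x. 0)"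
      by (rule integral_cong) (simp add: profile_left ws_def)
    also have "integral {0..b} (\<lambda>x. \<rho> x * (profile 0 x)\<^sup>2) = integral {0..b} (\<lambda>x. \<rho> x * (v x)\<^sup>2)"
      by (rule integral_cong) (simp add: profile_right start)
    finally show ?thesis using v(2) by simp
  qed
  obtain \<delta> C c where loc: "\<delta> > 0" "c > 0" "\<forall>\<^sub>F \<epsilon> in at_right 0.
       \<bar>lam \<epsilon> j / \<epsilon> - m\<bar> \<le> C * sqrt \<epsilon> \<and> \<bar>lam \<epsilon> (j + 1) / \<epsilon> - m\<bar> \<le> C * sqrt \<epsilon> \<and>
       (\<forall>t\<in>{m - \<delta>..m}. c * sqrt \<epsilon> * \<bar>t - lam \<epsilon> j / \<epsilon>\<bar> \<le> \<bar>char_fun \<epsilon> t\<bar>) \<and>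
       (\<forall>t\<in>{m..m + \<delta>}. c * sqrt \<epsilon> * \<bar>t - lam \<epsilon> (j + 1) / \<epsilon>\<bar> \<le> \<bar>char_fun \<epsilon> t\<bar>)"
    using double_eigenvalue_splits[OF perturbed_eigenvalues perturbed_eigenfunctions(1,3) limit_eigenvalues double(1) m_def[symmetric] _ P Q]
      double(2) m_def by auto
  have norm: "weighted_integral (\<lambda>x. (u \<epsilon> n x)\<^sup>2) = 1" if "\<epsilon> > 0" "n \<ge> 1" for \<epsilon> n
    using perturbed_eigenfunctions(2)[OF that] by (simp add: weighted_integral_def weight)
  have lower: "is_branch (-1) (\<lambda>\<epsilon>. lam \<epsilon> j) (\<lambda>\<epsilon>. u \<epsilon> j)"
    unfolding is_branch_def
  proof (intro conjI allI impI)
    fix n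
    show "\<exists>C. \<forall>\<^sub>F \<epsilon> in at_right 0. \<bar>lam \<epsilon> j / \<epsilon> - eigenvalue_sum n (- 1 * sqrt \<epsilon>)\<bar> \<le> C * sqrt \<epsilon> ^ (n + 1)"
    proof (rule eigenvalue_expansion_error[OF _ loc(1,2)])
      show "\<forall>\<^sub>F \<epsilon> in at_right 0. \<forall>t. 0 \<le> - 1 * (t - m) \<longrightarrow> - 1 * (t - m) \<le> \<delta> \<longrightarrow>
          c * sqrt \<epsilon> * \<bar>t - lam \<epsilon> j / \<epsilon>\<bar> \<le> \<bar>char_fun \<epsilon> t\<bar>"
        using loc(3) by eventually_elim auto
    qed simp
  qed (use perturbed_eigenfunctions(1,3) norm double in auto)
  have upper: "is_branch 1 (\<lambda>\<epsilon>. lam \<epsilon> (j + 1)) (\<lambda>\<epsilon>. u \<epsilon> (j + 1))"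
    unfolding is_branch_def
  proof (intro conjI allI impI)
    fix n
    show "\<exists>C. \<forall>\<^sub>F \<epsilon> in at_right 0. \<bar>lam \<epsilon> (j + 1) / \<epsilon> - eigenvalue_sum n (1 * sqrt \<epsilon>)\<bar> \<le> C * sqrt \<epsilon> ^ (n + 1)"
    proof (rule eigenvalue_expansion_error[OF _ loc(1,2)])
      show "\<forall>\<^sub>F \<epsilon> in at_right 0. \<forall>t. 0 \<le> 1 * (t - m) \<longrightarrow> 1 * (t - m) \<le> \<delta> \<longrightarrow>
          c * sqrt \<epsilon> * \<bar>t - lam \<epsilon> (j + 1) / \<epsilon>\<bar> \<le> \<bar>char_fun \<epsilon> t\<bar>"
        using loc(3) by eventually_elim auto
    qed simp
  qed (use perturbed_eigenfunctions(1,3) norm in auto)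
  \<comment> \<open>For \<open>\<sigma> = -1\<close> the powers of \<open>\<sigma>\<close> are the signs of the lower branch, for \<open>\<sigma> = 1\<close> they disappear.\<close>
  have expansion: "has_expansion a b m (\<lambda>n. \<sigma> ^ n * \<nu>p n) (\<lambda>n x. \<sigma> ^ n * vp n x) (\<lambda>n x. \<sigma> ^ n * wp n x) (\<lambda>\<epsilon>. l \<epsilon> / \<epsilon>) f"
    if br: "is_branch \<sigma> l f" for \<sigma> l f
    unfolding has_expansion_def
  proof (intro allI conjI)
    fix n
    have pw: "\<epsilon> powr (real i / 2) = sqrt \<epsilon> ^ i" if "0 < \<epsilon>" for \<epsilon> :: real and i
      using that by (simp add: powr_half_sqrt[symmetric] powr_powr powr_realpow[symmetric])
    have eig: "eigenvalue_expansion m (\<lambda>n. \<sigma> ^ n * \<nu>p n) n \<epsilon> = eigenvalue_sum n (\<sigma> * sqrt \<epsilon>)" if "0 < \<epsilon>" for \<epsilon>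
      unfolding eigenvalue_expansion_def eigenvalue_sum_def
      by (intro arg_cong2[of _ _ _ _ "(+)"] sum.cong refl) (simp add: pw[OF that] power_mult_distrib)
    have efun: "eigenfunction_expansion (\<lambda>n x. \<sigma> ^ n * vp n x) (\<lambda>n x. \<sigma> ^ n * wp n x) n \<epsilon> = profile_sum n (\<sigma> * sqrt \<epsilon>)" if "0 < \<epsilon>" for \<epsilon>
    proof
      fix x
      have "(\<Sum>i\<le>n. (\<sigma> * sqrt \<epsilon>) ^ i * ws i x) = (\<Sum>i=1..n. (\<sigma> * sqrt \<epsilon>) ^ i * ws i x)"
        by (simp add: atMost_atLeast0 sum.atLeast_Suc_atMost ws_def)
      also have "\<dots> = (\<Sum>i=1..n. \<epsilon> powr (real i / 2) * (\<sigma> ^ i * wp i x))"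
        by (intro sum.cong refl) (auto simp: ws_def pw[OF that] power_mult_distrib)
      finally have l: "(\<Sum>i\<le>n. (\<sigma> * sqrt \<epsilon>) ^ i * ws i x) = (\<Sum>i=1..n. \<epsilon> powr (real i / 2) * (\<sigma> ^ i * wp i x))" .
      have r: "(\<Sum>i\<le>n. (\<sigma> * sqrt \<epsilon>) ^ i * vp i x) = (\<Sum>i=0..n. \<epsilon> powr (real i / 2) * (\<sigma> ^ i * vp i x))"
        unfolding atMost_atLeast0 by (intro sum.cong refl) (simp only: pw[OF that] power_mult_distrib mult_ac)
      show "eigenfunction_expansion (\<lambda>n x. \<sigma> ^ n * vp n x) (\<lambda>n x. \<sigma> ^ n * wp n x) n \<epsilon> x = profile_sum n (\<sigma> * sqrt \<epsilon>) x"
        unfolding eigenfunction_expansion_def profile_sum_def profile_def glue_def fst_conv snd_conv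
        using l r by (cases "x < 0") simp_all
    qed
    obtain C where "\<forall>\<^sub>F \<epsilon> in at_right 0. \<bar>l \<epsilon> / \<epsilon> - eigenvalue_sum n (\<sigma> * sqrt \<epsilon>)\<bar> \<le> C * sqrt \<epsilon> ^ (n + 1)"
      using br unfolding is_branch_def by blast
    then have "\<forall>\<^sub>F \<epsilon> in at_right 0. \<bar>l \<epsilon> / \<epsilon> - eigenvalue_expansion m (\<lambda>n. \<sigma> ^ n * \<nu>p n) n \<epsilon>\<bar> \<le> C * \<epsilon> powr (real (n + 1) / 2)"
      using eventually_at_right_less[of "0::real"]
    proof eventually_elim
      case (elim \<epsilon>)
      then show ?case by (simp only: eig[OF elim(2)] pw[OF elim(2)])
    qed
    then show "\<exists>c. \<forall>\<^sub>F \<epsilon> in at_right 0. \<bar>l \<epsilon> / \<epsilon> - eigenvalue_expansion m (\<lambda>n. \<sigma> ^ n * \<nu>p n) n \<epsilon>\<bar> \<le> c * \<epsilon> powr (real (n + 1) / 2)"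
      by blast
    obtain \<theta> D where \<theta>: "(\<theta> \<longlongrightarrow> 1) (at_right 0)"
      "\<forall>\<^sub>F \<epsilon> in at_right 0. pw_C1_bound a b (\<lambda>x. f \<epsilon> x - \<theta> \<epsilon> * profile_sum n (\<sigma> * sqrt \<epsilon>) x) (D * sqrt \<epsilon> ^ (n + 1))"
      using branch_expansion[OF br N1, of n] by blast
    let ?e = "eigenfunction_expansion (\<lambda>n x. \<sigma> ^ n * vp n x) (\<lambda>n x. \<sigma> ^ n * wp n x) n"
    have "\<forall>\<^sub>F \<epsilon> in at_right 0. (\<lambda>x. f \<epsilon> x - \<theta> \<epsilon> * ?e \<epsilon> x) \<in> H1 a b \<and>
        H1_norm a b (\<lambda>x. f \<epsilon> x - \<theta> \<epsilon> * ?e \<epsilon> x) \<le> (sqrt (2 * (b - a)) * D) * \<epsilon> powr (real (n + 1) / 2)"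
      using \<theta>(2) eventually_at_right_less[of "0::real"]
    proof eventually_elim
      case (elim \<epsilon>)
      show ?case
        unfolding efun[OF elim(2)] pw[OF elim(2)]
        using pw_C1_bound_H1[OF elim(1) interval] by (simp only: mult.assoc simp_thms)
    qed
    then show "\<exists>C \<theta> L. L > 0 \<and> (\<theta> \<longlongrightarrow> L) (at_right 0) \<and> (\<forall>\<^sub>F \<epsilon> in at_right 0.
        (\<lambda>x. f \<epsilon> x - \<theta> \<epsilon> * ?e \<epsilon> x) \<in> H1 a b \<and>
        H1_norm a b (\<lambda>x. f \<epsilon> x - \<theta> \<epsilon> * ?e \<epsilon> x) \<le> C * \<epsilon> powr (real (n + 1) / 2))"
      using \<theta>(1) zero_less_one by blast
  qed
  have adj: "glue Ustar x = (profile 1 x - overlap * profile 0 x) / \<omega>" if x: "x \<in> {a..b}" for x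
  proof -
    have A: "SL_op k r a 0 (fst Ustar) (\<lambda>x. m * fst Ustar x)"
      "SL_op \<kappa> \<rho> 0 b (snd Ustar) (\<lambda>x. m * snd Ustar x + v x)"
      "fst Ustar a = 0" "snd Ustar b = 0" "fst Ustar 0 = snd Ustar 0"
      using Ustar(1) by (auto simp: A_op_def pair_scale_def U m_def plus_fun_def)
    have f1: "sl_flow k r a 0 (fst Ustar) (\<lambda>x. k x *\<^sub>R dI a 0 (fst Ustar) x) (\<lambda>x. m * fst Ustar x)"
      using SL_op_continuous[OF A(1)] coefficients_continuous positive interval
      by (intro SL_op_flow[OF A(1)]) (auto intro!: continuous_intros)
    have f2: "sl_flow \<kappa> \<rho> 0 b (snd Ustar) (\<lambda>x. \<kappa> x *\<^sub>R dI 0 b (snd Ustar) x) (\<lambda>x. m * snd Ustar x + vp 0 x)"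
      unfolding start
      using SL_op_continuous[OF A(2)] SL_op_continuous[OF v_op(1)] coefficients_continuous positive interval
      by (intro SL_op_flow[OF A(2)]) (auto intro!: continuous_intros)
    have o: "weighted_integral (\<lambda>x. profile 0 x * glue (fst Ustar, snd Ustar) x) = 0"
      using Ustar(2) by (simp add: weighted_integral_def weight profile_0 mult.assoc)
    show ?thesis
      using adjoined_function[OF f1 f2 A(3-5) N1 o x] start by simp
  qed
  have "converges_H1 a b (\<lambda>\<epsilon> x. (u \<epsilon> (j + 1) x - u \<epsilon> j x) / sqrt \<epsilon>) (\<lambda>x. (2 * \<omega>) * glue Ustar x)"
  proof -
    have "\<omega> \<noteq> 0" using \<nu>1 start by simp
    then have eq: "2 * (profile 1 x - overlap * profile 0 x) = (2 * \<omega>) * glue Ustar x" if "x \<in> {a..b}" for x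
      using adj[OF that] by simp
    show ?thesis by (rule converges_H1_cong[OF branch_difference[OF upper lower N1] eq])
  qed
  moreover have "2 * \<omega> \<noteq> 0" using \<nu>1 start by simp
  moreover have "converges_H1 a b (\<lambda>\<epsilon>. u \<epsilon> j) (glue U)" "converges_H1 a b (\<lambda>\<epsilon>. u \<epsilon> (j + 1)) (glue U)"
    using branch_converges[OF lower N1] branch_converges[OF upper N1] unfolding profile_0[abs_def] by auto
  moreover have "has_expansion a b m \<nu>p vp wp (\<lambda>\<epsilon>. lam \<epsilon> (j + 1) / \<epsilon>) (\<lambda>\<epsilon>. u \<epsilon> (j + 1))"
    using expansion[OF upper] by simp
  moreover have "has_expansion a b m \<nu>m vm wm (\<lambda>\<epsilon>. lam \<epsilon> j / \<epsilon>) (\<lambda>\<epsilon>. u \<epsilon> j)"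
    using expansion[OF lower] unfolding minus .
  ultimately show ?thesis unfolding m_def by blast
qed

end
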